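(* Assume the standing setting below, with $\Gamma\in C^\infty(\mathbb T^2)$ and the initial condition satisfying (A0). (1) If $np_n\to\infty$, then for every $q\ge1$, $$\mathbf E\Big[\sup_{s\le T} d_{BL}(\mu^n_s,\mu_s)^q\Big]\xrightarrow[n\to\infty]{}0,\quad \mathbb P\text{-a.s.}$$ (2) Suppose in addition that the initial condition is independent of the graphs. (a) If $np_n^3\to\infty$, then for every fixed $l\ge1$ and every $q\ge1$, $\mathbf E[\sup_{s\le T} d_{BL}(\mu^{n,l}_s,\mu_s)^q]\to0$, $\mathbb P$-a.s. (b) If $np_n^5\to\infty$, then for every $q\ge1$, $\mathbf E[\sup_{s\le T} d_{BL}(\mu^{n,1,2}_s,\mu_s)^q]\to0$, $\mathbb P$-a.s.
   Context: Let $\mathbb T=\mathbb R/2\pi\mathbb Z$. For each $n\ge2$ let $p_n\in(0,1]$ and let $(\xi^{(n)}_{ij})_{i,j=1}^n$ be i.i.d. Bernoulli$(p_n)$ random variables (a directed Erdős–Rényi graph; graphs for different $n$ are defined on a common probability space). Fix $T>0$ and $\Gamma\in C^\infty(\mathbb T^2)$. Let $(B^i)_{i\ge1}$ be i.i.d. standard real Brownian motions, independent of the graphs and of the initial conditions. The particle system is $d\theta^{i,n}_t=\frac1{np_n}\sum_{j=1}^n\xi^{(n)}_{ij}\Gamma(\theta^{i,n}_t,\theta^{j,n}_t)\,dt+dB^i_t$, $t\in(0,T]$, $i=1,\dots,n$, with initial condition $(\theta^{i,n}_0)_{i\le n}$ in $\mathbb T^n$, independent of the Brownian motions (possibly dependent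 on the graph, not necessarily i.i.d.). $\mathbb P$ is the joint law of graphs and initial conditions, $\mathbb P_g,\mathbb P_0$ its marginals; $\mathbf P,\mathbf E$ refer to the Brownian motions only. $\mu^n_t=\frac1n\sum_{i}\delta_{\theta^{i,n}_t}$, $\mu^{n,l}_t=\frac1{np_n}\sum_{i}\xi^{(n)}_{li}\delta_{\theta^{i,n}_t}$, $\mu^{n,1,2}_t=\frac1{np_n^2}\sum_i\xi^{(n)}_{1i}\xi^{(n)}_{2i}\delta_{\theta^{i,n}_t}$ (the last two need not have mass 1). For finite measures, $d_{BL}(\mu,\nu)=\sup\{\int f\,d\mu-\int f\,d\nu: \|f\|_\infty\le1,\|f\|_{Lip}\le1\}$. Given a probability measure $\mu_0$ on $\mathbb T$, $(\mu_t)_{t\in[0,T]}$ is the unique solution of $\partial_t\mu_t=\frac12\partial_\theta^2\mu_t-\partial_\theta[\mu_t(\Gamma*\mu_t)]$ with initial value $\mu_0$, where $(\Gamma*\mu)(\theta)=\int\Gamma(\theta,\theta')\mu(d\theta')$. Assumption (A0): $d_{BL}(\mu^n_0,\mu_0)\to0$ $\mathbb P_0$-a.s. *)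

theory Defs
  imports "HOL-Probability.Probability"
begin

text \<open>The torus T = R/2piZ is represented by the real line; functions on T are
  2pi-periodic functions on R and measures on T are represented by Borel measures on R
  (only integrals of 2pi-periodic functions are ever taken, i.e. everything is seen
  through the projection R -> T).\<close>

definition periodic1 :: "(real \<Rightarrow> real) \<Rightarrow> bool" where
  "periodic1 f \<longleftrightarrow> (\<forall>x. f (x + 2 * pi) = f x)"

definition periodic2 :: "(real \<Rightarrow> real \<Rightarrow> real) \<Rightarrow> bool" where
  "periodic2 G \<longleftrightarrow> (\<forall>x y. G (x + 2 * pi) y = G x y \<and> G x (y + 2 * pi) = G x y)"

definition smooth1 :: "(real \<Rightarrow> real) \<Rightarrow> bool" where
  "smooth1 f \<longleftrightarrow> (\<exists>D :: nat \<Rightarrow> real \<Rightarrow> real. D 0 = f \<and>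
     (\<forall>k x. (D k has_real_derivative D (Suc k) x) (at x)))"

definition smooth2 :: "(real \<Rightarrow> real \<Rightarrow> real) \<Rightarrow> bool" where
  "smooth2 G \<longleftrightarrow> (\<exists>D :: nat \<Rightarrow> nat \<Rightarrow> real \<Rightarrow> real \<Rightarrow> real. D 0 0 = G \<and>
     (\<forall>a b. continuous_on UNIV (\<lambda>z. D a b (fst z) (snd z))) \<and>
     (\<forall>a b x y. ((\<lambda>u. D a b u y) has_real_derivative D (Suc a) b x y) (at x)) \<and>
     (\<forall>a b x y. ((\<lambda>v. D a b x v) has_real_derivative D a (Suc b) x y) (at y)))"

text \<open>Bounded-Lipschitz test functions on T: 2pi-periodic, sup norm \<le> 1, Lipschitz
  constant \<le> 1 (for periodic functions, 1-Lipschitz on R is the same as 1-Lipschitz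
  for the quotient metric of T).\<close>
definition BL_test :: "(real \<Rightarrow> real) set" where
  "BL_test = {f. periodic1 f \<and> (\<forall>x. \<bar>f x\<bar> \<le> 1) \<and> (\<forall>x y. \<bar>f x - f y\<bar> \<le> \<bar>x - y\<bar>)}"

definition d_BL :: "real measure \<Rightarrow> real measure \<Rightarrow> real" where
  "d_BL \<mu> \<nu> = (SUP f\<in>BL_test. (\<integral>x. f x \<partial>\<mu>) - (\<integral>x. f x \<partial>\<nu>))"

definition emp_measure :: "nat \<Rightarrow> (nat \<Rightarrow> real) \<Rightarrow> (nat \<Rightarrow> real) \<Rightarrow> real measure" where
  "emp_measure n w x = distr (density (count_space {1..n}) (\<lambda>i. ennreal (w i))) borel x"

definition BM_family :: "'m measure \<Rightarrow> (nat \<Rightarrow> 'm \<Rightarrow> real \<Rightarrow> real) \<Rightarrow> bool" where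
  "BM_family M B \<longleftrightarrow> prob_space M \<and>
     (\<forall>i\<ge>1. \<forall>\<omega>\<in>space M. B i \<omega> 0 = 0 \<and> continuous_on {0..} (B i \<omega>)) \<and>
     (\<forall>i\<ge>1. \<forall>t. (\<lambda>\<omega>. B i \<omega> t) \<in> borel_measurable M) \<and>
     (\<forall>i\<ge>1. \<forall>s t. 0 \<le> s \<and> s < t \<longrightarrow>
        distributed M lborel (\<lambda>\<omega>. B i \<omega> t - B i \<omega> s)
          (\<lambda>x. ennreal (normal_density 0 (sqrt (t - s)) x))) \<and>
     (\<forall>(ts :: nat \<Rightarrow> real) m I. finite I \<and> I \<subseteq> {1..} \<and> 0 \<le> ts 0 \<and>
        (\<forall>k<m. ts k < ts (Suc k)) \<longrightarrow>
        prob_space.indep_vars M (\<lambda>_. borel)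
          (\<lambda>(i, k) \<omega>. B i \<omega> (ts (Suc k)) - B i \<omega> (ts k)) (I \<times> {..<m}))"

text \<open>Weak (measure-valued) solution on [0,T] of
  d/dt mu = 1/2 mu'' - (mu (Gamma * mu))'  with initial value mu0:
  probability measures, weakly continuous in time, and the weak formulation
  holds for every smooth 2pi-periodic test function.\<close>
definition mckean_vlasov_sol ::
  "(real \<Rightarrow> real \<Rightarrow> real) \<Rightarrow> real \<Rightarrow> real measure \<Rightarrow> (real \<Rightarrow> real measure) \<Rightarrow> bool" where
  "mckean_vlasov_sol G T \<mu>0 \<mu> \<longleftrightarrow>
     \<mu> 0 = \<mu>0 \<and>
     (\<forall>t\<in>{0..T}. prob_space (\<mu> t) \<and> sets (\<mu> t) = sets borel) \<and>
     (\<forall>f :: real \<Rightarrow> real. continuous_on UNIV f \<and> bounded (range f) \<longrightarrow>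
        continuous_on {0..T} (\<lambda>t. \<integral>x. f x \<partial>(\<mu> t))) \<and>
     (\<forall>\<phi>. smooth1 \<phi> \<and> periodic1 \<phi> \<longrightarrow> (\<forall>t\<in>{0..T}.
        (\<integral>x. \<phi> x \<partial>(\<mu> t)) = (\<integral>x. \<phi> x \<partial>\<mu>0) +
          integral {0..t} (\<lambda>s. \<integral>x. (deriv (deriv \<phi>) x / 2 +
              deriv \<phi> x * (\<integral>y. G x y \<partial>(\<mu> s))) \<partial>(\<mu> s))))"

definition gen_sigma :: "'w measure \<Rightarrow> ('i \<Rightarrow> 'w \<Rightarrow> 'b) \<Rightarrow> 'b measure \<Rightarrow> 'w set set" where
  "gen_sigma P X N = sigma_sets (space P) (\<Union>i. {X i -` A \<inter> space P | A. A \<in> sets N})"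

end

theory Submission
  imports Defs
begin

text \<open>
  Fix a realisation of the graph and of the initial condition. The particles are compared pathwise,
  with the same Brownian motions, to an Euler scheme \<open>Y\<close> with small step in which particle \<open>i\<close> feels
  the mean field \<open>z \<mapsto> 1/n \<Sum>\<^sub>j E \<Gamma>(z, Y\<^sup>j)\<close>; the particles of the scheme are independent. Three
  ingredients control the difference.

  The graph enters only through \<open>\<delta>\<^sub>n = max\<^sub>U n\<^sup>-\<^sup>2 \<Sum>\<^sub>i \<bar>\<Sum>\<^sub>j\<^sub>\<in>\<^sub>U (\<xi>\<^sub>i\<^sub>j / p - 1)\<bar>\<close>: writing a
  periodic Lipschitz function as a superposition of indicators of arcs bounds the mean over \<open>i\<close> of the drift
  error by a multiple of \<open>\<delta>\<^sub>n\<close>, uniformly over all configurations. A Chernoff bound and a union over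
  \<open>4\<^sup>n\<close> pairs of subsets show that \<open>\<delta>\<^sub>n\<close> is of order \<open>(n p)\<^sup>-\<^sup>1\<^sup>/\<^sup>2\<close>, with summable error
  probabilities. The measures seen from one or two fixed vertices have weights at most \<open>W/n\<close> with
  \<open>W = 1/p\<close> or \<open>W = 1/p\<^sup>2\<close>, and \<open>W \<delta>\<^sub>n \<rightarrow> 0\<close> is exactly \<open>n p\<^sup>3 \<rightarrow> \<infinity>\<close> or \<open>n p\<^sup>5 \<rightarrow> \<infinity>\<close>.

  The fluctuations of the independent scheme are handled by variances of the same arc indicators.

  The law of the scheme at a grid point is the image of the previous one under a drift step followed
  by the heat semigroup. Testing both this recursion and the weak equation
  against the heat flow of a bounded Lipschitz function telescopes to a Gronwall inequality with the integrable kernel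
  \<open>(t - s)\<^sup>-\<^sup>1\<^sup>/\<^sup>2\<close>, which gives convergence of the scheme to the given weak solution (and hence
  uniqueness of the latter) without stochastic calculus.

  Independence of the graph and the initial condition is used only at time 0: it makes the weighted
  and the uniform empirical measures of the initial positions close.
\<close>

section \<open>Periodic Lipschitz functions\<close>

text \<open>Two time grids are used. The comparison with the scheme controls only the average
  displacement of the particles, so a measure with weights up to \<open>W/n\<close> pays it
  multiplied by \<open>W\<close>, which may diverge. The fine grid of \<open>2^J\<close> steps
  therefore depends on \<open>n\<close> and is chosen so fine that \<open>W\<close> times the error
  made within a step vanishes. The fluctuations of a weighted measure are controlled one time at a
  time. Summing them over the fine grid would be too expensive, so they are summed over a coarse
  grid of \<open>2^J0\<close> points with \<open>J0\<close> independent of \<open>n\<close>; the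
  other times are reached through the modulus of continuity of the paths and of the limit. Moments
  of order \<open>q\<close> follow from first moments: the distance is eventually at most 3, so its
  \<open>q\<close>-th power is at most a constant times the distance. Every random quantity is
  dominated pathwise by an integrable variable, so the measurability of the supremum over time never
  enters.\<close>

definition lip_per :: "real \<Rightarrow> (real \<Rightarrow> real) \<Rightarrow> bool" where
  "lip_per L f \<longleftrightarrow> periodic1 f \<and> (\<forall>x y. \<bar>f x - f y\<bar> \<le> L * \<bar>x - y\<bar>)"

lemma lip_perD: "lip_per L f \<Longrightarrow> \<bar>f x - f y\<bar> \<le> L * \<bar>x - y\<bar>"
  by (simp add: lip_per_def)

lemma lip_const_nonneg:
  fixes f :: "real \<Rightarrow> real"
  assumes "\<And>x y. \<bar>f x - f y\<bar> \<le> L * \<bar>x - y\<bar>"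
  shows "0 \<le> L"
proof -
  have "0 \<le> L * \<bar>0 - 1 :: real\<bar>"
    using order_trans[OF abs_ge_zero assms[of 0 1]] .
  then show ?thesis by simp
qed

lemma lip_per_nonneg: "lip_per L f \<Longrightarrow> 0 \<le> L"
  by (rule lip_const_nonneg[of f L]) (rule lip_perD)

lemma lip_continuous:
  assumes "\<And>x y. \<bar>f x - f y\<bar> \<le> L * \<bar>x - y\<bar>"
  shows "continuous_on UNIV (f :: real \<Rightarrow> real)"
proof -
  have "0 \<le> L" using assms by (rule lip_const_nonneg)
  then have "L-lipschitz_on UNIV f"
    using assms by (auto simp: lipschitz_on_def dist_real_def)
  then show ?thesis by (rule lipschitz_on_continuous_on)
qed

lemma lip_per_continuous: "lip_per L f \<Longrightarrow> continuous_on UNIV f"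
  by (rule lip_continuous) (auto simp: lip_per_def)

lemma BL_test_iff: "f \<in> BL_test \<longleftrightarrow> lip_per 1 f \<and> (\<forall>x. \<bar>f x\<bar> \<le> 1)"
  by (auto simp: BL_test_def lip_per_def)

lemma BL_test_continuous: "f \<in> BL_test \<Longrightarrow> continuous_on UNIV f"
  by (auto simp: BL_test_iff intro: lip_per_continuous)

lemma BL_test_borel: "f \<in> BL_test \<Longrightarrow> f \<in> borel_measurable borel"
  by (simp add: BL_test_continuous borel_measurable_continuous_onI)

lemma BL_test_uminus: "f \<in> BL_test \<Longrightarrow> (\<lambda>x. - f x) \<in> BL_test"
  by (auto simp: BL_test_def periodic1_def abs_minus_commute)

lemma zero_BL_test: "(\<lambda>x. 0) \<in> BL_test"
  by (auto simp: BL_test_def periodic1_def)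

lemma lip_per_scale_BL_test:
  assumes "lip_per L f" "\<And>x. \<bar>f x\<bar> \<le> A" "L \<le> C" "A \<le> C" "0 < C"
  shows "(\<lambda>x. f x / C) \<in> BL_test"
proof -
  have "\<bar>f x - f y\<bar> \<le> C * \<bar>x - y\<bar>" for x y
    using lip_perD[OF assms(1), of x y] assms(3) by (smt (verit) mult_right_mono)
  moreover have "\<bar>f x\<bar> \<le> C" for x using assms(2)[of x] assms(4) by linarith
  ultimately show ?thesis using assms(1,5)
    by (auto simp: BL_test_def lip_per_def periodic1_def abs_divide divide_le_eq mult.commute
        simp flip: diff_divide_distrib)
qed

lemma periodic1_nat:
  assumes "periodic1 f" shows "f (x + 2 * pi * real n) = f x"
proof (induction n)
  case (Suc n)
  have "f (x + 2 * pi * real (Suc n)) = f ((x + 2 * pi * real n) + 2 * pi)"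
    by (simp add: algebra_simps)
  also have "\<dots> = f (x + 2 * pi * real n)" using assms by (simp only: periodic1_def)
  finally show ?case using Suc by simp
qed simp

lemma periodic1_int:
  assumes "periodic1 f" shows "f (x - 2 * pi * real_of_int k) = f x"
proof (cases k)
  case (nonneg n)
  then show ?thesis using periodic1_nat[OF assms, of "x - 2 * pi * real n" n] by simp
next
  case (neg n)
  have "x - 2 * pi * real_of_int (- int (Suc n)) = x + 2 * pi * real (Suc n)"
      by (simp add: algebra_simps)
  then show ?thesis using periodic1_nat[OF assms, of x "Suc n"] neg by (simp only:)
qed

section \<open>Arcs of the circle and approximation by step functions\<close>

definition rmod :: "real \<Rightarrow> real" where
  "rmod y = y - 2 * pi * real_of_int \<lfloor>y / (2 * pi)\<rfloor>"

lemma rmod_bounds: "0 \<le> rmod y" "rmod y < 2 * pi"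
proof -
  have a: "real_of_int \<lfloor>y / (2 * pi)\<rfloor> \<le> y / (2 * pi)" "y / (2 * pi) < real_of_int \<lfloor>y / (2 * pi)\<rfloor>
      + 1"
    by linarith+
  have p: "0 < 2 * pi" by simp
  show "0 \<le> rmod y" using mult_left_mono[OF a(1), of "2 * pi"] by (simp add: rmod_def)
  show "rmod y < 2 * pi" using mult_strict_left_mono[OF a(2) p] by (simp add: rmod_def distrib_left)
qed

lemma rmod_measurable [measurable]: "rmod \<in> borel_measurable borel"
  unfolding rmod_def by measurable

lemma periodic1_rmod: "periodic1 f \<Longrightarrow> f (rmod y) = f y"
  by (simp add: rmod_def periodic1_int)

text \<open>Nested arcs rather than disjoint cells: the coefficient of an arc is then an increment
  of \<open>f\<close>, of order \<open>1/K\<close>, instead of a value of \<open>f\<close>. A sum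
  over all \<open>K\<close> arcs thus costs a bounded multiple of the average error per arc.\<close>

definition stp :: "nat \<Rightarrow> nat \<Rightarrow> real \<Rightarrow> real" where
  "stp K a y = (if 2 * pi * real (Suc a) / real K \<le> rmod y then 1 else 0)"

lemma stp_measurable [measurable]: "stp K a \<in> borel_measurable borel"
  unfolding stp_def by measurable

lemma stp_bounds: "0 \<le> stp K a y" "stp K a y \<le> 1" "\<bar>stp K a y\<bar> \<le> 1"
  by (auto simp: stp_def)

text \<open>The step functions do not depend on \<open>f\<close>, so bounds obtained through them are uniform over the
  test functions and no covering argument is needed.\<close>

lemma step_approx:
  assumes f: "lip_per L f" and K: "K > 0"
  obtains \<Delta> :: "nat \<Rightarrow> real" where "\<And>a. \<bar>\<Delta> a\<bar> \<le> 2 * pi * L / real K"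
    and "\<And>y. \<bar>f y - f 0 - (\<Sum>a<K. \<Delta> a * stp K a y)\<bar> \<le> 2 * pi * L / real K"
proof -
  define v where "v a = 2 * pi * real a / real K" for a :: nat
  define \<Delta> where "\<Delta> a = f (v (Suc a)) - f (v a)" for a
  have vd: "v (Suc a) - v a = 2 * pi / real K" for a
    using K by (simp add: v_def field_simps)
  have 1: "\<bar>\<Delta> a\<bar> \<le> 2 * pi * L / real K" for a
    using lip_perD[OF f, of "v (Suc a)" "v a"] vd[of a] K by (simp add: \<Delta>_def mult_ac)
  have 2: "\<bar>f y - f 0 - (\<Sum>a<K. \<Delta> a * stp K a y)\<bar> \<le> 2 * pi * L / real K" for y
  proof -
    define x where "x = rmod y * real K / (2 * pi)"
    define j where "j = nat \<lfloor>x\<rfloor>"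
    have x0: "0 \<le> x" using rmod_bounds[of y] by (simp add: x_def)
    have xK: "x < real K" using rmod_bounds[of y] K
      by (simp add: x_def divide_less_eq mult.commute)
    have j: "real j \<le> x" "x < real j + 1"
      using x0 by (auto simp: j_def)
    have jK: "j < K" using j(1) xK by linarith
    have st: "stp K a y = (if a < j then 1 else 0)" for a
    proof -
      have "2 * pi * real (Suc a) / real K \<le> rmod y \<longleftrightarrow> real (Suc a) \<le> x"
        using K by (simp add: x_def field_simps)
      also have "\<dots> \<longleftrightarrow> a < j" using j by (simp add: of_nat_Suc) linarith
      finally show ?thesis by (simp add: stp_def)
    qed
    \<comment> \<open>For \<open>K > 0\<close> the arcs containing \<open>y\<close> are exactly
      those with \<open>a < j\<close>, so the sum telescopes to the value of \<open>f\<close> at the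
      grid point just below \<open>rmod y\<close>.\<close>
    have "(\<Sum>a<K. \<Delta> a * stp K a y) = (\<Sum>a<j. \<Delta> a)"
      unfolding st using jK by (intro sum.mono_neutral_cong_right) auto
    also have "\<dots> = f (v j) - f (v 0)"
      unfolding \<Delta>_def by (rule sum_lessThan_telescope)
    finally have s: "(\<Sum>a<K. \<Delta> a * stp K a y) = f (v j) - f 0" by (simp add: v_def)
    have rv: "rmod y = 2 * pi * x / real K" using K by (simp add: x_def)
    have "rmod y - v j = 2 * pi / real K * (x - real j)"
      by (simp add: rv v_def diff_divide_distrib right_diff_distrib)
    then have "\<bar>rmod y - v j\<bar> = 2 * pi / real K * \<bar>x - real j\<bar>"
      by (simp add: abs_mult)
    also have "\<dots> \<le> 2 * pi / real K * 1" using j by (intro mult_left_mono) auto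
    finally have d: "\<bar>rmod y - v j\<bar> \<le> 2 * pi / real K" by simp
    have "\<bar>f (rmod y) - f (v j)\<bar> \<le> L * \<bar>rmod y - v j\<bar>" by (rule lip_perD[OF f])
    also have "\<dots> \<le> L * (2 * pi / real K)"
      using d lip_per_nonneg[OF f] by (intro mult_left_mono)
    finally show ?thesis
      using periodic1_rmod[of f y] f s by (simp add: lip_per_def mult_ac)
  qed
  show thesis by (rule that[OF 1 2])
qed

section \<open>The bounded-Lipschitz distance\<close>

lemma d_BL_le: "(\<And>f. f \<in> BL_test \<Longrightarrow> (\<integral>x. f x \<partial>\<mu>) - (\<integral>x. f x \<partial>\<nu>) \<le> c) \<Longrightarrow> d_BL \<mu> \<nu> \<le> c"
  unfolding d_BL_def using zero_BL_test by (intro cSUP_least) auto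

text \<open>A real \<open>SUP\<close> dominates its members only when the set is bounded above,
  hence the two a priori bounds on the integrals. The absolute value comes from
  \<open>BL_test\<close> being closed under negation.\<close>

lemma d_BL_upper:
  assumes "\<And>f. f \<in> BL_test \<Longrightarrow> \<bar>\<integral>x. f x \<partial>\<mu>\<bar> \<le> a" "\<And>f. f \<in> BL_test \<Longrightarrow> \<bar>\<integral>x. f x \<partial>\<nu>\<bar> \<le> b"
    and f: "f \<in> BL_test"
  shows "\<bar>(\<integral>x. f x \<partial>\<mu>) - (\<integral>x. f x \<partial>\<nu>)\<bar> \<le> d_BL \<mu> \<nu>"
proof -
  have bdd: "bdd_above ((\<lambda>f. (\<integral>x. f x \<partial>\<mu>) - (\<integral>x. f x \<partial>\<nu>)) ` BL_test)"
    by (rule bdd_aboveI2[where M = "a + b"]) (use assms(1,2) in force)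
  have "(\<integral>x. f x \<partial>\<mu>) - (\<integral>x. f x \<partial>\<nu>) \<le> d_BL \<mu> \<nu>"
    unfolding d_BL_def by (rule cSUP_upper[OF f bdd])
  moreover have "(\<integral>x. - f x \<partial>\<mu>) - (\<integral>x. - f x \<partial>\<nu>) \<le> d_BL \<mu> \<nu>"
    unfolding d_BL_def by (rule cSUP_upper[OF BL_test_uminus[OF f] bdd])
  ultimately show ?thesis by simp
qed

lemma integral_emp_measure:
  fixes f :: "real \<Rightarrow> real"
  assumes "\<And>i. i \<in> {1..n} \<Longrightarrow> 0 \<le> w i" and [measurable]: "f \<in> borel_measurable borel"
  shows "(\<integral>y. f y \<partial>(emp_measure n w x)) = (\<Sum>i=1..n. w i * f (x i))"
proof -
  have "(\<integral>y. f y \<partial>(emp_measure n w x)) = (\<integral>i. f (x i) \<partial>(density (count_space {1..n}) (\<lambda>i. ennreal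
      (w i))))"
    unfolding emp_measure_def by (rule integral_distr) auto
  also have "\<dots> = (\<integral>i. w i *\<^sub>R f (x i) \<partial>(count_space {1..n}))"
    by (rule integral_density) (use assms(1) in \<open>auto simp: AE_count_space\<close>)
  also have "\<dots> = (\<Sum>i=1..n. w i * f (x i))"
    by (simp add: lebesgue_integral_count_space_finite)
  finally show ?thesis .
qed

text \<open>A non-integrable function has integral 0 by convention and \<open>c\<close> is
  nonnegative, so the bound survives in that case too. It can therefore be applied before
  measurability is known, as happens in the recursion defining the Euler scheme.\<close>

lemma integral_bound_prob:
  fixes f :: "'a \<Rightarrow> real"
  assumes "prob_space \<mu>" "\<And>x. x \<in> space \<mu> \<Longrightarrow> \<bar>f x\<bar> \<le> c"
  shows "\<bar>\<integral>x. f x \<partial>\<mu>\<bar> \<le> c"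
proof -
  interpret prob_space \<mu> by fact
  obtain x where "x \<in> space \<mu>" using not_empty by blast
  then have c: "0 \<le> c" using assms(2)[of x] by simp
  show ?thesis
  proof (cases "integrable \<mu> f")
    case True
    have "\<bar>\<integral>x. f x \<partial>\<mu>\<bar> \<le> (\<integral>x. \<bar>f x\<bar> \<partial>\<mu>)" by (rule integral_abs_bound)
    also have "\<dots> \<le> (\<integral>x. c \<partial>\<mu>)"
      using True assms(2) by (intro integral_mono) auto
    finally show ?thesis by (simp add: prob_space)
  qed (simp add: not_integrable_integral_eq c)
qed

lemma integrable_bounded_cont:
  fixes f :: "real \<Rightarrow> real"
  assumes "finite_measure M" "sets M = sets borel" "continuous_on UNIV f" "\<And>x. \<bar>f x\<bar> \<le> c"
  shows "integrable M f"
proof (rule finite_measure.integrable_const_bound[OF assms(1), where B = c])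
  show "f \<in> borel_measurable M"
    using borel_measurable_continuous_onI[OF assms(3)] assms(2) measurable_cong_sets by blast
qed (use assms in auto)

section \<open>Discrete Gronwall inequalities\<close>

lemma discrete_gronwall:
  fixes e a :: "nat \<Rightarrow> real"
  assumes "e 0 \<le> 0" "\<And>k. k < m \<Longrightarrow> e (Suc k) \<le> (1 + c) * e k + a k" "0 \<le> c" "\<And>k. 0 \<le> a k"
  shows "k \<le> m \<Longrightarrow> e k \<le> exp (c * real k) * (\<Sum>l<k. a l)"
proof (induction k)
  case (Suc k)
  have S: "0 \<le> (\<Sum>l<k. a l)" using assms(4) by (intro sum_nonneg) auto
  have E: "exp (c * real (Suc k)) = exp c * exp (c * real k)"
    by (metis exp_add of_nat_Suc distrib_left mult.right_neutral)
  have "e (Suc k) \<le> (1 + c) * e k + a k" using assms(2) Suc.prems by simp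
  also have "\<dots> \<le> (1 + c) * (exp (c * real k) * (\<Sum>l<k. a l)) + a k"
    using Suc assms(3) by (intro add_right_mono mult_left_mono) auto
  also have "\<dots> \<le> exp c * (exp (c * real k) * (\<Sum>l<k. a l)) + exp (c * real (Suc k)) * a k"
  proof (intro add_mono mult_right_mono)
    show "1 + c \<le> exp c" by simp
    have "1 \<le> exp (c * real (Suc k))" using assms(3) by simp
    then show "a k \<le> exp (c * real (Suc k)) * a k"
      using mult_right_mono[OF _ assms(4)[of k]] by fastforce
  qed (use S in auto)
  also have "\<dots> = exp (c * real (Suc k)) * (\<Sum>l<Suc k. a l)"
    unfolding E sum.lessThan_Suc by algebra
  finally show ?case .
qed (use assms(1) in simp)

text \<open>Comparison with the primitive of \<open>x powr (-3/4)\<close>, done algebraically: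
  consecutive fourth roots \<open>v \<le> u\<close> satisfy 1 = u^4 - v^4 \<le> 4 u^3 (u - v), so
  each summand is dominated by a telescoping difference.\<close>

lemma sum_powr_three_quarters:
  "(\<Sum>j<m. real (Suc j) powr (-3/4)) \<le> 4 * real m powr (1/4)"
proof (induction m)
  case (Suc m)
  define u where "u = real (Suc m) powr (1/4)"
  define v where "v = real m powr (1/4)"
  have u0: "u > 0" and v0: "v \<ge> 0" by (auto simp: u_def v_def)
  have vu: "v \<le> u" by (simp add: u_def v_def powr_mono2)
  have u4: "u ^ 4 = real (Suc m)" by (simp add: u_def powr_power)
  have v4: "v ^ 4 = real m" by (cases "m = 0") (simp_all add: v_def powr_power)
  have "1 = u ^ 4 - v ^ 4" using u4 v4 by simp
  also have "\<dots> = (u - v) * (u^3 + u^2 * v + u * v^2 + v^3)"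
    by (simp add: algebra_simps power2_eq_square power3_eq_cube power4_eq_xxxx)
  also have "\<dots> \<le> (u - v) * (u^3 + u^3 + u^3 + u^3)"
  proof (intro mult_left_mono add_mono)
    show "u^2 * v \<le> u^3" using vu u0 by (simp add: power2_eq_square power3_eq_cube)
    have "v^2 \<le> u^2" using vu v0 by (intro power_mono)
    then show "u * v^2 \<le> u^3" using u0 by (simp add: power2_eq_square power3_eq_cube)
    show "v^3 \<le> u^3" using vu v0 by (intro power_mono)
  qed (use vu in auto)
  finally have "1 \<le> 4 * (u - v) * u^3" by argo
  then have "1 / u^3 \<le> 4 * (u - v)" using u0 by (simp add: divide_le_eq)
  moreover have "real (Suc m) powr (-3/4) = 1 / u^3"
  proof -
    have "u ^ 3 = real (Suc m) powr (3/4)" by (simp add: u_def powr_power)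
    then show ?thesis by (simp add: powr_minus_divide)
  qed
  ultimately show ?case using Suc by (simp add: u_def v_def)
qed simp

text \<open>The exponent 1/4 is a compromise. Multiplied by the singularity
  \<open>y powr (-1/2)\<close> it leaves \<open>y powr (-3/4)\<close>, which is still integrable at
  0, while the rate in the exponential produces a factor that tends to 0 as the rate grows.\<close>

lemma exp_minus_le_powr:
  assumes "(y::real) > 0" shows "exp (- y) \<le> y powr (-1/4)"
proof -
  have "y powr (1/4) \<le> 1 + y"
  proof (cases "y \<le> 1")
    case True
    then have "y powr (1/4) \<le> 1" using assms by (simp add: powr_le1)
    then show ?thesis using assms by simp
  next
    case False
    then have "y powr (1/4) \<le> y powr 1" by (intro powr_mono) auto
    then show ?thesis using assms by simp
  qed
  also have "\<dots> \<le> exp y" by simp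
  finally have "exp (- y) \<le> inverse (y powr (1/4))"
    using assms by (simp add: exp_minus le_imp_inverse_le)
  then show ?thesis by (simp add: powr_minus)
qed

text \<open>The weight \<open>exp (- lam k h)\<close> makes the singular kernel a contraction uniformly in the step
    size.\<close>

lemma singular_gronwall:
  fixes C T :: real
  assumes C: "C > 0" and T: "T > 0"
  shows "\<exists>R>0. \<forall>h>0. \<forall>M a D. real M * h \<le> T \<longrightarrow> 0 \<le> a \<longrightarrow> (\<forall>k. 0 \<le> D k) \<longrightarrow>
     (\<forall>m\<le>M. D m \<le> a + C * h * (\<Sum>k<m. D k / sqrt (real (m - k) * h))) \<longrightarrow>
     (\<forall>m\<le>M. D m \<le> R * a)"
proof -
  \<comment> \<open>The value at which the bound 4 lam^(-1/4) T^(1/4) of the weighted kernel sum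
    equals 1/(2 C).\<close>
  define lam where "lam = (8 * C) ^ 4 * T"
  have lam0: "lam > 0" using assms by (simp add: lam_def)
  have "D m \<le> (2 * exp (lam * T)) * a"
    if h: "h > 0" and Mh: "real M * h \<le> T" and a: "0 \<le> a" and D0: "\<forall>k. 0 \<le> D k"
      and D: "\<forall>m\<le>M. D m \<le> a + C * h * (\<Sum>k<m. D k / sqrt (real (m - k) * h))" and m: "m \<le> M"
    for h M a D m
  proof -
    define w where "w k = exp (- lam * real k * h) * D k" for k :: nat
    define N where "N = Max (w ` {..M})"
    have wN: "w k \<le> N" if "k \<le> M" for k using that unfolding N_def by (intro Max_ge) auto
    have N0: "0 \<le> N" using wN[of 0] D0[rule_format, of 0] by (simp add: w_def)
    have ker: "h * exp (- lam * real (Suc j) * h) / sqrt (real (Suc j) * h)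
        \<le> lam powr (-1/4) * h powr (1/4) * real (Suc j) powr (-3/4)" for j
    proof -
      define y where "y = real (Suc j) * h"
      have y: "y > 0" using h by (simp add: y_def)
      have "exp (- (lam * y)) \<le> (lam * y) powr (-1/4)" using lam0 y
          by (intro exp_minus_le_powr) auto
      also have "\<dots> = lam powr (-1/4) * y powr (-1/4)" using lam0 y by (simp add: powr_mult)
      finally have "h * exp (- (lam * y)) / sqrt y \<le> h * (lam powr (-1/4) * y powr (-1/4)) / sqrt y"
        using h y by (intro divide_right_mono mult_left_mono) auto
      also have "\<dots> = lam powr (-1/4) * (h * (y powr (-1/4) * y powr (-1/2)))"
        using y by (simp add: powr_minus powr_half_sqrt field_simps)
      also have "y powr (-1/4) * y powr (-1/2) = y powr (-3/4)"
        by (simp add: powr_add[symmetric])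
      also have "h * y powr (-3/4) = (h powr 1 * h powr (-3/4)) * real (Suc j) powr (-3/4)"
        using h by (simp add: y_def powr_mult mult_ac)
      also have "h powr 1 * h powr (-3/4) = h powr (1/4)" by (simp only: powr_add[symmetric]) simp
      finally show ?thesis by (simp add: y_def mult_ac)
    qed
    have kersum: "(\<Sum>j<m. h * exp (- lam * real (Suc j) * h) / sqrt (real (Suc j) * h))
        \<le> 1 / (2 * C)"
      if "m \<le> M" for m
    proof -
      have "(\<Sum>j<m. h * exp (- lam * real (Suc j) * h) / sqrt (real (Suc j) * h))
         \<le> (\<Sum>j<m. lam powr (-1/4) * h powr (1/4) * real (Suc j) powr (-3/4))"
        by (intro sum_mono ker)
      also have "\<dots> = lam powr (-1/4) * h powr (1/4) * (\<Sum>j<m. real (Suc j) powr (-3/4))"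
        by (simp add: sum_distrib_left)
      also have "\<dots> \<le> lam powr (-1/4) * h powr (1/4) * (4 * real m powr (1/4))"
        by (intro mult_left_mono sum_powr_three_quarters) auto
      also have "\<dots> = 4 * lam powr (-1/4) * (real m * h) powr (1/4)"
        using h by (simp add: powr_mult)
      also have "\<dots> \<le> 4 * lam powr (-1/4) * T powr (1/4)"
      proof (intro mult_left_mono powr_mono2)
        have "real m * h \<le> real M * h" using that h by simp
        then show "real m * h \<le> T" using Mh by simp
      qed (use h in auto)
      also have "\<dots> = 1 / (2 * C)"
      proof -
        have "lam powr (1/4) = ((8 * C) ^ 4) powr (1/4) * T powr (1/4)"
          unfolding lam_def using C T by (simp add: powr_mult)
        also have "((8 * C) ^ 4) powr (1/4) = 8 * C"
        proof -
          have "(8 * C) ^ 4 = (8 * C) powr 4" using C powr_realpow[of "8 * C" 4] by simp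
          then show ?thesis using C by (simp only: powr_powr) simp
        qed
        finally have "lam powr (-1/4) = 1 / (8 * C * T powr (1/4))"
          using powr_minus_divide[of lam "1/4"] by simp
        then show ?thesis using T C by simp
      qed
      finally show ?thesis .
    qed
    have wle: "w m \<le> a + N / 2" if m: "m \<le> M" for m
    proof -
      have e1: "exp (- lam * real m * h) \<le> 1" using lam0 h by simp
      have "w m \<le> exp (- lam * real m * h) * (a + C * h * (\<Sum>k<m. D k / sqrt (real (m - k) * h)))"
        unfolding w_def using D m by (intro mult_left_mono) auto
      also have "\<dots> = exp (- lam * real m * h) * a
          + C * (\<Sum>k<m. exp (- lam * real m * h) * h * (D k / sqrt (real (m - k) * h)))"
        by (simp add: algebra_simps sum_distrib_left)
      finally have f1: "w m \<le> exp (- lam * real m * h) * a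
          + C * (\<Sum>k<m. exp (- lam * real m * h) * h * (D k / sqrt (real (m - k) * h)))" .
      have "(\<Sum>k<m. exp (- lam * real m * h) * h * (D k / sqrt (real (m - k) * h)))
          = (\<Sum>k<m. w k * (h * exp (- lam * real (m - k) * h) / sqrt (real (m - k) * h)))"
      proof (rule sum.cong[OF refl])
        fix k assume "k \<in> {..<m}"
        then have "- lam * real m * h = - lam * real k * h + - lam * real (m - k) * h"
          by (simp add: of_nat_diff algebra_simps)
        then have "exp (- lam * real m * h) = exp (- lam * real k * h) * exp (- lam * real (m
            - k) * h)"
          by (simp only: exp_add)
        then show "exp (- lam * real m * h) * h * (D k / sqrt (real (m - k) * h))
          = w k * (h * exp (- lam * real (m - k) * h) / sqrt (real (m - k) * h))"
          by (simp add: w_def mult_ac)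
      qed
      also have "\<dots> \<le> (\<Sum>k<m. N * (h * exp (- lam * real (m - k) * h) / sqrt (real (m - k) * h)))"
        using m h by (intro sum_mono mult_right_mono wN) auto
      also have "\<dots> = N * (\<Sum>k<m. h * exp (- lam * real (m - k) * h) / sqrt (real (m - k) * h))"
        by (simp add: sum_distrib_left)
      also have "(\<Sum>k<m. h * exp (- lam * real (m - k) * h) / sqrt (real (m - k) * h))
          = (\<Sum>j<m. h * exp (- lam * real (Suc j) * h) / sqrt (real (Suc j) * h))"
        by (rule sum.reindex_bij_witness[where i = "\<lambda>j. m - Suc j" and j = "\<lambda>k. m - Suc k"])
           (auto simp: Suc_diff_Suc)
      also have "N * \<dots> \<le> N * (1 / (2 * C))"
        using kersum[OF m] N0 by (intro mult_left_mono)
      finally have "C * (\<Sum>k<m. exp (- lam * real m * h) * h * (D k / sqrt (real (m - k) * h)))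
          \<le> C * (N * (1 / (2 * C)))" using C by (intro mult_left_mono) auto
      with f1 have "w m \<le> exp (- lam * real m * h) * a + C * (N * (1 / (2 * C)))" by linarith
      also have "\<dots> \<le> 1 * a + N / 2"
        using C mult_right_mono[OF e1 a] by simp
      finally show ?thesis by simp
    qed
    \<comment> \<open>At an index where the weighted maximum \<open>N\<close> is attained, the
      estimate reads N \<le> a + N/2.\<close>
    have "N \<in> w ` {..M}" unfolding N_def by (intro Max_in) auto
    then have "N \<le> 2 * a" using wle by fastforce
    then have "w m \<le> 2 * a" using wN[OF m] by simp
    then have "D m \<le> 2 * a * exp (lam * real m * h)"
      by (simp add: w_def exp_minus field_simps)
    also have "\<dots> \<le> 2 * a * exp (lam * T)"
    proof -
      have "real m * h \<le> real M * h" using m h by simp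
      then have "lam * (real m * h) \<le> lam * T" using Mh lam0 by (intro mult_left_mono) auto
      then show ?thesis using a by (intro mult_left_mono) (auto simp: mult_ac)
    qed
    finally show ?thesis by (simp add: mult_ac)
  qed
  then show ?thesis by (intro exI[of _ "2 * exp (lam * T)"] conjI allI impI) (simp, blast)
qed

section \<open>The heat semigroup\<close>

abbreviation SN :: "real measure" where
  "SN \<equiv> density lborel (\<lambda>x. ennreal (std_normal_density x))"

lemma prob_space_SN: "prob_space SN"
  by (rule prob_space_normal_density) simp

lemma SN_has_integral:
  fixes g :: "real \<Rightarrow> real"
  assumes "has_bochner_integral lborel (\<lambda>z. std_normal_density z * g z) I"
    "g \<in> borel_measurable borel"
  shows "has_bochner_integral SN g I"
  by (rule has_bochner_integral_density) (use assms in auto)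

lemma SN_moments:
  shows "has_bochner_integral SN (\<lambda>z. z) 0" "has_bochner_integral SN (\<lambda>z. z^2) 1"
    "has_bochner_integral SN (\<lambda>z. z^4) 3"
proof -
  show "has_bochner_integral SN (\<lambda>z. z) 0"
    using std_normal_moment_odd[of 0] by (intro SN_has_integral) auto
  show "has_bochner_integral SN (\<lambda>z. z^2) 1"
    using std_normal_moment_even[of 1] by (intro SN_has_integral) (auto simp: fact_numeral)
  show "has_bochner_integral SN (\<lambda>z. z^4) 3"
    using std_normal_moment_even[of 2] by (intro SN_has_integral) (auto simp: fact_numeral)
qed

lemma SN_integrable_abs [simp]: "integrable SN (\<lambda>z. \<bar>z\<bar>)"
  using SN_moments(1) by (auto simp: has_bochner_integral_iff)

lemma SN_abs: "(\<integral>z. \<bar>z\<bar> \<partial>SN) \<le> 1"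
proof -
  interpret prob_space SN by (rule prob_space_SN)
  have i: "integrable SN (\<lambda>z. z^2)" "(\<integral>z. z^2 \<partial>SN) = 1"
    using SN_moments(2) by (auto simp: has_bochner_integral_iff)
  have "\<bar>z\<bar> \<le> (1 + z^2) / 2" for z :: real
    using sum_squares_ge_zero[of "\<bar>z\<bar> - 1" 0] by (simp add: power2_eq_square algebra_simps)
  then have "(\<integral>z. \<bar>z\<bar> \<partial>SN) \<le> (\<integral>z. (1 + z^2) / 2 \<partial>SN)"
    using i by (intro integral_mono) auto
  also have "\<dots> = 1" using i prob_space by simp
  finally show ?thesis .
qed

text \<open>The third absolute moment is bounded by the mean of the second and the fourth, which are
  1 and 3.\<close>

lemma SN_abs3: "integrable SN (\<lambda>z. \<bar>z\<bar>^3)" "(\<integral>z. \<bar>z\<bar>^3 \<partial>SN) \<le> 2"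
proof -
  interpret prob_space SN by (rule prob_space_SN)
  have i: "integrable SN (\<lambda>z. z^2)" "(\<integral>z. z^2 \<partial>SN) = 1"
     "integrable SN (\<lambda>z. z^4)" "(\<integral>z. z^4 \<partial>SN) = 3"
    using SN_moments by (auto simp: has_bochner_integral_iff)
  have le: "\<bar>z\<bar>^3 \<le> (z^2 + z^4) / 2" for z :: real
  proof -
    have "0 \<le> z^2 * (\<bar>z\<bar> - 1)^2" by simp
    also have "\<dots> = z^2 + z^4 - 2 * (z^2 * \<bar>z\<bar>)"
      by (simp add: power2_diff algebra_simps)
    also have "z^2 * \<bar>z\<bar> = \<bar>z\<bar>^3"
      using power2_abs[of z] by (metis power2_eq_square power3_eq_cube)
    finally show ?thesis by simp
  qed
  show int: "integrable SN (\<lambda>z. \<bar>z\<bar>^3)"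
    by (rule Bochner_Integration.integrable_bound[where f = "\<lambda>z. (z^2 + z^4) / 2"])
       (use i le in \<open>auto intro!: AE_I2 order_trans[OF le] \<close>)
  have "(\<integral>z. \<bar>z\<bar>^3 \<partial>SN) \<le> (\<integral>z. (z^2 + z^4) / 2 \<partial>SN)"
    using i int le by (intro integral_mono) auto
  also have "\<dots> = 2" using i by simp
  finally show "(\<integral>z. \<bar>z\<bar>^3 \<partial>SN) \<le> 2" .
qed

text \<open>The two constants are kept apart, and periodicity is left out, because differentiating
  the heat flow trades the sup bound and the Lipschitz constant against powers of
  \<open>sqrt r\<close>.\<close>

definition blip :: "real \<Rightarrow> real \<Rightarrow> (real \<Rightarrow> real) \<Rightarrow> bool" where
  "blip c L f \<longleftrightarrow> (\<forall>x. \<bar>f x\<bar> \<le> c) \<and> (\<forall>x y. \<bar>f x - f y\<bar> \<le> L * \<bar>x - y\<bar>)"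

lemma blipD: assumes "blip c L f"
  shows "\<bar>f x\<bar> \<le> c" "\<bar>f x - f y\<bar> \<le> L * \<bar>x - y\<bar>" "continuous_on UNIV f"
    "f \<in> borel_measurable borel" "0 \<le> c" "0 \<le> L"
proof -
  show "\<bar>f x\<bar> \<le> c" for x using assms by (simp add: blip_def)
  from this[of 0] show "0 \<le> c" by linarith
  show *: "\<bar>f x - f y\<bar> \<le> L * \<bar>x - y\<bar>" for x y using assms by (simp add: blip_def)
  show "continuous_on UNIV f" using * by (rule lip_continuous)
  then show "f \<in> borel_measurable borel" by (rule borel_measurable_continuous_onI)
  show "0 \<le> L" using * by (rule lip_const_nonneg)
qed

section \<open>The heat operator and its gradient\<close>

definition heat :: "real \<Rightarrow> (real \<Rightarrow> real) \<Rightarrow> real \<Rightarrow> real" where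
  "heat r f x = (\<integral>z. f (x + sqrt r * z) \<partial>SN)"

text \<open>The spatial derivative of \<open>heat r f\<close>, written by Gaussian integration by
  parts. In this form it makes sense for every bounded measurable \<open>f\<close>, and its bounds
  come from absolute moments.\<close>

definition dheat :: "real \<Rightarrow> (real \<Rightarrow> real) \<Rightarrow> real \<Rightarrow> real" where
  "dheat r f x = (\<integral>z. f (x + sqrt r * z) * z \<partial>SN) / sqrt r"

lemma SN_integrable_bounded:
  fixes g :: "real \<Rightarrow> real"
  assumes "g \<in> borel_measurable borel" "\<And>z. \<bar>g z\<bar> \<le> c"
  shows "integrable SN g"
proof -
  interpret prob_space SN by (rule prob_space_SN)
  show ?thesis by (rule integrable_const_bound[where B = c]) (use assms in auto)
qed

lemma SN_integrable_bounded_mult: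
  fixes g :: "real \<Rightarrow> real"
  assumes [measurable]: "g \<in> borel_measurable borel" and "\<And>z. \<bar>g z\<bar> \<le> c"
  shows "integrable SN (\<lambda>z. g z * z)"
proof (rule Bochner_Integration.integrable_bound[where f = "\<lambda>z. c * \<bar>z\<bar>"])
  have "0 \<le> c" using assms(2)[of 0] by linarith
  then show "AE z in SN. norm (g z * z) \<le> norm (c * \<bar>z\<bar>)"
    using assms(2) by (intro AE_I2) (auto simp: abs_mult intro!: mult_right_mono)
qed auto

lemma heat_integrable:
  assumes "blip c L f"
  shows "integrable SN (\<lambda>z. f (x + s * z))" "integrable SN (\<lambda>z. f (x + s * z) * z)"
proof -
  have [measurable]: "f \<in> borel_measurable borel" using assms by (rule blipD)
  show "integrable SN (\<lambda>z. f (x + s * z))"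
    by (rule SN_integrable_bounded[where c = c]) (use blipD[OF assms] in auto)
  show "integrable SN (\<lambda>z. f (x + s * z) * z)"
    by (rule SN_integrable_bounded_mult[where c = c]) (use blipD[OF assms] in auto)
qed

lemma heat_0 [simp]: "heat 0 f = f"
  using prob_space.prob_space[OF prob_space_SN] by (auto simp: heat_def fun_eq_iff)

lemma heat_blip:
  assumes "blip c L f" shows "blip c L (heat r f)"
proof -
  have "\<bar>heat r f x\<bar> \<le> c" for x
    unfolding heat_def by (rule integral_bound_prob[OF prob_space_SN]) (rule blipD[OF assms])
  moreover have "\<bar>heat r f x - heat r f y\<bar> \<le> L * \<bar>x - y\<bar>" for x y
  proof -
    have "heat r f x - heat r f y = (\<integral>z. f (x + sqrt r * z) - f (y + sqrt r * z) \<partial>SN)"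
      unfolding heat_def by (simp add: heat_integrable[OF assms])
    also have "\<bar>\<dots>\<bar> \<le> L * \<bar>x - y\<bar>"
    proof (rule integral_bound_prob[OF prob_space_SN])
      fix z show "\<bar>f (x + sqrt r * z) - f (y + sqrt r * z)\<bar> \<le> L * \<bar>x - y\<bar>"
        using blipD(2)[OF assms, of "x + sqrt r * z" "y + sqrt r * z"] by simp
    qed
    finally show ?thesis .
  qed
  ultimately show ?thesis by (auto simp: blip_def)
qed

lemma SN_integral_abs_bound:
  fixes g :: "real \<Rightarrow> real"
  assumes "integrable SN g" "\<And>z. \<bar>g z\<bar> \<le> c * \<bar>z\<bar>"
  shows "\<bar>\<integral>z. g z \<partial>SN\<bar> \<le> c"
proof -
  have c: "0 \<le> c" using assms(2)[of 1] by simp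
  have "\<bar>\<integral>z. g z \<partial>SN\<bar> \<le> (\<integral>z. \<bar>g z\<bar> \<partial>SN)" by (rule integral_abs_bound)
  also have "\<dots> \<le> (\<integral>z. c * \<bar>z\<bar> \<partial>SN)" using assms by (intro integral_mono) auto
  also have "\<dots> = c * (\<integral>z. \<bar>z\<bar> \<partial>SN)" by simp
  also have "\<dots> \<le> c * 1" using SN_abs c by (intro mult_left_mono)
  finally show ?thesis by simp
qed

lemma dheat_blip:
  assumes "blip c L f" "r > 0"
  shows "blip (c / sqrt r) (L / sqrt r) (dheat r f)"
proof -
  have "\<bar>dheat r f x\<bar> \<le> c / sqrt r" for x
  proof -
    have "\<bar>\<integral>z. f (x + sqrt r * z) * z \<partial>SN\<bar> \<le> c"
      by (rule SN_integral_abs_bound[OF heat_integrable(2)[OF assms(1)]])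
         (auto simp: abs_mult intro!: mult_right_mono blipD[OF assms(1)])
    then show ?thesis using assms(2) by (simp add: dheat_def divide_right_mono)
  qed
  moreover have "\<bar>dheat r f x - dheat r f y\<bar> \<le> L / sqrt r * \<bar>x - y\<bar>" for x y
  proof -
    have i: "integrable SN (\<lambda>z. (f (x + sqrt r * z) - f (y + sqrt r * z)) * z)"
      using heat_integrable(2)[OF assms(1)] by (simp add: left_diff_distrib)
    have "\<bar>\<integral>z. (f (x + sqrt r * z) - f (y + sqrt r * z)) * z \<partial>SN\<bar> \<le> L * \<bar>x - y\<bar>"
    proof (rule SN_integral_abs_bound[OF i])
      fix z
      show "\<bar>(f (x + sqrt r * z) - f (y + sqrt r * z)) * z\<bar> \<le> L * \<bar>x - y\<bar> * \<bar>z\<bar>"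
        unfolding abs_mult using blipD(2)[OF assms(1), of "x + sqrt r * z" "y + sqrt r * z"]
        by (intro mult_right_mono) auto
    qed
    moreover have "dheat r f x - dheat r f y
        = (\<integral>z. (f (x + sqrt r * z) - f (y + sqrt r * z)) * z \<partial>SN) / sqrt r"
      by (simp add: dheat_def left_diff_distrib heat_integrable(2)[OF assms(1)] diff_divide_distrib)
    ultimately show ?thesis using assms(2) by (simp add: divide_right_mono)
  qed
  ultimately show ?thesis by (auto simp: blip_def)
qed

text \<open>Since the Gaussian variable is centred, \<open>f x\<close> may be subtracted under the
  integral. The Lipschitz bound then supplies a factor \<open>sqrt r\<close> that cancels the
  denominator, so the gradient stays bounded as \<open>r\<close> tends to 0.\<close>

lemma dheat_le_lip:
  assumes "blip c L f" "r > 0"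
  shows "\<bar>dheat r f x\<bar> \<le> L"
proof -
  interpret prob_space SN by (rule prob_space_SN)
  have m: "integrable SN (\<lambda>z. z^2)" "(\<integral>z. z^2 \<partial>SN) = 1" "integrable SN (\<lambda>z. z)" "(\<integral>z. z \<partial>SN) = 0"
    using SN_moments by (auto simp: has_bochner_integral_iff)
  have i: "integrable SN (\<lambda>z. (f (x + sqrt r * z) - f x) * z)"
    using heat_integrable(2)[OF assms(1)] m(3) by (simp add: left_diff_distrib)
  have eq: "(\<integral>z. f (x + sqrt r * z) * z \<partial>SN) = (\<integral>z. (f (x + sqrt r * z) - f x) * z \<partial>SN)"
    using heat_integrable(2)[OF assms(1)] m(3,4) by (simp add: left_diff_distrib)
  have "\<bar>\<integral>z. (f (x + sqrt r * z) - f x) * z \<partial>SN\<bar> \<le> (\<integral>z. \<bar>(f (x + sqrt r * z) - f x) * z\<bar> \<partial>SN)"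
    by (rule integral_abs_bound)
  also have "\<dots> \<le> (\<integral>z. L * sqrt r * z^2 \<partial>SN)"
  proof (rule integral_mono)
    fix z
    have "\<bar>f (x + sqrt r * z) - f x\<bar> * \<bar>z\<bar> \<le> (L * \<bar>x + sqrt r * z - x\<bar>) * \<bar>z\<bar>"
      by (intro mult_right_mono blipD(2)[OF assms(1)]) auto
    also have "\<dots> = L * sqrt r * z^2"
      using assms(2) by (simp add: abs_mult power2_eq_square)
    finally show "\<bar>(f (x + sqrt r * z) - f x) * z\<bar> \<le> L * sqrt r * z^2" by (simp add: abs_mult)
  qed (use i m in auto)
  also have "\<dots> = L * sqrt r" using m by simp
  finally show ?thesis using assms(2) by (simp add: dheat_def eq divide_le_eq)
qed

text \<open>Takes the place of differentiation under the integral by dominated convergence: a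
  remainder estimate of second order that can be integrated directly is enough.\<close>

lemma quadratic_DERIV:
  fixes f :: "real \<Rightarrow> real"
  assumes "\<epsilon> > 0" "\<And>\<delta>. \<bar>\<delta>\<bar> \<le> \<epsilon> \<Longrightarrow> \<bar>f (x + \<delta>) - f x - \<delta> * d\<bar> \<le> K * \<delta>^2"
  shows "(f has_real_derivative d) (at x)"
proof -
  have "((\<lambda>h. (f (x + h) - f x) / h - d) \<longlongrightarrow> 0) (at 0)"
  proof (rule Lim_null_comparison)
    show "\<forall>\<^sub>F h in at 0. norm ((f (x + h) - f x) / h - d) \<le> K * \<bar>h\<bar>"
      unfolding eventually_at
    proof (intro exI[of _ \<epsilon>] conjI ballI impI, goal_cases)
      case (2 h)
      then have h: "h \<noteq> 0" "\<bar>h\<bar> \<le> \<epsilon>" by (auto simp: dist_real_def)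
      have "(f (x + h) - f x) / h - d = (f (x + h) - f x - h * d) / h"
        using h by (simp add: field_simps)
      then have "norm ((f (x + h) - f x) / h - d) = \<bar>f (x + h) - f x - h * d\<bar> / \<bar>h\<bar>"
        by (simp add: abs_divide)
      also have "\<dots> \<le> K * h^2 / \<bar>h\<bar>" using assms(2)[OF h(2)] by (intro divide_right_mono) auto
      also have "\<dots> = K * \<bar>h\<bar>" using h
        by (metis abs_0_eq nonzero_mult_div_cancel_right power2_abs power2_eq_square
            times_divide_eq_right)
      finally show ?case .
    qed (use assms in auto)
    have "((\<lambda>h. K * \<bar>h\<bar>) \<longlongrightarrow> K * \<bar>0\<bar>) (at 0)" by (intro tendsto_intros)
    then show "((\<lambda>h. K * \<bar>h\<bar>) \<longlongrightarrow> 0) (at 0)" by simp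
  qed
  then show ?thesis unfolding DERIV_def by (rule LIM_zero_cancel)
qed

section \<open>Differentiability of the heat flow by a change of measure\<close>

lemma normal_density_shift:
  "normal_density a 1 z = std_normal_density z * exp (a * z - a^2 / 2)"
proof -
  have "- (z - a)\<^sup>2 / (2 * 1\<^sup>2) = - z\<^sup>2 / 2 + (a * z - a^2 / 2)"
    by (simp add: power2_eq_square algebra_simps diff_divide_distrib add_divide_distrib)
  then show ?thesis unfolding normal_density_def by (simp add: exp_add[symmetric])
qed

text \<open>Cameron--Martin shift: the translate \<open>heat r f (x + \<delta>)\<close> is the expectation of
  \<open>f (x + sqrt r * Z)\<close> against the density \<open>exp (a Z - a\<^sup>2 / 2)\<close> with \<open>a = \<delta> / sqrt r\<close>, whose
  second-order remainder has \<open>L\<^sup>2\<close>-norm \<open>sqrt (exp (a\<^sup>2) - 1 - a\<^sup>2)\<close>.\<close>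

lemma SN_shift:
  assumes [measurable]: "g \<in> borel_measurable borel"
  shows "(\<integral>z. g (z + a) \<partial>SN) = (\<integral>z. g z * exp (a * z - a^2 / 2) \<partial>SN)"
proof -
  have "(\<integral>z. g (z + a) \<partial>SN) = (\<integral>z. std_normal_density z * g (z + a) \<partial>lborel)"
    by (simp add: integral_density)
  also have "\<dots> = (\<integral>z. std_normal_density (- a + 1 * z) * g ((- a + 1 * z) + a) \<partial>lborel)"
    by (subst lborel_integral_real_affine[where c = 1 and t = "- a"]) simp_all
  also have "\<dots> = (\<integral>z. std_normal_density z * (g z * exp (a * z - a^2 / 2)) \<partial>lborel)"
  proof (intro Bochner_Integration.integral_cong refl)
    fix z
    have "std_normal_density (- a + 1 * z) = normal_density a 1 z"
      by (simp add: normal_density_def power2_eq_square algebra_simps)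
    then show "std_normal_density (- a + 1 * z) * g ((- a + 1 * z) + a)
      = std_normal_density z * (g z * exp (a * z - a^2 / 2))"
      by (simp add: normal_density_shift[of a])
  qed
  also have "\<dots> = (\<integral>z. g z * exp (a * z - a^2 / 2) \<partial>SN)"
    by (simp add: integral_density)
  finally show ?thesis .
qed

lemma SN_exp:
  "has_bochner_integral SN (\<lambda>z. exp (a * z - a^2 / 2)) 1"
  "has_bochner_integral SN (\<lambda>z. exp (a * z - a^2 / 2) * z) a"
proof -
  have "has_bochner_integral lborel (\<lambda>z. normal_density a 1 z) 1"
    by (simp add: has_bochner_integral_iff)
  then show "has_bochner_integral SN (\<lambda>z. exp (a * z - a^2 / 2)) 1"
    unfolding normal_density_shift[of a] by (rule SN_has_integral) simp
  show "has_bochner_integral SN (\<lambda>z. exp (a * z - a^2 / 2) * z) a"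
    using normal_moment_nz_1[of 1 a] unfolding normal_density_shift[of a] mult.assoc
    by (intro SN_has_integral) auto
qed

lemma SN_remainder:
  assumes a: "\<bar>a\<bar> \<le> 1"
  shows "integrable SN (\<lambda>z. \<bar>exp (a * z - a^2 / 2) - 1 - a * z\<bar>)"
    and "(\<integral>z. \<bar>exp (a * z - a^2 / 2) - 1 - a * z\<bar> \<partial>SN) \<le> a^2"
proof -
  interpret prob_space SN by (rule prob_space_SN)
  define E where "E z = exp (a * z - a^2 / 2)" for z
  define q where "q z = E z - 1 - a * z" for z
  have m: "has_bochner_integral SN (\<lambda>z. z^2) 1" "has_bochner_integral SN (\<lambda>z. z) 0"
    using SN_moments by auto
  have E1: "has_bochner_integral SN E 1" "has_bochner_integral SN (\<lambda>z. E z * z) a"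
    unfolding E_def using SN_exp by auto
  \<comment> \<open>Completing the square: the square of the density is exp(a^2) times the density
    with parameter 2a, whose mean is 1.\<close>
  have "E z ^ 2 = exp (a^2) * exp ((2 * a) * z - (2 * a)^2 / 2)" for z
  proof -
    have "(a * z - a^2 / 2) + (a * z - a^2 / 2) = a^2 + ((2 * a) * z - (2 * a)^2 / 2)"
      by (simp add: power2_eq_square algebra_simps)
    then show ?thesis unfolding E_def power2_eq_square[of "exp _"] exp_add[symmetric]
        by (simp only:)
  qed
  then have E2: "has_bochner_integral SN (\<lambda>z. E z ^ 2) (exp (a^2))"
    using has_bochner_integral_mult_right[OF SN_exp(1)[of "2 * a"], of "exp (a^2)"] by simp
  have one: "has_bochner_integral SN (\<lambda>z. 1 :: real) 1"
    using prob_space by (simp add: has_bochner_integral_iff)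
  have qsq: "(\<lambda>z. q z ^ 2)
      = (\<lambda>z. E z ^ 2 + 1 + a^2 * z^2 - 2 * E z - 2 * a * (E z * z) + 2 * a * z)"
    by (auto simp: q_def fun_eq_iff power2_eq_square algebra_simps)
  have "has_bochner_integral SN (\<lambda>z. q z ^ 2)
     (exp (a^2) + 1 + a^2 * 1 - 2 * 1 - 2 * a * a + 2 * a * 0)"
    unfolding qsq
    by (intro has_bochner_integral_add has_bochner_integral_diff has_bochner_integral_mult_right
        E1 E2 one m)
  then have q2: "integrable SN (\<lambda>z. q z ^ 2)" "(\<integral>z. q z ^ 2 \<partial>SN) = exp (a^2) - 1 - a^2"
    by (auto simp: has_bochner_integral_iff power2_eq_square)
  have "integrable SN q" unfolding q_def
    using E1(1) m(2) by (auto simp: has_bochner_integral_iff)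
  then have qi: "integrable SN (\<lambda>z. \<bar>q z\<bar>)" by simp
  then show "integrable SN (\<lambda>z. \<bar>exp (a * z - a^2 / 2) - 1 - a * z\<bar>)"
    by (simp add: q_def E_def)
  have "(\<integral>z. \<bar>q z\<bar> \<partial>SN) \<le> a^2"
  proof (cases "a = 0")
    case True then show ?thesis by (simp add: q_def E_def)
  next
    case False
    \<comment> \<open>Young's inequality with weight a^2. The second moment exp(a^2) - 1 - a^2 is at
      most a^4 for |a| \<le> 1, so both terms of the bound are of order a^2.\<close>
    have "\<bar>q z\<bar> \<le> (q z ^ 2 / a^2 + a^2) / 2" for z
    proof -
      have "0 \<le> (\<bar>q z\<bar> / \<bar>a\<bar> - \<bar>a\<bar>)^2" by simp
      also have "\<dots> = q z ^ 2 / a^2 + a^2 - 2 * \<bar>q z\<bar>"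
        using False by (simp add: power2_diff power_divide)
      finally show ?thesis by simp
    qed
    then have "(\<integral>z. \<bar>q z\<bar> \<partial>SN) \<le> (\<integral>z. (q z ^ 2 / a^2 + a^2) / 2 \<partial>SN)"
      using q2 qi by (intro integral_mono) auto
    also have "\<dots> = ((exp (a^2) - 1 - a^2) / a^2 + a^2) / 2"
      using q2 prob_space by simp
    also have "\<dots> \<le> (a^2 + a^2) / 2"
    proof -
      have "a^2 \<le> 1" using a by (simp add: abs_square_le_1)
      then have "exp (a^2) \<le> 1 + a^2 + (a^2)^2" by (intro exp_bound) auto
      then have "(exp (a^2) - 1 - a^2) \<le> a^2 * a^2" by (simp add: power2_eq_square)
      then show ?thesis using False by (simp add: divide_le_eq)
    qed
    finally show ?thesis by simp
  qed
  then show "(\<integral>z. \<bar>exp (a * z - a^2 / 2) - 1 - a * z\<bar> \<partial>SN) \<le> a^2"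
    by (simp add: q_def E_def)
qed

lemma heat_DERIV:
  assumes f: "blip c L f" and r: "r > 0"
  shows "(heat r f has_real_derivative dheat r f x) (at x)"
proof (rule quadratic_DERIV)
  show "sqrt r > 0" using r by simp
  fix \<delta> assume d: "\<bar>\<delta>\<bar> \<le> sqrt r"
  define a where "a = \<delta> / sqrt r"
  have a: "\<bar>a\<bar> \<le> 1" using d r by (simp add: a_def abs_divide)
  have da: "\<delta> = a * sqrt r" using r by (simp add: a_def)
  have [measurable]: "f \<in> borel_measurable borel" using f by (rule blipD)
  define g where "g z = f (x + sqrt r * z)" for z
  have [measurable]: "g \<in> borel_measurable borel" unfolding g_def by measurable
  have gb: "\<bar>g z\<bar> \<le> c" for z unfolding g_def by (rule blipD[OF f])
  have Ei: "integrable SN (\<lambda>z. g z * exp (a * z - a^2 / 2))"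
  proof (rule Bochner_Integration.integrable_bound[where f = "\<lambda>z. c * exp (a * z - a^2 / 2)"])
    show "integrable SN (\<lambda>z. c * exp (a * z - a^2 / 2))"
      using SN_exp(1)[of a] by (auto simp: has_bochner_integral_iff)
    show "AE z in SN. norm (g z * exp (a * z - a^2 / 2)) \<le> norm (c * exp (a * z - a^2 / 2))"
      using gb blipD(5)[OF f] by (intro AE_I2) (auto simp: abs_mult intro!: mult_right_mono)
  qed auto
  have gi: "integrable SN g" "integrable SN (\<lambda>z. g z * z)"
    unfolding g_def by (rule heat_integrable[OF f])+
  have "heat r f (x + \<delta>) = (\<integral>z. g (z + a) \<partial>SN)"
    unfolding heat_def g_def da by (simp add: algebra_simps)
  also have "\<dots> = (\<integral>z. g z * exp (a * z - a^2 / 2) \<partial>SN)" by (rule SN_shift) simp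
  finally have h1: "heat r f (x + \<delta>) = (\<integral>z. g z * exp (a * z - a^2 / 2) \<partial>SN)" .
  have h2: "heat r f x = (\<integral>z. g z \<partial>SN)" by (simp add: heat_def g_def)
  have h3: "\<delta> * dheat r f x = (\<integral>z. a * (g z * z) \<partial>SN)"
    using r by (simp add: dheat_def g_def da)
  define q where "q z = exp (a * z - a^2 / 2) - 1 - a * z" for z
  have qi: "integrable SN (\<lambda>z. \<bar>q z\<bar>)" "(\<integral>z. \<bar>q z\<bar> \<partial>SN) \<le> a^2"
    unfolding q_def by (rule SN_remainder[OF a])+
  have gq: "g z * exp (a * z - a^2 / 2) - g z - a * (g z * z) = g z * q z" for z
    unfolding q_def by (simp only: right_diff_distrib mult_1_right mult.left_commute)
  have gqi: "integrable SN (\<lambda>z. g z * q z)"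
    unfolding gq[symmetric] using Ei gi by simp
  have "heat r f (x + \<delta>) - heat r f x - \<delta> * dheat r f x
      = (\<integral>z. g z * exp (a * z - a^2 / 2) - g z - a * (g z * z) \<partial>SN)"
    unfolding h1 h2 h3 using Ei gi by simp
  also have "\<dots> = (\<integral>z. g z * q z \<partial>SN)" unfolding gq ..
  also have "\<bar>\<dots>\<bar> \<le> (\<integral>z. \<bar>g z * q z\<bar> \<partial>SN)"
    by (rule integral_abs_bound)
  also have "\<dots> \<le> (\<integral>z. c * \<bar>q z\<bar> \<partial>SN)"
  proof (rule integral_mono)
    show "\<bar>g z * q z\<bar> \<le> c * \<bar>q z\<bar>" for z
      unfolding abs_mult using gb[of z] by (intro mult_right_mono) auto
  qed (use gqi qi in auto)
  also have "\<dots> = c * (\<integral>z. \<bar>q z\<bar> \<partial>SN)" by simp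
  also have "\<dots> \<le> c * a^2" using qi(2) blipD(5)[OF f] by (intro mult_left_mono)
  also have "\<dots> = c / r * \<delta>^2" using r by (simp add: da power_mult_distrib)
  finally show "\<bar>heat r f (x + \<delta>) - heat r f x - \<delta> * dheat r f x\<bar> \<le> c / r * \<delta>^2" .
qed

section \<open>Taylor estimates and their integrated versions\<close>

lemma taylor1:
  fixes \<phi> :: "real \<Rightarrow> real"
  assumes "\<And>x. (\<phi> has_real_derivative \<phi>' x) (at x)" "\<And>x y. \<bar>\<phi>' x - \<phi>' y\<bar> \<le> K * \<bar>x - y\<bar>"
  shows "\<bar>\<phi> (x + u) - \<phi> x - u * \<phi>' x\<bar> \<le> K * u^2"
proof -
  have K: "0 \<le> K" using assms(2) by (rule lip_const_nonneg)
  have "\<exists>\<xi>. \<bar>\<xi> - x\<bar> \<le> \<bar>u\<bar> \<and> \<phi> (x + u) - \<phi> x = u * \<phi>' \<xi>"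
  proof (cases u "0 :: real" rule: linorder_cases)
    case less
    then obtain \<xi> where "x + u < \<xi>" "\<xi> < x" "\<phi> x - \<phi> (x + u) = (x - (x + u)) * \<phi>' \<xi>"
      using MVT2[of "x + u" x \<phi> \<phi>'] assms(1) by auto
    then show ?thesis by (intro exI[of _ \<xi>]) auto
  next
    case greater
    then obtain \<xi> where "x < \<xi>" "\<xi> < x + u" "\<phi> (x + u) - \<phi> x = (x + u - x) * \<phi>' \<xi>"
      using MVT2[of x "x + u" \<phi> \<phi>'] assms(1) by auto
    then show ?thesis by (intro exI[of _ \<xi>]) auto
  qed auto
  then obtain \<xi> where xi: "\<bar>\<xi> - x\<bar> \<le> \<bar>u\<bar>" "\<phi> (x + u) - \<phi> x = u * \<phi>' \<xi>" by blast
  have "\<bar>\<phi> (x + u) - \<phi> x - u * \<phi>' x\<bar> = \<bar>u\<bar> * \<bar>\<phi>' \<xi> - \<phi>' x\<bar>"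
    unfolding xi(2) by (simp add: abs_mult[symmetric] right_diff_distrib)
  also have "\<dots> \<le> \<bar>u\<bar> * (K * \<bar>u\<bar>)"
    using assms(2)[of \<xi> x] mult_left_mono[OF xi(1) K] by (intro mult_left_mono) auto
  also have "\<dots> = K * u^2" by (simp add: power2_eq_square)
  finally show ?thesis .
qed

text \<open>The remainder, as a function of the increment, vanishes at 0 and has as derivative the
  first-order remainder of \<phi>'. One application of the mean value theorem reduces the claim to
  \<open>taylor1\<close>, at the price of constants that are not sharp.\<close>

lemma taylor2:
  fixes \<phi> :: "real \<Rightarrow> real"
  assumes d: "\<And>x. (\<phi> has_real_derivative \<phi>' x) (at x)" "\<And>x. (\<phi>' has_real_derivative \<phi>'' x) (at x)"
    and l: "\<And>x y. \<bar>\<phi>'' x - \<phi>'' y\<bar> \<le> K * \<bar>x - y\<bar>"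
  shows "\<bar>\<phi> (x + u) - \<phi> x - u * \<phi>' x - u^2 / 2 * \<phi>'' x\<bar> \<le> K * \<bar>u\<bar>^3"
proof -
  have K: "0 \<le> K" using l by (rule lip_const_nonneg)
  define g where "g v = \<phi> (x + v) - \<phi> x - v * \<phi>' x - v^2 / 2 * \<phi>'' x" for v
  define g' where "g' v = \<phi>' (x + v) - \<phi>' x - v * \<phi>'' x" for v
  have der: "(g has_real_derivative g' v) (at v)" for v
    unfolding g_def g'_def
    by (rule derivative_eq_intros DERIV_chain2[OF d(1)] refl | simp)+
  have g'b: "\<bar>g' v\<bar> \<le> K * v^2" for v
    unfolding g'_def by (rule taylor1[OF d(2) l])
  have "\<exists>\<xi>. \<bar>\<xi>\<bar> \<le> \<bar>u\<bar> \<and> g u = u * g' \<xi>"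
  proof (cases u "0 :: real" rule: linorder_cases)
    case less
    then obtain \<xi> where "u < \<xi>" "\<xi> < 0" "g 0 - g u = (0 - u) * g' \<xi>"
      using MVT2[of u 0 g g'] der by auto
    then show ?thesis by (intro exI[of _ \<xi>]) (auto simp: g_def)
  next
    case greater
    then obtain \<xi> where "0 < \<xi>" "\<xi> < u" "g u - g 0 = (u - 0) * g' \<xi>"
      using MVT2[of 0 u g g'] der by auto
    then show ?thesis by (intro exI[of _ \<xi>]) (auto simp: g_def)
  qed (auto simp: g_def)
  then obtain \<xi> where xi: "\<bar>\<xi>\<bar> \<le> \<bar>u\<bar>" "g u = u * g' \<xi>" by blast
  have "\<xi>^2 \<le> u^2" using xi(1) by (simp add: abs_le_square_iff)
  then have "\<bar>g' \<xi>\<bar> \<le> K * u^2" using g'b[of \<xi>] mult_left_mono[OF _ K] order_trans by blast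
  then have "\<bar>g u\<bar> \<le> \<bar>u\<bar> * (K * u^2)" unfolding xi(2) abs_mult by (intro mult_left_mono) auto
  also have "\<dots> = K * \<bar>u\<bar>^3" by (simp add: power2_eq_square power3_eq_cube)
  finally show ?thesis by (simp add: g_def)
qed

lemma heat_DERIV_commute:
  assumes u: "blip c L u" "\<And>x. (u has_real_derivative u' x) (at x)" "blip c' L' u'"
  shows "(heat s u has_real_derivative heat s u' x) (at x)"
proof (rule quadratic_DERIV[of 1])
  fix \<delta> :: real
  have "heat s u (x + \<delta>) - heat s u x - \<delta> * heat s u' x
      = (\<integral>z. u (x + \<delta> + sqrt s * z) - u (x + sqrt s * z) - \<delta> * u' (x + sqrt s * z) \<partial>SN)"
    unfolding heat_def using heat_integrable(1)[OF u(1)] heat_integrable(1)[OF u(3)] by simp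
  also have "\<bar>\<dots>\<bar> \<le> L' * \<delta>^2"
  proof (rule integral_bound_prob[OF prob_space_SN])
    fix z
    show "\<bar>u (x + \<delta> + sqrt s * z) - u (x + sqrt s * z) - \<delta> * u' (x + sqrt s * z)\<bar> \<le> L' * \<delta>^2"
      using taylor1[OF u(2) blipD(2)[OF u(3)], of "x + sqrt s * z" \<delta>] by (simp add: algebra_simps)
  qed
  finally show "\<bar>heat s u (x + \<delta>) - heat s u x - \<delta> * heat s u' x\<bar> \<le> L' * \<delta>^2" .
qed simp

section \<open>Convolution of normal densities and the semigroup property\<close>

lemma heat_normal:
  assumes r: "r > 0" and [measurable]: "f \<in> borel_measurable borel"
  shows "heat r f x = (\<integral>y. normal_density 0 (sqrt r) y * f (x + y) \<partial>lborel)"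
proof -
  have "(\<integral>y. normal_density 0 (sqrt r) y * f (x + y) \<partial>lborel)
      = (\<integral>z. sqrt r * (normal_density 0 (sqrt r) (0 + sqrt r * z) * f (x + (0
          + sqrt r * z))) \<partial>lborel)"
    using r by (subst lborel_integral_real_affine[where c = "sqrt r" and t = 0]) simp_all
  also have "\<dots> = (\<integral>z. std_normal_density z * f (x + sqrt r * z) \<partial>lborel)"
  proof (intro Bochner_Integration.integral_cong refl)
    fix z
    have "sqrt r * normal_density 0 (sqrt r) (sqrt r * z) = std_normal_density z"
      using r by (simp add: normal_density_def real_sqrt_mult power_mult_distrib)
    then show "sqrt r * (normal_density 0 (sqrt r) (0 + sqrt r * z) * f (x + (0 + sqrt r * z)))
        = std_normal_density z * f (x + sqrt r * z)" by (metis add_0 mult.assoc)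
  qed
  also have "\<dots> = heat r f x" by (simp add: heat_def integral_density)
  finally show ?thesis by simp
qed

lemma heat_nn:
  assumes r: "r > 0" and [measurable]: "f \<in> borel_measurable borel"
    and f: "\<And>x. 0 \<le> f x" "\<And>x. f x \<le> c"
  shows "ennreal (heat r f x)
    = (\<integral>\<^sup>+y. ennreal (normal_density 0 (sqrt r) y) * ennreal (f (x + y)) \<partial>lborel)"
proof -
  have "integrable lborel (\<lambda>y. normal_density 0 (sqrt r) y * f (x + y))"
  proof (rule Bochner_Integration.integrable_bound[where f = "\<lambda>y. c * normal_density 0 (sqrt r) y"])
    have "0 \<le> c" using f[of 0] by simp
    then show "AE y in lborel. norm (normal_density 0 (sqrt r) y * f (x + y))
        \<le> norm (c * normal_density 0 (sqrt r) y)"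
      using f by (intro AE_I2) (auto simp: abs_mult mult.commute[of c] intro!: mult_left_mono)
  qed (use r in auto)
  then show ?thesis unfolding heat_normal[OF assms(1,2)]
    by (subst nn_integral_eq_integral[symmetric]) (use f in \<open>auto simp: ennreal_mult\<close>)
qed

text \<open>For nonnegative functions everything can be computed with extended nonnegative
  integrals, where the order of integration may be exchanged freely; the rest is that normal
  densities convolve to a normal density.\<close>

lemma heat_semigroup_nonneg:
  assumes s: "s > 0" and t: "t > 0" and f: "blip c L f" "\<And>x. 0 \<le> f x"
  shows "heat s (heat t f) x = heat (s + t) f x"
proof -
  have [measurable]: "f \<in> borel_measurable borel" by (rule blipD[OF f(1)])
  have [measurable]: "heat t f \<in> borel_measurable borel" by (rule blipD[OF heat_blip[OF f(1)]])
  have fc: "f x \<le> c" for x using blipD(1)[OF f(1), of x] by simp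
  have h0: "0 \<le> heat r f x" for r x unfolding heat_def using f(2) by simp
  have h0': "0 \<le> heat r (heat t f) x" for r x unfolding heat_def[of r] using h0 by simp
  have hc: "heat t f x \<le> c" for x using blipD(1)[OF heat_blip[OF f(1), of t], of x] by simp
  define ns where "ns y = ennreal (normal_density 0 (sqrt s) y)" for y
  define nt where "nt y = ennreal (normal_density 0 (sqrt t) y)" for y
  define F where "F y = ennreal (f y)" for y
  have [measurable]: "ns \<in> borel_measurable borel" "nt \<in> borel_measurable borel" "F
      \<in> borel_measurable borel"
    unfolding ns_def nt_def F_def by auto
  have "ennreal (heat s (heat t f) x) = (\<integral>\<^sup>+u. ns u * (\<integral>\<^sup>+v. nt v * F (x + u + v) \<partial>lborel) \<partial>lborel)"
    unfolding ns_def nt_def F_def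
    by (subst heat_nn[OF s _ h0 hc]; simp add: heat_nn[OF t _ f(2) fc])
  also have "\<dots> = (\<integral>\<^sup>+u. ns u * (\<integral>\<^sup>+v. nt (v - u) * F (x + v) \<partial>lborel) \<partial>lborel)"
  proof -
    have "(\<integral>\<^sup>+v. nt v * F (x + u + v) \<partial>lborel) = (\<integral>\<^sup>+v. nt (v - u) * F (x + v) \<partial>lborel)"
        for u :: real
      by (subst nn_integral_real_affine[where c = 1 and t = "- u"]) (simp_all add: algebra_simps)
    then show ?thesis by (simp only:)
  qed
  also have "\<dots> = (\<integral>\<^sup>+u. (\<integral>\<^sup>+v. F (x + v) * (nt (v - u) * ns u) \<partial>lborel) \<partial>lborel)"
    by (simp add: nn_integral_cmult[symmetric] mult_ac)
  also have "\<dots> = (\<integral>\<^sup>+v. (\<integral>\<^sup>+u. F (x + v) * (nt (v - u) * ns u) \<partial>lborel) \<partial>lborel)"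
    by (rule lborel_pair.Fubini') measurable
  also have "\<dots> = (\<integral>\<^sup>+v. F (x + v) * (\<integral>\<^sup>+u. nt (v - u) * ns u \<partial>lborel) \<partial>lborel)"
    by (simp add: nn_integral_cmult)
  also have "(\<lambda>v. \<integral>\<^sup>+u. nt (v - u) * ns u \<partial>lborel) = (\<lambda>v. ennreal (normal_density 0 (sqrt (s
      + t)) v))"
  proof -
    have "(\<lambda>v. \<integral>\<^sup>+u. ennreal (normal_density 0 (sqrt t) (v
        - u) * normal_density 0 (sqrt s) u) \<partial>lborel)
      = normal_density 0 (sqrt ((sqrt t)\<^sup>2 + (sqrt s)\<^sup>2))"
      by (rule conv_normal_density_zero_mean) (use s t in auto)
    then show ?thesis using s t by (simp add: nt_def ns_def ennreal_mult add.commute)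
  qed
  also have "(\<integral>\<^sup>+v. F (x + v) * ennreal (normal_density 0 (sqrt (s + t)) v) \<partial>lborel)
      = ennreal (heat (s + t) f x)"
    unfolding F_def by (subst heat_nn[OF _ _ f(2) fc]) (use s t in \<open>auto simp: mult.commute\<close>)
  finally show ?thesis using h0 h0' by simp
qed

lemma heat_add_const:
  assumes "blip c L f" shows "heat r (\<lambda>x. f x + d) = (\<lambda>x. heat r f x + d)"
proof
  interpret prob_space SN by (rule prob_space_SN)
  fix x
  have "(\<integral>z. f (x + sqrt r * z) + d \<partial>SN) = (\<integral>z. f (x + sqrt r * z) \<partial>SN) + (\<integral>z. d \<partial>SN)"
    by (rule Bochner_Integration.integral_add) (use heat_integrable(1)[OF assms] in auto)
  then show "heat r (\<lambda>x. f x + d) x = heat r f x + d"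
    unfolding heat_def using prob_space by simp
qed

lemma heat_semigroup:
  assumes "s \<ge> 0" "t \<ge> 0" and f: "blip c L f"
  shows "heat s (heat t f) = heat (s + t) f"
proof (cases "s = 0 \<or> t = 0")
  case False
  then have st: "s > 0" "t > 0" using assms by auto
  \<comment> \<open>Adding the sup bound \<open>c\<close> makes the function nonnegative, and both
    sides shift by the same constant.\<close>
  have b: "blip (2 * c) L (\<lambda>x. f x + c)" unfolding blip_def
  proof (intro conjI allI)
    show "\<bar>f x + c\<bar> \<le> 2 * c" for x using blipD(1)[OF f, of x] by linarith
  qed (use blipD(2)[OF f] in simp)
  have "0 \<le> f x + c" for x using blipD(1)[OF f, of x] by linarith
  then have "heat s (heat t (\<lambda>x. f x + c)) x = heat (s + t) (\<lambda>x. f x + c) x" for x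
    by (rule heat_semigroup_nonneg[OF st b])
  then show ?thesis
    by (simp add: heat_add_const[OF f] heat_add_const[OF heat_blip[OF f]] fun_eq_iff)
qed auto

lemma heat_periodic: "periodic1 f \<Longrightarrow> periodic1 (heat r f)"
  unfolding periodic1_def heat_def
  by (intro allI Bochner_Integration.integral_cong refl) (metis add.assoc add.commute)

lemma dheat_periodic: "periodic1 f \<Longrightarrow> periodic1 (dheat r f)"
proof -
  assume f: "periodic1 f"
  have "f (x + 2 * pi + s * z) = f (x + s * z)" for x s z
    using f unfolding periodic1_def by (metis add.assoc add.commute)
  then show ?thesis by (simp add: periodic1_def dheat_def)
qed

text \<open>Both sides are derivatives of \<open>heat (s + t) f\<close>: one by differentiating
  under the outer Gaussian integral, the other by the semigroup property first.\<close>

lemma heat_dheat: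
  assumes f: "blip c L f" and "s \<ge> 0" "t > 0"
  shows "heat s (dheat t f) = dheat (s + t) f"
proof
  fix x
  have "(heat s (heat t f) has_real_derivative heat s (dheat t f) x) (at x)"
    by (rule heat_DERIV_commute[OF heat_blip[OF f] heat_DERIV[OF f] dheat_blip[OF f]]) (use assms
        in auto)
  moreover have "(heat s (heat t f) has_real_derivative dheat (s + t) f x) (at x)"
    using heat_DERIV[OF f, of "s + t" x] heat_semigroup[OF _ _ f, of s t] assms by simp
  ultimately show "heat s (dheat t f) x = dheat (s + t) f x" by (rule DERIV_unique)
qed

text \<open>The second derivative of \<open>heat r f\<close>. Splitting the time into two halves
  lets each half pay for one derivative.\<close>

definition d2heat :: "real \<Rightarrow> (real \<Rightarrow> real) \<Rightarrow> real \<Rightarrow> real" where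
  "d2heat r f = dheat (r / 2) (dheat (r / 2) f)"

lemma dheat_DERIV:
  assumes f: "blip c L f" and r: "r > 0"
  shows "(dheat r f has_real_derivative d2heat r f x) (at x)"
  using heat_DERIV[OF dheat_blip[OF f], of "r / 2" "r / 2" x] heat_dheat[OF f, of "r / 2" "r / 2"] r
  by (simp add: d2heat_def)

text \<open>Each differentiation spends half of the remaining heat time: the derivative is again a
  heat flow, run for \<open>r / 2\<close> from the bounded Lipschitz function
  \<open>dheat (r / 2) f\<close>. This makes \<open>heat r f\<close> an admissible test function for
  the weak equation even when \<open>f\<close> is only Lipschitz.\<close>

lemma heat_higher_DERIV:
  "blip c L f \<Longrightarrow> r > 0 \<Longrightarrow>
    ((deriv ^^ k) (heat r f) has_real_derivative (deriv ^^ Suc k) (heat r f) x) (at x)"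
proof (induction k arbitrary: c L f r x)
  case 0
  then show ?case using heat_DERIV[OF 0] DERIV_imp_deriv[OF heat_DERIV[OF 0]] by simp
next
  case (Suc k)
  have "deriv (heat r f) = dheat r f"
    using heat_DERIV[OF Suc.prems] DERIV_imp_deriv by blast
  also have "\<dots> = heat (r / 2) (dheat (r / 2) f)"
    using heat_dheat[OF Suc.prems(1), of "r / 2" "r / 2"] Suc.prems(2) by simp
  finally have e: "(deriv ^^ Suc j) (heat r f) = (deriv ^^ j) (heat (r / 2) (dheat (r / 2) f))"
      for j
    by (simp only: funpow_Suc_right o_apply)
  show ?case unfolding e
    by (rule Suc.IH[OF dheat_blip[OF Suc.prems(1)]]) (use Suc.prems in auto)
qed

lemma heat_smooth1: "blip c L f \<Longrightarrow> r > 0 \<Longrightarrow> smooth1 (heat r f)"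
  unfolding smooth1_def
  by (intro exI[of _ "\<lambda>k. (deriv ^^ k) (heat r f)"] conjI allI) (simp, rule heat_higher_DERIV)

lemma deriv_heat: "blip c L f \<Longrightarrow> r > 0 \<Longrightarrow> deriv (heat r f) = dheat r f"
  using heat_DERIV DERIV_imp_deriv by blast

lemma deriv_dheat: "blip c L f \<Longrightarrow> r > 0 \<Longrightarrow> deriv (dheat r f) = d2heat r f"
  using dheat_DERIV DERIV_imp_deriv by blast

section \<open>The heat flow of bounded Lipschitz test functions\<close>

lemma BL_blip: "f \<in> BL_test \<Longrightarrow> blip 1 1 f"
  by (auto simp: BL_test_def blip_def)

lemma BL_heat: assumes "f \<in> BL_test" shows "heat r f \<in> BL_test"
  using heat_blip[OF BL_blip[OF assms], of r] heat_periodic[of f r] assms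
  by (auto simp: BL_test_def blip_def)

lemma sqrt_half: "r > 0 \<Longrightarrow> 1 / sqrt (r / 2) = sqrt (2 / r)"
  by (simp add: real_sqrt_divide)

text \<open>The gradient inherits the bound 1 from the Lipschitz constant of \<open>f\<close>. Its
  Lipschitz constant blows up only like \<open>r powr (-1/2)\<close>, and this is the integrable
  singularity of the final Gronwall kernel. The factor 2 is the price of halving the time.\<close>

lemma BL_dheat:
  assumes f: "f \<in> BL_test" and r: "r > 0"
  shows "periodic1 (dheat r f)" "blip 1 (sqrt (2 / r)) (dheat r f)"
proof -
  show "periodic1 (dheat r f)" using f by (intro dheat_periodic) (simp add: BL_test_def)
  have "blip (1 / sqrt (r / 2)) (1 / sqrt (r / 2)) (dheat (r / 2) f)"
    using dheat_blip[OF BL_blip[OF f], of "r / 2"] r by simp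
  from heat_blip[OF this, of "r / 2"]
  have "blip (1 / sqrt (r / 2)) (1 / sqrt (r / 2)) (dheat r f)"
    using heat_dheat[OF BL_blip[OF f], of "r / 2" "r / 2"] r by simp
  then show "blip 1 (sqrt (2 / r)) (dheat r f)"
    using dheat_le_lip[OF BL_blip[OF f] r] r unfolding sqrt_half[OF r] by (auto simp: blip_def)
qed

lemma BL_d2heat:
  assumes f: "f \<in> BL_test" and r: "r > 0"
  shows "periodic1 (d2heat r f)" "blip (sqrt (2 / r)) (2 / r) (d2heat r f)"
proof -
  show "periodic1 (d2heat r f)"
    using f unfolding d2heat_def by (intro dheat_periodic) (simp add: BL_test_def)
  have r2: "r / 2 > 0" using r by simp
  have b: "blip 1 (1 / sqrt (r / 2)) (dheat (r / 2) f)"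
    using dheat_blip[OF BL_blip[OF f] r2] dheat_le_lip[OF BL_blip[OF f] r2] by (auto simp: blip_def)
  have "1 / sqrt (r / 2) / sqrt (r / 2) = 1 / (sqrt (r / 2) * sqrt (r / 2))" by simp
  also have "sqrt (r / 2) * sqrt (r / 2) = r / 2" using r
      by (intro real_sqrt_mult_self[THEN trans]) auto
  finally have "1 / sqrt (r / 2) / sqrt (r / 2) = 2 / r" by simp
  then show "blip (sqrt (2 / r)) (2 / r) (d2heat r f)"
    using dheat_blip[OF b r2] unfolding d2heat_def sqrt_half[OF r] by simp
qed

lemma heat_close:
  assumes f: "blip c L f" and h: "h \<ge> 0"
  shows "\<bar>heat h f x - f x\<bar> \<le> L * sqrt h"
proof -
  interpret prob_space SN by (rule prob_space_SN)
  have "heat h f x - f x = (\<integral>z. f (x + sqrt h * z) - f x \<partial>SN)"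
    unfolding heat_def using heat_integrable(1)[OF f] prob_space by simp
  also have "\<bar>\<dots>\<bar> \<le> L * sqrt h"
  proof (rule SN_integral_abs_bound)
    show "integrable SN (\<lambda>z. f (x + sqrt h * z) - f x)" using heat_integrable(1)[OF f] by simp
    show "\<bar>f (x + sqrt h * z) - f x\<bar> \<le> L * sqrt h * \<bar>z\<bar>" for z
      using blipD(2)[OF f, of "x + sqrt h * z" x] h by (simp add: abs_mult mult_ac)
  qed
  finally show ?thesis .
qed

text \<open>Taylor expansion under the Gaussian integral: the first moment vanishes, the second
  gives the half Laplacian, and the third absolute moment bounds the remainder.\<close>

lemma heat_second_order:
  assumes u: "blip c L u" "\<And>x. (u has_real_derivative u' x) (at x)" "\<And>x. (u' has_real_derivative
      u'' x) (at x)"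
    and l: "\<And>x y. \<bar>u'' x - u'' y\<bar> \<le> K * \<bar>x - y\<bar>" and h: "h \<ge> 0"
  shows "\<bar>heat h u x - u x - h / 2 * u'' x\<bar> \<le> 2 * K * (h * sqrt h)"
proof -
  interpret prob_space SN by (rule prob_space_SN)
  have K: "0 \<le> K" using l by (rule lip_const_nonneg)
  have m: "integrable SN (\<lambda>z. z^2)" "(\<integral>z. z^2 \<partial>SN) = 1" "integrable SN (\<lambda>z. z)" "(\<integral>z. z \<partial>SN) = 0"
    using SN_moments by (auto simp: has_bochner_integral_iff)
  define R where "R z = u (x + sqrt h * z) - u x - sqrt h * z * u' x - (sqrt h * z)^2 / 2 * u'' x"
      for z
  have R: "R = (\<lambda>z. u (x + sqrt h * z) - u x - (sqrt h * u' x) * z - (h / 2 * u'' x) * z^2)"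
    using h by (auto simp: R_def fun_eq_iff power_mult_distrib)
  have Ri: "integrable SN R" unfolding R using heat_integrable(1)[OF u(1)] m by simp
  have "(\<integral>z. R z \<partial>SN) = heat h u x - u x - h / 2 * u'' x"
    unfolding R heat_def using heat_integrable(1)[OF u(1)] m prob_space by simp
  then have "\<bar>heat h u x - u x - h / 2 * u'' x\<bar> = \<bar>\<integral>z. R z \<partial>SN\<bar>" by simp
  also have "\<dots> \<le> (\<integral>z. \<bar>R z\<bar> \<partial>SN)" by (rule integral_abs_bound)
  also have "\<dots> \<le> (\<integral>z. (K * (h * sqrt h)) * \<bar>z\<bar>^3 \<partial>SN)"
  proof (rule integral_mono)
    fix z
    have "\<bar>R z\<bar> \<le> K * \<bar>sqrt h * z\<bar>^3" unfolding R_def by (rule taylor2[OF u(2,3) l])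
    also have "\<bar>sqrt h * z\<bar>^3 = (h * sqrt h) * \<bar>z\<bar>^3"
      using h by (simp add: abs_mult power_mult_distrib) (simp add: power3_eq_cube)
    finally show "\<bar>R z\<bar> \<le> (K * (h * sqrt h)) * \<bar>z\<bar>^3" by simp
  qed (use Ri SN_abs3 in auto)
  also have "\<dots> = (K * (h * sqrt h)) * (\<integral>z. \<bar>z\<bar>^3 \<partial>SN)" by simp
  also have "\<dots> \<le> (K * (h * sqrt h)) * 2" using K h SN_abs3(2) by (intro mult_left_mono) auto
  finally show ?thesis by simp
qed

section \<open>The limit equation and its time discretisation\<close>

lemma abs_integral_le_const:
  fixes f :: "real \<Rightarrow> real"
  assumes "f integrable_on {a..b}" "a \<le> b" "\<And>x. x \<in> {a..b} \<Longrightarrow> \<bar>f x\<bar> \<le> c"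
  shows "\<bar>integral {a..b} f\<bar> \<le> c * (b - a)"
proof -
  have "norm (integral {a..b} f) \<le> integral {a..b} (\<lambda>x. c)"
    by (rule integral_norm_bound_integral) (use assms in auto)
  then show ?thesis using assms(2) by (simp add: mult.commute)
qed

locale mean_field_limit =
  fixes G :: "real \<Rightarrow> real \<Rightarrow> real" and T A L :: real and \<mu>0 :: "real measure"
    and \<mu> :: "real \<Rightarrow> real measure"
  assumes T_pos: "T > 0" and G_per: "periodic2 G"
    and G_bound: "\<And>x y. \<bar>G x y\<bar> \<le> A"
    and G_lip1: "\<And>x x' y. \<bar>G x y - G x' y\<bar> \<le> L * \<bar>x - x'\<bar>"
    and G_lip2: "\<And>x y y'. \<bar>G x y - G x y'\<bar> \<le> L * \<bar>y - y'\<bar>"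
    and A_ge: "1 \<le> A" and L_ge: "1 \<le> L"
    and sol: "mckean_vlasov_sol G T \<mu>0 \<mu>"
begin

section \<open>The weak solution as a family of functionals\<close>

definition muI :: "real \<Rightarrow> (real \<Rightarrow> real) \<Rightarrow> real" where
  "muI t f = (\<integral>x. f x \<partial>(\<mu> t))"

definition b :: "real \<Rightarrow> real \<Rightarrow> real" where
  "b t x = muI t (G x)"

lemma mu_prob: "t \<in> {0..T} \<Longrightarrow> prob_space (\<mu> t)"
  and mu_sets: "t \<in> {0..T} \<Longrightarrow> sets (\<mu> t) = sets borel"
  and mu_0: "\<mu> 0 = \<mu>0"
  and mu_cont: "\<And>f. continuous_on UNIV f \<Longrightarrow> bounded (range f) \<Longrightarrow> continuous_on {0..T} (\<lambda>t. muI t f)"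
  using sol by (auto simp: mckean_vlasov_sol_def muI_def)

lemma mu_integrable:
  fixes f :: "real \<Rightarrow> real"
  assumes "t \<in> {0..T}" "continuous_on UNIV f" "\<And>x. \<bar>f x\<bar> \<le> c"
  shows "integrable (\<mu> t) f"
  using integrable_bounded_cont[OF prob_space.finite_measure[OF mu_prob[OF assms(1)]] mu_sets[OF
      assms(1)]
      assms(2,3)] .

lemma muI_bound: "t \<in> {0..T} \<Longrightarrow> (\<And>x. \<bar>f x\<bar> \<le> c) \<Longrightarrow> \<bar>muI t f\<bar> \<le> c"
  unfolding muI_def by (rule integral_bound_prob[OF mu_prob]) auto

lemma muI_diff:
  assumes "t \<in> {0..T}" "continuous_on UNIV f" "\<And>x. \<bar>f x\<bar> \<le> c" "continuous_on UNIV g" "\<And>x. \<bar>g x\<bar>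
      \<le> c'"
  shows "muI t (\<lambda>x. f x - g x) = muI t f - muI t g"
  unfolding muI_def using mu_integrable[OF assms(1-3)] mu_integrable[OF assms(1,4,5)] by simp

lemma muI_add:
  assumes "t \<in> {0..T}" "continuous_on UNIV f" "\<And>x. \<bar>f x\<bar> \<le> c" "continuous_on UNIV g" "\<And>x. \<bar>g x\<bar>
      \<le> c'"
  shows "muI t (\<lambda>x. f x + g x) = muI t f + muI t g"
  unfolding muI_def using mu_integrable[OF assms(1-3)] mu_integrable[OF assms(1,4,5)] by simp

lemma muI_cmult: "muI t (\<lambda>x. c * f x) = c * muI t f"
  unfolding muI_def by simp

lemma muI_close:
  assumes "t \<in> {0..T}" "continuous_on UNIV f" "\<And>x. \<bar>f x\<bar> \<le> c" "continuous_on UNIV g" "\<And>x. \<bar>g x\<bar>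
      \<le> c'"
    "\<And>x. \<bar>f x - g x\<bar> \<le> e"
  shows "\<bar>muI t f - muI t g\<bar> \<le> e"
  using muI_bound[OF assms(1), of "\<lambda>x. f x - g x" e] muI_diff[OF assms(1-5)] assms(6) by simp

lemma G_cont: "continuous_on UNIV (G x)" by (rule lip_continuous[OF G_lip2])

lemma G_bounded: "bounded (range (G x))"
  by (rule boundedI[where B = A]) (use G_bound in auto)

lemma b_bound: "t \<in> {0..T} \<Longrightarrow> \<bar>b t x\<bar> \<le> A"
  unfolding b_def by (rule muI_bound[OF _ G_bound])

lemma b_lip: "t \<in> {0..T} \<Longrightarrow> \<bar>b t x - b t y\<bar> \<le> L * \<bar>x - y\<bar>"
  unfolding b_def by (rule muI_close[OF _ G_cont G_bound G_cont G_bound G_lip1])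

lemma b_per: "periodic1 (b t)"
proof -
  have "G (x + 2 * pi) = G x" for x using G_per by (auto simp: periodic2_def)
  then show ?thesis by (simp add: periodic1_def b_def)
qed

lemma b_blip: "t \<in> {0..T} \<Longrightarrow> blip A L (b t)"
  unfolding blip_def using b_bound b_lip by blast

lemma blip_mult:
  assumes "blip c1 L1 f" "blip c2 L2 g"
  shows "blip (c1 * c2) (c1 * L2 + c2 * L1) (\<lambda>x. f x * g x)"
  unfolding blip_def
proof (intro conjI allI)
  fix x y
  note F = blipD[OF assms(1)] and G = blipD[OF assms(2)]
  show "\<bar>f x * g x\<bar> \<le> c1 * c2" unfolding abs_mult using F G by (intro mult_mono) auto
  have "f x * g x - f y * g y = f x * (g x - g y) + g y * (f x - f y)" by (simp add: algebra_simps)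
  also have "\<bar>\<dots>\<bar> \<le> \<bar>f x\<bar> * \<bar>g x - g y\<bar> + \<bar>g y\<bar> * \<bar>f x - f y\<bar>"
    by (metis abs_mult abs_triangle_ineq)
  also have "\<dots> \<le> c1 * (L2 * \<bar>x - y\<bar>) + c2 * (L1 * \<bar>x - y\<bar>)"
    using F G by (intro add_mono mult_mono) auto
  finally show "\<bar>f x * g x - f y * g y\<bar> \<le> (c1 * L2 + c2 * L1) * \<bar>x - y\<bar>"
    by (simp add: algebra_simps)
qed

text \<open>The measure and the integrand both move with \<open>s\<close>. Weak continuity handles
  the first. For the second, weak continuity gives only pointwise convergence of the drift; since
  the drifts are periodic with a common Lipschitz constant, convergence at finitely many grid points
  is already uniform.\<close>

lemma b_time_cont:
  assumes \<phi>: "blip c K \<phi>"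
  shows "continuous_on {0..T} (\<lambda>s. muI s (\<lambda>x. \<phi> x * b s x))"
  unfolding continuous_on_def
proof
  fix s assume s: "s \<in> {0..T}"
  note P = blipD[OF \<phi>]
  have bl: "blip (c * A) (c * L + A * K) (\<lambda>x. \<phi> x * b s x)" by (rule blip_mult[OF \<phi> b_blip[OF s]])
  show "((\<lambda>s. muI s (\<lambda>x. \<phi> x * b s x)) \<longlongrightarrow> muI s (\<lambda>x. \<phi> x * b s x)) (at s within {0..T})"
  proof (rule tendstoI)
    fix e :: real assume e: "e > 0"
    define d where "d = e / (2 * (c + 1))"
    have d: "d > 0" using e P(5) by (simp add: d_def)
    \<comment> \<open>The mesh is so small that the two Lipschitz errors, at \<open>s\<close> and at
      \<open>s'\<close>, together stay below \<open>d\<close>.\<close>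
    obtain N :: nat where N': "4 * pi * L / d < real N" using reals_Archimedean2 by blast
    moreover have "0 \<le> 4 * pi * L / d" using L_ge d by simp
    ultimately have N: "N > 0" "4 * pi * L / d < real N" by (auto intro!: gr0I)
    have N2: "4 * pi * L / real N < d" using N d by (simp add: field_simps)
    define v where "v a = 2 * pi * real a / real N" for a :: nat
    have bc: "((\<lambda>s'. b s' x) \<longlongrightarrow> b s x) (at s within {0..T})" for x
      using mu_cont[OF G_cont G_bounded] s unfolding b_def continuous_on_def by blast
    have muc: "((\<lambda>s'. muI s' (\<lambda>x. \<phi> x * b s x)) \<longlongrightarrow> muI s (\<lambda>x. \<phi> x * b s x)) (at s within {0..T})"
    proof -
      have "bounded (range (\<lambda>x. \<phi> x * b s x))"
        by (rule boundedI[where B = "c * A"]) (use blipD(1)[OF bl] in auto)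
      from mu_cont[OF blipD(3)[OF bl] this] show ?thesis using s unfolding continuous_on_def
          by blast
    qed
    define H where "H s' = \<bar>muI s' (\<lambda>x. \<phi> x * b s x) - muI s (\<lambda>x. \<phi> x * b s x)\<bar>
       + c * (\<Sum>a<N. \<bar>b s' (v a) - b s (v a)\<bar>)" for s'
    have "(H \<longlongrightarrow> \<bar>muI s (\<lambda>x. \<phi> x * b s x) - muI s (\<lambda>x. \<phi> x * b s x)\<bar>
       + c * (\<Sum>a<N. \<bar>b s (v a) - b s (v a)\<bar>)) (at s within {0..T})"
      unfolding H_def by (intro tendsto_intros muc bc)
    then have "(H \<longlongrightarrow> 0) (at s within {0..T})" by simp
    then have ev: "\<forall>\<^sub>F s' in at s within {0..T}. H s' < e / 2"
      using e by (intro order_tendstoD(2)[of H 0]) auto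
    have main: "\<bar>muI s' (\<lambda>x. \<phi> x * b s' x) - muI s (\<lambda>x. \<phi> x * b s x)\<bar> < e"
      if s': "s' \<in> {0..T}" and H: "H s' < e / 2" for s'
    proof -
      define S where "S = (\<Sum>a<N. \<bar>b s' (v a) - b s (v a)\<bar>)"
      have diff: "\<bar>b s' x - b s x\<bar> \<le> d + S" for x
      proof -
        define y where "y = rmod x * real N / (2 * pi)"
        define j where "j = nat \<lfloor>y\<rfloor>"
        have y0: "0 \<le> y" using rmod_bounds[of x] by (simp add: y_def)
        have yN: "y < real N" using rmod_bounds[of x] N
          by (simp add: y_def divide_less_eq mult.commute)
        have j: "real j \<le> y" "y < real j + 1" using y0 by (auto simp: j_def)
        have jN: "j < N" using j yN by linarith
        have "rmod x - v j = 2 * pi / real N * (y - real j)"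
          using N by (simp add: y_def v_def field_simps)
        then have "\<bar>rmod x - v j\<bar> = 2 * pi / real N * \<bar>y - real j\<bar>" by (simp add: abs_mult)
        also have "\<dots> \<le> 2 * pi / real N * 1" using j by (intro mult_left_mono) auto
        finally have dd: "L * \<bar>rmod x - v j\<bar> \<le> L * (2 * pi / real N)"
          using L_ge by (intro mult_left_mono) auto
        have x: "b s x = b s (rmod x)" "b s' x = b s' (rmod x)"
            by (simp_all add: periodic1_rmod[OF b_per])
        have "\<bar>b s' (v j) - b s (v j)\<bar> \<le> S"
          unfolding S_def by (rule member_le_sum[where f = "\<lambda>a. \<bar>b s' (v a)
              - b s (v a)\<bar>"]) (use jN in auto)
        then have "\<bar>b s' x - b s x\<bar> \<le> 2 * (L * (2 * pi / real N)) + S"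
          using b_lip[OF s, of "rmod x" "v j"] b_lip[OF s', of "rmod x" "v j"] dd unfolding x
              by linarith
        then show ?thesis using N2 by (simp add: mult_ac)
      qed
      have bl': "blip (c * A) (c * L + A * K) (\<lambda>x. \<phi> x * b s' x)"
          by (rule blip_mult[OF \<phi> b_blip[OF s']])
      have "\<bar>muI s' (\<lambda>x. \<phi> x * b s' x) - muI s' (\<lambda>x. \<phi> x * b s x)\<bar> \<le> c * (d + S)"
      proof (rule muI_close[OF s' blipD(3)[OF bl'] blipD(1)[OF bl'] blipD(3)[OF bl] blipD(1)[OF
          bl]])
        fix x
        have "\<bar>\<phi> x * (b s' x - b s x)\<bar> \<le> c * (d + S)"
          unfolding abs_mult using P(1,5) diff[of x] by (intro mult_mono) auto
        then show "\<bar>\<phi> x * b s' x - \<phi> x * b s x\<bar> \<le> c * (d + S)" by (simp add: right_diff_distrib)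
      qed
      moreover have "c * d < e / 2"
      proof -
        have "c * e < (c + 1) * e" using e by simp
        then show ?thesis using P(5) by (simp add: d_def field_simps)
      qed
      ultimately show ?thesis using H unfolding H_def S_def[symmetric] distrib_left by linarith
    qed
    show "\<forall>\<^sub>F s' in at s within {0..T}. dist (muI s' (\<lambda>x. \<phi> x * b s' x)) (muI s (\<lambda>x. \<phi> x * b s x))
        < e"
      using ev unfolding eventually_at_filter dist_real_def
          by (rule eventually_mono) (use main in blast)
  qed
qed

text \<open>The integrand of the weak formulation for the test function
  \<open>heat r f\<close>.\<close>

definition gen :: "real \<Rightarrow> (real \<Rightarrow> real) \<Rightarrow> real \<Rightarrow> real" where
  "gen r f s = muI s (\<lambda>x. d2heat r f x / 2) + muI s (\<lambda>x. dheat r f x * b s x)"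

lemma blip_half: "blip c K f \<Longrightarrow> blip c K (\<lambda>x. f x / 2)"
  unfolding blip_def
proof (intro conjI allI)
  fix x y assume *: "(\<forall>x. \<bar>f x\<bar> \<le> c) \<and> (\<forall>x y. \<bar>f x - f y\<bar> \<le> K * \<bar>x - y\<bar>)"
  have "f x / 2 - f y / 2 = (f x - f y) / 2" by (simp add: diff_divide_distrib)
  then show "\<bar>f x / 2 - f y / 2\<bar> \<le> K * \<bar>x - y\<bar>" using *[THEN conjunct2, rule_format, of x y] by simp
  show "\<bar>f x / 2\<bar> \<le> c" using *[THEN conjunct1, rule_format, of x] by simp
qed

text \<open>The weak formulation speaks of integrals from 0 only. Continuity of
  \<open>gen r f\<close> in time makes it integrable, so that two such integrals can be
  subtracted.\<close>

lemma weak_increment: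
  assumes f: "f \<in> BL_test" and r: "r > 0" and st: "0 \<le> s" "s \<le> t" "t \<le> T"
  shows "muI t (heat r f) - muI s (heat r f) = integral {s..t} (gen r f)"
    and "gen r f integrable_on {s..t}"
proof -
  have w: "muI t (heat r f) = muI 0 (heat r f) + integral {0..t} (gen r f)" if t: "t \<in> {0..T}" for t
  proof -
    have "smooth1 (heat r f)" "periodic1 (heat r f)"
      using heat_smooth1[OF BL_blip[OF f] r] BL_heat[OF f, of r] by (auto simp: BL_test_def)
    then have "muI t (heat r f) = muI 0 (heat r f)
        + integral {0..t} (\<lambda>s. \<integral>x. (deriv (deriv (heat r f)) x / 2 +
              deriv (heat r f) x * (\<integral>y. G x y \<partial>(\<mu> s))) \<partial>(\<mu> s))"
      using sol t unfolding mckean_vlasov_sol_def muI_def by auto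
    also have "integral {0..t} (\<lambda>s. \<integral>x. (deriv (deriv (heat r f)) x / 2 +
              deriv (heat r f) x * (\<integral>y. G x y \<partial>(\<mu> s))) \<partial>(\<mu> s)) = integral {0..t} (gen r f)"
    proof (rule Henstock_Kurzweil_Integration.integral_cong)
      fix s assume "s \<in> {0..t}"
      then have s: "s \<in> {0..T}" using t by auto
      have 1: "blip (sqrt (2 / r)) (2 / r) (\<lambda>x. d2heat r f x / 2)"
          by (rule blip_half[OF BL_d2heat(2)[OF f r]])
      note 2 = blip_mult[OF BL_dheat(2)[OF f r] b_blip[OF s]]
      show "(\<integral>x. (deriv (deriv (heat r f)) x / 2 +
              deriv (heat r f) x * (\<integral>y. G x y \<partial>(\<mu> s))) \<partial>(\<mu> s)) = gen r f s"
        unfolding deriv_heat[OF BL_blip[OF f] r] deriv_dheat[OF BL_blip[OF f] r] gen_def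
        using muI_add[OF s blipD(3)[OF 1] blipD(1)[OF 1] blipD(3)[OF 2] blipD(1)[OF 2]]
        by (simp add: muI_def b_def)
    qed
    finally show ?thesis .
  qed
  have c1: "continuous_on {0..T} (\<lambda>s. muI s (\<lambda>x. d2heat r f x / 2))"
  proof (rule mu_cont)
    have 1: "blip (sqrt (2 / r)) (2 / r) (\<lambda>x. d2heat r f x / 2)"
        by (rule blip_half[OF BL_d2heat(2)[OF f r]])
    show "continuous_on UNIV (\<lambda>x. d2heat r f x / 2)" by (rule blipD(3)[OF 1])
    show "bounded (range (\<lambda>x. d2heat r f x / 2))"
      by (rule boundedI[where B = "sqrt (2 / r)"]) (use blipD(1)[OF 1] in auto)
  qed
  have cont: "continuous_on {0..T} (gen r f)"
    unfolding gen_def by (intro continuous_on_add c1 b_time_cont[OF BL_dheat(2)[OF f r]])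
  have int: "gen r f integrable_on {0..t}"
    by (rule integrable_continuous_real) (use cont st in \<open>auto intro: continuous_on_subset\<close>)
  show "gen r f integrable_on {s..t}"
    by (rule integrable_continuous_real) (use cont st in \<open>auto intro: continuous_on_subset\<close>)
  have "integral {0..s} (gen r f) + integral {s..t} (gen r f) = integral {0..t} (gen r f)"
    by (rule Henstock_Kurzweil_Integration.integral_combine) (use int st in auto)
  then show "muI t (heat r f) - muI s (heat r f) = integral {s..t} (gen r f)"
    using w[of t] w[of s] st by simp
qed

section \<open>Regularity in time of the weak solution\<close>

lemma gen_bound:
  assumes f: "f \<in> BL_test" and r: "r > 0" and s: "s \<in> {0..T}"
  shows "\<bar>gen r f s\<bar> \<le> sqrt (2 / r) + A"
proof -
  have "\<bar>muI s (\<lambda>x. d2heat r f x / 2)\<bar> \<le> sqrt (2 / r)"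
    by (rule muI_bound[OF s]) (rule blipD[OF blip_half[OF BL_d2heat(2)[OF f r]]])
  moreover have "\<bar>muI s (\<lambda>x. dheat r f x * b s x)\<bar> \<le> 1 * A"
    by (rule muI_bound[OF s]) (rule blipD[OF blip_mult[OF BL_dheat(2)[OF f r] b_blip[OF s]]])
  ultimately show ?thesis unfolding gen_def by linarith
qed

text \<open>The 4 collects two smoothing errors and a square root of 2 rounded up to 2; the other
  summand comes from estimating a time increment r \<le> T by sqrt T * sqrt r.\<close>

definition c0 :: real where "c0 = 4 + A * sqrt T"

text \<open>The test function is smoothed for the time \<open>r = t - s\<close>. Smoothing costs
  \<open>sqrt r\<close> at either end, and the weak equation contributes r * (sqrt (2/r) + A); this
  choice of \<open>r\<close> gives both errors the same order.\<close>

lemma muI_holder_le: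
  assumes f: "f \<in> BL_test" and st: "0 \<le> s" "s \<le> t" "t \<le> T"
  shows "\<bar>muI t f - muI s f\<bar> \<le> c0 * sqrt (t - s)"
proof (cases "s = t")
  case False
  define r where "r = t - s"
  have r: "r > 0" using False st by (simp add: r_def)
  have sT: "s \<in> {0..T}" "t \<in> {0..T}" using st by auto
  note F = BL_blip[OF f]
  have cl: "\<bar>muI u f - muI u (heat r f)\<bar> \<le> sqrt r" if "u \<in> {0..T}" for u
    using muI_close[OF that blipD(3)[OF F] blipD(1)[OF F] blipD(3)[OF heat_blip[OF F]] blipD(1)[OF
        heat_blip[OF F]], of r "sqrt r"]
      heat_close[OF F, of r] r by (simp add: abs_minus_commute)
  have "\<bar>integral {s..t} (gen r f)\<bar> \<le> (sqrt (2 / r) + A) * (t - s)"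
    by (rule abs_integral_le_const[OF weak_increment(2)[OF f r st] st(2)])
       (use st gen_bound[OF f r] in auto)
  then have "\<bar>muI t (heat r f) - muI s (heat r f)\<bar> \<le> (sqrt (2 / r) + A) * r"
    using weak_increment(1)[OF f r st] by (simp add: r_def)
  also have "\<dots> = sqrt (2 / r) * (sqrt r * sqrt r) + A * (sqrt r * sqrt r)" using r
      by (simp add: distrib_right)
  also have "sqrt (2 / r) * (sqrt r * sqrt r) = sqrt 2 * sqrt r" using r
      by (simp add: real_sqrt_divide)
       (metis less_eq_real_def real_div_sqrt times_divide_eq_right)
  also have "sqrt 2 * sqrt r \<le> 2 * sqrt r" using r
      by (intro mult_right_mono) (auto simp: real_le_lsqrt)
  finally have "\<bar>muI t (heat r f) - muI s (heat r f)\<bar> \<le> 2 * sqrt r + A * (sqrt r * sqrt r)" by simp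
  moreover have "A * (sqrt r * sqrt r) \<le> A * (sqrt T * sqrt r)"
    using A_ge r st by (intro mult_left_mono mult_right_mono) (auto simp: r_def)
  ultimately have "\<bar>muI t (heat r f) - muI s (heat r f)\<bar> \<le> 2 * sqrt r + A * (sqrt T * sqrt r)"
      by linarith
  then have "\<bar>muI t f - muI s f\<bar> \<le> 4 * sqrt r + A * (sqrt T * sqrt r)"
    using cl[OF sT(1)] cl[OF sT(2)] by linarith
  then show ?thesis by (simp add: c0_def r_def algebra_simps)
qed simp

lemma muI_holder:
  assumes f: "f \<in> BL_test" and s: "s \<in> {0..T}" and t: "t \<in> {0..T}"
  shows "\<bar>muI t f - muI s f\<bar> \<le> c0 * sqrt \<bar>t - s\<bar>"
  using muI_holder_le[OF f, of s t] muI_holder_le[OF f, of t s] s t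
  by (cases "s \<le> t") (auto simp: abs_minus_commute)

lemma blip_scale_BL:
  assumes "periodic1 g" "blip c K g" "c + K > 0"
  shows "(\<lambda>x. g x / (c + K)) \<in> BL_test"
  by (rule lip_per_scale_BL_test[of K _ c])
     (use assms blipD[OF assms(2)] in \<open>auto simp: lip_per_def\<close>)

lemma muI_holder_blip:
  assumes g: "periodic1 g" "blip c K g" and s: "s \<in> {0..T}" and t: "t \<in> {0..T}"
  shows "\<bar>muI t g - muI s g\<bar> \<le> (c + K) * (c0 * sqrt \<bar>t - s\<bar>)"
proof (cases "c + K = 0")
  case True
  then have "c = 0" using blipD(5,6)[OF g(2)] by linarith
  then have "g x = 0" for x using blipD(1)[OF g(2), of x] by simp
  then show ?thesis using True by (simp add: muI_def)
next
  case False
  then have pos: "c + K > 0" using blipD(5,6)[OF g(2)] by linarith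
  have "muI u g = (c + K) * muI u (\<lambda>x. g x / (c + K))" for u
    using muI_cmult[of u "c + K" "\<lambda>x. g x / (c + K)"] pos by simp
  then have "\<bar>muI t g - muI s g\<bar> = (c + K) * \<bar>muI t (\<lambda>x. g x / (c + K)) - muI s (\<lambda>x. g x / (c
      + K))\<bar>"
    using pos by (simp add: right_diff_distrib[symmetric] abs_mult)
  also have "\<dots> \<le> (c + K) * (c0 * sqrt \<bar>t - s\<bar>)"
    using muI_holder[OF blip_scale_BL[OF g pos] s t] pos by (intro mult_left_mono) auto
  finally show ?thesis .
qed

lemma G_per2: "periodic1 (G x)" using G_per by (simp add: periodic1_def periodic2_def)

lemma G_blip: "blip A L (G x)" unfolding blip_def using G_bound G_lip2 by blast

text \<open>The three groups bound the effect of changing the time in the measure integrating the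
  half Laplacian, in the drift, and in the measure integrating the transport term. Each is a sup
  bound plus a Lipschitz constant.\<close>

definition cgen :: "real \<Rightarrow> real" where
  "cgen r = c0 * ((sqrt (2 / r) + 2 / r) + (A + L) + (A + (L + A * sqrt (2 / r))))"

lemma gen_holder:
  assumes f: "f \<in> BL_test" and r: "r > 0" and s: "s \<in> {0..T}" and t: "t \<in> {0..T}"
  shows "\<bar>gen r f s - gen r f t\<bar> \<le> cgen r * sqrt \<bar>s - t\<bar>"
proof -
  define q where "q = c0 * sqrt \<bar>s - t\<bar>"
  note D = BL_dheat[OF f r]
  have 1: "\<bar>muI s (\<lambda>x. d2heat r f x / 2) - muI t (\<lambda>x. d2heat r f x / 2)\<bar> \<le> (sqrt (2 / r)
      + 2 / r) * q"
    unfolding q_def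
    by (rule muI_holder_blip[OF _ blip_half[OF BL_d2heat(2)[OF f r]] t s])
       (use BL_d2heat(1)[OF f r] in \<open>simp add: periodic1_def\<close>)
  note bs = blip_mult[OF D(2) b_blip[OF s]] and bt = blip_mult[OF D(2) b_blip[OF t]]
  have "\<bar>muI s (\<lambda>x. dheat r f x * b s x) - muI s (\<lambda>x. dheat r f x * b t x)\<bar> \<le> (A + L) * q"
  proof (rule muI_close[OF s blipD(3)[OF bs] blipD(1)[OF bs] blipD(3)[OF bt] blipD(1)[OF bt]])
    fix x
    have "\<bar>b s x - b t x\<bar> \<le> (A + L) * q"
      unfolding q_def b_def by (rule muI_holder_blip[OF G_per2 G_blip t s])
    then have "\<bar>dheat r f x\<bar> * \<bar>b s x - b t x\<bar> \<le> 1 * ((A + L) * q)"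
      using blipD(1)[OF D(2)] by (intro mult_mono) auto
    then show "\<bar>dheat r f x * b s x - dheat r f x * b t x\<bar> \<le> (A + L) * q"
      by (simp add: abs_mult[symmetric] right_diff_distrib)
  qed
  moreover have "\<bar>muI s (\<lambda>x. dheat r f x * b t x) - muI t (\<lambda>x. dheat r f x * b t x)\<bar>
      \<le> (1 * A + (1 * L + A * sqrt (2 / r))) * q"
    unfolding q_def
    by (rule muI_holder_blip[OF _ bt t s])
       (use D(1) b_per in \<open>simp add: periodic1_def\<close>)
  moreover have "\<bar>gen r f s - gen r f t\<bar> \<le> \<bar>muI s (\<lambda>x. d2heat r f x / 2)
      - muI t (\<lambda>x. d2heat r f x / 2)\<bar>
     + \<bar>muI s (\<lambda>x. dheat r f x * b s x) - muI s (\<lambda>x. dheat r f x * b t x)\<bar>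
     + \<bar>muI s (\<lambda>x. dheat r f x * b t x) - muI t (\<lambda>x. dheat r f x * b t x)\<bar>"
    unfolding gen_def by linarith
  ultimately have "\<bar>gen r f s - gen r f t\<bar> \<le> (sqrt (2 / r) + 2 / r) * q + (A + L) * q + (A + (L
      + A * sqrt (2 / r))) * q"
    using 1 by simp
  then show ?thesis by (simp add: cgen_def q_def algebra_simps)
qed

text \<open>The summands come from freezing \<open>gen\<close> over one step, from the second-order
  expansion of the heat flow, and from replacing \<open>dheat r f\<close> by
  \<open>dheat (h + r) f\<close>.\<close>

definition cstep :: "real \<Rightarrow> real" where
  "cstep r = cgen r + 4 / r + A * sqrt (2 / r)"

section \<open>One time step, for the weak solution and for the scheme\<close>

lemma c0_pos: "c0 > 0" unfolding c0_def using A_ge T_pos by (simp add: add_pos_nonneg)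

lemma cstep_mono:
  assumes "0 < e" "e \<le> r" shows "cstep r \<le> cstep e"
proof -
  have "2 / r \<le> 2 / e" using assms by (simp add: frac_le)
  moreover from this have "sqrt (2 / r) \<le> sqrt (2 / e)" by simp
  moreover from this have "A * sqrt (2 / r) \<le> A * sqrt (2 / e)" using A_ge
      by (intro mult_left_mono) auto
  moreover have "4 / r \<le> 4 / e" using assms by (simp add: frac_le)
  moreover from calculation have "cgen r \<le> cgen e"
    unfolding cgen_def using c0_pos A_ge by (intro mult_left_mono add_mono) auto
  ultimately show ?thesis unfolding cstep_def by linarith
qed

text \<open>Moving forward by \<open>h\<close> while shortening the heat time by \<open>h\<close>
  makes the diffusion cancel to first order, since \<open>heat h\<close> expands with exactly the
  half Laplacian of the weak equation. Only the transport term remains.\<close>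

lemma muI_step:
  assumes f: "f \<in> BL_test" and r: "r > 0" and h: "h \<ge> 0" and t: "0 \<le> t" "t + h \<le> T"
  shows "\<bar>muI (t + h) (heat r f) - muI t (heat (h + r) f) - h * muI t (\<lambda>x. dheat (h
      + r) f x * b t x)\<bar>
     \<le> cstep r * (h * sqrt h)"
proof -
  have tT: "t \<in> {0..T}" "t + h \<in> {0..T}" using h t by auto
  have hr: "h + r > 0" using h r by simp
  note F = BL_blip[OF f] and D = BL_dheat(2)[OF f r]
  define \<phi> where "\<phi> = heat r f"
  define I2 where "I2 = muI t (\<lambda>x. d2heat r f x / 2)"
  define I1 where "I1 = muI t (\<lambda>x. dheat r f x * b t x)"
  define J1 where "J1 = muI t (\<lambda>x. dheat (h + r) f x * b t x)"
  have "\<bar>integral {t..t+h} (\<lambda>s. gen r f s - gen r f t)\<bar> \<le> (cgen r * sqrt h) * (t + h - t)"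
  proof (rule abs_integral_le_const)
    show "(\<lambda>s. gen r f s - gen r f t) integrable_on {t..t + h}"
      using weak_increment(2)[OF f r, of t "t + h"] t h by (intro integrable_diff) auto
    fix s assume s: "s \<in> {t..t + h}"
    then have "\<bar>gen r f s - gen r f t\<bar> \<le> cgen r * sqrt \<bar>s - t\<bar>"
      using tT by (intro gen_holder[OF f r]) auto
    also have "\<dots> \<le> cgen r * sqrt h"
    proof (rule mult_left_mono)
      show "0 \<le> cgen r" unfolding cgen_def using A_ge L_ge c0_pos r by simp
    qed (use s in auto)
    finally show "\<bar>gen r f s - gen r f t\<bar> \<le> cgen r * sqrt h" .
  qed (use h in auto)
  moreover have "integral {t..t+h} (\<lambda>s. gen r f s - gen r f t)
      = muI (t + h) \<phi> - muI t \<phi> - h * gen r f t"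
    using weak_increment[OF f r, of t "t + h"] t h
    by (subst Henstock_Kurzweil_Integration.integral_diff) (auto simp: \<phi>_def)
  ultimately have 1: "\<bar>muI (t + h) \<phi> - muI t \<phi> - h * (I2 + I1)\<bar> \<le> cgen r * sqrt h * h"
    by (simp add: gen_def I1_def I2_def)
  have P: "blip 1 1 \<phi>" unfolding \<phi>_def by (rule heat_blip[OF F])
  have hp: "heat h \<phi> = heat (h + r) f"
    unfolding \<phi>_def using heat_semigroup[OF h _ F, of r] r by simp
  have P': "blip 1 1 (heat (h + r) f)" by (rule heat_blip[OF F])
  have D2: "blip (sqrt (2 / r)) (2 / r) (\<lambda>x. d2heat r f x / 2)"
      by (rule blip_half[OF BL_d2heat(2)[OF f r]])
  have hD2c: "continuous_on UNIV (\<lambda>x. h * (d2heat r f x / 2))"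
    by (intro continuous_intros blipD(3)[OF BL_d2heat(2)[OF f r]]) auto
  have hD2b: "\<bar>h * (d2heat r f x / 2)\<bar> \<le> h * sqrt (2 / r)" for x
    using blipD(1)[OF D2, of x] h by (simp only: abs_mult) (intro mult_mono, auto)
  have cont2: "continuous_on UNIV (\<lambda>x. \<phi> x + h * (d2heat r f x / 2))"
    by (intro continuous_on_add hD2c blipD(3)[OF P])
  have b2: "\<bar>\<phi> x + h * (d2heat r f x / 2)\<bar> \<le> 1 + h * sqrt (2 / r)" for x
    using blipD(1)[OF P, of x] hD2b[of x] by linarith
  have "\<bar>muI t (heat (h + r) f) - muI t (\<lambda>x. \<phi> x + h * (d2heat r f x / 2))\<bar>
      \<le> 2 * (2 / r) * (h * sqrt h)"
  proof (rule muI_close[OF tT(1) blipD(3)[OF P'] blipD(1)[OF P'] cont2 b2])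
    fix x
    have "\<bar>heat h \<phi> x - \<phi> x - h / 2 * d2heat r f x\<bar> \<le> 2 * (2 / r) * (h * sqrt h)"
      by (rule heat_second_order[OF P _ _ _ h, of "dheat r f"])
         (use heat_DERIV[OF F r] dheat_DERIV[OF F r] blipD(2)[OF BL_d2heat(2)[OF f r]] in \<open>auto
             simp: \<phi>_def\<close>)
    then show "\<bar>heat (h + r) f x - (\<phi> x + h * (d2heat r f x / 2))\<bar> \<le> 2 * (2 / r) * (h * sqrt h)"
      unfolding hp by (simp add: diff_diff_add)
  qed
  moreover have "muI t (\<lambda>x. \<phi> x + h * (d2heat r f x / 2)) = muI t \<phi> + h * I2"
    unfolding I2_def muI_cmult[symmetric]
    by (rule muI_add[OF tT(1) blipD(3)[OF P] blipD(1)[OF P] hD2c hD2b])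
  ultimately have 2: "\<bar>muI t (heat (h + r) f) - (muI t \<phi> + h * I2)\<bar> \<le> 4 / r * (h * sqrt h)" by simp
  note B1 = blip_mult[OF D b_blip[OF tT(1)]] and B2
      = blip_mult[OF BL_dheat(2)[OF f hr] b_blip[OF tT(1)]]
  have "\<bar>I1 - J1\<bar> \<le> A * sqrt (2 / r) * sqrt h"
    unfolding I1_def J1_def
  proof (rule muI_close[OF tT(1) blipD(3)[OF B1] blipD(1)[OF B1] blipD(3)[OF B2] blipD(1)[OF B2]])
    fix x
    have "\<bar>heat h (dheat r f) x - dheat r f x\<bar> \<le> sqrt (2 / r) * sqrt h" by (rule heat_close[OF D h])
    then have "\<bar>dheat r f x - dheat (h + r) f x\<bar> \<le> sqrt (2 / r) * sqrt h"
      unfolding heat_dheat[OF F h r] by linarith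
    then have "\<bar>dheat r f x - dheat (h + r) f x\<bar> * \<bar>b t x\<bar> \<le> (sqrt (2 / r) * sqrt h) * A"
      using b_bound[OF tT(1), of x] by (intro mult_mono) (use r h in auto)
    then show "\<bar>dheat r f x * b t x - dheat (h + r) f x * b t x\<bar> \<le> A * sqrt (2 / r) * sqrt h"
      unfolding left_diff_distrib[symmetric] abs_mult by (simp only: mult_ac)
  qed
  then have 3: "\<bar>h * I1 - h * J1\<bar> \<le> h * (A * sqrt (2 / r) * sqrt h)"
    using h by (simp add: right_diff_distrib[symmetric] abs_mult mult_left_mono)
  have "\<bar>muI (t + h) \<phi> - muI t (heat (h + r) f) - h * J1\<bar>
     \<le> cgen r * sqrt h * h + 4 / r * (h * sqrt h) + h * (A * sqrt (2 / r) * sqrt h)"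
    using 1 2 3 unfolding distrib_left by linarith
  also have "\<dots> = cstep r * (h * sqrt h)"
    by (simp add: cstep_def algebra_simps)
  finally show ?thesis by (simp add: \<phi>_def J1_def)
qed

text \<open>The functionals \<open>\<rho> k\<close> play the role of the law of the Euler scheme at time \<open>k * h\<close>.\<close>

definition scheme :: "real \<Rightarrow> nat \<Rightarrow> (nat \<Rightarrow> (real \<Rightarrow> real) \<Rightarrow> real) \<Rightarrow> bool" where
  "scheme h m \<rho> \<longleftrightarrow> h > 0 \<and> real m * h \<le> T \<and>
    (\<forall>k f g c c'. continuous_on UNIV f \<longrightarrow> continuous_on UNIV g \<longrightarrow> (\<forall>x. \<bar>f x\<bar> \<le> c) \<longrightarrow> (\<forall>x. \<bar>g x\<bar> \<le> c') \<longrightarrow>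
       \<rho> k (\<lambda>x. f x - g x) = \<rho> k f - \<rho> k g) \<and>
    (\<forall>k c f. \<rho> k (\<lambda>x. c * f x) = c * \<rho> k f) \<and>
    (\<forall>k f c. continuous_on UNIV f \<longrightarrow> (\<forall>x. \<bar>f x\<bar> \<le> c) \<longrightarrow> \<bar>\<rho> k f\<bar> \<le> c) \<and>
    (\<forall>k<m. \<forall>f\<in>BL_test. \<rho> (Suc k) f = \<rho> k (\<lambda>x. heat h f (x + h * \<rho> k (G x))))"

text \<open>For the scheme the diffusion cancels exactly by the semigroup property, and only the
  drift shift is expanded. The transport terms of scheme and limit differ in two ways: in the drift
  field, which costs (A + L) D, and in the law tested against gradient times drift, which costs A +
  L + A sqrt (2/(h+r)) times D. The heat time there is \<open>h + r\<close>, so the singularity is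
  never evaluated below one step.\<close>

lemma scheme_step:
  assumes sch: "scheme h m \<rho>" and f: "f \<in> BL_test" and r: "r > 0" and k: "k < m"
    and D: "\<And>f. f \<in> BL_test \<Longrightarrow> \<bar>\<rho> k f - muI (real k * h) f\<bar> \<le> D"
  shows "\<bar>(\<rho> (Suc k) (heat r f) - muI (real (Suc k) * h) (heat r f))
        - (\<rho> k (heat (h + r) f) - muI (real k * h) (heat (h + r) f))\<bar>
     \<le> h * ((2 * A + 2 * L + A * sqrt (2 / (h + r))) * D) + (cstep r * (h * sqrt h)
         + sqrt (2 / r) * (h * A)^2)"
proof -
  have h: "h > 0" and mh: "real m * h \<le> T"
    and lin: "\<And>k f g c c'. continuous_on UNIV f \<Longrightarrow> continuous_on UNIV g \<Longrightarrow> (\<And>x. \<bar>f x\<bar> \<le> c) \<Longrightarrow>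
       (\<And>x. \<bar>g x\<bar> \<le> c') \<Longrightarrow> \<rho> k (\<lambda>x. f x - g x) = \<rho> k f - \<rho> k g"
    and sc: "\<And>k c f. \<rho> k (\<lambda>x. c * f x) = c * \<rho> k f"
    and bd: "\<And>k f c. continuous_on UNIV f \<Longrightarrow> (\<And>x. \<bar>f x\<bar> \<le> c) \<Longrightarrow> \<bar>\<rho> k f\<bar> \<le> c"
    and st: "\<rho> (Suc k) (heat r f) = \<rho> k (\<lambda>x. heat h (heat r f) (x + h * \<rho> k (G x)))"
    using sch k BL_heat[OF f, of r] unfolding scheme_def by blast+
  define t where "t = real k * h"
  have kh: "real (Suc k) * h \<le> T"
  proof -
    have "real (Suc k) * h \<le> real m * h" using k h by (intro mult_right_mono) auto
    then show ?thesis using mh by linarith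
  qed
  have t: "0 \<le> t" "t + h \<le> T" "t \<in> {0..T}" "real (Suc k) * h = t + h"
    using h kh by (auto simp: t_def algebra_simps)
  have D0: "0 \<le> D" using D[OF zero_BL_test] by linarith
  define R where "R = h + r"
  have R: "R > 0" "r \<le> R" using h r by (auto simp: R_def)
  define \<beta> where "\<beta> x = \<rho> k (G x)" for x
  have clos: "\<bar>\<rho> k u - \<rho> k v\<bar> \<le> e" if "continuous_on UNIV u" "continuous_on UNIV v" "\<And>x. \<bar>u x\<bar>
      \<le> c" "\<And>x. \<bar>v x\<bar> \<le> c'"
     "\<And>x. \<bar>u x - v x\<bar> \<le> e" for u v c c' e
    using bd[of "\<lambda>x. u x - v x" e k] lin[OF that(1-4), of k] that(5) continuous_on_diff[OF
        that(1,2)] by simp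
  have bb: "\<bar>\<beta> x\<bar> \<le> A" for x unfolding \<beta>_def by (rule bd[OF G_cont G_bound])
  have bl: "\<bar>\<beta> x - \<beta> y\<bar> \<le> L * \<bar>x - y\<bar>" for x y
    unfolding \<beta>_def by (rule clos[OF G_cont G_cont G_bound G_bound G_lip1])
  have bB: "blip A L \<beta>" unfolding blip_def using bb bl by blast
  have Dg: "\<bar>\<rho> k g - muI t g\<bar> \<le> (c + K) * D" if g: "periodic1 g" "blip c K g" for g c K
  proof (cases "c + K = 0")
    case True
    then have "c = 0" using blipD(5,6)[OF g(2)] by linarith
    then have "g x = 0" for x using blipD(1)[OF g(2), of x] by simp
    then have "g = (\<lambda>x. 0)" by auto
    then show ?thesis using True sc[of k 0 "\<lambda>x. 0"] by (simp add: muI_def)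
  next
    case False
    then have pos: "c + K > 0" using blipD(5,6)[OF g(2)] by linarith
    have e1: "muI t g = (c + K) * muI t (\<lambda>x. g x / (c + K))"
      using muI_cmult[of t "c + K" "\<lambda>x. g x / (c + K)"] pos by simp
    have e2: "\<rho> k g = (c + K) * \<rho> k (\<lambda>x. g x / (c + K))"
      using sc[of k "c + K" "\<lambda>x. g x / (c + K)"] pos by simp
    have "\<bar>\<rho> k g - muI t g\<bar> = (c + K) * \<bar>\<rho> k (\<lambda>x. g x / (c + K)) - muI t (\<lambda>x. g x / (c + K))\<bar>"
      unfolding e1 e2 using pos by (simp add: right_diff_distrib[symmetric] abs_mult)
    also have "\<dots> \<le> (c + K) * D"
      using D[OF blip_scale_BL[OF g pos]] pos by (intro mult_left_mono) (auto simp: t_def)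
    finally show ?thesis .
  qed
  note F = BL_blip[OF f] and dR = BL_dheat[OF f R(1)]
  define \<phi> where "\<phi> = heat R f"
  have P: "blip 1 1 \<phi>" unfolding \<phi>_def by (rule heat_blip[OF F])
  have hp: "heat h (heat r f) = \<phi>"
    unfolding \<phi>_def R_def using heat_semigroup[OF _ _ F, of h r] r h by simp
  have Pb: "continuous_on UNIV (\<lambda>x. \<phi> (x + h * \<beta> x))"
  proof -
    have "continuous_on UNIV (\<phi> \<circ> (\<lambda>x. x + h * \<beta> x))"
      by (intro continuous_on_compose continuous_intros blipD(3)[OF bB]
          continuous_on_subset[OF blipD(3)[OF P]]) auto
    then show ?thesis by (simp add: o_def)
  qed
  note m\<beta> = blip_mult[OF dR(2) bB] and mb = blip_mult[OF dR(2) b_blip[OF t(3)]]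
  define I where "I = \<rho> k (\<lambda>x. dheat R f x * \<beta> x)"
  define J where "J = muI t (\<lambda>x. dheat R f x * b t x)"
  have hm: "continuous_on UNIV (\<lambda>x. h * (dheat R f x * \<beta> x))"
      by (intro continuous_intros blipD(3)[OF m\<beta>])
  have hmb: "\<bar>h * (dheat R f x * \<beta> x)\<bar> \<le> h * (1 * A)" for x
    using blipD(1)[OF m\<beta>, of x] h by (simp add: abs_mult[of h])
  have "\<bar>\<rho> k (\<lambda>x. \<phi> (x + h * \<beta> x) - \<phi> x) - \<rho> k (\<lambda>x. h * (dheat R f x * \<beta> x))\<bar>
      \<le> sqrt (2 / r) * (h * A)^2"
  proof (rule clos)
    show "\<bar>\<phi> (x + h * \<beta> x) - \<phi> x\<bar> \<le> 1 + 1" for x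
      using blipD(1)[OF P, of x] blipD(1)[OF P, of "x + h * \<beta> x"] by linarith
    show "\<bar>\<phi> (x + h * \<beta> x) - \<phi> x - h * (dheat R f x * \<beta> x)\<bar> \<le> sqrt (2 / r) * (h * A)^2" for x
    proof -
      have "\<bar>\<phi> (x + h * \<beta> x) - \<phi> x - (h * \<beta> x) * dheat R f x\<bar> \<le> sqrt (2 / R) * (h * \<beta> x)^2"
        unfolding \<phi>_def by (rule taylor1[OF heat_DERIV[OF F R(1)] blipD(2)[OF dR(2)]])
      also have "\<dots> \<le> sqrt (2 / r) * (h * A)^2"
      proof (intro mult_mono)
        show "sqrt (2 / R) \<le> sqrt (2 / r)" using R r by (simp add: frac_le)
        have "\<bar>h * \<beta> x\<bar> \<le> \<bar>h * A\<bar>" using bb[of x] h A_ge by (simp add: abs_mult)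
        then show "(h * \<beta> x)^2 \<le> (h * A)^2" by (simp add: abs_le_square_iff)
      qed (use r in auto)
      finally show ?thesis by (simp add: mult_ac)
    qed
    show "\<bar>h * (dheat R f x * \<beta> x)\<bar> \<le> h * (1 * A)" for x by (rule hmb)
  qed (intro continuous_on_diff Pb blipD(3)[OF P] hm)+
  moreover have "\<rho> k (\<lambda>x. \<phi> (x + h * \<beta> x) - \<phi> x) = \<rho> k (\<lambda>x. \<phi> (x + h * \<beta> x)) - \<rho> k \<phi>"
    by (rule lin[OF Pb blipD(3)[OF P] blipD(1)[OF P] blipD(1)[OF P]])
  ultimately have 1: "\<bar>\<rho> (Suc k) (heat r f) - \<rho> k \<phi> - h * I\<bar> \<le> sqrt (2 / r) * (h * A)^2"
    unfolding st hp I_def sc by (simp add: \<beta>_def)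
  have 2: "\<bar>muI (t + h) (heat r f) - muI t \<phi> - h * J\<bar> \<le> cstep r * (h * sqrt h)"
    unfolding \<phi>_def J_def R_def using muI_step[OF f r _ t(1,2)] h by simp
  have "\<bar>I - \<rho> k (\<lambda>x. dheat R f x * b t x)\<bar> \<le> (A + L) * D"
    unfolding I_def
  proof (rule clos[OF blipD(3)[OF m\<beta>] blipD(3)[OF mb] blipD(1)[OF m\<beta>] blipD(1)[OF mb]])
    fix x
    have "\<bar>\<beta> x - b t x\<bar> \<le> (A + L) * D"
      unfolding \<beta>_def b_def by (rule Dg[OF G_per2 G_blip])
    then have "\<bar>dheat R f x\<bar> * \<bar>\<beta> x - b t x\<bar> \<le> 1 * ((A + L) * D)"
      using blipD(1)[OF dR(2)] by (intro mult_mono) auto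
    then show "\<bar>dheat R f x * \<beta> x - dheat R f x * b t x\<bar> \<le> (A + L) * D"
      by (simp add: abs_mult[symmetric] right_diff_distrib)
  qed
  moreover have "\<bar>\<rho> k (\<lambda>x. dheat R f x * b t x) - J\<bar> \<le> (1 * A + (1 * L + A * sqrt (2 / R))) * D"
    unfolding J_def by (rule Dg[OF _ mb]) (use dR(1) b_per in \<open>simp add: periodic1_def\<close>)
  ultimately have "\<bar>I - J\<bar> \<le> (A + L) * D + (A + (L + A * sqrt (2 / R))) * D" by simp
  then have IJ: "\<bar>I - J\<bar> \<le> (2 * A + 2 * L + A * sqrt (2 / R)) * D" by (simp add: algebra_simps)
  have 3: "\<bar>h * I - h * J\<bar> \<le> h * ((2 * A + 2 * L + A * sqrt (2 / R)) * D)"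
    using mult_left_mono[OF IJ, of h] h by (simp add: right_diff_distrib[symmetric] abs_mult)
  show ?thesis unfolding t(4) t_def[symmetric] R_def[symmetric] \<phi>_def[symmetric]
    using 1 2 3 by linarith
qed

text \<open>The regular part of the coefficient is absorbed into the singular kernel, using that
  elapsed times are at most \<open>T\<close>, and the square root of 2 is rounded up to 2.\<close>

definition c3 :: real where "c3 = (2 * A + 2 * L) * sqrt T + 2 * A"

lemma c3_pos: "c3 > 0"
  unfolding c3_def using A_ge L_ge T_pos by (simp add: add_pos_pos)

lemma kernel_bound:
  assumes "u > 0" "u \<le> T" "u \<le> R"
  shows "2 * A + 2 * L + A * sqrt (2 / R) \<le> c3 / sqrt u"
proof -
  have su: "sqrt u > 0" using assms by simp
  have "2 / R \<le> 2 / u" using assms by (simp add: frac_le)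
  then have "sqrt (2 / R) \<le> sqrt (2 / u)" by simp
  also have "\<dots> = sqrt 2 / sqrt u" by (simp add: real_sqrt_divide)
  also have "\<dots> \<le> 2 / sqrt u" using su by (intro divide_right_mono) (auto simp: real_le_lsqrt)
  finally have "A * sqrt (2 / R) \<le> A * (2 / sqrt u)" using A_ge by (intro mult_left_mono) auto
  moreover have "2 * A + 2 * L \<le> (2 * A + 2 * L) * (sqrt T / sqrt u)"
  proof -
    have "1 \<le> sqrt T / sqrt u" using su assms by simp
    then have "(2 * A + 2 * L) * 1 \<le> (2 * A + 2 * L) * (sqrt T / sqrt u)"
      using A_ge L_ge by (intro mult_left_mono) auto
    then show ?thesis by simp
  qed
  ultimately have "2 * A + 2 * L + A * sqrt (2 / R) \<le> (2 * A + 2 * L) * (sqrt T / sqrt u)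
      + A * (2 / sqrt u)"
    by linarith
  also have "\<dots> = c3 / sqrt u" by (simp add: c3_def add_divide_distrib)
  finally show ?thesis .
qed

text \<open>Telescoping along the backward heat flow \<open>ph k\<close>, whose heat time at step
  \<open>k\<close> is the time left until step \<open>n\<close>, plus \<open>e\<close>. The extra
  time \<open>e\<close> keeps the constants finite at the last steps; removing it at the end costs
  \<open>sqrt e\<close> for the scheme and \<open>sqrt e\<close> for the limit.\<close>

lemma scheme_error:
  assumes sch: "scheme h m \<rho>" and f: "f \<in> BL_test" and e: "e > 0" and n: "n \<le> m"
    and D: "\<And>k f. f \<in> BL_test \<Longrightarrow> k \<le> m \<Longrightarrow> \<bar>\<rho> k f - muI (real k * h) f\<bar> \<le> D k"
  shows "\<bar>\<rho> n f - muI (real n * h) f\<bar> \<le> D 0 + 2 * sqrt e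
     + T * (cstep e * sqrt h + sqrt (2 / e) * A^2 * h) + c3 * h * (\<Sum>k<n. D k / sqrt (real (n
         - k) * h))"
proof -
  have h: "h > 0" and mh: "real m * h \<le> T"
    and lin: "\<And>k f g c c'. continuous_on UNIV f \<Longrightarrow> continuous_on UNIV g \<Longrightarrow> (\<And>x. \<bar>f x\<bar> \<le> c) \<Longrightarrow>
       (\<And>x. \<bar>g x\<bar> \<le> c') \<Longrightarrow> \<rho> k (\<lambda>x. f x - g x) = \<rho> k f - \<rho> k g"
    and bd: "\<And>k f c. continuous_on UNIV f \<Longrightarrow> (\<And>x. \<bar>f x\<bar> \<le> c) \<Longrightarrow> \<bar>\<rho> k f\<bar> \<le> c"
    using sch unfolding scheme_def by blast+
  define ph where "ph k = heat (real (n - k) * h + e) f" for k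
  define a where "a k = \<rho> k (ph k) - muI (real k * h) (ph k)" for k
  define Q where "Q = cstep e * (h * sqrt h) + sqrt (2 / e) * (h * A)^2"
  have D0: "0 \<le> D k" if "k \<le> m" for k using D[OF zero_BL_test that] by linarith
  have nh: "real n * h \<le> T"
  proof -
    have "real n * h \<le> real m * h" using n h by (intro mult_right_mono) auto
    then show ?thesis using mh by linarith
  qed
  have step: "\<bar>a (Suc k) - a k\<bar> \<le> c3 * h * (D k / sqrt (real (n - k) * h)) + Q" if k: "k < n" for k
  proof -
    define r where "r = real (n - Suc k) * h + e"
    have r: "r > 0" "e \<le> r" using h e by (auto simp: r_def add_nonneg_pos)
    have nk: "real (n - k) = real (n - Suc k) + 1" using k
        by (simp add: Suc_diff_Suc[symmetric] del: Suc_diff_Suc)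
    have hr: "h + r = real (n - k) * h + e" unfolding nk r_def by (simp add: algebra_simps)
    have u: "real (n - k) * h > 0" "real (n - k) * h \<le> T" "real (n - k) * h \<le> h + r"
    proof -
      show "real (n - k) * h > 0" using k h by simp
      have "real (n - k) * h \<le> real n * h" using h by (intro mult_right_mono) auto
      then show "real (n - k) * h \<le> T" using nh by linarith
      show "real (n - k) * h \<le> h + r" unfolding hr using e by simp
    qed
    have km: "k < m" "k \<le> m" using k n by auto
    have "\<bar>a (Suc k) - a k\<bar> \<le> h * ((2 * A + 2 * L + A * sqrt (2 / (h + r))) * D k)
        + (cstep r * (h * sqrt h) + sqrt (2 / r) * (h * A)^2)"
      unfolding a_def ph_def hr[symmetric] r_def[symmetric]
      by (rule scheme_step[OF sch f r(1) km(1) D]) (use km in auto)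
    also have "\<dots> \<le> h * (c3 / sqrt (real (n - k) * h) * D k) + Q"
      unfolding Q_def
    proof (intro add_mono mult_left_mono mult_right_mono)
      show "2 * A + 2 * L + A * sqrt (2 / (h + r)) \<le> c3 / sqrt (real (n - k) * h)"
        by (rule kernel_bound[OF u])
      show "cstep r \<le> cstep e" by (rule cstep_mono[OF e r(2)])
      show "sqrt (2 / r) \<le> sqrt (2 / e)" using r e by (simp add: frac_le)
    qed (use h D0[OF km(2)] in auto)
    finally show ?thesis by (simp add: mult_ac)
  qed
  have "a n - a 0 = (\<Sum>k<n. a (Suc k) - a k)" by (simp add: sum_lessThan_telescope)
  also have "\<bar>\<dots>\<bar> \<le> (\<Sum>k<n. c3 * h * (D k / sqrt (real (n - k) * h)) + Q)"
    using step by (intro order_trans[OF sum_abs] sum_mono) auto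
  also have "\<dots> = c3 * h * (\<Sum>k<n. D k / sqrt (real (n - k) * h)) + real n * Q"
    by (simp add: sum.distrib sum_distrib_left)
  also have "real n * Q \<le> T * (cstep e * sqrt h + sqrt (2 / e) * A^2 * h)"
  proof -
    have "real n * Q = (real n * h) * (cstep e * sqrt h + sqrt (2 / e) * A^2 * h)"
      by (simp add: Q_def power_mult_distrib power2_eq_square algebra_simps)
    also have "\<dots> \<le> T * (cstep e * sqrt h + sqrt (2 / e) * A^2 * h)"
    proof (rule mult_right_mono[OF nh])
      have "0 \<le> cstep e" unfolding cstep_def cgen_def using A_ge L_ge c0_pos e by simp
      then show "0 \<le> cstep e * sqrt h + sqrt (2 / e) * A^2 * h" using h e by simp
    qed
    finally show ?thesis .
  qed
  finally have 1: "\<bar>a n - a 0\<bar> \<le> c3 * h * (\<Sum>k<n. D k / sqrt (real (n - k) * h))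
     + T * (cstep e * sqrt h + sqrt (2 / e) * A^2 * h)" by simp
  have 2: "\<bar>a 0\<bar> \<le> D 0"
    unfolding a_def ph_def using D[OF BL_heat[OF f], of 0] by simp
  have e': "ph n = heat e f" by (simp add: ph_def)
  note F = BL_blip[OF f] and H = heat_blip[OF BL_blip[OF f], of e]
  have cl: "\<bar>f x - heat e f x\<bar> \<le> sqrt e" for x
    using heat_close[OF F, of e x] e by (simp add: abs_minus_commute)
  have 3: "\<bar>muI (real n * h) f - muI (real n * h) (heat e f)\<bar> \<le> sqrt e"
    by (rule muI_close[OF _ blipD(3)[OF F] blipD(1)[OF F] blipD(3)[OF H] blipD(1)[OF H] cl])
       (use nh h in auto)
  have "\<rho> n (\<lambda>x. f x - heat e f x) = \<rho> n f - \<rho> n (heat e f)"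
    by (rule lin[OF blipD(3)[OF F] blipD(3)[OF H] blipD(1)[OF F] blipD(1)[OF H]])
  moreover have "\<bar>\<rho> n (\<lambda>x. f x - heat e f x)\<bar> \<le> sqrt e"
    by (rule bd[OF continuous_on_diff[OF blipD(3)[OF F] blipD(3)[OF H]] cl])
  ultimately have 4: "\<bar>\<rho> n f - \<rho> n (heat e f)\<bar> \<le> sqrt e" by simp
  have "\<bar>a n\<bar> = \<bar>\<rho> n (heat e f) - muI (real n * h) (heat e f)\<bar>" by (simp add: a_def e')
  then show ?thesis using 1 2 3 4 by linarith
qed

text \<open>\<open>R\<close> is the Gronwall constant and depends on \<open>c3\<close> and
  \<open>T\<close> only, and \<open>h0\<close> depends on \<eta> but not on the initial error
  \<open>d\<close>. This uniformity is essential later, where the initial data, the step and hence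
  \<open>d\<close> all change with the number of particles.\<close>

theorem scheme_convergence:
  "\<exists>R>0. \<forall>\<eta>>0. \<exists>h0>0. \<forall>h m \<rho> d. scheme h m \<rho> \<longrightarrow> h < h0 \<longrightarrow>
     (\<forall>f\<in>BL_test. \<bar>\<rho> 0 f - muI 0 f\<bar> \<le> d) \<longrightarrow>
     (\<forall>k\<le>m. \<forall>f\<in>BL_test. \<bar>\<rho> k f - muI (real k * h) f\<bar> \<le> R * (d + \<eta>))"
proof -
  obtain R where R: "R > 0" "\<forall>h>0. \<forall>M a D. real M * h \<le> T \<longrightarrow> 0 \<le> a \<longrightarrow> (\<forall>k. 0 \<le> D k) \<longrightarrow>
     (\<forall>m\<le>M. D m \<le> a + c3 * h * (\<Sum>k<m. D k / sqrt (real (m - k) * h))) \<longrightarrow> (\<forall>m\<le>M. D m \<le> R * a)"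
    using singular_gronwall[OF c3_pos T_pos] by blast
  have "\<exists>h0>0. \<forall>h m \<rho> d. scheme h m \<rho> \<longrightarrow> h < h0 \<longrightarrow>
     (\<forall>f\<in>BL_test. \<bar>\<rho> 0 f - muI 0 f\<bar> \<le> d) \<longrightarrow>
     (\<forall>k\<le>m. \<forall>f\<in>BL_test. \<bar>\<rho> k f - muI (real k * h) f\<bar> \<le> R * (d + \<eta>))" if \<eta>: "\<eta> > 0" for \<eta>
  proof -
    \<comment> \<open>Makes the smoothing cost \<eta>/2; the threshold \<open>h0\<close> will spend
      the other half on the local errors, whose constants depend on \<open>e\<close>.\<close>
    define e where "e = (\<eta> / 4)^2"
    have e: "e > 0" "2 * sqrt e = \<eta> / 2" using \<eta> by (auto simp: e_def)
    have "((\<lambda>h. T * (cstep e * sqrt h + sqrt (2 / e) * A^2 * h)) \<longlongrightarrow> T * (cstep e * sqrt 0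
        + sqrt (2 / e) * A^2 * 0)) (at_right 0)"
      by (intro tendsto_intros)
    then have "\<forall>\<^sub>F h in at_right 0. T * (cstep e * sqrt h + sqrt (2 / e) * A^2 * h) < \<eta> / 2"
      using \<eta> by (intro order_tendstoD(2)) auto
    then obtain h0 where h0: "h0 > 0" "\<And>h. 0 < h \<Longrightarrow> h < h0 \<Longrightarrow> T * (cstep e * sqrt h
        + sqrt (2 / e) * A^2 * h) < \<eta> / 2"
      unfolding eventually_at_right_field by auto
    have "\<bar>\<rho> k f - muI (real k * h) f\<bar> \<le> R * (d + \<eta>)"
      if sch: "scheme h m \<rho>" and hh: "h < h0" and d: "\<forall>f\<in>BL_test. \<bar>\<rho> 0 f - muI 0 f\<bar> \<le> d"
        and k: "k \<le> m" and f: "f \<in> BL_test" for h m \<rho> d k f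
    proof -
      have h: "h > 0" and mh: "real m * h \<le> T"
        and bd: "\<And>k f c. continuous_on UNIV f \<Longrightarrow> (\<And>x. \<bar>f x\<bar> \<le> c) \<Longrightarrow> \<bar>\<rho> k f\<bar> \<le> c"
        using sch unfolding scheme_def by blast+
      \<comment> \<open>The supremum over test functions turns the family of inequalities into a
        scalar recursion. The value 0 beyond the last step provides the nonnegativity that
        Gronwall's inequality asks for at every index.\<close>
      define D where "D k = (if k \<le> m then (SUP f\<in>BL_test. \<bar>\<rho> k f - muI (real k * h) f\<bar>) else 0)"
          for k
      have two: "\<bar>\<rho> k f - muI (real k * h) f\<bar> \<le> 2" if "k \<le> m" "f \<in> BL_test" for k f
      proof -
        have "real k * h \<le> real m * h" using that h by (intro mult_right_mono) auto
        then have "real k * h \<le> T" using mh by linarith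
        then have "real k * h \<in> {0..T}" using h by simp
        then have "\<bar>muI (real k * h) f\<bar> \<le> 1" using that
            by (intro muI_bound) (auto simp: BL_test_def)
        moreover have "\<bar>\<rho> k f\<bar> \<le> 1" using that BL_test_continuous
            by (intro bd) (auto simp: BL_test_def)
        ultimately show ?thesis by linarith
      qed
      have bdd: "bdd_above ((\<lambda>f. \<bar>\<rho> k f - muI (real k * h) f\<bar>) ` BL_test)" if "k \<le> m" for k
        using two[OF that] by (intro bdd_aboveI2[where M = 2]) auto
      have up: "\<bar>\<rho> k f - muI (real k * h) f\<bar> \<le> D k" if "f \<in> BL_test" "k \<le> m" for k f
        unfolding D_def using cSUP_upper[OF that(1) bdd[OF that(2)]] that by simp
      have Dn: "0 \<le> D k" for k
        using order_trans[OF abs_ge_zero up[OF zero_BL_test]] by (cases "k \<le> m") (auto simp: D_def)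
      have D0: "D 0 \<le> d"
        unfolding D_def using d zero_BL_test by (auto intro!: cSUP_least)
      have d0: "0 \<le> d" using D0 Dn[of 0] by linarith
      have "D n \<le> (d + \<eta>) + c3 * h * (\<Sum>k<n. D k / sqrt (real (n - k) * h))" if n: "n \<le> m" for n
      proof -
        have "\<bar>\<rho> n f - muI (real n * h) f\<bar> \<le> (d + \<eta>) + c3 * h * (\<Sum>k<n. D k / sqrt (real (n
            - k) * h))"
          if "f \<in> BL_test" for f
          using scheme_error[OF sch that e(1) n up] D0 e(2) h0(2)[OF h hh] by linarith
        then have "(SUP f\<in>BL_test. \<bar>\<rho> n f - muI (real n * h) f\<bar>) \<le> (d + \<eta>)
            + c3 * h * (\<Sum>k<n. D k / sqrt (real (n - k) * h))"
          using zero_BL_test by (intro cSUP_least) auto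
        then show ?thesis using n by (simp add: D_def)
      qed
      then have "D k \<le> R * (d + \<eta>)"
        using R(2)[rule_format, OF h mh, of "d + \<eta>" D k] d0 \<eta> Dn k by auto
      then show ?thesis using up[OF f k] by linarith
    qed
    then show ?thesis using h0(1) by blast
  qed
  then show ?thesis using R(1) by blast
qed

end

section \<open>Modulus of continuity of the Brownian motions\<close>

text \<open>At level \<open>j\<close> the fourth moments of the dyadic increments sum to 3 T^2
  2^(-j), which is 3 T^2 bmq^(4j). Dividing by bmq^(3j) leaves a geometric sequence of ratio
  \<open>bmq\<close>, so the levels are summable.\<close>

definition bmq :: real where "bmq = 2 powr (- 1 / 4)"

lemma bmq: "0 < bmq" "bmq < 1" "bmq ^ 4 = 1 / 2"
proof -
  show "0 < bmq" by (simp add: bmq_def)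
  show "bmq < 1" unfolding bmq_def by (intro powr_less_one) auto
  show "bmq ^ 4 = 1 / 2" unfolding bmq_def by (subst powr_power) (auto simp: powr_minus_divide)
qed

definition dyad_osc :: "real \<Rightarrow> (nat \<Rightarrow> 'm \<Rightarrow> real \<Rightarrow> real) \<Rightarrow> nat \<Rightarrow> nat \<Rightarrow> 'm \<Rightarrow> real" where
  "dyad_osc T B j i \<omega> = bmq ^ j + (\<Sum>k<2^j. (B i \<omega> (real (Suc k) * T / 2^j)
      - B i \<omega> (real k * T / 2^j))^4) / bmq ^ (3 * j)"

lemma dyad_osc_nonneg: "0 \<le> dyad_osc T B j i \<omega>"
  unfolding dyad_osc_def using bmq by (intro add_nonneg_nonneg divide_nonneg_nonneg sum_nonneg) auto

text \<open>The bound \<open>a \<le> q + a\<^sup>4 / q\<^sup>3\<close> turns fourth moments into a bound on the maximal dyadic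
    increment.\<close>

lemma dyad_osc_ge:
  assumes "k < 2^j"
  shows "\<bar>B i \<omega> (real (Suc k) * T / 2^j) - B i \<omega> (real k * T / 2^j)\<bar> \<le> dyad_osc T B j i \<omega>"
proof -
  define a where "a k = B i \<omega> (real (Suc k) * T / 2^j) - B i \<omega> (real k * T / 2^j)" for k
  define q where "q = bmq ^ j"
  have q: "q > 0" using bmq by (simp add: q_def)
  have "\<bar>a k\<bar> \<le> q + (a k)^4 / q^3"
  proof (cases "\<bar>a k\<bar> \<le> q")
    case True
    then show ?thesis using q by (simp add: add_increasing2)
  next
    case False
    then have "\<bar>a k\<bar> * q^3 \<le> \<bar>a k\<bar> * \<bar>a k\<bar>^3" using q by (intro mult_left_mono power_mono) auto
    also have "\<dots> = (a k)^4" by (simp add: power4_eq_xxxx power3_eq_cube abs_mult[symmetric])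
    finally have "\<bar>a k\<bar> \<le> (a k)^4 / q^3" using q by (simp add: le_divide_eq)
    then show ?thesis using q by linarith
  qed
  also have "(a k)^4 / q^3 \<le> (\<Sum>k<2^j. (a k)^4) / q^3"
  proof (intro divide_right_mono member_le_sum[where f = "\<lambda>k. (a k)^4"])
    show "k \<in> {..<2 ^ j}" using assms by simp
  qed (use q in auto)
  also have "q ^ 3 = bmq ^ (3 * j)" by (simp add: q_def power_mult[symmetric] mult.commute)
  finally show ?thesis by (simp add: dyad_osc_def a_def q_def)
qed

lemma BM_increment_moment4:
  assumes "BM_family M B" "i \<ge> 1" "0 \<le> s" "s < t"
  shows "has_bochner_integral M (\<lambda>\<omega>. (B i \<omega> t - B i \<omega> s)^4) (3 * (t - s)^2)"
proof -
  interpret prob_space M using assms by (simp add: BM_family_def)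
  have d: "distributed M lborel (\<lambda>\<omega>. B i \<omega> t - B i \<omega> s) (\<lambda>x. ennreal (normal_density 0 (sqrt (t
      - s)) x))"
    using assms unfolding BM_family_def by blast
  have "has_bochner_integral lborel (\<lambda>x. normal_density 0 (sqrt (t - s)) x * (x - 0) ^ (2 * 2))
     (fact (2 * 2) / ((2 / (sqrt (t - s))\<^sup>2)^2 * fact 2))"
    by (rule normal_moment_even) (use assms in auto)
  also have "fact (2 * 2) / ((2 / (sqrt (t - s))\<^sup>2)^2 * fact 2) = 3 * (t - s)^2"
    using assms by (simp add: fact_numeral power_divide)
  finally have n: "has_bochner_integral lborel (\<lambda>x. normal_density 0 (sqrt (t
      - s)) x * x ^ 4) (3 * (t - s)^2)"
    by simp
  have "integrable M (\<lambda>\<omega>. (B i \<omega> t - B i \<omega> s)^4)"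
    using distributed_integrable[OF d, of "\<lambda>x. x^4"] n by (simp add: has_bochner_integral_iff)
  moreover have "(\<integral>\<omega>. (B i \<omega> t - B i \<omega> s)^4 \<partial>M) = 3 * (t - s)^2"
    using distributed_integral[OF d, of "\<lambda>x. x^4"] n by (simp add: has_bochner_integral_iff)
  ultimately show ?thesis by (simp add: has_bochner_integral_iff)
qed

lemma dyad_osc_mean:
  assumes "BM_family M B" "i \<ge> 1" "T > 0"
  shows "has_bochner_integral M (dyad_osc T B j i) ((1 + 3 * T^2) * bmq ^ j)"
proof -
  interpret prob_space M using assms by (simp add: BM_family_def)
  have one: "has_bochner_integral M (\<lambda>\<omega>. bmq ^ j) (bmq ^ j)"
    using prob_space by (simp add: has_bochner_integral_iff)
  have "has_bochner_integral M (\<lambda>\<omega>. (B i \<omega> (real (Suc k) * T / 2^j)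
      - B i \<omega> (real k * T / 2^j))^4) (3 * (T / 2^j)^2)" for k
  proof -
    have "real (Suc k) * T / 2^j - real k * T / 2^j = T / 2^j" by (simp add: field_simps)
    then show ?thesis
      using BM_increment_moment4[OF assms(1,2), of "real k * T / 2^j" "real (Suc k) * T / 2^j"]
          assms(3)
      by (simp add: divide_strict_right_mono)
  qed
  then have "has_bochner_integral M (dyad_osc T B j i) (bmq ^ j
      + (\<Sum>k<(2::nat)^j. 3 * (T / 2^j)^2) / bmq ^ (3 * j))"
    unfolding dyad_osc_def[abs_def]
    by (intro has_bochner_integral_add one has_bochner_integral_divide has_bochner_integral_sum)
  moreover have "bmq ^ j + (\<Sum>k<(2::nat)^j. 3 * (T / 2^j)^2) / bmq ^ (3 * j) = (1
      + 3 * T^2) * bmq ^ j"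
  proof -
    have "(\<Sum>k<(2::nat)^j. 3 * (T / 2^j)^2) = 3 * T^2 * (1 / 2) ^ j"
      by (simp add: power_divide power2_eq_square)
    also have "(1 / 2 :: real) ^ j = bmq ^ j * bmq ^ (3 * j)"
      unfolding bmq(3)[symmetric] by (simp add: power_mult[symmetric] power_add[symmetric])
    finally show ?thesis using bmq(1) by (simp add: algebra_simps)
  qed
  ultimately show ?thesis by simp
qed

text \<open>The chaining bound, summed over all levels finer than \<open>J\<close>, for the
  oscillation within one dyadic interval of level \<open>J\<close>. The series converges only almost
  surely.\<close>

definition BM_osc :: "real \<Rightarrow> (nat \<Rightarrow> 'm \<Rightarrow> real \<Rightarrow> real) \<Rightarrow> nat \<Rightarrow> nat \<Rightarrow> 'm \<Rightarrow> real" where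
  "BM_osc T B J i \<omega> = (\<Sum>j. dyad_osc T B (Suc (J + j)) i \<omega>)"

lemma dyad_osc_AE_summable:
  assumes "BM_family M B" "i \<ge> 1" "T > 0"
  shows "AE \<omega> in M. summable (\<lambda>j. dyad_osc T B (Suc (J + j)) i \<omega>)"
proof -
  interpret prob_space M using assms by (simp add: BM_family_def)
  define U where "U j \<omega> = dyad_osc T B (Suc (J + j)) i \<omega>" for j \<omega>
  define c where "c j = (1 + 3 * T^2) * bmq ^ (Suc (J + j))" for j
  have U: "has_bochner_integral M (U j) (c j)" for j
    unfolding U_def c_def by (rule dyad_osc_mean[OF assms])
  have U0: "0 \<le> U j \<omega>" for j \<omega> by (simp add: U_def dyad_osc_nonneg)
  have [measurable]: "U j \<in> borel_measurable M" for j using U[of j]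
      by (auto simp: has_bochner_integral_iff)
  have c0: "0 \<le> c j" for j using bmq(1) by (simp add: c_def)
  have "summable (\<lambda>j. bmq ^ j)" using bmq by (intro summable_geometric) auto
  then have sc: "summable c" unfolding c_def using summable_mult[of "\<lambda>j. bmq ^ j" "(1
      + 3 * T^2) * bmq ^ Suc J"]
    by (simp add: power_add mult_ac)
  have "(\<integral>\<^sup>+\<omega>. (\<Sum>j. ennreal (U j \<omega>)) \<partial>M) = (\<Sum>j. \<integral>\<^sup>+\<omega>. ennreal (U j \<omega>) \<partial>M)"
    by (rule nn_integral_suminf) simp
  also have "\<dots> = (\<Sum>j. ennreal (c j))"
  proof -
    have "(\<integral>\<^sup>+\<omega>. ennreal (U j \<omega>) \<partial>M) = ennreal (c j)" for j
      using U[of j] U0 by (subst nn_integral_eq_integral) (auto simp: has_bochner_integral_iff)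
    then show ?thesis by simp
  qed
  also have "\<dots> = ennreal (\<Sum>j. c j)" by (rule suminf_ennreal2[OF c0 sc])
  finally have "(\<integral>\<^sup>+\<omega>. (\<Sum>j. ennreal (U j \<omega>)) \<partial>M) \<noteq> \<infinity>" by simp
  then have "AE \<omega> in M. (\<Sum>j. ennreal (U j \<omega>)) \<noteq> \<infinity>"
    by (intro nn_integral_PInf_AE) measurable
  then show ?thesis
  proof eventually_elim
    case (elim \<omega>)
    then have "summable (\<lambda>j. U j \<omega>)" using U0 by (intro summable_suminf_not_top) auto
    then show ?case by (simp add: U_def)
  qed
qed

definition BM_osc_mean :: "real \<Rightarrow> nat \<Rightarrow> real" where
  "BM_osc_mean T J = (1 + 3 * T^2) * bmq ^ J * (bmq / (1 - bmq))"

lemma BM_osc_mean_nonneg: "0 \<le> BM_osc_mean T J"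
  unfolding BM_osc_mean_def using bmq by simp

lemma BM_osc_mean_tendsto: "BM_osc_mean T \<longlonglongrightarrow> 0"
proof -
  have "(\<lambda>J. bmq ^ J) \<longlonglongrightarrow> 0" using bmq by (intro LIMSEQ_power_zero) auto
  then have "(\<lambda>J. (1 + 3 * T^2) * bmq ^ J * (bmq / (1 - bmq))) \<longlonglongrightarrow> (1 + 3 * T^2) * 0 * (bmq / (1
      - bmq))"
    by (intro tendsto_mult tendsto_const)
  then show ?thesis by (simp add: BM_osc_mean_def[abs_def])
qed

lemma BM_osc_integral:
  assumes "BM_family M B" "i \<ge> 1" "T > 0"
  shows "integrable M (BM_osc T B J i)" "(\<integral>\<omega>. BM_osc T B J i \<omega> \<partial>M) = BM_osc_mean T J"
proof -
  define U where "U j \<omega> = dyad_osc T B (Suc (J + j)) i \<omega>" for j \<omega>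
  define c where "c j = (1 + 3 * T^2) * bmq ^ (Suc (J + j))" for j
  have U: "integrable M (U j)" "(\<integral>\<omega>. U j \<omega> \<partial>M) = c j" for j
    unfolding U_def c_def using dyad_osc_mean[OF assms, of "Suc (J + j)"]
        by (auto simp: has_bochner_integral_iff)
  have "(\<lambda>j. bmq ^ j) sums (1 / (1 - bmq))" using bmq by (intro geometric_sums) auto
  then have "(\<lambda>j. ((1 + 3 * T^2) * bmq ^ Suc J) * bmq ^ j) sums (((1
      + 3 * T^2) * bmq ^ Suc J) * (1 / (1 - bmq)))"
    by (rule sums_mult)
  then have sc: "c sums BM_osc_mean T J" unfolding c_def BM_osc_mean_def
      by (simp add: power_add mult_ac)
  have ae: "AE \<omega> in M. summable (\<lambda>j. norm (U j \<omega>))"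
    using dyad_osc_AE_summable[OF assms, of J] by (simp add: U_def dyad_osc_nonneg)
  have n: "(\<lambda>j. \<integral>\<omega>. norm (U j \<omega>) \<partial>M) = c" using U(2) by (auto simp: U_def dyad_osc_nonneg)
  have sn: "summable (\<lambda>j. \<integral>\<omega>. norm (U j \<omega>) \<partial>M)" unfolding n using sc by (simp add: sums_iff)
  show "integrable M (BM_osc T B J i)"
    using integrable_suminf[OF U(1) ae sn] by (simp add: BM_osc_def[abs_def] U_def)
  show "(\<integral>\<omega>. BM_osc T B J i \<omega> \<partial>M) = BM_osc_mean T J"
    using integral_suminf[OF U(1) ae sn] sc by (simp add: BM_osc_def U_def[symmetric] U(2) sums_iff)
qed

text \<open>A dyadic point is linked to its parent with index \<open>l div 2\<close>: for even
  \<open>l\<close> the two points coincide, for odd \<open>l\<close> they are one increment of that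
  level apart. All ancestors stay in the interval with index \<open>k\<close>.\<close>

lemma dyadic_chaining:
  assumes "k < 2^J" "k * 2^d \<le> l" "l < (k + 1) * 2^d"
  shows "\<bar>B i \<omega> (real l * T / 2^(J + d)) - B i \<omega> (real k * T / 2^J)\<bar> \<le> (\<Sum>j<d. dyad_osc T B (Suc (J
      + j)) i \<omega>)"
  using assms(2,3)
proof (induction d arbitrary: l)
  case 0
  then have "l = k" by simp
  then show ?case by simp
next
  case (Suc d)
  define l' where "l' = l div 2"
  have r: "k * 2^d \<le> l'" "l' < (k + 1) * 2^d" using Suc.prems by (auto simp: l'_def)
  have IH: "\<bar>B i \<omega> (real l' * T / 2^(J + d)) - B i \<omega> (real k * T / 2^J)\<bar>
      \<le> (\<Sum>j<d. dyad_osc T B (Suc (J + j)) i \<omega>)"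
    by (rule Suc.IH[OF r])
  have e: "real (2 * l') * T / 2^(J + Suc d) = real l' * T / 2^(J + d)" by simp
  have "\<bar>B i \<omega> (real l * T / 2^(J + Suc d)) - B i \<omega> (real l' * T / 2^(J + d))\<bar>
      \<le> dyad_osc T B (Suc (J + d)) i \<omega>"
  proof (cases "even l")
    case True
    then have "l = 2 * l'" by (simp add: l'_def)
    then show ?thesis using e by (simp add: dyad_osc_nonneg)
  next
    case False
    then have l: "l = Suc (2 * l')" by (simp add: l'_def)
    have "l < (k + 1) * 2 ^ Suc d" by fact
    also have "\<dots> \<le> 2^J * 2 ^ Suc d" using assms(1) by (intro mult_right_mono) auto
    also have "\<dots> = 2 ^ Suc (J + d)" by (simp add: power_add)
    finally have lt: "2 * l' < 2 ^ Suc (J + d)" using l by simp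
    show ?thesis using dyad_osc_ge[OF lt, of B i \<omega> T] unfolding l e[symmetric] by simp
  qed
  then show ?case using IH by simp
qed

lemma BM_osc_bound:
  assumes "BM_family M B" "i \<ge> 1" "T > 0" "\<omega> \<in> space M"
    and sm: "summable (\<lambda>j. dyad_osc T B (Suc (J + j)) i \<omega>)"
    and k: "k < 2^J" and s: "real k * T / 2^J \<le> s" "s \<le> real (Suc k) * T / 2^J"
  shows "\<bar>B i \<omega> s - B i \<omega> (real k * T / 2^J)\<bar> \<le> BM_osc T B J i \<omega>"
proof (cases "s = real k * T / 2^J")
  case True
  then show ?thesis using sm by (simp add: BM_osc_def dyad_osc_nonneg suminf_nonneg)
next
  case False
  have cont: "continuous_on {0..} (B i \<omega>)" using assms(1,2,4) by (simp add: BM_family_def)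
  define x where "x d = s * 2^(J + d) / T" for d :: nat
  \<comment> \<open>The largest integer strictly below \<open>x d\<close>. The strict inequality
    keeps the approximating points in the interval with index \<open>k\<close> even when
    \<open>s\<close> is its right end, and it is why the left end is treated separately.\<close>
  define l where "l d = nat (\<lceil>x d\<rceil> - 1)" for d
  have x1: "real (k * 2^d) < x d" for d
  proof -
    have "real k * T / 2^J < s" using s False by simp
    then have "real k < s * 2^J / T" using assms(3) by (simp add: field_simps)
    then have "real k * 2^d < s * 2^J / T * 2^d" by (intro mult_strict_right_mono) auto
    then show ?thesis by (simp add: x_def power_add)
  qed
  have x2: "x d \<le> real ((k + 1) * 2^d)" for d
  proof -
    have "s * 2^J / T \<le> real (Suc k)" using s(2) assms(3) by (simp add: field_simps)
    then have "s * 2^J / T * 2^d \<le> real (Suc k) * 2^d" by (intro mult_right_mono) auto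
    moreover have "s * 2^J / T * 2^d = x d" by (simp add: x_def power_add)
    moreover have "real (Suc k) * 2^d = real ((k + 1) * 2^d)" by (simp add: distrib_right)
    ultimately show ?thesis by simp
  qed
  have x0: "0 < x d" for d using x1[of d] by (meson of_nat_0_le_iff order_le_less_trans)
  have lr: "real (l d) < x d" "x d \<le> real (l d) + 1" for d
  proof -
    have "0 \<le> \<lceil>x d\<rceil> - 1" using x0[of d] by linarith
    then have "real (l d) = real_of_int (\<lceil>x d\<rceil> - 1)" unfolding l_def by simp
    then show "real (l d) < x d" "x d \<le> real (l d) + 1" by linarith+
  qed
  have lk: "k * 2^d \<le> l d" "l d < (k + 1) * 2^d" for d
  proof -
    have "real (k * 2^d) < real (l d) + 1" using x1[of d] lr(2)[of d] by linarith
    then show "k * 2^d \<le> l d" by linarith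
    have "real (l d) < real ((k + 1) * 2^d)" using x2[of d] lr(1)[of d] by linarith
    then show "l d < (k + 1) * 2^d" by (simp only: of_nat_less_iff)
  qed
  define y where "y d = real (l d) * T / 2^(J + d)" for d
  have ys: "\<bar>y d - s\<bar> \<le> T * (1 / 2) ^ d" for d
  proof -
    have "s = x d * T / 2^(J + d)" using assms(3) by (simp add: x_def)
    then have "y d - s = (real (l d) - x d) * (T / 2^(J + d))"
      by (simp add: y_def left_diff_distrib diff_divide_distrib)
    then have "\<bar>y d - s\<bar> = \<bar>real (l d) - x d\<bar> * (T / 2^(J + d))"
      using assms(3) by (simp only: abs_mult) simp
    also have "\<dots> \<le> 1 * (T / 2^(J + d))" using lr[of d] assms(3) by (intro mult_right_mono) auto
    also have "\<dots> \<le> T / 2^d" using assms(3) by (simp add: frac_le power_increasing)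
    finally show ?thesis by (simp add: power_divide)
  qed
  have "(\<lambda>d. y d - s) \<longlonglongrightarrow> 0"
  proof (rule Lim_null_comparison)
    show "\<forall>\<^sub>F d in sequentially. norm (y d - s) \<le> T * (1 / 2) ^ d" using ys by simp
    have "(\<lambda>d. T * (1 / 2) ^ d) \<longlonglongrightarrow> T * 0" by (intro tendsto_intros LIMSEQ_power_zero) auto
    then show "(\<lambda>d. T * (1 / 2) ^ d) \<longlonglongrightarrow> 0" by simp
  qed
  then have yl: "y \<longlonglongrightarrow> s" by (rule LIM_zero_cancel)
  have s0: "s \<in> {0..}" using s(1) assms(3) by (auto intro: order_trans[rotated])
  have "(\<lambda>d. B i \<omega> (y d)) \<longlonglongrightarrow> B i \<omega> s"
    by (rule continuous_on_tendsto_compose[OF cont yl s0]) (use assms(3) in \<open>auto simp: y_def\<close>)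
  then have "(\<lambda>d. \<bar>B i \<omega> (y d) - B i \<omega> (real k * T / 2^J)\<bar>) \<longlonglongrightarrow> \<bar>B i \<omega> s - B i \<omega> (real k * T / 2^J)\<bar>"
    by (intro tendsto_intros)
  moreover have "\<bar>B i \<omega> (y d) - B i \<omega> (real k * T / 2^J)\<bar> \<le> BM_osc T B J i \<omega>" for d
  proof -
    have "\<bar>B i \<omega> (y d) - B i \<omega> (real k * T / 2^J)\<bar> \<le> (\<Sum>j<d. dyad_osc T B (Suc (J + j)) i \<omega>)"
      unfolding y_def by (rule dyadic_chaining[OF k lk])
    also have "\<dots> \<le> BM_osc T B J i \<omega>"
      unfolding BM_osc_def by (rule sum_le_suminf[OF sm]) (auto simp: dyad_osc_nonneg)
    finally show ?thesis .
  qed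
  ultimately show ?thesis by (intro LIMSEQ_le_const2) auto
qed

lemma BM_osc_AE:
  assumes "BM_family M B" "T > 0"
  shows "AE \<omega> in M. \<forall>i\<ge>1. \<forall>J. 0 \<le> BM_osc T B J i \<omega> \<and>
     (\<forall>k<2^J. \<forall>s\<in>{real k * T / 2^J..real (Suc k) * T / 2^J}.
        \<bar>B i \<omega> s - B i \<omega> (real k * T / 2^J)\<bar> \<le> BM_osc T B J i \<omega>)"
proof -
  have "AE \<omega> in M. \<forall>i\<ge>1. \<forall>J. summable (\<lambda>j. dyad_osc T B (Suc (J + j)) i \<omega>)"
    using dyad_osc_AE_summable[OF assms(1) _ assms(2)]
        by (subst AE_all_countable; auto simp: AE_all_countable)+
  then show ?thesis
    using AE_space
  proof eventually_elim
    case (elim \<omega>)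
    have "0 \<le> BM_osc T B J i \<omega>" if "i \<ge> 1" for i J
      using elim(1) that by (auto simp: BM_osc_def dyad_osc_nonneg intro!: suminf_nonneg)
    then show ?case using BM_osc_bound[OF assms(1) _ assms(2) elim(2)] elim(1) by auto
  qed
qed

section \<open>The nonlinear Euler scheme\<close>

text \<open>Independent centred variables are orthogonal, so the second moment of the sum is at most
  the sum of the squared weights. The elementary inequality 2|y| \<le> y^2/c + c then does the work
  of Cauchy-Schwarz.\<close>

lemma (in prob_space) indep_sum_abs_mean:
  fixes X :: "'i \<Rightarrow> 'a \<Rightarrow> real" and w :: "'i \<Rightarrow> real"
  assumes fin: "finite I" and ind: "indep_vars (\<lambda>_. borel) X I"
    and b: "\<And>i \<omega>. i \<in> I \<Longrightarrow> \<omega> \<in> space M \<Longrightarrow> \<bar>X i \<omega>\<bar> \<le> 1" and z: "\<And>i. i \<in> I \<Longrightarrow> expectation (X i) = 0"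
    and c: "c > 0" "(\<Sum>i\<in>I. (w i)^2) \<le> c^2"
  shows "expectation (\<lambda>\<omega>. \<bar>\<Sum>i\<in>I. w i * X i \<omega>\<bar>) \<le> c"
proof -
  have rv: "X i \<in> borel_measurable M" if "i \<in> I" for i using ind that by (auto simp: indep_vars_def)
  have int2: "integrable M (\<lambda>\<omega>. X i \<omega> * X j \<omega>)" if "i \<in> I" "j \<in> I" for i j
  proof (rule integrable_const_bound[where B = 1])
    show "AE \<omega> in M. norm (X i \<omega> * X j \<omega>) \<le> 1"
    proof (rule AE_I2)
      fix \<omega> assume "\<omega> \<in> space M"
      then have "\<bar>X i \<omega>\<bar> * \<bar>X j \<omega>\<bar> \<le> 1 * 1" using b that by (intro mult_mono) auto
      then show "norm (X i \<omega> * X j \<omega>) \<le> 1" by (simp add: abs_mult)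
    qed
  qed (use rv that in auto)
  have int1: "integrable M (X i)" if "i \<in> I" for i
    by (rule integrable_const_bound[where B = 1]) (use rv b that in auto)
  have cov: "expectation (\<lambda>\<omega>. X i \<omega> * X j \<omega>) = 0" if "i \<in> I" "j \<in> I" "i \<noteq> j" for i j
  proof -
    have "expectation (\<lambda>\<omega>. \<Prod>l\<in>{i, j}. X l \<omega>) = (\<Prod>l\<in>{i, j}. expectation (X l))"
      by (rule indep_vars_lebesgue_integral[OF _ indep_vars_subset[OF ind]]) (use that int1 in auto)
    then show ?thesis using that z by simp
  qed
  have sq: "(\<Sum>i\<in>I. w i * X i \<omega>)^2 = (\<Sum>i\<in>I. \<Sum>j\<in>I. (w i * w j) * (X i \<omega> * X j \<omega>))" for \<omega>
    by (simp add: power2_eq_square sum_product mult_ac)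
  have isq: "integrable M (\<lambda>\<omega>. (\<Sum>i\<in>I. w i * X i \<omega>)^2)"
    unfolding sq using int2 by (intro Bochner_Integration.integrable_sum integrable_mult_right) auto
  have "expectation (\<lambda>\<omega>. (\<Sum>i\<in>I. w i * X i \<omega>)^2)
      = (\<Sum>i\<in>I. \<Sum>j\<in>I. (w i * w j) * expectation (\<lambda>\<omega>. X i \<omega> * X j \<omega>))"
    unfolding sq using int2 by (simp add: Bochner_Integration.integral_sum)
  also have "\<dots> = (\<Sum>i\<in>I. (w i * w i) * expectation (\<lambda>\<omega>. X i \<omega> * X i \<omega>))"
  proof (rule sum.cong[OF refl])
    fix i assume i: "i \<in> I"
    have "(\<Sum>j\<in>I. (w i * w j) * expectation (\<lambda>\<omega>. X i \<omega> * X j \<omega>))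
       = (\<Sum>j\<in>I. if j = i then (w i * w i) * expectation (\<lambda>\<omega>. X i \<omega> * X i \<omega>) else 0)"
      using cov[OF i] by (intro sum.cong) auto
    then show "(\<Sum>j\<in>I. (w i * w j) * expectation (\<lambda>\<omega>. X i \<omega> * X j \<omega>))
        = (w i * w i) * expectation (\<lambda>\<omega>. X i \<omega> * X i \<omega>)"
      using fin i by simp
  qed
  also have "\<dots> \<le> (\<Sum>i\<in>I. (w i)^2)"
  proof (rule sum_mono)
    fix i assume i: "i \<in> I"
    have "\<bar>expectation (\<lambda>\<omega>. X i \<omega> * X i \<omega>)\<bar> \<le> 1"
    proof (rule integral_bound_prob[OF prob_space_axioms])
      fix \<omega> assume "\<omega> \<in> space M"
      then have "\<bar>X i \<omega>\<bar> * \<bar>X i \<omega>\<bar> \<le> 1 * 1" using b i by (intro mult_mono) auto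
      then show "\<bar>X i \<omega> * X i \<omega>\<bar> \<le> 1" by (simp add: abs_mult)
    qed
    then have "(w i * w i) * expectation (\<lambda>\<omega>. X i \<omega> * X i \<omega>) \<le> (w i * w i) * 1"
        by (intro mult_left_mono) auto
    then show "(w i * w i) * expectation (\<lambda>\<omega>. X i \<omega> * X i \<omega>) \<le> (w i)^2"
        by (simp add: power2_eq_square)
  qed
  also have "\<dots> \<le> c^2" by fact
  finally have e2: "expectation (\<lambda>\<omega>. (\<Sum>i\<in>I. w i * X i \<omega>)^2) \<le> c^2" .
  have amgm: "\<bar>y\<bar> \<le> (y^2 / c + c) / 2" for y :: real
  proof -
    have "0 \<le> (\<bar>y\<bar> - c)^2 / c" using c by simp
    also have "\<dots> = y^2 / c + c - 2 * \<bar>y\<bar>"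
    proof -
      have "(\<bar>y\<bar> - c)^2 / c = (y^2 + c * c - 2 * \<bar>y\<bar> * c) / c"
          by (simp add: power2_diff power2_eq_square[of c])
      also have "\<dots> = y^2 / c + c - 2 * \<bar>y\<bar>" using c(1)
          by (simp only: diff_divide_distrib add_divide_distrib) simp
      finally show ?thesis .
    qed
    finally show ?thesis by simp
  qed
  have "expectation (\<lambda>\<omega>. \<bar>\<Sum>i\<in>I. w i * X i \<omega>\<bar>) \<le> expectation (\<lambda>\<omega>. ((\<Sum>i\<in>I. w i * X i \<omega>)^2 / c
      + c) / 2)"
    using int1 isq amgm by (intro integral_mono) auto
  also have "\<dots> = (expectation (\<lambda>\<omega>. (\<Sum>i\<in>I. w i * X i \<omega>)^2) / c + c) / 2" using isq prob_space by simp
  also have "\<dots> \<le> (c^2 / c + c) / 2" using e2 c by (intro divide_right_mono add_right_mono) auto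
  also have "\<dots> = c" using c by (simp add: power2_eq_square)
  finally show ?thesis .
qed

locale euler = mean_field_limit G T A L \<mu>0 \<mu>
  for G :: "real \<Rightarrow> real \<Rightarrow> real" and T A L :: real and \<mu>0 :: "real measure"
      and \<mu> :: "real \<Rightarrow> real measure" +
  fixes M :: "'m measure" and B :: "nat \<Rightarrow> 'm \<Rightarrow> real \<Rightarrow> real" and n :: nat and x :: "nat \<Rightarrow> real"
      and J :: nat
  assumes BM: "BM_family M B" and n_ge: "n \<ge> 1"
begin

sublocale prob_space M using BM by (simp add: BM_family_def)

section \<open>The scheme and its averaged law\<close>

definition h :: real where "h = T / 2^J"

definition tp :: "nat \<Rightarrow> real" where "tp k = real k * T / 2^J"

definition dB :: "nat \<Rightarrow> nat \<Rightarrow> 'm \<Rightarrow> real" where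
  "dB i k \<omega> = B i \<omega> (tp (Suc k)) - B i \<omega> (tp k)"

text \<open>The recursion defines all particles at once, with the particle index inside, because a
  step of one particle uses the laws of all particles at the previous time. The expectation over
  \<open>\<omega>'\<close> removes the interaction between the random positions.\<close>

primrec Y :: "nat \<Rightarrow> nat \<Rightarrow> 'm \<Rightarrow> real" where
  "Y 0 = (\<lambda>i \<omega>. x i)"
| "Y (Suc k) = (\<lambda>i \<omega>. Y k i \<omega> + h * (1 / real n * (\<Sum>j=1..n. \<integral>\<omega>'. G (Y k i \<omega>) (Y k j \<omega>') \<partial>M))
    + dB i k \<omega>)"

definition rho :: "nat \<Rightarrow> (real \<Rightarrow> real) \<Rightarrow> real" where
  "rho k f = 1 / real n * (\<Sum>j=1..n. \<integral>\<omega>. f (Y k j \<omega>) \<partial>M)"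

definition bet :: "nat \<Rightarrow> real \<Rightarrow> real" where
  "bet k z = rho k (G z)"

lemma Y_Suc: "Y (Suc k) i \<omega> = Y k i \<omega> + h * bet k (Y k i \<omega>) + dB i k \<omega>"
  by (simp add: bet_def rho_def)

declare Y.simps(2) [simp del]

lemma h_pos: "h > 0" using T_pos by (simp add: h_def)

lemma tp_diff: "tp (Suc k) - tp k = h" by (simp add: tp_def h_def field_simps)

lemma tp_h: "tp k = real k * h" by (simp add: tp_def h_def)

lemma dB_measurable: "i \<ge> 1 \<Longrightarrow> dB i k \<in> borel_measurable M"
proof -
  assume "i \<ge> 1"
  then have "(\<lambda>\<omega>. B i \<omega> t) \<in> borel_measurable M" for t using BM by (simp add: BM_family_def)
  then show ?thesis unfolding dB_def[abs_def] by (intro borel_measurable_diff)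
qed

lemma int_Y:
  fixes f :: "real \<Rightarrow> real"
  assumes "Y k j \<in> borel_measurable M" "f \<in> borel_measurable borel" "\<And>z. \<bar>f z\<bar> \<le> c"
  shows "integrable M (\<lambda>\<omega>. f (Y k j \<omega>))"
  by (rule integrable_const_bound[where B = c]) (use assms in \<open>auto intro: measurable_compose\<close>)

lemma rho_bound_gen:
  assumes "\<And>z. \<bar>f z\<bar> \<le> c" shows "\<bar>rho k f\<bar> \<le> c"
proof -
  have "\<bar>\<Sum>j=1..n. \<integral>\<omega>. f (Y k j \<omega>) \<partial>M\<bar> \<le> (\<Sum>j=1..n. c)"
    by (intro order_trans[OF sum_abs] sum_mono integral_bound_prob[OF prob_space_axioms] assms)
  then have "\<bar>\<Sum>j=1..n. \<integral>\<omega>. f (Y k j \<omega>) \<partial>M\<bar> \<le> real n * c" by simp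
  then show ?thesis using n_ge by (simp add: rho_def abs_mult divide_le_eq mult.commute)
qed

text \<open>Measurability is an assumption at this stage: the induction that proves it needs
  continuity of \<open>bet k\<close>, which rests on this linearity.\<close>

lemma rho_diff_gen:
  assumes "\<And>j. j \<ge> 1 \<Longrightarrow> Y k j \<in> borel_measurable M"
   "f \<in> borel_measurable borel" "\<And>z. \<bar>f z\<bar> \<le> c" "g \<in> borel_measurable borel" "\<And>z. \<bar>g z\<bar> \<le> c'"
  shows "rho k (\<lambda>z. f z - g z) = rho k f - rho k g"
proof -
  have "(\<integral>\<omega>. f (Y k j \<omega>) - g (Y k j \<omega>) \<partial>M) = (\<integral>\<omega>. f (Y k j \<omega>) \<partial>M) - (\<integral>\<omega>. g (Y k j \<omega>) \<partial>M)" if "j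
      \<in> {1..n}" for j
    using int_Y[OF assms(1) assms(2,3), of j] int_Y[OF assms(1) assms(4,5), of j] that by simp
  then show ?thesis by (simp add: rho_def sum_subtractf right_diff_distrib)
qed

lemma bet_lip_gen:
  assumes "\<And>j. j \<ge> 1 \<Longrightarrow> Y k j \<in> borel_measurable M"
  shows "\<bar>bet k z - bet k z'\<bar> \<le> L * \<bar>z - z'\<bar>"
proof -
  have Gm: "G z \<in> borel_measurable borel" for z by (rule borel_measurable_continuous_onI[OF G_cont])
  have "bet k z - bet k z' = rho k (\<lambda>y. G z y - G z' y)"
    unfolding bet_def by (rule rho_diff_gen[symmetric, OF assms Gm G_bound Gm G_bound])
  also have "\<bar>\<dots>\<bar> \<le> L * \<bar>z - z'\<bar>" by (rule rho_bound_gen[OF G_lip1])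
  finally show ?thesis .
qed

lemma Y_measurable: "i \<ge> 1 \<Longrightarrow> Y k i \<in> borel_measurable M"
proof (induction k arbitrary: i)
  case (Suc k)
  have "bet k \<in> borel_measurable borel"
    by (rule borel_measurable_continuous_onI[OF lip_continuous[OF bet_lip_gen[OF Suc.IH]]])
  then have "(\<lambda>\<omega>. bet k (Y k i \<omega>)) \<in> borel_measurable M"
    using Suc by (auto intro: measurable_compose)
  then show ?case unfolding Y_Suc[abs_def] using Suc dB_measurable[OF Suc.prems] by simp
qed simp

lemma bet_blip: "blip A L (bet k)"
  unfolding blip_def
proof (intro conjI allI)
  show "\<bar>bet k z\<bar> \<le> A" for z unfolding bet_def by (rule rho_bound_gen[OF G_bound])
  show "\<bar>bet k z - bet k z'\<bar> \<le> L * \<bar>z - z'\<bar>" for z z' by (rule bet_lip_gen[OF Y_measurable])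
qed

lemma bet_per: "bet k (z + 2 * pi) = bet k z"
proof -
  have "G (z + 2 * pi) = G z" using G_per by (auto simp: periodic2_def)
  then show ?thesis by (simp add: bet_def)
qed

section \<open>Independence of the particles and of the increments\<close>

lemma dB_indep:
  assumes "finite I" "I \<subseteq> {1..}"
  shows "indep_vars (\<lambda>_. borel) (\<lambda>p \<omega>. dB (fst p) (snd p) \<omega>) (I \<times> {..<m})"
proof -
  have ord: "0 \<le> tp 0" "\<forall>k<m. tp k < tp (Suc k)" using tp_diff h_pos
      by (auto simp: tp_def divide_strict_right_mono T_pos)
  have "\<forall>(ts :: nat \<Rightarrow> real) m I. finite I \<and> I \<subseteq> {1..} \<and> 0 \<le> ts 0 \<and>
        (\<forall>k<m. ts k < ts (Suc k)) \<longrightarrow>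
        prob_space.indep_vars M (\<lambda>_. borel)
          (\<lambda>(i, k) \<omega>. B i \<omega> (ts (Suc k)) - B i \<omega> (ts k)) (I \<times> {..<m})"
    using BM by (simp add: BM_family_def)
  from this[rule_format, of I tp m] show ?thesis
    using assms ord by (simp add: dB_def case_prod_unfold)
qed

text \<open>The scheme as a deterministic function of an array of increments. It reads only the
  entries of its own particle before step \<open>k\<close>, so independence of the increments passes
  to the particles.\<close>

primrec yy :: "nat \<Rightarrow> nat \<Rightarrow> (nat \<times> nat \<Rightarrow> real) \<Rightarrow> real" where
  "yy 0 = (\<lambda>i u. x i)"
| "yy (Suc k) = (\<lambda>i u. yy k i u + h * bet k (yy k i u) + u (i, k))"

lemma yy_measurable:
  assumes "{i} \<times> {..<k} \<subseteq> K"
  shows "yy k i \<in> borel_measurable (PiM K (\<lambda>_. borel))"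
  using assms
proof (induction k)
  case (Suc k)
  have 1[measurable]: "yy k i \<in> borel_measurable (PiM K (\<lambda>_. borel))"
    by (rule Suc.IH) (use Suc.prems in \<open>auto simp: less_Suc_eq\<close>)
  have [measurable]: "bet k \<in> borel_measurable borel" by (rule blipD[OF bet_blip])
  have [measurable]: "(\<lambda>u. u (i, k)) \<in> borel_measurable (PiM K (\<lambda>_. borel))"
    by (rule measurable_component_singleton) (use Suc.prems in auto)
  show ?case unfolding yy.simps by measurable
qed simp

lemma Y_yy:
  assumes "{i} \<times> {..<k} \<subseteq> K"
  shows "Y k i \<omega> = yy k i (restrict (\<lambda>p. dB (fst p) (snd p) \<omega>) K)"
  using assms
proof (induction k)
  case (Suc k)
  have "Y k i \<omega> = yy k i (restrict (\<lambda>p. dB (fst p) (snd p) \<omega>) K)"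
    by (rule Suc.IH) (use Suc.prems in \<open>auto simp: less_Suc_eq\<close>)
  then show ?case using Suc.prems unfolding Y_Suc yy.simps by auto
qed simp

lemma Y_indep: "indep_vars (\<lambda>_. borel) (Y k) {1..n}"
proof -
  have "indep_vars (\<lambda>i. PiM ({i} \<times> {..<k}) (\<lambda>_. borel))
     (\<lambda>i \<omega>. restrict (\<lambda>p. dB (fst p) (snd p) \<omega>) ({i} \<times> {..<k})) {1..n}"
    by (rule indep_vars_restrict[OF dB_indep[of "{1..n}" k]]) (auto simp: disjoint_family_on_def)
  then have "indep_vars (\<lambda>_. borel)
     (\<lambda>i \<omega>. yy k i (restrict (\<lambda>p. dB (fst p) (snd p) \<omega>) ({i} \<times> {..<k}))) {1..n}"
    by (rule indep_vars_compose2) (rule yy_measurable, simp)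
  then show ?thesis by (simp add: Y_yy[OF order_refl, symmetric, abs_def])
qed

lemma Y_dB_indep:
  assumes "i \<ge> 1" shows "indep_var borel (Y k i) borel (dB i k)"
proof -
  have "indep_var (PiM ({i} \<times> {..<k}) (\<lambda>_. borel)) (\<lambda>\<omega>. restrict (\<lambda>p. dB (fst p) (snd p) \<omega>) ({i} \<times>
      {..<k}))
     (PiM {(i, k)} (\<lambda>_. borel)) (\<lambda>\<omega>. restrict (\<lambda>p. dB (fst p) (snd p) \<omega>) {(i, k)})"
    by (rule indep_var_restrict[OF dB_indep[of "{i}" "Suc k"]]) (use assms in auto)
  then have "indep_var borel (yy k i \<circ> (\<lambda>\<omega>. restrict (\<lambda>p. dB (fst p) (snd p) \<omega>) ({i} \<times> {..<k})))
     borel ((\<lambda>u. u (i, k)) \<circ> (\<lambda>\<omega>. restrict (\<lambda>p. dB (fst p) (snd p) \<omega>) {(i, k)}))"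
    by (rule indep_var_compose) (auto intro: yy_measurable measurable_component_singleton)
  then show ?thesis
    by (simp add: o_def Y_yy[OF order_refl, symmetric])
qed

text \<open>The next increment is independent of the current position, so Fubini's theorem
  integrates it out first; as its variance is \<open>h\<close>, this integration is the heat
  operator.\<close>

lemma Y_step_law:
  assumes i: "i \<ge> 1" and f: "blip c K f"
  shows "(\<integral>\<omega>. f (Y (Suc k) i \<omega>) \<partial>M) = (\<integral>\<omega>. heat h f (Y k i \<omega> + h * bet k (Y k i \<omega>)) \<partial>M)"
proof -
  have [measurable]: "Y k i \<in> borel_measurable M" "dB i k \<in> borel_measurable M"
    using Y_measurable[OF i] dB_measurable[OF i] by auto
  have [measurable]: "f \<in> borel_measurable borel" "bet k \<in> borel_measurable borel"
    by (rule blipD[OF f], rule blipD[OF bet_blip])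
  have [measurable]: "heat h f \<in> borel_measurable borel" by (rule blipD[OF heat_blip[OF f]])
  define N1 where "N1 = distr M borel (Y k i)"
  define N2 where "N2 = distr M borel (dB i k)"
  interpret N1: prob_space N1 unfolding N1_def by (rule prob_space_distr) simp
  interpret N2: prob_space N2 unfolding N2_def by (rule prob_space_distr) simp
  interpret P: pair_prob_space N1 N2 ..
  have [measurable_cong]: "sets N1 = sets borel" "sets N2 = sets borel"
      by (auto simp: N1_def N2_def)
  have prod: "N1 \<Otimes>\<^sub>M N2 = distr M (borel \<Otimes>\<^sub>M borel) (\<lambda>\<omega>. (Y k i \<omega>, dB i k \<omega>))"
    using indep_var_distribution_eq[of borel "Y k i" borel "dB i k"] Y_dB_indep[OF i, of k]
    by (simp add: N1_def N2_def)
  define F where "F p = f (fst p + h * bet k (fst p) + snd p)" for p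
  have [measurable]: "F \<in> borel_measurable (borel \<Otimes>\<^sub>M borel)" unfolding F_def by measurable
  have Fi: "integrable (N1 \<Otimes>\<^sub>M N2) F"
    by (rule P.integrable_const_bound[where B = c]) (auto simp: F_def blipD(1)[OF f])
  have d: "distributed M lborel (dB i k) (\<lambda>x. ennreal (normal_density 0 (sqrt h) x))"
  proof -
    have "0 \<le> tp k" "tp k < tp (Suc k)" using tp_diff[of k] h_pos T_pos by (auto simp: tp_def)
    then have "distributed M lborel (\<lambda>\<omega>. B i \<omega> (tp (Suc k)) - B i \<omega> (tp k))
       (\<lambda>x. ennreal (normal_density 0 (sqrt (tp (Suc k) - tp k)) x))"
      using BM i by (simp add: BM_family_def)
    then show ?thesis unfolding tp_diff dB_def[abs_def] .
  qed
  have inner: "(\<integral>z. f (a + z) \<partial>N2) = heat h f a" for a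
  proof -
    have "(\<integral>z. f (a + z) \<partial>N2) = (\<integral>\<omega>. f (a + dB i k \<omega>) \<partial>M)"
      unfolding N2_def by (rule integral_distr) auto
    also have "\<dots> = (\<integral>z. normal_density 0 (sqrt h) z * f (a + z) \<partial>lborel)"
      by (rule distributed_integral[OF d, symmetric]) auto
    also have "\<dots> = heat h f a" by (rule heat_normal[symmetric, OF h_pos]) simp
    finally show ?thesis .
  qed
  have "(\<integral>\<omega>. f (Y (Suc k) i \<omega>) \<partial>M) = (\<integral>\<omega>. F (Y k i \<omega>, dB i k \<omega>) \<partial>M)"
    by (simp add: F_def Y_Suc)
  also have "\<dots> = (\<integral>p. F p \<partial>(N1 \<Otimes>\<^sub>M N2))"
    unfolding prod by (rule integral_distr[symmetric]) measurable
  also have "\<dots> = (\<integral>a. (\<integral>z. F (a, z) \<partial>N2) \<partial>N1)"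
    using P.integral_fst'[OF Fi] by simp
  also have "\<dots> = (\<integral>a. heat h f (a + h * bet k a) \<partial>N1)"
    by (simp add: F_def inner)
  also have "\<dots> = (\<integral>\<omega>. heat h f (Y k i \<omega> + h * bet k (Y k i \<omega>)) \<partial>M)"
    unfolding N1_def by (rule integral_distr) auto
  finally show ?thesis .
qed

section \<open>Transition operators of the scheme\<close>

definition S :: "nat \<Rightarrow> (real \<Rightarrow> real) \<Rightarrow> real \<Rightarrow> real" where
  "S k f z = heat h f (z + h * bet k z)"

text \<open>The latest step acts on the test function first, as for any inhomogeneous Markov
  chain.\<close>

primrec Q :: "nat \<Rightarrow> (real \<Rightarrow> real) \<Rightarrow> real \<Rightarrow> real" where
  "Q 0 = (\<lambda>f. f)"
| "Q (Suc k) = (\<lambda>f. Q k (S k f))"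

lemma S_blip:
  assumes "blip c K f" shows "blip c ((1 + h * L) * K) (S k f)"
  unfolding blip_def S_def
proof (intro conjI allI)
  note H = heat_blip[OF assms, of h]
  show "\<bar>heat h f (z + h * bet k z)\<bar> \<le> c" for z by (rule blipD(1)[OF H])
  fix z y
  have "\<bar>heat h f (z + h * bet k z) - heat h f (y + h * bet k y)\<bar> \<le> K * \<bar>(z + h * bet k z) - (y
      + h * bet k y)\<bar>"
    by (rule blipD(2)[OF H])
  also have "\<dots> \<le> K * ((1 + h * L) * \<bar>z - y\<bar>)"
  proof (rule mult_left_mono[OF _ blipD(6)[OF assms]])
    have "h * \<bar>bet k z - bet k y\<bar> \<le> h * (L * \<bar>z - y\<bar>)"
      using blipD(2)[OF bet_blip] h_pos by (intro mult_left_mono) auto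
    moreover have "(z + h * bet k z) - (y + h * bet k y) = (z - y) + h * (bet k z - bet k y)"
      by (simp add: algebra_simps)
    then have "\<bar>(z + h * bet k z) - (y + h * bet k y)\<bar> \<le> \<bar>z - y\<bar> + h * \<bar>bet k z - bet k y\<bar>"
      using h_pos abs_triangle_ineq[of "z - y" "h * (bet k z - bet k y)"] by (simp add: abs_mult)
    ultimately show "\<bar>(z + h * bet k z) - (y + h * bet k y)\<bar> \<le> (1 + h * L) * \<bar>z - y\<bar>"
      by (simp add: algebra_simps)
  qed
  finally show "\<bar>heat h f (z + h * bet k z) - heat h f (y + h * bet k y)\<bar> \<le> (1 + h * L) * K * \<bar>z
      - y\<bar>"
    by (simp add: mult_ac)
qed

lemma S_periodic:
  assumes "periodic1 f" shows "periodic1 (S k f)"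
  unfolding periodic1_def
proof
  fix z
  have "S k f (z + 2 * pi) = heat h f ((z + h * bet k z) + 2 * pi)"
    unfolding S_def bet_per by (simp only: add_ac)
  also have "\<dots> = S k f z"
    using heat_periodic[OF assms, of h] by (simp add: periodic1_def S_def)
  finally show "S k f (z + 2 * pi) = S k f z" .
qed

lemma Q_blip: "blip c K f \<Longrightarrow> blip c ((1 + h * L)^k * K) (Q k f)"
proof (induction k arbitrary: f K)
  case (Suc k)
  from Suc.IH[OF S_blip[OF Suc.prems, of k]] show ?case by (simp add: mult_ac)
qed simp

lemma Q_periodic: "periodic1 f \<Longrightarrow> periodic1 (Q k f)"
  by (induction k arbitrary: f) (auto intro: S_periodic)

text \<open>All particles share the same transition operators, so \<open>i\<close> enters only
  through the starting point \<open>x i\<close>. A difference between weighted and uniform averages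
  at a later time is thereby reduced to one at time 0, tested on a Lipschitz function.\<close>

lemma Y_law: "i \<ge> 1 \<Longrightarrow> blip c K f \<Longrightarrow> (\<integral>\<omega>. f (Y k i \<omega>) \<partial>M) = Q k f (x i)"
proof (induction k arbitrary: f K)
  case 0
  then show ?case using prob_space by simp
next
  case (Suc k)
  have "(\<integral>\<omega>. f (Y (Suc k) i \<omega>) \<partial>M) = (\<integral>\<omega>. S k f (Y k i \<omega>) \<partial>M)"
    unfolding S_def by (rule Y_step_law[OF Suc.prems])
  also have "\<dots> = Q k (S k f) (x i)" by (rule Suc.IH[OF Suc.prems(1) S_blip[OF Suc.prems(2)]])
  finally show ?case by simp
qed

text \<open>Bounds the Lipschitz constants of all \<open>Q k f\<close> uniformly in the step size,
  so the initial discrepancy is amplified by a fixed factor only.\<close>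

lemma Q_lip_exp:
  assumes "k \<le> 2^J" shows "(1 + h * L)^k \<le> exp (L * T)"
proof -
  have "(1 + h * L)^k \<le> exp (h * L)^k" using h_pos L_ge by (intro power_mono) auto
  also have "\<dots> = exp (real k * (h * L))" by (simp add: exp_of_nat_mult)
  also have "\<dots> \<le> exp (L * T)"
  proof -
    have "real k \<le> 2^J" using assms by (metis of_nat_le_iff of_nat_numeral of_nat_power)
    then have "real k * h \<le> 2^J * h" using h_pos by (intro mult_right_mono) auto
    then have "real k * h \<le> T" by (simp add: h_def)
    then have "L * (real k * h) \<le> L * T" using L_ge by (intro mult_left_mono) auto
    then show ?thesis by (simp add: mult_ac)
  qed
  finally show ?thesis .
qed

lemma rho_scheme: "scheme h (2^J) rho"
  unfolding scheme_def
proof (intro conjI allI impI ballI)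
  show "real (2^J) * h \<le> T" by (simp add: h_def)
  show "rho k (\<lambda>z. f z - g z) = rho k f - rho k g"
    if "continuous_on UNIV f" "continuous_on UNIV g" "\<forall>z. \<bar>f z\<bar> \<le> c" "\<forall>z. \<bar>g z\<bar> \<le> c'" for k f g c c'
    by (rule rho_diff_gen[OF Y_measurable]) (use that in \<open>auto intro:
        borel_measurable_continuous_onI\<close>)
  show "rho k (\<lambda>z. c * f z) = c * rho k f" for k c f
    by (simp add: rho_def sum_distrib_left[symmetric])
  show "\<bar>rho k f\<bar> \<le> c" if "\<forall>z. \<bar>f z\<bar> \<le> c" for k f c using that by (intro rho_bound_gen) auto
  show "rho (Suc k) f = rho k (\<lambda>z. heat h f (z + h * rho k (G z)))" if "f \<in> BL_test" for k f
    unfolding rho_def[of "Suc k"] rho_def[of k "\<lambda>z. heat h f (z + h * rho k (G z))"]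
    using Y_step_law[OF _ BL_blip[OF that], of _ k] by (simp add: bet_def)
qed (rule h_pos)

text \<open>A single random variable that dominates the centred weighted sums of all test functions
  at once: the centred arc counts, averaged over the arcs.\<close>

definition Fl :: "(nat \<Rightarrow> real) \<Rightarrow> nat \<Rightarrow> nat \<Rightarrow> 'm \<Rightarrow> real" where
  "Fl w K k \<omega> = 2 * pi / real K *
     (\<Sum>a<K. \<bar>\<Sum>i=1..n. w i * (stp K a (Y k i \<omega>) - (\<integral>\<omega>'. stp K a (Y k i \<omega>') \<partial>M))\<bar>)"

lemma stp_Y_integrable: "i \<ge> 1 \<Longrightarrow> integrable M (\<lambda>\<omega>. stp K a (Y k i \<omega>))"
  by (rule int_Y[OF Y_measurable, where c = 1]) (auto simp: stp_bounds)

lemma Fl_integrable: "integrable M (Fl w K k)"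
  unfolding Fl_def[abs_def] using stp_Y_integrable
  by (intro integrable_mult_right Bochner_Integration.integrable_sum integrable_abs
      Bochner_Integration.integrable_diff) auto

lemma Fl_nonneg: "0 \<le> Fl w K k \<omega>"
  unfolding Fl_def by (intro mult_nonneg_nonneg sum_nonneg) auto

text \<open>The prefactor \<open>1/K\<close> compensates the number of arcs, so the bound is
  independent of \<open>K\<close> and the mesh may be refined freely.\<close>

lemma Fl_mean:
  assumes K: "K > 0" and c: "c > 0" "(\<Sum>i=1..n. (w i)^2) \<le> c^2"
  shows "expectation (Fl w K k) \<le> 2 * pi * c"
proof -
  define X where "X a i \<omega> = stp K a (Y k i \<omega>) - (\<integral>\<omega>'. stp K a (Y k i \<omega>') \<partial>M)" for a i \<omega>
  have i1: "integrable M (\<lambda>\<omega>. \<bar>\<Sum>i=1..n. w i * X a i \<omega>\<bar>)" for a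
    unfolding X_def using stp_Y_integrable
    by (intro Bochner_Integration.integrable_sum integrable_abs integrable_mult_right
      Bochner_Integration.integrable_diff) auto
  have "expectation (\<lambda>\<omega>. \<bar>\<Sum>i=1..n. w i * X a i \<omega>\<bar>) \<le> c" for a
  proof (rule indep_sum_abs_mean[OF _ _ _ _ c])
    show "indep_vars (\<lambda>_. borel) (X a) {1..n}"
      unfolding X_def by (rule indep_vars_compose2[OF Y_indep[of k]]) auto
    have m: "0 \<le> (\<integral>\<omega>'. stp K a (Y k i \<omega>') \<partial>M)" "(\<integral>\<omega>'. stp K a (Y k i \<omega>') \<partial>M) \<le> 1" for i
      using integral_bound_prob[OF prob_space_axioms, of "\<lambda>\<omega>. stp K a (Y k i \<omega>)" 1]
      by (auto simp: stp_bounds)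
    then show "\<bar>X a i \<omega>\<bar> \<le> 1" for i \<omega>
      unfolding X_def using m[of i] stp_bounds[of K a "Y k i \<omega>"] by linarith
    show "expectation (X a i) = 0" if "i \<in> {1..n}" for i
      unfolding X_def using stp_Y_integrable[of i K a k] that prob_space by simp
  qed auto
  then have "(\<Sum>a<K. expectation (\<lambda>\<omega>. \<bar>\<Sum>i=1..n. w i * X a i \<omega>\<bar>)) \<le> real K * c"
    using sum_bounded_above[of "{..<K}" "\<lambda>a. expectation (\<lambda>\<omega>. \<bar>\<Sum>i=1..n. w i * X a i \<omega>\<bar>)" c] by simp
  then have "2 * pi / real K * (\<Sum>a<K. expectation (\<lambda>\<omega>. \<bar>\<Sum>i=1..n. w i * X a i \<omega>\<bar>))
      \<le> 2 * pi / real K * (real K * c)"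
    by (intro mult_left_mono) auto
  moreover have "expectation (Fl w K k) = 2 * pi / real K * (\<Sum>a<K. expectation (\<lambda>\<omega>. \<bar>\<Sum>i=1..n. w i
      * X a i \<omega>\<bar>))"
    unfolding Fl_def[abs_def] X_def[symmetric] using i1
        by (simp add: Bochner_Integration.integral_sum)
  ultimately show ?thesis using K by simp
qed

text \<open>The step function part is linear in the arc indicators. The approximation error enters
  twice, for the value and for its mean, which gives the constant 4 pi.\<close>

lemma fluctuation_bound:
  assumes f: "lip_per Lf f" and fb: "\<And>z. \<bar>f z\<bar> \<le> c" and K: "K > 0"
  shows "\<bar>\<Sum>i=1..n. w i * (f (Y k i \<omega>) - (\<integral>\<omega>'. f (Y k i \<omega>') \<partial>M))\<bar>
     \<le> Lf * Fl w K k \<omega> + 4 * pi * Lf / real K * (\<Sum>i=1..n. \<bar>w i\<bar>)"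
proof -
  obtain \<Delta> where \<Delta>: "\<And>a. \<bar>\<Delta> a\<bar> \<le> 2 * pi * Lf / real K"
    "\<And>y. \<bar>f y - f 0 - (\<Sum>a<K. \<Delta> a * stp K a y)\<bar> \<le> 2 * pi * Lf / real K"
    using step_approx[OF f K] by metis
  define d where "d = 2 * pi * Lf / real K"
  define R where "R y = f y - f 0 - (\<Sum>a<K. \<Delta> a * stp K a y)" for y
  define E where "E a i = (\<integral>\<omega>'. stp K a (Y k i \<omega>') \<partial>M)" for a i
  have fm: "f \<in> borel_measurable borel" by (rule borel_measurable_continuous_onI[OF
      lip_per_continuous[OF f]])
  have dec: "f (Y k i \<omega>) - (\<integral>\<omega>'. f (Y k i \<omega>') \<partial>M)
     = (\<Sum>a<K. \<Delta> a * (stp K a (Y k i \<omega>) - E a i)) + (R (Y k i \<omega>) - (\<integral>\<omega>'. R (Y k i \<omega>') \<partial>M))"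
         if i: "i \<in> {1..n}" for i
  proof -
    have i1: "integrable M (\<lambda>\<omega>. f (Y k i \<omega>))" using int_Y[OF Y_measurable fm fb] i by auto
    have i2: "integrable M (\<lambda>\<omega>. stp K a (Y k i \<omega>))" for a using stp_Y_integrable i by auto
    have "(\<integral>\<omega>'. R (Y k i \<omega>') \<partial>M) = (\<integral>\<omega>'. f (Y k i \<omega>') \<partial>M) - f 0 - (\<Sum>a<K. \<Delta> a * E a i)"
      unfolding R_def E_def using i1 i2 prob_space by (simp add: Bochner_Integration.integral_sum)
    then show ?thesis by (simp add: R_def right_diff_distrib sum_subtractf)
  qed
  define V where "V a = (\<Sum>i=1..n. w i * (stp K a (Y k i \<omega>) - E a i))" for a
  define W where "W i = w i * (R (Y k i \<omega>) - (\<integral>\<omega>'. R (Y k i \<omega>') \<partial>M))" for i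
  have "(\<Sum>i=1..n. w i * (f (Y k i \<omega>) - (\<integral>\<omega>'. f (Y k i \<omega>') \<partial>M)))
     = (\<Sum>i=1..n. w i * (\<Sum>a<K. \<Delta> a * (stp K a (Y k i \<omega>) - E a i))) + (\<Sum>i=1..n. W i)"
    unfolding sum.distrib[symmetric] using dec by (intro sum.cong) (auto simp: distrib_left W_def)
  moreover have "(\<Sum>i=1..n. w i * (\<Sum>a<K. \<Delta> a * (stp K a (Y k i \<omega>) - E a i))) = (\<Sum>a<K. \<Delta> a * V a)"
    unfolding V_def sum_distrib_left by (subst sum.swap) (simp add: mult_ac)
  moreover have "\<bar>(\<Sum>a<K. \<Delta> a * V a) + (\<Sum>i=1..n. W i)\<bar> \<le> (\<Sum>a<K. d * \<bar>V a\<bar>)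
      + (\<Sum>i=1..n. \<bar>w i\<bar> * (2 * d))"
  proof (intro order_trans[OF abs_triangle_ineq] add_mono order_trans[OF sum_abs] sum_mono)
    fix a show "\<bar>\<Delta> a * V a\<bar> \<le> d * \<bar>V a\<bar>"
      unfolding abs_mult d_def by (intro mult_right_mono \<Delta>) auto
  next
    fix i
    have "\<bar>R (Y k i \<omega>)\<bar> \<le> d" unfolding R_def d_def by (rule \<Delta>)
    moreover have "\<bar>\<integral>\<omega>'. R (Y k i \<omega>') \<partial>M\<bar> \<le> d"
      by (rule integral_bound_prob[OF prob_space_axioms]) (unfold R_def d_def, rule \<Delta>)
    ultimately have "\<bar>R (Y k i \<omega>) - (\<integral>\<omega>'. R (Y k i \<omega>') \<partial>M)\<bar> \<le> 2 * d" by linarith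
    then show "\<bar>W i\<bar> \<le> \<bar>w i\<bar> * (2 * d)"
      unfolding W_def abs_mult by (intro mult_left_mono) auto
  qed
  moreover have "(\<Sum>a<K. d * \<bar>V a\<bar>) = Lf * Fl w K k \<omega>"
    unfolding Fl_def E_def[symmetric] V_def[symmetric] sum_distrib_left[symmetric]
        by (simp add: d_def)
  moreover have "(\<Sum>i=1..n. \<bar>w i\<bar> * (2 * d)) = 4 * pi * Lf / real K * (\<Sum>i=1..n. \<bar>w i\<bar>)"
    unfolding sum_distrib_right[symmetric] by (simp add: d_def)
  ultimately show ?thesis by simp
qed

end

section \<open>Comparison of the particle system with the Euler scheme\<close>

lemma step_weighted_bound:
  assumes f: "lip_per Lf f" and fb: "\<bar>f 0\<bar> \<le> A" and K: "K > 0"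
  shows "\<bar>\<Sum>j\<in>I. c j * f (y j)\<bar> \<le> A * \<bar>\<Sum>j\<in>I. c j\<bar>
     + 2 * pi * Lf / real K * (\<Sum>a<K. \<bar>\<Sum>j\<in>I. c j * stp K a (y j)\<bar>)
         + 2 * pi * Lf / real K * (\<Sum>j\<in>I. \<bar>c j\<bar>)"
proof -
  obtain \<Delta> where \<Delta>: "\<And>a. \<bar>\<Delta> a\<bar> \<le> 2 * pi * Lf / real K"
    "\<And>y. \<bar>f y - f 0 - (\<Sum>a<K. \<Delta> a * stp K a y)\<bar> \<le> 2 * pi * Lf / real K"
    using step_approx[OF f K] by metis
  define d where "d = 2 * pi * Lf / real K"
  define R where "R j = f (y j) - f 0 - (\<Sum>a<K. \<Delta> a * stp K a (y j))" for j
  define V where "V a = (\<Sum>j\<in>I. c j * stp K a (y j))" for a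
  have sw: "(\<Sum>j\<in>I. c j * (\<Sum>a<K. \<Delta> a * stp K a (y j))) = (\<Sum>a<K. \<Delta> a * V a)"
    unfolding V_def sum_distrib_left by (subst sum.swap) (simp add: mult_ac)
  have "(\<Sum>j\<in>I. c j * f (y j)) = (\<Sum>j\<in>I. c j * f 0) + (\<Sum>j\<in>I. c j * (\<Sum>a<K. \<Delta> a * stp K a (y j)))
      + (\<Sum>j\<in>I. c j * R j)"
    unfolding sum.distrib[symmetric] by (intro sum.cong refl) (simp add: R_def algebra_simps)
  also have "\<dots> = (\<Sum>j\<in>I. c j) * f 0 + (\<Sum>a<K. \<Delta> a * V a) + (\<Sum>j\<in>I. c j * R j)"
    unfolding sw by (simp add: sum_distrib_right)
  finally have eq: "(\<Sum>j\<in>I. c j * f (y j)) = (\<Sum>j\<in>I. c j) * f 0 + (\<Sum>a<K. \<Delta> a * V a)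
      + (\<Sum>j\<in>I. c j * R j)" .
  have 1: "\<bar>(\<Sum>j\<in>I. c j) * f 0\<bar> \<le> A * \<bar>\<Sum>j\<in>I. c j\<bar>"
    unfolding abs_mult using fb by (subst mult.commute) (intro mult_right_mono, auto)
  have 2: "\<bar>\<Sum>a<K. \<Delta> a * V a\<bar> \<le> d * (\<Sum>a<K. \<bar>V a\<bar>)"
    unfolding sum_distrib_left
    by (intro order_trans[OF sum_abs] sum_mono) (unfold abs_mult d_def, intro mult_right_mono \<Delta>,
        simp)
  have 3: "\<bar>\<Sum>j\<in>I. c j * R j\<bar> \<le> d * (\<Sum>j\<in>I. \<bar>c j\<bar>)"
    unfolding sum_distrib_left
    by (intro order_trans[OF sum_abs] sum_mono) (unfold abs_mult d_def R_def, subst mult.commute,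
        intro mult_right_mono \<Delta>, simp)
  show ?thesis unfolding eq using 1 2 3 unfolding V_def d_def by linarith
qed

text \<open>The graph is a fixed matrix here, and only \<open>cut\<close> is known about it. Single
  vertices may have very large degree, so drifts and distances are always estimated after summation
  over \<open>i\<close>.\<close>

locale particles = euler G T A L \<mu>0 \<mu> M B n x J
  for G :: "real \<Rightarrow> real \<Rightarrow> real" and T A L :: real and \<mu>0 :: "real measure"
      and \<mu> :: "real \<Rightarrow> real measure"
    and M :: "'m measure" and B :: "nat \<Rightarrow> 'm \<Rightarrow> real \<Rightarrow> real" and n :: nat and x :: "nat \<Rightarrow> real"
        and J :: nat +
  fixes p :: real and xi :: "nat \<Rightarrow> nat \<Rightarrow> bool" and \<theta> :: "nat \<Rightarrow> 'm \<Rightarrow> real \<Rightarrow> real" and \<delta> :: real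
  assumes p_pos: "p > 0"
    and path_cont: "\<And>i \<omega>. i \<in> {1..n} \<Longrightarrow> \<omega> \<in> space M \<Longrightarrow> continuous_on {0..T} (\<theta> i \<omega>)"
    and path_eq: "\<And>i \<omega> t. i \<in> {1..n} \<Longrightarrow> \<omega> \<in> space M \<Longrightarrow> t \<in> {0..T} \<Longrightarrow> \<theta> i \<omega> t = x i +
           integral {0..t} (\<lambda>s. (1 / (real n * p)) *
             (\<Sum>j=1..n. if xi i j then G (\<theta> i \<omega> s) (\<theta> j \<omega> s) else 0)) + B i \<omega> t"
    and cut: "\<And>U. U \<subseteq> {1..n} \<Longrightarrow> (\<Sum>i=1..n. \<bar>\<Sum>j\<in>U. (if xi i j then 1 / p else 0) - 1\<bar>)
        \<le> \<delta> * (real n)^2"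
begin

section \<open>The drift through the graph and its mean-field counterpart\<close>

definition Fd :: "nat \<Rightarrow> (nat \<Rightarrow> real) \<Rightarrow> real" where
  "Fd i y = (1 / (real n * p)) * (\<Sum>j=1..n. if xi i j then G (y i) (y j) else 0)"

definition Fb :: "nat \<Rightarrow> (nat \<Rightarrow> real) \<Rightarrow> real" where
  "Fb i y = (1 / real n) * (\<Sum>j=1..n. G (y i) (y j))"

definition g :: real where "g = (A + 2 * pi * L) * \<delta>"

lemma n_pos: "real n > 0" using n_ge by simp

lemma delta_nonneg: "0 \<le> \<delta>"
proof -
  have "0 \<le> \<delta> * (real n)^2" using cut[of "{}"] by simp
  then show ?thesis using n_pos by (simp add: zero_le_mult_iff)
qed

lemma g_nonneg: "0 \<le> g" unfolding g_def using delta_nonneg A_ge L_ge by simp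

text \<open>The function \<open>G (y i)\<close> changes with \<open>i\<close>, but after
  approximation by steps the vertex sets do not: they collect the \<open>j\<close> with
  \<open>y j\<close> in a given arc. Hence for each arc the sum over \<open>i\<close> is a row-sum
  deviation on one fixed set, which \<open>cut\<close> controls.\<close>

lemma graph_error: "(\<Sum>i=1..n. \<bar>Fd i y - Fb i y\<bar>) \<le> real n * g"
proof -
  define m where "m i j = (if xi i j then 1 / p else 0) - 1" for i j
  define C where "C = 2 * pi * L * (\<Sum>i=1..n. \<Sum>j=1..n. \<bar>m i j\<bar>) / real n"
  have eq: "Fd i y - Fb i y = (1 / real n) * (\<Sum>j=1..n. m i j * G (y i) (y j))" for i
  proof -
    have "(\<Sum>j=1..n. m i j * G (y i) (y j))
        = (\<Sum>j=1..n. 1 / p * (if xi i j then G (y i) (y j) else 0) - G (y i) (y j))"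
      by (intro sum.cong refl) (auto simp: m_def algebra_simps)
    also have "\<dots> = 1 / p * (\<Sum>j=1..n. if xi i j then G (y i) (y j) else 0)
        - (\<Sum>j=1..n. G (y i) (y j))"
      by (simp add: sum_subtractf sum_distrib_left)
    finally show ?thesis by (simp add: Fd_def Fb_def right_diff_distrib)
  qed
  have bnd: "(\<Sum>i=1..n. \<bar>Fd i y - Fb i y\<bar>) \<le> real n * g + C / real K" if K: "K > 0" for K
  proof -
    have G1: "lip_per L (G z)" for z unfolding lip_per_def using G_per2 G_lip2 by auto
    have stU: "(\<Sum>j=1..n. m i j * stp K a (y j)) = (\<Sum>j\<in>{j\<in>{1..n}. stp K a (y j) = 1}. m i j)" for i a
      unfolding sum.inter_filter[OF finite_atLeastAtMost]
          by (intro sum.cong refl) (auto simp: stp_def)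
    have "\<bar>\<Sum>j=1..n. m i j * G (y i) (y j)\<bar> \<le> A * \<bar>\<Sum>j=1..n. m i j\<bar>
       + 2 * pi * L / real K * (\<Sum>a<K. \<bar>\<Sum>j\<in>{j\<in>{1..n}. stp K a (y j) = 1}. m i j\<bar>)
           + 2 * pi * L / real K * (\<Sum>j=1..n. \<bar>m i j\<bar>)" for i
      using step_weighted_bound[OF G1 G_bound K, of "m i" "y i" y "{1..n}"] unfolding stU .
    then have "(\<Sum>i=1..n. \<bar>\<Sum>j=1..n. m i j * G (y i) (y j)\<bar>) \<le> (\<Sum>i=1..n. A * \<bar>\<Sum>j=1..n. m i j\<bar>
       + 2 * pi * L / real K * (\<Sum>a<K. \<bar>\<Sum>j\<in>{j\<in>{1..n}. stp K a (y j) = 1}. m i j\<bar>)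
           + 2 * pi * L / real K * (\<Sum>j=1..n. \<bar>m i j\<bar>))"
      by (intro sum_mono)
    also have "\<dots> = A * (\<Sum>i=1..n. \<bar>\<Sum>j=1..n. m i j\<bar>)
       + 2 * pi * L / real K * (\<Sum>a<K. \<Sum>i=1..n. \<bar>\<Sum>j\<in>{j\<in>{1..n}. stp K a (y j) = 1}. m i j\<bar>)
       + 2 * pi * L / real K * (\<Sum>i=1..n. \<Sum>j=1..n. \<bar>m i j\<bar>)"
      unfolding sum.distrib sum_distrib_left[symmetric] by (subst sum.swap) simp
    also have "\<dots> \<le> A * (\<delta> * (real n)^2) + 2 * pi * L / real K * (\<Sum>a<K. \<delta> * (real n)^2)
       + 2 * pi * L / real K * (\<Sum>i=1..n. \<Sum>j=1..n. \<bar>m i j\<bar>)"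
      unfolding m_def using A_ge L_ge
      by (intro add_mono mult_left_mono sum_mono cut order_refl) auto
    also have "\<dots> = real n * (real n * g + C / real K)"
      using K n_pos by (simp add: g_def C_def power2_eq_square algebra_simps)
    finally have "(\<Sum>i=1..n. \<bar>\<Sum>j=1..n. m i j * G (y i) (y j)\<bar>) \<le> real n * (real n * g
        + C / real K)" .
    moreover have "(\<Sum>i=1..n. \<bar>Fd i y - Fb i y\<bar>)
        = (\<Sum>i=1..n. \<bar>\<Sum>j=1..n. m i j * G (y i) (y j)\<bar>) / real n"
      unfolding eq abs_mult sum_divide_distrib using n_pos by simp
    ultimately show ?thesis using n_pos by (simp add: divide_le_eq mult.commute)
  qed
  \<comment> \<open>The number of arcs tends to infinity with the configuration and \<open>n\<close>
    fixed, so the size of \<open>C\<close> is irrelevant.\<close>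
  have "(\<lambda>K. C / real (Suc K)) \<longlonglongrightarrow> 0"
    using LIMSEQ_Suc[OF lim_const_over_n[of C]] by simp
  then have lim: "(\<lambda>K. real n * g + C / real (Suc K)) \<longlonglongrightarrow> real n * g + 0" by (intro tendsto_intros)
  have "\<forall>K. (\<Sum>i=1..n. \<bar>Fd i y - Fb i y\<bar>) \<le> real n * g + C / real (Suc K)" using bnd by blast
  then have "(\<Sum>i=1..n. \<bar>Fd i y - Fb i y\<bar>) \<le> real n * g + 0" by (intro LIMSEQ_le_const[OF lim]) blast
  then show ?thesis by simp
qed

lemma Fb_bound: "\<bar>Fb i y\<bar> \<le> A"
proof -
  have "\<bar>\<Sum>j=1..n. G (y i) (y j)\<bar> \<le> (\<Sum>j=1..n. A)" by (intro order_trans[OF sum_abs] sum_mono G_bound)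
  then show ?thesis using n_pos by (simp add: Fb_def abs_mult divide_le_eq mult.commute)
qed

lemma Fb_lip: "(\<Sum>i=1..n. \<bar>Fb i y - Fb i z\<bar>) \<le> 2 * L * (\<Sum>i=1..n. \<bar>y i - z i\<bar>)"
proof -
  have G2: "\<bar>G a b - G a' b'\<bar> \<le> L * \<bar>a - a'\<bar> + L * \<bar>b - b'\<bar>" for a a' b b'
    using G_lip1[of a b a'] G_lip2[of a' b b'] by linarith
  have "\<bar>Fb i y - Fb i z\<bar> \<le> L * \<bar>y i - z i\<bar> + L / real n * (\<Sum>j=1..n. \<bar>y j - z j\<bar>)" for i
  proof -
    have "Fb i y - Fb i z = (1 / real n) * (\<Sum>j=1..n. G (y i) (y j) - G (z i) (z j))"
      by (simp add: Fb_def sum_subtractf right_diff_distrib diff_divide_distrib)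
    then have "\<bar>Fb i y - Fb i z\<bar> = (1 / real n) * \<bar>\<Sum>j=1..n. G (y i) (y j) - G (z i) (z j)\<bar>"
      using n_pos by (simp add: abs_mult)
    also have "\<dots> \<le> (1 / real n) * (\<Sum>j=1..n. L * \<bar>y i - z i\<bar> + L * \<bar>y j - z j\<bar>)"
      by (intro mult_left_mono order_trans[OF sum_abs] sum_mono G2) auto
    also have "\<dots> = L * \<bar>y i - z i\<bar> + L / real n * (\<Sum>j=1..n. \<bar>y j - z j\<bar>)"
      using n_pos by (simp add: sum.distrib sum_distrib_left[symmetric] distrib_left
          add_divide_distrib)
    finally show ?thesis .
  qed
  then have "(\<Sum>i=1..n. \<bar>Fb i y - Fb i z\<bar>) \<le> (\<Sum>i=1..n. L * \<bar>y i - z i\<bar>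
      + L / real n * (\<Sum>j=1..n. \<bar>y j - z j\<bar>))"
    by (intro sum_mono)
  also have "\<dots> = 2 * L * (\<Sum>i=1..n. \<bar>y i - z i\<bar>)"
    using n_pos by (simp add: sum.distrib sum_distrib_left[symmetric])
  finally show ?thesis .
qed

text \<open>The drift through the graph has no pointwise bound. It is split into the mean-field
  drift, bounded by \<open>A\<close>, and the graph error, which is small only on average and
  therefore costs the factor \<open>W\<close>.\<close>

lemma weighted_drift:
  assumes w: "\<And>i. i \<in> {1..n} \<Longrightarrow> 0 \<le> w i \<and> w i \<le> W / real n"
  shows "(\<Sum>i=1..n. w i * \<bar>Fd i y\<bar>) \<le> A * (\<Sum>i=1..n. w i) + W * g"
proof -
  have "1 \<in> {1..n}" using n_ge by simp
  from w[OF this] have "0 \<le> W / real n" by linarith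
  then have W: "0 \<le> W" using n_pos by (simp add: zero_le_divide_iff)
  have "(\<Sum>i=1..n. w i * \<bar>Fd i y\<bar>) \<le> (\<Sum>i=1..n. w i * A + W / real n * \<bar>Fd i y - Fb i y\<bar>)"
  proof (rule sum_mono)
    fix i assume i: "i \<in> {1..n}"
    have "w i * \<bar>Fd i y\<bar> \<le> w i * (A + \<bar>Fd i y - Fb i y\<bar>)"
      using w[OF i] Fb_bound[of i y] by (intro mult_left_mono) auto
    also have "\<dots> \<le> w i * A + W / real n * \<bar>Fd i y - Fb i y\<bar>"
      unfolding distrib_left using w[OF i] by (intro add_left_mono mult_right_mono) auto
    finally show "w i * \<bar>Fd i y\<bar> \<le> w i * A + W / real n * \<bar>Fd i y - Fb i y\<bar>" .
  qed
  also have "\<dots> = A * (\<Sum>i=1..n. w i) + W / real n * (\<Sum>i=1..n. \<bar>Fd i y - Fb i y\<bar>)"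
    by (simp add: sum.distrib sum_distrib_left mult.commute)
  also have "\<dots> \<le> A * (\<Sum>i=1..n. w i) + W / real n * (real n * g)"
    using W by (intro add_left_mono mult_left_mono graph_error) auto
  finally show ?thesis using n_pos by simp
qed

section \<open>Continuity and increments of the particle paths\<close>

lemma G_tendsto:
  assumes "(u \<longlongrightarrow> a0) F" "(v \<longlongrightarrow> b0) F"
  shows "((\<lambda>t. G (u t) (v t)) \<longlongrightarrow> G a0 b0) F"
proof -
  have "((\<lambda>t. G (u t) (v t) - G a0 b0) \<longlongrightarrow> 0) F"
  proof (rule Lim_null_comparison)
    show "\<forall>\<^sub>F t in F. norm (G (u t) (v t) - G a0 b0) \<le> L * \<bar>u t - a0\<bar> + L * \<bar>v t - b0\<bar>"
    proof (intro always_eventually allI)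
      fix t
      show "norm (G (u t) (v t) - G a0 b0) \<le> L * \<bar>u t - a0\<bar> + L * \<bar>v t - b0\<bar>"
        using G_lip1[of "u t" "v t" a0] G_lip2[of a0 "v t" b0] unfolding real_norm_def by linarith
    qed
    have "((\<lambda>t. L * \<bar>u t - a0\<bar> + L * \<bar>v t - b0\<bar>) \<longlongrightarrow> L * \<bar>a0 - a0\<bar> + L * \<bar>b0 - b0\<bar>) F"
      by (intro tendsto_intros assms)
    then show "((\<lambda>t. L * \<bar>u t - a0\<bar> + L * \<bar>v t - b0\<bar>) \<longlongrightarrow> 0) F" by simp
  qed
  then show ?thesis by (simp add: LIM_zero_iff)
qed

lemma Fd_cont:
  assumes "i \<in> {1..n}" "\<omega> \<in> space M"
  shows "continuous_on {0..T} (\<lambda>u. Fd i (\<lambda>j. \<theta> j \<omega> u))"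
proof -
  have "continuous_on {0..T} (\<lambda>u. if xi i j then G (\<theta> i \<omega> u) (\<theta> j \<omega> u) else 0)" if "j \<in> {1..n}"
      for j
  proof (cases "xi i j")
    case True
    then show ?thesis using path_cont[OF assms] path_cont[OF that assms(2)]
      unfolding continuous_on_def by (auto intro: G_tendsto)
  qed simp
  then show ?thesis unfolding Fd_def by (intro continuous_intros)
qed

lemma path_increment:
  assumes i: "i \<in> {1..n}" and \<omega>: "\<omega> \<in> space M" and st: "0 \<le> s" "s \<le> t" "t \<le> T"
  shows "\<theta> i \<omega> t - \<theta> i \<omega> s = integral {s..t} (\<lambda>u. Fd i (\<lambda>j. \<theta> j \<omega> u)) + (B i \<omega> t - B i \<omega> s)"
    and "(\<lambda>u. Fd i (\<lambda>j. \<theta> j \<omega> u)) integrable_on {s..t}"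
proof -
  have int: "(\<lambda>u. Fd i (\<lambda>j. \<theta> j \<omega> u)) integrable_on {a..b}" if "0 \<le> a" "b \<le> T" for a b
    by (rule integrable_continuous_real[OF continuous_on_subset[OF Fd_cont[OF i \<omega>]]]) (use that in
        auto)
  show "(\<lambda>u. Fd i (\<lambda>j. \<theta> j \<omega> u)) integrable_on {s..t}" using int st by auto
  have e: "\<theta> i \<omega> u = x i + integral {0..u} (\<lambda>u. Fd i (\<lambda>j. \<theta> j \<omega> u)) + B i \<omega> u" if "u \<in> {0..T}" for u
    using path_eq[OF i \<omega> that] by (simp add: Fd_def)
  have "integral {0..s} (\<lambda>u. Fd i (\<lambda>j. \<theta> j \<omega> u)) + integral {s..t} (\<lambda>u. Fd i (\<lambda>j. \<theta> j \<omega> u))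
      = integral {0..t} (\<lambda>u. Fd i (\<lambda>j. \<theta> j \<omega> u))"
    by (rule Henstock_Kurzweil_Integration.integral_combine) (use int st in auto)
  then show "\<theta> i \<omega> t - \<theta> i \<omega> s = integral {s..t} (\<lambda>u. Fd i (\<lambda>j. \<theta> j \<omega> u)) + (B i \<omega> t - B i \<omega> s)"
    using e[of s] e[of t] st by simp
qed

lemma sum_integral_bound:
  fixes F :: "nat \<Rightarrow> real \<Rightarrow> real"
  assumes "\<And>i. i \<in> {1..n} \<Longrightarrow> continuous_on {s..t} (F i)" "s \<le> t"
    "\<And>i. i \<in> {1..n} \<Longrightarrow> 0 \<le> w i" "\<And>u. u \<in> {s..t} \<Longrightarrow> (\<Sum>i=1..n. w i * \<bar>F i u\<bar>) \<le> c"
  shows "(\<Sum>i=1..n. w i * \<bar>integral {s..t} (F i)\<bar>) \<le> c * (t - s)"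
proof -
  have ci: "continuous_on {s..t} (\<lambda>u. w i * \<bar>F i u\<bar>)" if "i \<in> {1..n}" for i
    using assms(1)[OF that] by (intro continuous_intros)
  have "(\<Sum>i=1..n. w i * \<bar>integral {s..t} (F i)\<bar>) \<le> (\<Sum>i=1..n. integral {s..t} (\<lambda>u. w i * \<bar>F i u\<bar>))"
  proof (rule sum_mono)
    fix i assume i: "i \<in> {1..n}"
    have "norm (integral {s..t} (F i)) \<le> integral {s..t} (\<lambda>u. \<bar>F i u\<bar>)"
      using assms(1)[OF i] by (intro integral_norm_bound_integral integrable_continuous_real
          continuous_intros) auto
    then have "w i * \<bar>integral {s..t} (F i)\<bar> \<le> w i * integral {s..t} (\<lambda>u. \<bar>F i u\<bar>)"
      using assms(3)[OF i] by (intro mult_left_mono) auto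
    then show "w i * \<bar>integral {s..t} (F i)\<bar> \<le> integral {s..t} (\<lambda>u. w i * \<bar>F i u\<bar>)" by simp
  qed
  also have "\<dots> = integral {s..t} (\<lambda>u. \<Sum>i=1..n. w i * \<bar>F i u\<bar>)"
    by (rule integral_sum[symmetric]) (use ci in \<open>auto intro: integrable_continuous_real\<close>)
  also have "\<dots> \<le> integral {s..t} (\<lambda>u. c)"
    using assms(4) ci by (intro integral_le integrable_continuous_real continuous_on_sum) auto
  also have "\<dots> = c * (t - s)" using assms(2) by simp
  finally show ?thesis .
qed

definition good :: "'m \<Rightarrow> bool" where
  "good \<omega> \<longleftrightarrow> (\<forall>i\<ge>1. \<forall>J. 0 \<le> BM_osc T B J i \<omega> \<and>
     (\<forall>k<2^J. \<forall>s\<in>{real k * T / 2^J..real (Suc k) * T / 2^J}.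
        \<bar>B i \<omega> s - B i \<omega> (real k * T / 2^J)\<bar> \<le> BM_osc T B J i \<omega>))"

lemma AE_good: "AE \<omega> in M. good \<omega>"
  unfolding good_def by (rule BM_osc_AE[OF BM T_pos])

lemma grid_le_T: "k < 2^J' \<Longrightarrow> real (Suc k) * T / 2^J' \<le> T"
proof -
  assume "k < 2^J'"
  then have "real (Suc k) \<le> 2^J'" by (metis Suc_leI of_nat_le_iff of_nat_numeral of_nat_power)
  then have "real (Suc k) * T \<le> 2^J' * T" using T_pos by (intro mult_right_mono) auto
  then show ?thesis by (simp add: divide_le_eq mult.commute)
qed

text \<open>Weights and level are left free because the estimate serves twice: with uniform weights
  on the fine grid of the scheme, and with the given weights on the coarse grid.\<close>

lemma path_modulus:
  assumes \<omega>: "\<omega> \<in> space M" "good \<omega>" and w: "\<And>i. i \<in> {1..n} \<Longrightarrow> 0 \<le> w i \<and> w i \<le> W / real n"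
    and k: "k < 2^J'" and s: "s \<in> {real k * T / 2^J'..real (Suc k) * T / 2^J'}"
  shows "(\<Sum>i=1..n. w i * \<bar>\<theta> i \<omega> s - \<theta> i \<omega> (real k * T / 2^J')\<bar>)
     \<le> (A * (\<Sum>i=1..n. w i) + W * g) * (T / 2^J') + (\<Sum>i=1..n. w i * BM_osc T B J' i \<omega>)"
proof -
  define t where "t = real k * T / 2^J'"
  have t: "0 \<le> t" "t \<le> s" "s \<le> T" using s grid_le_T[OF k] T_pos by (auto simp: t_def)
  have "real (Suc k) * T / 2^J' = t + T / 2^J'"
      by (simp add: t_def add_divide_distrib distrib_right)
  then have sT: "s - t \<le> T / 2^J'" using s by auto
  have c0': "0 \<le> A * (\<Sum>i=1..n. w i) + W * g"
  proof -
    have "0 \<le> (\<Sum>i=1..n. w i * \<bar>Fd i (\<lambda>_. 0)\<bar>)" using w by (intro sum_nonneg) auto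
    then show ?thesis using weighted_drift[OF w, where y = "\<lambda>_. 0"] by (meson order_trans)
  qed
  have "(\<Sum>i=1..n. w i * \<bar>\<theta> i \<omega> s - \<theta> i \<omega> t\<bar>)
      \<le> (\<Sum>i=1..n. w i * \<bar>integral {t..s} (\<lambda>u. Fd i (\<lambda>j. \<theta> j \<omega> u))\<bar> + w i * BM_osc T B J' i \<omega>)"
  proof (rule sum_mono)
    fix i assume i: "i \<in> {1..n}"
    have "\<bar>B i \<omega> s - B i \<omega> t\<bar> \<le> BM_osc T B J' i \<omega>"
      using \<omega>(2) i k s unfolding good_def t_def by auto
    then have "\<bar>\<theta> i \<omega> s - \<theta> i \<omega> t\<bar> \<le> \<bar>integral {t..s} (\<lambda>u. Fd i (\<lambda>j. \<theta> j \<omega> u))\<bar> + BM_osc T B J' i \<omega>"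
      unfolding path_increment(1)[OF i \<omega>(1) t] by linarith
    then have "w i * \<bar>\<theta> i \<omega> s - \<theta> i \<omega> t\<bar> \<le> w i * (\<bar>integral {t..s} (\<lambda>u. Fd i (\<lambda>j. \<theta> j \<omega> u))\<bar>
        + BM_osc T B J' i \<omega>)"
      using w[OF i] by (intro mult_left_mono) auto
    then show "w i * \<bar>\<theta> i \<omega> s - \<theta> i \<omega> t\<bar> \<le> w i * \<bar>integral {t..s} (\<lambda>u. Fd i (\<lambda>j. \<theta> j \<omega> u))\<bar>
        + w i * BM_osc T B J' i \<omega>"
      by (simp add: distrib_left)
  qed
  also have "\<dots> = (\<Sum>i=1..n. w i * \<bar>integral {t..s} (\<lambda>u. Fd i (\<lambda>j. \<theta> j \<omega> u))\<bar>)
      + (\<Sum>i=1..n. w i * BM_osc T B J' i \<omega>)"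
    by (rule sum.distrib)
  finally have 1: "(\<Sum>i=1..n. w i * \<bar>\<theta> i \<omega> s - \<theta> i \<omega> t\<bar>)
      \<le> (\<Sum>i=1..n. w i * \<bar>integral {t..s} (\<lambda>u. Fd i (\<lambda>j. \<theta> j \<omega> u))\<bar>)
          + (\<Sum>i=1..n. w i * BM_osc T B J' i \<omega>)" .
  have "(\<Sum>i=1..n. w i * \<bar>integral {t..s} (\<lambda>u. Fd i (\<lambda>j. \<theta> j \<omega> u))\<bar>) \<le> (A * (\<Sum>i=1..n. w i)
      + W * g) * (s - t)"
  proof (rule sum_integral_bound)
    show "continuous_on {t..s} (\<lambda>u. Fd i (\<lambda>j. \<theta> j \<omega> u))" if "i \<in> {1..n}" for i
      by (rule continuous_on_subset[OF Fd_cont[OF that \<omega>(1)]]) (use t in auto)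
    show "0 \<le> w i" if "i \<in> {1..n}" for i using w[OF that] by simp
    show "(\<Sum>i=1..n. w i * \<bar>Fd i (\<lambda>j. \<theta> j \<omega> u)\<bar>) \<le> A * (\<Sum>i=1..n. w i) + W * g" for u
      by (rule weighted_drift[OF w])
  qed (rule t)
  also have "\<dots> \<le> (A * (\<Sum>i=1..n. w i) + W * g) * (T / 2^J')"
    by (rule mult_left_mono[OF sT c0'])
  finally show ?thesis using 1 unfolding t_def by linarith
qed

section \<open>Gronwall comparison of the particles with the scheme\<close>

definition vb :: "'m \<Rightarrow> real" where "vb \<omega> = (1 / real n) * (\<Sum>i=1..n. BM_osc T B J i \<omega>)"

text \<open>The local error per unit time: graph error, motion of the particles within a step, and
  fluctuation of the scheme around its averaged law.\<close>

definition err :: "nat \<Rightarrow> nat \<Rightarrow> 'm \<Rightarrow> real" where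
  "err K k \<omega> = g + 2 * L * (h * (A + g) + vb \<omega>) + (L * Fl (\<lambda>_. 1 / real n) K k \<omega>
      + 4 * pi * L / real K)"

definition dist_avg :: "nat \<Rightarrow> 'm \<Rightarrow> real" where
  "dist_avg k \<omega> = (1 / real n) * (\<Sum>i=1..n. \<bar>\<theta> i \<omega> (tp k) - Y k i \<omega>\<bar>)"

text \<open>Particle and scheme use the same Brownian increments, which cancel. The drift difference
  passes through the mean-field drift at the particles and then at the scheme; the three gaps are
  the graph error, a Lipschitz term, and the fluctuation.\<close>

lemma dist_avg_step:
  assumes \<omega>: "\<omega> \<in> space M" "good \<omega>" and K: "K > 0" and k: "k < 2^J"
  shows "dist_avg (Suc k) \<omega> \<le> (1 + 2 * L * h) * dist_avg k \<omega> + h * err K k \<omega>"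
proof -
  define D where "D i u = Fd i (\<lambda>j. \<theta> j \<omega> u) - bet k (Y k i \<omega>)" for i u
  define a where "a = tp k"
  define b' where "b' = tp (Suc k)"
  have ab: "0 \<le> a" "a \<le> b'" "b' \<le> T" "b' - a = h"
    using grid_le_T[OF k] tp_diff[of k] h_pos T_pos by (auto simp: a_def b'_def tp_def)
  have wn: "0 \<le> 1 / real n \<and> 1 / real n \<le> 1 / real n" using n_pos by simp
  have s1: "(\<Sum>i=1..n. 1 / real n) = 1" using n_pos by simp
  have step: "\<theta> i \<omega> b' - Y (Suc k) i \<omega> = (\<theta> i \<omega> a - Y k i \<omega>) + integral {a..b'} (D i)" if i: "i
      \<in> {1..n}" for i
  proof -
    have "integral {a..b'} (D i) = integral {a..b'} (\<lambda>u. Fd i (\<lambda>j. \<theta> j \<omega> u))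
        - integral {a..b'} (\<lambda>u. bet k (Y k i \<omega>))"
      unfolding D_def using path_increment(2)[OF i \<omega>(1) ab(1-3)]
      by (intro Henstock_Kurzweil_Integration.integral_diff) auto
    also have "integral {a..b'} (\<lambda>u. bet k (Y k i \<omega>)) = h * bet k (Y k i \<omega>)" using ab by simp
    finally show ?thesis using path_increment(1)[OF i \<omega>(1) ab(1-3)]
      by (simp add: Y_Suc dB_def a_def b'_def)
  qed
  have Dc: "(\<Sum>i=1..n. 1 / real n * \<bar>D i u\<bar>) \<le> 2 * L * dist_avg k \<omega> + err K k \<omega>" if u: "u
      \<in> {a..b'}" for u
  proof -
    have u': "u \<in> {real k * T / 2^J..real (Suc k) * T / 2^J}" using u
        by (simp add: a_def b'_def tp_def)
    have m: "(\<Sum>i=1..n. 1 / real n * \<bar>\<theta> i \<omega> u - \<theta> i \<omega> a\<bar>) \<le> h * (A + g) + vb \<omega>"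
      using path_modulus[OF \<omega> wn k u'] unfolding s1
      by (simp add: a_def tp_def h_def vb_def sum_divide_distrib mult.commute)
    define q where "q = L * Fl (\<lambda>_. 1 / real n) K k \<omega> + 4 * pi * L / real K"
    have f3: "\<bar>Fb i (\<lambda>j. Y k j \<omega>) - bet k (Y k i \<omega>)\<bar> \<le> q" for i
    proof -
      have G1: "lip_per L (G z)" for z unfolding lip_per_def using G_per2 G_lip2 by auto
      have "Fb i (\<lambda>j. Y k j \<omega>) - bet k (Y k i \<omega>)
         = (\<Sum>j=1..n. 1 / real n * (G (Y k i \<omega>) (Y k j \<omega>) - (\<integral>\<omega>'. G (Y k i \<omega>) (Y k j \<omega>') \<partial>M)))"
        by (simp add: Fb_def bet_def rho_def sum_distrib_left sum_subtractf right_diff_distrib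
            sum_divide_distrib diff_divide_distrib)
      then show ?thesis
        using fluctuation_bound[OF G1[of "Y k i \<omega>"] G_bound K, where w = "\<lambda>_. 1 / real n" and k
            = k and \<omega> = \<omega>] s1
        unfolding q_def by simp
    qed
    have "(\<Sum>i=1..n. \<bar>D i u\<bar>) \<le> (\<Sum>i=1..n. \<bar>Fd i (\<lambda>j. \<theta> j \<omega> u) - Fb i (\<lambda>j. \<theta> j \<omega> u)\<bar>
        + \<bar>Fb i (\<lambda>j. \<theta> j \<omega> u) - Fb i (\<lambda>j. Y k j \<omega>)\<bar> + q)"
    proof (rule sum_mono)
      fix i
      show "\<bar>D i u\<bar> \<le> \<bar>Fd i (\<lambda>j. \<theta> j \<omega> u) - Fb i (\<lambda>j. \<theta> j \<omega> u)\<bar>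
        + \<bar>Fb i (\<lambda>j. \<theta> j \<omega> u) - Fb i (\<lambda>j. Y k j \<omega>)\<bar> + q"
        unfolding D_def using f3[of i] by linarith
    qed
    also have "\<dots> \<le> real n * g + 2 * L * (\<Sum>i=1..n. \<bar>\<theta> i \<omega> u - Y k i \<omega>\<bar>)
        + real n * q"
      unfolding sum.distrib
      using graph_error[of "\<lambda>j. \<theta> j \<omega> u"] Fb_lip[of "\<lambda>j. \<theta> j \<omega> u" "\<lambda>j. Y k j \<omega>"]
      by (intro add_mono) auto
    finally have 1: "(\<Sum>i=1..n. \<bar>D i u\<bar>) \<le> real n * g + 2 * L * (\<Sum>i=1..n. \<bar>\<theta> i \<omega> u - Y k i \<omega>\<bar>)
        + real n * q" .
    have "(\<Sum>i=1..n. \<bar>\<theta> i \<omega> u - Y k i \<omega>\<bar>) \<le> (\<Sum>i=1..n. \<bar>\<theta> i \<omega> u - \<theta> i \<omega> a\<bar>) + (\<Sum>i=1..n. \<bar>\<theta> i \<omega> a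
        - Y k i \<omega>\<bar>)"
      unfolding sum.distrib[symmetric] by (intro sum_mono) linarith
    then have "2 * L * (\<Sum>i=1..n. \<bar>\<theta> i \<omega> u - Y k i \<omega>\<bar>) \<le> 2 * L * ((\<Sum>i=1..n. \<bar>\<theta> i \<omega> u - \<theta> i \<omega> a\<bar>)
        + (\<Sum>i=1..n. \<bar>\<theta> i \<omega> a - Y k i \<omega>\<bar>))"
      using L_ge by (intro mult_left_mono) auto
    with 1 have "(\<Sum>i=1..n. \<bar>D i u\<bar>) \<le> real n * g + 2 * L * ((\<Sum>i=1..n. \<bar>\<theta> i \<omega> u - \<theta> i \<omega> a\<bar>)
        + (\<Sum>i=1..n. \<bar>\<theta> i \<omega> a - Y k i \<omega>\<bar>))
        + real n * q" by linarith
    then have "1 / real n * (\<Sum>i=1..n. \<bar>D i u\<bar>) \<le> 1 / real n * (real n * g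
        + 2 * L * ((\<Sum>i=1..n. \<bar>\<theta> i \<omega> u - \<theta> i \<omega> a\<bar>) + (\<Sum>i=1..n. \<bar>\<theta> i \<omega> a - Y k i \<omega>\<bar>))
        + real n * q)"
      using n_pos by (intro mult_left_mono) auto
    also have "\<dots> = g + 2 * L * ((\<Sum>i=1..n. 1 / real n * \<bar>\<theta> i \<omega> u - \<theta> i \<omega> a\<bar>) + dist_avg k \<omega>)
        + q"
      using n_pos unfolding sum_distrib_left[symmetric] dist_avg_def a_def[symmetric]
          by (simp add: field_simps)
    also have "\<dots> \<le> g + 2 * L * ((h * (A + g) + vb \<omega>) + dist_avg k \<omega>)
        + q"
      using m L_ge by (intro add_mono mult_left_mono order_refl) auto
    also have "\<dots> = 2 * L * dist_avg k \<omega> + err K k \<omega>" unfolding err_def q_def[symmetric]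
        by (simp add: algebra_simps)
    finally show ?thesis by (simp add: sum_distrib_left)
  qed
  have "dist_avg (Suc k) \<omega> = (\<Sum>i=1..n. 1 / real n * \<bar>(\<theta> i \<omega> a - Y k i \<omega>) + integral {a..b'} (D i)\<bar>)"
    unfolding dist_avg_def b'_def[symmetric] sum_distrib_left using step by (intro sum.cong) auto
  also have "\<dots> \<le> (\<Sum>i=1..n. 1 / real n * \<bar>\<theta> i \<omega> a - Y k i \<omega>\<bar>
      + 1 / real n * \<bar>integral {a..b'} (D i)\<bar>)"
    unfolding distrib_left[symmetric] by (intro sum_mono mult_left_mono abs_triangle_ineq) auto
  also have "\<dots> = dist_avg k \<omega> + (\<Sum>i=1..n. 1 / real n * \<bar>integral {a..b'} (D i)\<bar>)"
    by (simp add: sum.distrib dist_avg_def a_def sum_distrib_left)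
  finally have 1: "dist_avg (Suc k) \<omega> \<le> dist_avg k \<omega>
      + (\<Sum>i=1..n. 1 / real n * \<bar>integral {a..b'} (D i)\<bar>)" .
  have "(\<Sum>i=1..n. 1 / real n * \<bar>integral {a..b'} (D i)\<bar>) \<le> (2 * L * dist_avg k \<omega>
      + err K k \<omega>) * (b' - a)"
  proof (rule sum_integral_bound)
    show "continuous_on {a..b'} (D i)" if "i \<in> {1..n}" for i
      unfolding D_def
      by (intro continuous_on_diff continuous_on_const continuous_on_subset[OF Fd_cont[OF that
          \<omega>(1)]]) (use ab in auto)
    show "(\<Sum>i=1..n. 1 / real n * \<bar>D i u\<bar>) \<le> 2 * L * dist_avg k \<omega> + err K k \<omega>" if "u \<in> {a..b'}"
        for u by (rule Dc[OF that])
  qed (use ab n_pos in auto)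
  then show ?thesis using 1 unfolding ab(4) by (simp add: algebra_simps)
qed

text \<open>The sum runs over all steps of the fine grid, so that one integrable variable dominates
  the distance at every grid time.\<close>

definition estar :: "nat \<Rightarrow> 'm \<Rightarrow> real" where
  "estar K \<omega> = exp (2 * L * T) * (\<Sum>l<2^J. h * err K l \<omega>)"

lemma err_nonneg:
  assumes "good \<omega>" "K > 0" shows "0 \<le> err K k \<omega>"
proof -
  have "0 \<le> vb \<omega>" using assms(1) unfolding vb_def good_def
      by (intro mult_nonneg_nonneg sum_nonneg) auto
  then show ?thesis unfolding err_def using g_nonneg L_ge A_ge h_pos Fl_nonneg[of "\<lambda>_. 1 / real n"
      K k \<omega>]
    by (intro add_nonneg_nonneg mult_nonneg_nonneg) auto
qed

lemma dist_avg_bound: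
  assumes \<omega>: "\<omega> \<in> space M" "good \<omega>" and K: "K > 0" and k: "k \<le> 2^J"
  shows "dist_avg k \<omega> \<le> estar K \<omega>"
proof -
  have "0 \<in> {0..T}" using T_pos by simp
  then have t0: "\<theta> i \<omega> 0 = x i" if "i \<in> {1..n}" for i
    using path_eq[OF that \<omega>(1), of 0] BM that \<omega>(1) by (simp add: BM_family_def)
  have d0: "dist_avg 0 \<omega> \<le> 0" unfolding dist_avg_def using t0 by (simp add: tp_def)
  have "dist_avg k \<omega> \<le> exp ((2 * L * h) * real k) * (\<Sum>l<k. h * err K l \<omega>)"
    by (rule discrete_gronwall[where e = "\<lambda>k. dist_avg k \<omega>" and m = "2^J" and c = "2 * L * h"])
       (use d0 dist_avg_step[OF \<omega> K] L_ge h_pos err_nonneg[OF \<omega>(2) K] k in auto)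
  also have "\<dots> \<le> exp (2 * L * T) * (\<Sum>l<2^J. h * err K l \<omega>)"
  proof (intro mult_mono sum_mono2)
    have "real k \<le> 2^J" using k by (metis of_nat_le_iff of_nat_numeral of_nat_power)
    then have "h * real k \<le> h * 2^J" using h_pos by (intro mult_left_mono) auto
    also have "\<dots> = T" by (simp add: h_def)
    finally show "exp (2 * L * h * real k) \<le> exp (2 * L * T)"
      using L_ge by (simp add: mult.assoc)
    show "0 \<le> (\<Sum>l<k. h * err K l \<omega>)" using h_pos err_nonneg[OF \<omega>(2) K] by (intro sum_nonneg) auto
  qed (use k h_pos err_nonneg[OF \<omega>(2) K] in auto)
  finally show ?thesis by (simp add: estar_def)
qed

definition mean_err :: "nat \<Rightarrow> real" where
  "mean_err K = exp (2 * L * T) * (T * (g + 2 * L * (h * (A + g) + BM_osc_mean T J)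
      + (L * (2 * pi * (1 / sqrt (real n))) + 4 * pi * L / real K)))"

lemma vb_mean: "integrable M vb" "expectation vb = BM_osc_mean T J"
proof -
  have i: "integrable M (BM_osc T B J i)" "expectation (BM_osc T B J i) = BM_osc_mean T J" if "i
      \<in> {1..n}" for i
    using BM_osc_integral[OF BM _ T_pos, of i J] that by auto
  show "integrable M vb" unfolding vb_def[abs_def] using i
      by (intro integrable_mult_right Bochner_Integration.integrable_sum)
  show "expectation vb = BM_osc_mean T J" unfolding vb_def[abs_def] using i n_pos by simp
qed

lemma err_mean:
  assumes K: "K > 0"
  shows "integrable M (err K l)"
    "expectation (err K l) \<le> g + 2 * L * (h * (A + g) + BM_osc_mean T J)
      + (L * (2 * pi * (1 / sqrt (real n))) + 4 * pi * L / real K)"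
proof -
  show "integrable M (err K l)" unfolding err_def[abs_def]
    using vb_mean(1) Fl_integrable[of "\<lambda>_. 1 / real n" K l] by simp
  have "expectation (err K l) = g + 2 * L * (h * (A + g) + expectation vb)
      + (L * expectation (Fl (\<lambda>_. 1 / real n) K l) + 4 * pi * L / real K)"
    unfolding err_def[abs_def] using vb_mean(1) Fl_integrable[of "\<lambda>_. 1 / real n" K l] prob_space
        by simp
  moreover have "L * expectation (Fl (\<lambda>_. 1 / real n) K l) \<le> L * (2 * pi * (1 / sqrt (real n)))"
  proof (intro mult_left_mono Fl_mean[OF K])
    show "(\<Sum>i = 1..n. (1 / real n)\<^sup>2) \<le> (1 / sqrt (real n))\<^sup>2"
      using n_pos by (simp add: power_divide) (simp add: power2_eq_square)
  qed (use n_pos L_ge in auto)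
  ultimately show "expectation (err K l) \<le> g + 2 * L * (h * (A + g) + BM_osc_mean T J)
      + (L * (2 * pi * (1 / sqrt (real n))) + 4 * pi * L / real K)"
    using vb_mean(2) by simp
qed

lemma estar_mean:
  assumes K: "K > 0"
  shows "integrable M (estar K)" "expectation (estar K) \<le> mean_err K"
proof -
  define m where "m = g + 2 * L * (h * (A + g) + BM_osc_mean T J)
      + (L * (2 * pi * (1 / sqrt (real n))) + 4 * pi * L / real K)"
  show "integrable M (estar K)" unfolding estar_def[abs_def]
    using err_mean(1)[OF K] by (intro integrable_mult_right Bochner_Integration.integrable_sum)
  have "(\<Sum>l<(2::nat)^J. h * expectation (err K l)) \<le> (\<Sum>l<(2::nat)^J. h * m)"
    using err_mean(2)[OF K] h_pos unfolding m_def by (intro sum_mono mult_left_mono) auto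
  also have "\<dots> = T * m" by (simp add: h_def)
  finally have "exp (2 * L * T) * (\<Sum>l<(2::nat)^J. h * expectation (err K l))
      \<le> exp (2 * L * T) * (T * m)"
    by (intro mult_left_mono) auto
  moreover have "expectation (estar K) = exp (2 * L * T) * (\<Sum>l<(2::nat)^J. h * expectation (err K
      l))"
    unfolding estar_def[abs_def] using err_mean(1)[OF K]
        by (simp add: Bochner_Integration.integral_sum)
  ultimately show "expectation (estar K) \<le> mean_err K" by (simp add: mean_err_def m_def)
qed

text \<open>The terms follow the chain of comparisons: motion since the last coarse grid point,
  distance to the scheme, fluctuation of the scheme, transported initial discrepancy, error of the
  scheme's law, and motion of the limit. The factor 2 beside \<open>A\<close> bounds the total mass
  of the weights.\<close>

definition Xi :: "(nat \<Rightarrow> real) \<Rightarrow> real \<Rightarrow> nat \<Rightarrow> nat \<Rightarrow> real \<Rightarrow> real \<Rightarrow> 'm \<Rightarrow> real" where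
  "Xi w W K J0 \<Delta> D \<omega> = (A * 2 + W * g) * (T / 2^J0) + (\<Sum>i=1..n. w i * BM_osc T B J0 i \<omega>)
      + W * estar K \<omega>
     + (\<Sum>k<2^J0. Fl w K (k * 2^(J - J0)) \<omega>) + 8 * pi / real K + exp (L * T) * \<Delta> + D
         + c0 * sqrt (T / 2^J0)"

section \<open>The error of a weighted empirical measure at all times\<close>

lemma exists_grid_point:
  assumes "s \<in> {0..T}"
  shows "\<exists>k<2^J0. s \<in> {real k * T / 2^J0..real (Suc k) * T / 2^J0}"
proof (cases "s = T")
  case True
  have "real (Suc (2^J0 - 1)) = 2^J0" by (simp add: of_nat_diff)
  then show ?thesis using True T_pos
    by (intro exI[of _ "2^J0 - 1"]) (auto simp: of_nat_diff divide_le_eq mult.commute)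
next
  case False
  define y where "y = s * 2^J0 / T"
  define k where "k = nat \<lfloor>y\<rfloor>"
  have s: "0 \<le> s" "s < T" using False assms by auto
  have y0: "0 \<le> y" using s by (simp add: y_def)
  have y1: "y < 2^J0" using s T_pos by (simp add: y_def divide_less_eq)
  have k: "real k \<le> y" "y < real k + 1" using y0 by (auto simp: k_def)
  have "real k < 2^J0" using k y1 by linarith
  then have "k < 2^J0" by (metis of_nat_less_iff of_nat_numeral of_nat_power)
  moreover have "real k * T / 2^J0 \<le> s" using k(1) T_pos by (simp add: y_def field_simps)
  moreover have "s \<le> real (Suc k) * T / 2^J0" using k(2) T_pos by (simp add: y_def field_simps)
  ultimately show ?thesis by auto
qed

text \<open>The route leads from time \<open>s\<close> to the preceding coarse grid point, then from
  the particles to the scheme, to the expectations of the scheme, to their uniform average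
  \<open>rho\<close>, to the limit, and back to \<open>s\<close>. The bound is free of
  \<open>f\<close> and \<open>s\<close>, so it survives both suprema.\<close>

lemma pathwise_bound:
  assumes \<omega>: "\<omega> \<in> space M" "good \<omega>" and w: "\<And>i. i \<in> {1..n} \<Longrightarrow> 0 \<le> w i \<and> w i \<le> W / real n"
    and sw: "(\<Sum>i=1..n. w i) \<le> 2" and J0: "J0 \<le> J" and K: "K > 0"
    and \<Delta>: "\<And>f. f \<in> BL_test \<Longrightarrow> \<bar>\<Sum>i=1..n. (w i - 1 / real n) * f (x i)\<bar> \<le> \<Delta>"
    and D: "\<And>k f. k \<le> 2^J \<Longrightarrow> f \<in> BL_test \<Longrightarrow> \<bar>rho k f - muI (real k * h) f\<bar> \<le> D"
    and f: "f \<in> BL_test" and s: "s \<in> {0..T}"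
  shows "\<bar>(\<Sum>i=1..n. w i * f (\<theta> i \<omega> s)) - muI s f\<bar> \<le> Xi w W K J0 \<Delta> D \<omega>"
proof -
  obtain k where k: "k < 2^J0" "s \<in> {real k * T / 2^J0..real (Suc k) * T / 2^J0}"
    using exists_grid_point[OF s] by blast
  define t where "t = real k * T / 2^J0"
  \<comment> \<open>Coarse grid points are fine grid points whose index is a multiple of
    \<open>2^(J - J0)\<close>.\<close>
  define k' where "k' = k * 2^(J - J0)"
  have pJ: "(2::real)^J = 2^J0 * 2^(J - J0)" using J0 by (simp add: power_add[symmetric])
  have tk: "tp k' = t" unfolding tp_def k'_def t_def pJ by simp
  have k'J: "k' \<le> 2^J"
  proof -
    have "k * 2^(J - J0) \<le> 2^J0 * 2^(J - J0)" using k(1) by (intro mult_right_mono) auto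
    then show ?thesis using J0 by (simp add: k'_def power_add[symmetric])
  qed
  have tT: "t \<in> {0..T}" using k(2) s T_pos by (auto simp: t_def)
  have "real (Suc k) * T / 2^J0 = t + T / 2^J0"
      by (simp add: t_def add_divide_distrib distrib_right)
  then have st: "0 \<le> s - t" "s - t \<le> T / 2^J0" using k(2) by (auto simp: t_def)
  have "1 \<in> {1..n}" using n_ge by simp
  from w[OF this] have "0 \<le> W / real n" by linarith
  then have W: "0 \<le> W" using n_pos by (simp add: zero_le_divide_iff)
  have sw0: "0 \<le> (\<Sum>i=1..n. w i)" using w by (intro sum_nonneg) auto
  have fl: "\<bar>f u - f v\<bar> \<le> \<bar>u - v\<bar>" for u v using f by (simp add: BL_test_def)
  have lipw: "\<bar>(\<Sum>i=1..n. w i * f (u i)) - (\<Sum>i=1..n. w i * f (v i))\<bar> \<le> (\<Sum>i=1..n. w i * \<bar>u i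
      - v i\<bar>)" for u v
  proof -
    have "\<bar>\<Sum>i=1..n. w i * f (u i) - w i * f (v i)\<bar> \<le> (\<Sum>i=1..n. w i * \<bar>u i - v i\<bar>)"
    proof (intro order_trans[OF sum_abs] sum_mono)
      fix i assume "i \<in> {1..n}"
      then show "\<bar>w i * f (u i) - w i * f (v i)\<bar> \<le> w i * \<bar>u i - v i\<bar>"
        using w fl[of "u i" "v i"] by (simp add: right_diff_distrib[symmetric] abs_mult
            mult_left_mono)
    qed
    then show ?thesis by (simp add: sum_subtractf)
  qed
  have a1: "\<bar>(\<Sum>i=1..n. w i * f (\<theta> i \<omega> s)) - (\<Sum>i=1..n. w i * f (\<theta> i \<omega> t))\<bar>
     \<le> (A * 2 + W * g) * (T / 2^J0) + (\<Sum>i=1..n. w i * BM_osc T B J0 i \<omega>)"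
  proof -
    have "\<bar>(\<Sum>i=1..n. w i * f (\<theta> i \<omega> s)) - (\<Sum>i=1..n. w i * f (\<theta> i \<omega> t))\<bar> \<le> (\<Sum>i=1..n. w i * \<bar>\<theta> i \<omega> s
        - \<theta> i \<omega> t\<bar>)"
      by (rule lipw)
    also have "\<dots> \<le> (A * (\<Sum>i=1..n. w i) + W * g) * (T / 2^J0) + (\<Sum>i=1..n. w i * BM_osc T B J0 i \<omega>)"
      using path_modulus[OF \<omega> w k] unfolding t_def .
    also have "\<dots> \<le> (A * 2 + W * g) * (T / 2^J0) + (\<Sum>i=1..n. w i * BM_osc T B J0 i \<omega>)"
      using sw A_ge T_pos by (intro add_right_mono mult_right_mono mult_left_mono) auto
    finally show ?thesis .
  qed
  have a2: "\<bar>(\<Sum>i=1..n. w i * f (\<theta> i \<omega> t)) - (\<Sum>i=1..n. w i * f (Y k' i \<omega>))\<bar> \<le> W * estar K \<omega>"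
  proof -
    have "\<bar>(\<Sum>i=1..n. w i * f (\<theta> i \<omega> t)) - (\<Sum>i=1..n. w i * f (Y k' i \<omega>))\<bar>
        \<le> (\<Sum>i=1..n. w i * \<bar>\<theta> i \<omega> t - Y k' i \<omega>\<bar>)"
      by (rule lipw)
    also have "\<dots> \<le> (\<Sum>i=1..n. W / real n * \<bar>\<theta> i \<omega> t - Y k' i \<omega>\<bar>)" using w
        by (intro sum_mono mult_right_mono) auto
    also have "\<dots> = W * dist_avg k' \<omega>" by (simp add: dist_avg_def tk sum_distrib_left)
    also have "\<dots> \<le> W * estar K \<omega>" using W by (intro mult_left_mono dist_avg_bound[OF \<omega> K k'J])
    finally show ?thesis .
  qed
  have fb: "\<bar>f z\<bar> \<le> 1" for z using f by (simp add: BL_test_def)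
  have a3: "\<bar>(\<Sum>i=1..n. w i * f (Y k' i \<omega>)) - (\<Sum>i=1..n. w i * Q k' f (x i))\<bar>
      \<le> (\<Sum>k<2^J0. Fl w K (k * 2^(J - J0)) \<omega>) + 8 * pi / real K"
  proof -
    have "(\<Sum>i=1..n. w i * f (Y k' i \<omega>)) - (\<Sum>i=1..n. w i * Q k' f (x i))
       = (\<Sum>i=1..n. w i * (f (Y k' i \<omega>) - (\<integral>\<omega>'. f (Y k' i \<omega>') \<partial>M)))"
      unfolding sum_subtractf[symmetric] using Y_law[OF _ BL_blip[OF f], of _ k']
          by (intro sum.cong) (auto simp: right_diff_distrib)
    then have "\<bar>(\<Sum>i=1..n. w i * f (Y k' i \<omega>)) - (\<Sum>i=1..n. w i * Q k' f (x i))\<bar> \<le> 1 * Fl w K k' \<omega>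
        + 4 * pi * 1 / real K * (\<Sum>i=1..n. \<bar>w i\<bar>)"
      using fluctuation_bound[of 1 f 1 K w k' \<omega>] f fb K by (simp add: BL_test_iff)
    moreover have "(\<Sum>i=1..n. \<bar>w i\<bar>) = (\<Sum>i=1..n. w i)" using w by (intro sum.cong) auto
    moreover have "4 * pi / real K * (\<Sum>i=1..n. w i) \<le> 4 * pi / real K * 2" using sw
        by (intro mult_left_mono) auto
    moreover have "Fl w K k' \<omega> \<le> (\<Sum>k<2^J0. Fl w K (k * 2^(J - J0)) \<omega>)"
      unfolding k'_def by (rule member_le_sum[where f = "\<lambda>k. Fl w K (k * 2^(J
          - J0)) \<omega>"]) (use k(1) Fl_nonneg in auto)
    ultimately show ?thesis by simp
  qed
  have a4: "\<bar>(\<Sum>i=1..n. w i * Q k' f (x i)) - rho k' f\<bar> \<le> exp (L * T) * \<Delta>"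
  proof -
    define E where "E = exp (L * T)"
    have E: "E \<ge> 1" using L_ge T_pos by (simp add: E_def)
    have Qb: "blip 1 ((1 + h * L)^k' * 1) (Q k' f)" by (rule Q_blip[OF BL_blip[OF f]])
    \<comment> \<open>After division by exp(L T), which dominates both its sup bound 1 and its
      Lipschitz constant, the propagated test function becomes a test function for the initial
      discrepancy.\<close>
    have "(\<lambda>z. Q k' f z / E) \<in> BL_test"
    proof (rule lip_per_scale_BL_test[where L = "(1 + h * L)^k' * 1" and A = 1])
      show "lip_per ((1 + h * L)^k' * 1) (Q k' f)" unfolding lip_per_def
        using blipD(2)[OF Qb] Q_periodic[of f k'] f by (auto simp: BL_test_def)
      show "(1 + h * L)^k' * 1 \<le> E" using Q_lip_exp[OF k'J] by (simp add: E_def)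
    qed (use E blipD(1)[OF Qb] in auto)
    from \<Delta>[OF this] have "\<bar>\<Sum>i=1..n. (w i - 1 / real n) * (Q k' f (x i) / E)\<bar> \<le> \<Delta>" .
    then have "\<bar>(\<Sum>i=1..n. (w i - 1 / real n) * Q k' f (x i)) / E\<bar> \<le> \<Delta>"
      unfolding sum_divide_distrib by simp
    then have "\<bar>\<Sum>i=1..n. (w i - 1 / real n) * Q k' f (x i)\<bar> \<le> E * \<Delta>"
      using E by (simp add: abs_divide divide_le_eq mult.commute)
    moreover have "rho k' f = (\<Sum>i=1..n. 1 / real n * Q k' f (x i))"
      unfolding rho_def sum_distrib_left using Y_law[OF _ BL_blip[OF f], of _ k']
          by (intro sum.cong) auto
    then have "(\<Sum>i=1..n. w i * Q k' f (x i)) - rho k' f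
        = (\<Sum>i=1..n. (w i - 1 / real n) * Q k' f (x i))"
      by (simp add: left_diff_distrib sum_subtractf)
    ultimately show ?thesis by (simp add: E_def)
  qed
  have a5: "\<bar>rho k' f - muI t f\<bar> \<le> D" using D[OF k'J f] tk by (simp add: tp_h)
  have a6: "\<bar>muI s f - muI t f\<bar> \<le> c0 * sqrt (T / 2^J0)"
    using muI_holder[OF f tT s] st c0_pos
    by (intro order_trans[OF muI_holder[OF f tT s]] mult_left_mono) auto
  show ?thesis unfolding Xi_def using a1 a2 a3 a4 a5 a6 by linarith
qed

definition Bnd :: "real \<Rightarrow> nat \<Rightarrow> nat \<Rightarrow> real \<Rightarrow> real \<Rightarrow> real" where
  "Bnd W K J0 \<Delta> D = (A * 2 + W * g) * (T / 2^J0) + 2 * BM_osc_mean T J0 + W * mean_err K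
     + 2^J0 * (2 * pi * sqrt (2 * W / real n)) + 8 * pi / real K + exp (L * T) * \<Delta> + D
         + c0 * sqrt (T / 2^J0)"

lemma Xi_mean:
  assumes w: "\<And>i. i \<in> {1..n} \<Longrightarrow> 0 \<le> w i \<and> w i \<le> W / real n" and W: "W \<ge> 1"
    and sw: "(\<Sum>i=1..n. w i) \<le> 2" and K: "K > 0"
  shows "integrable M (Xi w W K J0 \<Delta> D)" "expectation (Xi w W K J0 \<Delta> D) \<le> Bnd W K J0 \<Delta> D"
proof -
  have i: "integrable M (BM_osc T B J0 i)" "expectation (BM_osc T B J0 i) = BM_osc_mean T J0"
      if "i \<in> {1..n}" for i
    using BM_osc_integral[OF BM _ T_pos, of i J0] that by auto
  have i1: "integrable M (\<lambda>\<omega>. \<Sum>i=1..n. w i * BM_osc T B J0 i \<omega>)" using i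
      by (intro Bochner_Integration.integrable_sum integrable_mult_right)
  have i2: "integrable M (\<lambda>\<omega>. \<Sum>k<2^J0. Fl w K (k * 2^(J - J0)) \<omega>)" using Fl_integrable
      by (intro Bochner_Integration.integrable_sum)
  have e1: "expectation (\<lambda>\<omega>. \<Sum>i=1..n. w i * BM_osc T B J0 i \<omega>) \<le> 2 * BM_osc_mean T J0"
  proof -
    have "expectation (\<lambda>\<omega>. \<Sum>i=1..n. w i * BM_osc T B J0 i \<omega>) = (\<Sum>i=1..n. w i * BM_osc_mean T J0)"
      using i by (subst Bochner_Integration.integral_sum) auto
    also have "\<dots> = (\<Sum>i=1..n. w i) * BM_osc_mean T J0" by (simp add: sum_distrib_right)
    also have "\<dots> \<le> 2 * BM_osc_mean T J0" using sw BM_osc_mean_nonneg by (intro mult_right_mono)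
    finally show ?thesis .
  qed
  have e2: "expectation (\<lambda>\<omega>. \<Sum>k<2^J0. Fl w K (k * 2^(J - J0)) \<omega>)
      \<le> 2^J0 * (2 * pi * sqrt (2 * W / real n))"
  proof -
    \<comment> \<open>Weights of size at most \<open>W/n\<close> and total mass at most 2 have sum
      of squares at most \<open>2W/n\<close>, whence the rate of the fluctuations.\<close>
    have "(\<Sum>i=1..n. (w i)^2) \<le> (\<Sum>i=1..n. W / real n * w i)"
    proof (rule sum_mono)
      fix i assume "i \<in> {1..n}"
      from w[OF this] show "(w i)^2 \<le> W / real n * w i"
        unfolding power2_eq_square by (intro mult_right_mono) auto
    qed
    also have "\<dots> = W / real n * (\<Sum>i=1..n. w i)" by (simp add: sum_distrib_left)
    also have "\<dots> \<le> W / real n * 2" using sw W by (intro mult_left_mono) auto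
    finally have sq: "(\<Sum>i=1..n. (w i)^2) \<le> (sqrt (2 * W / real n))^2" using W
        by (simp add: mult.commute)
    have "expectation (\<lambda>\<omega>. \<Sum>k<2^J0. Fl w K (k * 2^(J - J0)) \<omega>)
        = (\<Sum>k<2^J0. expectation (Fl w K (k * 2^(J - J0))))"
      using Fl_integrable by (intro Bochner_Integration.integral_sum)
    also have "\<dots> \<le> (\<Sum>k<(2::nat)^J0. 2 * pi * sqrt (2 * W / real n))"
      using W n_pos by (intro sum_mono Fl_mean[OF K _ sq]) auto
    finally show ?thesis by simp
  qed
  show "integrable M (Xi w W K J0 \<Delta> D)"
    unfolding Xi_def[abs_def] using i1 i2 estar_mean(1)[OF K] by simp
  have "expectation (Xi w W K J0 \<Delta> D) = (A * 2 + W * g) * (T / 2^J0)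
      + expectation (\<lambda>\<omega>. \<Sum>i=1..n. w i * BM_osc T B J0 i \<omega>)
     + W * expectation (estar K) + expectation (\<lambda>\<omega>. \<Sum>k<2^J0. Fl w K (k * 2^(J - J0)) \<omega>)
     + 8 * pi / real K + exp (L * T) * \<Delta> + D + c0 * sqrt (T / 2^J0)"
    unfolding Xi_def[abs_def] using i1 i2 estar_mean(1)[OF K] prob_space by simp
  moreover have "W * expectation (estar K) \<le> W * mean_err K" using estar_mean(2)[OF K] W
      by (intro mult_left_mono) auto
  ultimately show "expectation (Xi w W K J0 \<Delta> D) \<le> Bnd W K J0 \<Delta> D"
    unfolding Bnd_def using e1 e2 by linarith
qed

text \<open>The empirical measure has mass at most 2 and the limit has mass 1, so the distance is at
  most 3 and its power \<open>q\<close> is at most 3^(q-1) times the distance. The first moment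
  therefore suffices.\<close>

lemma quenched_bound:
  assumes w: "\<And>i. i \<in> {1..n} \<Longrightarrow> 0 \<le> w i \<and> w i \<le> W / real n" and W: "W \<ge> 1"
    and sw: "(\<Sum>i=1..n. w i) \<le> 2" and J0: "J0 \<le> J" and K: "K > 0"
    and \<Delta>: "\<And>f. f \<in> BL_test \<Longrightarrow> \<bar>\<Sum>i=1..n. (w i - 1 / real n) * f (x i)\<bar> \<le> \<Delta>"
    and D: "\<And>k f. k \<le> 2^J \<Longrightarrow> f \<in> BL_test \<Longrightarrow> \<bar>rho k f - muI (real k * h) f\<bar> \<le> D"
    and q: "(q::real) \<ge> 1"
  shows "(\<integral>\<^sup>+ \<omega>. ennreal ((SUP s\<in>{0..T}. d_BL (emp_measure n w (\<lambda>i. \<theta> i \<omega> s)) (\<mu> s)) powr q) \<partial>M)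
     \<le> ennreal (3 powr (q - 1) * Bnd W K J0 \<Delta> D)"
proof -
  have w0: "0 \<le> w i" if "i \<in> {1..n}" for i using w[OF that] by simp
  have 1: "(SUP s\<in>{0..T}. d_BL (emp_measure n w (\<lambda>i. \<theta> i \<omega> s)) (\<mu> s)) powr q
      \<le> 3 powr (q - 1) * Xi w W K J0 \<Delta> D \<omega>"
    if \<omega>: "\<omega> \<in> space M" "good \<omega>" for \<omega>
  proof -
    define X where "X = (SUP s\<in>{0..T}. d_BL (emp_measure n w (\<lambda>i. \<theta> i \<omega> s)) (\<mu> s))"
    have emp: "(\<integral>y. f y \<partial>(emp_measure n w (\<lambda>i. \<theta> i \<omega> s))) = (\<Sum>i=1..n. w i * f (\<theta> i \<omega> s))" if "f
        \<in> BL_test" for f s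
      by (rule integral_emp_measure[OF w0 BL_test_borel[OF that]])
    have b1: "\<bar>\<integral>y. f y \<partial>(emp_measure n w (\<lambda>i. \<theta> i \<omega> s))\<bar> \<le> 2" if f: "f \<in> BL_test" for f s
    proof -
      have "\<bar>\<Sum>i=1..n. w i * f (\<theta> i \<omega> s)\<bar> \<le> (\<Sum>i=1..n. w i * 1)"
        using w0 f by (intro order_trans[OF sum_abs] sum_mono) (auto simp: abs_mult BL_test_def
            intro!: mult_left_le)
      then show ?thesis unfolding emp[OF f] using sw by simp
    qed
    have b2: "\<bar>\<integral>y. f y \<partial>(\<mu> s)\<bar> \<le> 1" if "f \<in> BL_test" "s \<in> {0..T}" for f s
      using muI_bound[OF that(2), of f 1] that(1) by (auto simp: muI_def BL_test_def)
    have le3: "d_BL (emp_measure n w (\<lambda>i. \<theta> i \<omega> s)) (\<mu> s) \<le> 3" if "s \<in> {0..T}" for s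
    proof (rule d_BL_le)
      fix f assume f: "f \<in> BL_test"
      show "(\<integral>y. f y \<partial>(emp_measure n w (\<lambda>i. \<theta> i \<omega> s))) - (\<integral>y. f y \<partial>(\<mu> s)) \<le> 3"
        using b1[OF f, of s] b2[OF f that] by linarith
    qed
    have leX: "d_BL (emp_measure n w (\<lambda>i. \<theta> i \<omega> s)) (\<mu> s) \<le> Xi w W K J0 \<Delta> D \<omega>" if s: "s \<in> {0..T}"
        for s
    proof (rule d_BL_le)
      fix f assume f: "f \<in> BL_test"
      show "(\<integral>y. f y \<partial>(emp_measure n w (\<lambda>i. \<theta> i \<omega> s))) - (\<integral>y. f y \<partial>(\<mu> s)) \<le> Xi w W K J0 \<Delta> D \<omega>"
        using pathwise_bound[OF \<omega> w sw J0 K \<Delta> D f s] unfolding emp[OF f] muI_def by linarith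
    qed
    have ne: "{0..T} \<noteq> {}" using T_pos by simp
    have X3: "X \<le> 3" unfolding X_def using le3 ne by (intro cSUP_least) auto
    have XX: "X \<le> Xi w W K J0 \<Delta> D \<omega>" unfolding X_def using leX ne by (intro cSUP_least) auto
    have T0: "0 \<in> {0..T}" using T_pos by simp
    have "0 \<le> d_BL (emp_measure n w (\<lambda>i. \<theta> i \<omega> 0)) (\<mu> 0)"
      using d_BL_upper[OF b1[of _ 0] b2[OF _ T0] zero_BL_test] by linarith
    also have "\<dots> \<le> X" unfolding X_def using le3 T0 by (intro cSUP_upper bdd_aboveI2[where M
        = 3]) auto
    finally have X0: "0 \<le> X" .
    have "X powr q \<le> 3 powr (q - 1) * X"
    proof (cases "X = 0")
      case False
      then have "X powr q = X powr (q - 1) * X" using X0 by (simp add: powr_diff)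
      also have "\<dots> \<le> 3 powr (q - 1) * X" using X0 X3 q by (intro mult_right_mono powr_mono2) auto
      finally show ?thesis .
    qed simp
    also have "\<dots> \<le> 3 powr (q - 1) * Xi w W K J0 \<Delta> D \<omega>" using XX by (intro mult_left_mono) auto
    finally show ?thesis by (simp add: X_def)
  qed
  have pos: "AE \<omega> in M. 0 \<le> 3 powr (q - 1) * Xi w W K J0 \<Delta> D \<omega>"
    using AE_good AE_space by eventually_elim (use 1 order_trans[OF powr_ge_zero] in blast)
  have "(\<integral>\<^sup>+ \<omega>. ennreal ((SUP s\<in>{0..T}. d_BL (emp_measure n w (\<lambda>i. \<theta> i \<omega> s)) (\<mu> s)) powr q) \<partial>M)
     \<le> (\<integral>\<^sup>+ \<omega>. ennreal (3 powr (q - 1) * Xi w W K J0 \<Delta> D \<omega>) \<partial>M)"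
  proof (rule nn_integral_mono_AE)
    show "AE \<omega> in M. ennreal ((SUP s\<in>{0..T}. d_BL (emp_measure n w (\<lambda>i. \<theta> i \<omega> s)) (\<mu> s)) powr q)
        \<le> ennreal (3 powr (q - 1) * Xi w W K J0 \<Delta> D \<omega>)"
      using AE_good AE_space by eventually_elim (rule ennreal_leI, rule 1)
  qed
  also have "\<dots> = ennreal (\<integral>\<omega>. 3 powr (q - 1) * Xi w W K J0 \<Delta> D \<omega> \<partial>M)"
    by (rule nn_integral_eq_integral[OF _ pos]) (use Xi_mean(1)[OF w W sw K] in auto)
  also have "\<dots> \<le> ennreal (3 powr (q - 1) * Bnd W K J0 \<Delta> D)"
    using Xi_mean(2)[OF w W sw K] by (intro ennreal_leI) (simp add: mult_left_mono)
  finally show ?thesis .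
qed

end

section \<open>Passage to the limit for a fixed graph and initial condition\<close>

lemma tendsto_zero_ennreal_le:
  fixes F :: "nat \<Rightarrow> ennreal"
  assumes "\<And>e::real. e > 0 \<Longrightarrow> \<forall>\<^sub>F n in sequentially. F n \<le> ennreal e"
  shows "F \<longlonglongrightarrow> 0"
proof (rule tendsto_zero_ennreal)
  fix r :: real assume r: "0 < r"
  then have "\<forall>\<^sub>F n in sequentially. F n \<le> ennreal (r / 2)" by (intro assms) simp
  then show "\<forall>\<^sub>F n in sequentially. F n < ennreal r"
    by eventually_elim (use r in \<open>auto intro: order_le_less_trans simp: ennreal_less_iff\<close>)
qed

text \<open>The order of choices matters. The coarse level \<open>J0\<close> and the tolerance
  \<eta> depend on \<open>e\<close> only; the fine level \<open>J n\<close> depends on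
  \<open>n\<close> through \<open>W n\<close>; the number of arcs is \<open>n\<close>. All remaining
  terms vanish as \<open>n\<close> grows with \<open>J0\<close> fixed.\<close>

lemma (in mean_field_limit) quenched_limit:
  fixes M :: "'m measure" and B :: "nat \<Rightarrow> 'm \<Rightarrow> real \<Rightarrow> real"
    and p W \<delta> \<Delta> d :: "nat \<Rightarrow> real" and xi :: "nat \<Rightarrow> nat \<Rightarrow> nat \<Rightarrow> bool" and x w :: "nat \<Rightarrow> nat \<Rightarrow> real"
    and \<theta> :: "nat \<Rightarrow> nat \<Rightarrow> 'm \<Rightarrow> real \<Rightarrow> real" and q :: real
  assumes BM: "BM_family M B" and p: "\<And>n. n \<ge> 2 \<Longrightarrow> p n > 0"
    and path_cont: "\<And>n i \<omega>. n \<ge> 2 \<Longrightarrow> i \<in> {1..n} \<Longrightarrow> \<omega> \<in> space M \<Longrightarrow> continuous_on {0..T} (\<theta> n i \<omega>)"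
    and path_eq: "\<And>n i \<omega> t. n \<ge> 2 \<Longrightarrow> i \<in> {1..n} \<Longrightarrow> \<omega> \<in> space M \<Longrightarrow> t \<in> {0..T} \<Longrightarrow> \<theta> n i \<omega> t = x n i +
           integral {0..t} (\<lambda>s. (1 / (real n * p n)) *
             (\<Sum>j=1..n. if xi n i j then G (\<theta> n i \<omega> s) (\<theta> n j \<omega> s) else 0)) + B i \<omega> t"
    and cut: "\<forall>\<^sub>F n in sequentially. \<forall>U\<subseteq>{1..n}.
           (\<Sum>i=1..n. \<bar>\<Sum>j\<in>U. (if xi n i j then 1 / p n else 0) - 1\<bar>) \<le> \<delta> n * (real n)^2"
    and W: "\<forall>\<^sub>F n in sequentially. W n \<ge> 1"
    and w: "\<forall>\<^sub>F n in sequentially. \<forall>i\<in>{1..n}. 0 \<le> w n i \<and> w n i \<le> W n / real n"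
    and sw: "\<forall>\<^sub>F n in sequentially. (\<Sum>i=1..n. w n i) \<le> 2"
    and \<Delta>: "\<forall>\<^sub>F n in sequentially. \<forall>f\<in>BL_test. \<bar>\<Sum>i=1..n. (w n i - 1 / real n) * f (x n i)\<bar> \<le> \<Delta> n"
    and d: "\<forall>\<^sub>F n in sequentially. \<forall>f\<in>BL_test. \<bar>(\<Sum>i=1..n. 1 / real n * f (x n i)) - muI 0 f\<bar> \<le> d n"
    and lims: "(\<lambda>n. W n * \<delta> n) \<longlonglongrightarrow> 0" "(\<lambda>n. W n / sqrt (real n)) \<longlonglongrightarrow> 0" "\<Delta> \<longlonglongrightarrow> 0" "d \<longlonglongrightarrow> 0"
    and q: "q \<ge> 1"
  shows "(\<lambda>n. \<integral>\<^sup>+ \<omega>. ennreal ((SUP s\<in>{0..T}. d_BL (emp_measure n (w n) (\<lambda>i. \<theta> n i \<omega> s)) (\<mu> s))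
      powr q) \<partial>M) \<longlonglongrightarrow> 0"
proof (rule tendsto_zero_ennreal_le)
  fix e :: real assume e: "e > 0"
  define e' where "e' = e / 3 powr (q - 1)"
  have e': "e' > 0" using e by (simp add: e'_def)
  have half: "(\<lambda>J. T / 2^J) \<longlonglongrightarrow> 0"
  proof -
    have "(\<lambda>J. T * (1 / 2)^J) \<longlonglongrightarrow> T * 0" by (intro tendsto_mult tendsto_const LIMSEQ_power_zero) auto
    then show ?thesis by (simp add: power_divide)
  qed
  have sq0: "(\<lambda>J. sqrt (T / 2^J)) \<longlonglongrightarrow> 0" using tendsto_real_sqrt[OF half] by simp
  \<comment> \<open>For fixed \<open>n\<close> the level can be taken as large as desired, so it
    absorbs \<open>W n\<close> however fast that grows. The requirement \<open>n \<le> J\<close>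
    makes the step tend to 0.\<close>
  have "\<exists>J. n \<le> J \<and> W n * (T / 2^J + BM_osc_mean T J) \<le> 1 / real (Suc n)" for n
  proof -
    have "(\<lambda>J. W n * (T / 2^J + BM_osc_mean T J)) \<longlonglongrightarrow> W n * (0 + 0)"
      by (intro tendsto_mult tendsto_const tendsto_add half BM_osc_mean_tendsto)
    then have "\<forall>\<^sub>F J in sequentially. W n * (T / 2^J + BM_osc_mean T J) < 1 / real (Suc n)"
      by (intro order_tendstoD(2)) auto
    then have "\<forall>\<^sub>F J in sequentially. n \<le> J \<and> W n * (T / 2^J + BM_osc_mean T J) < 1 / real (Suc n)"
      using eventually_ge_at_top[of n] by eventually_elim simp
    then show ?thesis unfolding eventually_sequentially by (metis less_imp_le order_refl)
  qed
  then obtain J where J: "\<And>n. n \<le> J n" "\<And>n. W n * (T / 2^J n + BM_osc_mean T (J n))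
      \<le> 1 / real (Suc n)" by metis
  obtain R where R: "R > 0" "\<forall>\<eta>>0. \<exists>h0>0. \<forall>h m \<rho> d. scheme h m \<rho> \<longrightarrow> h < h0 \<longrightarrow>
     (\<forall>f\<in>BL_test. \<bar>\<rho> 0 f - muI 0 f\<bar> \<le> d) \<longrightarrow>
     (\<forall>k\<le>m. \<forall>f\<in>BL_test. \<bar>\<rho> k f - muI (real k * h) f\<bar> \<le> R * (d + \<eta>))"
    using scheme_convergence by blast
  define \<eta> where "\<eta> = e' / (4 * R)"
  have \<eta>: "\<eta> > 0" "R * \<eta> = e' / 4" using e' R(1) by (auto simp: \<eta>_def)
  obtain h0 where h0: "h0 > 0" "\<And>h m \<rho> d. scheme h m \<rho> \<Longrightarrow> h < h0 \<Longrightarrow>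
     (\<forall>f\<in>BL_test. \<bar>\<rho> 0 f - muI 0 f\<bar> \<le> d) \<Longrightarrow>
     (\<forall>k\<le>m. \<forall>f\<in>BL_test. \<bar>\<rho> k f - muI (real k * h) f\<bar> \<le> R * (d + \<eta>))"
    using R(2) \<eta>(1) by metis
  define cJ where "cJ J0 = A * 2 * (T / 2^J0) + 2 * BM_osc_mean T J0 + c0 * sqrt (T / 2^J0)" for J0
  have "cJ \<longlonglongrightarrow> A * 2 * 0 + 2 * 0 + c0 * 0"
    unfolding cJ_def by (intro tendsto_add tendsto_mult tendsto_const half BM_osc_mean_tendsto sq0)
  then have "\<forall>\<^sub>F J0 in sequentially. cJ J0 < e' / 4" using e' by (intro order_tendstoD(2)) auto
  then obtain J0 where J0: "cJ J0 < e' / 4" unfolding eventually_sequentially by blast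
  define gg where "gg n = (A + 2 * pi * L) * \<delta> n" for n
  define hh where "hh n = T / 2^J n" for n
  define E where "E n = exp (2 * L * T) * (T * (W n * gg n + 2 * L * (A * (W n * hh n)
      + hh n * (W n * gg n) + W n * BM_osc_mean T (J n))
      + (L * (2 * pi * (W n / sqrt (real n)))
          + 4 * pi * L * (W n / sqrt (real n) * (1 / sqrt (real n))))))" for n
  \<comment> \<open>Everything that tends to 0 as \<open>n\<close> grows. \<open>W n / n\<close> is
    written as \<open>W n / sqrt n\<close> times \<open>1 / sqrt n\<close>, so that its limit
    follows from the assumed one.\<close>
  define rest where "rest n = W n * gg n * (T / 2^J0) + E n
      + 2^J0 * (2 * pi * sqrt (2 * (W n / sqrt (real n) * (1 / sqrt (real n)))))
     + 8 * pi / real n + exp (L * T) * \<Delta> n + R * d n" for n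
  have lg: "(\<lambda>n. W n * gg n) \<longlonglongrightarrow> 0"
    using tendsto_mult[OF tendsto_const[of "A + 2 * pi * L"] lims(1)] by (simp add: gg_def mult_ac)
  have ls: "(\<lambda>n. 1 / sqrt (real n)) \<longlonglongrightarrow> 0"
    by (intro tendsto_divide_0[OF tendsto_const] filterlim_at_top_imp_at_infinity
        filterlim_compose[OF sqrt_at_top filterlim_real_sequentially])
  have inv0: "(\<lambda>n. 1 / real (Suc n)) \<longlonglongrightarrow> 0" using LIMSEQ_Suc[OF lim_const_over_n[of 1]] by simp
  have lhW: "(\<lambda>n. W n * hh n) \<longlonglongrightarrow> 0" and lkW: "(\<lambda>n. W n * BM_osc_mean T (J n)) \<longlonglongrightarrow> 0"
  proof -
    have "\<forall>\<^sub>F n in sequentially. norm (W n * hh n) \<le> 1 / real (Suc n)"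
      using W
    proof eventually_elim
      case (elim n)
      have "0 \<le> W n * BM_osc_mean T (J n)" using elim BM_osc_mean_nonneg[of T "J n"] by simp
      moreover have "0 \<le> W n * hh n" using elim T_pos by (simp add: hh_def)
      ultimately show ?case using J(2)[of n] unfolding distrib_left hh_def real_norm_def by linarith
    qed
    then show "(\<lambda>n. W n * hh n) \<longlonglongrightarrow> 0" by (rule Lim_null_comparison[OF _ inv0])
    have "\<forall>\<^sub>F n in sequentially. norm (W n * BM_osc_mean T (J n)) \<le> 1 / real (Suc n)"
      using W
    proof eventually_elim
      case (elim n)
      have "0 \<le> W n * BM_osc_mean T (J n)" using elim BM_osc_mean_nonneg[of T "J n"] by simp
      moreover have "0 \<le> W n * (T / 2^J n)" using elim T_pos by simp
      ultimately show ?case using J(2)[of n] unfolding distrib_left real_norm_def by linarith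
    qed
    then show "(\<lambda>n. W n * BM_osc_mean T (J n)) \<longlonglongrightarrow> 0" by (rule Lim_null_comparison[OF _ inv0])
  qed
  have lh: "hh \<longlonglongrightarrow> 0"
  proof (rule Lim_null_comparison[OF _ half])
    show "\<forall>\<^sub>F n in sequentially. norm (hh n) \<le> T / 2^n"
      using J(1) T_pos by (intro always_eventually allI) (auto simp: hh_def intro!:
          divide_left_mono power_increasing)
  qed
  have lE: "E \<longlonglongrightarrow> exp (2 * L * T) * (T * (0 + 2 * L * (A * 0 + 0 * 0 + 0) + (L * (2 * pi * 0)
      + 4 * pi * L * (0 * 0))))"
    unfolding E_def by (intro tendsto_add tendsto_mult tendsto_const lg lhW lh lkW lims(2) ls)
  have lr: "rest \<longlonglongrightarrow> 0 * (T / 2^J0) + exp (2 * L * T) * (T * (0 + 2 * L * (A * 0 + 0 * 0 + 0)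
      + (L * (2 * pi * 0) + 4 * pi * L * (0 * 0))))
     + 2^J0 * (2 * pi * sqrt (2 * (0 * 0))) + 0 + exp (L * T) * 0 + R * 0"
    unfolding rest_def
    by (intro tendsto_add tendsto_mult tendsto_const tendsto_real_sqrt lg lE lims ls
        lim_const_over_n)
  then have ev_rest: "\<forall>\<^sub>F n in sequentially. rest n < e' / 4" using e'
      by (intro order_tendstoD(2)) auto
  have ev_h: "\<forall>\<^sub>F n in sequentially. hh n < h0" using lh h0(1) by (rule order_tendstoD(2))
  show "\<forall>\<^sub>F n in sequentially. (\<integral>\<^sup>+ \<omega>. ennreal ((SUP s\<in>{0..T}. d_BL (emp_measure n (w n) (\<lambda>i. \<theta> n
      i \<omega> s)) (\<mu> s)) powr q) \<partial>M) \<le> ennreal e"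
    using cut W w sw \<Delta> d ev_rest ev_h eventually_ge_at_top[of "max 2 J0"]
  proof eventually_elim
    case (elim n)
    have n2: "n \<ge> 2" and nJ0: "J0 \<le> J n" using elim(9) J(1)[of n] by auto
    interpret particles G T A L \<mu>0 \<mu> M B n "x n" "J n" "p n" "xi n" "\<theta> n" "\<delta> n"
      by (unfold_locales; use BM p[OF n2] path_cont[OF n2] path_eq[OF n2] elim(1) n2 in \<open>auto simp
          del: One_nat_def\<close>)
    have hn: "h = hh n" by (simp add: h_def hh_def)
    have gn: "g = gg n" by (simp add: g_def gg_def)
    have r0: "\<forall>f\<in>BL_test. \<bar>rho 0 f - muI 0 f\<bar> \<le> d n"
      using elim(6) prob_space by (simp add: rho_def sum_distrib_left)
    have DD: "\<bar>rho k f - muI (real k * h) f\<bar> \<le> R * (d n + \<eta>)" if "k \<le> 2^J n" "f \<in> BL_test" for k f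
      using h0(2)[OF rho_scheme _ r0] elim(8) that by (simp add: hn)
    have n0: "n > 0" using n2 by simp
    have "(\<integral>\<^sup>+ \<omega>. ennreal ((SUP s\<in>{0..T}. d_BL (emp_measure n (w n) (\<lambda>i. \<theta> n i \<omega> s)) (\<mu> s)) powr
        q) \<partial>M)
       \<le> ennreal (3 powr (q - 1) * Bnd (W n) n J0 (\<Delta> n) (R * (d n + \<eta>)))"
      by (rule quenched_bound[OF _ elim(2) elim(4) nJ0 n0 _ DD q]) (use elim(3,5) in auto)
    also have "\<dots> \<le> ennreal e"
    proof (rule ennreal_leI)
      have Wn: "W n / sqrt (real n) * (1 / sqrt (real n)) = W n / real n" by simp
      have "W n * mean_err n = E n"
      proof -
        have "4 * pi * L * (W n / sqrt (real n) * (1 / sqrt (real n)))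
            = W n * (4 * pi * L / real n)" unfolding Wn by simp
        moreover have "L * (2 * pi * (W n / sqrt (real n)))
            = W n * (L * (2 * pi * (1 / sqrt (real n))))" by simp
        ultimately show ?thesis unfolding mean_err_def E_def gn hn
            by (simp only:) (simp only: algebra_simps)
      qed
      then have "Bnd (W n) n J0 (\<Delta> n) (R * (d n + \<eta>)) = cJ J0 + rest n + R * \<eta>"
        unfolding Bnd_def cJ_def rest_def gn Wn by (simp add: algebra_simps)
      also have "\<dots> \<le> e'" using J0 elim(7) \<eta>(2) e' by linarith
      finally have "3 powr (q - 1) * Bnd (W n) n J0 (\<Delta> n) (R * (d n + \<eta>)) \<le> 3 powr (q - 1) * e'"
          by (intro mult_left_mono) auto
      then show "3 powr (q - 1) * Bnd (W n) n J0 (\<Delta> n) (R * (d n + \<eta>)) \<le> e" by (simp add: e'_def)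
    qed
    finally show ?case .
  qed
qed

section \<open>Concentration of the random graph\<close>

text \<open>For y = -z negative, the identity (1 + z)(1 - z + z^2) = 1 + z^3 together with 1 + z
  \<le> exp z bounds exp(-z).\<close>

lemma exp_le_quadratic:
  fixes y :: real
  assumes "\<bar>y\<bar> \<le> 1" shows "exp y \<le> 1 + y + y^2"
proof (cases "0 \<le> y")
  case True
  then show ?thesis using assms exp_bound[of y] by simp
next
  case False
  define z where "z = - y"
  have z: "0 \<le> z" "z \<le> 1" using False assms by (auto simp: z_def)
  have "1 \<le> (1 + z) * (1 - z + z^2)" using z by (simp add: algebra_simps power2_eq_square)
  also have "\<dots> \<le> exp z * (1 - z + z^2)"
  proof (rule mult_right_mono)
    have "0 \<le> 1 - z" using z by simp
    then show "0 \<le> 1 - z + z\<^sup>2" by (simp add: add_nonneg_nonneg)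
  qed simp
  finally have "exp (- z) \<le> 1 - z + z^2"
    by (simp add: exp_minus field_simps)
  then show ?thesis by (simp add: z_def)
qed

text \<open>A second-order bound on the moment generating function keeps the factor \<rho> of the
  Bernoulli variance. The exponent is therefore proportional to the expected number of edges, which
  is what sparse graphs demand.\<close>

lemma (in prob_space) bernoulli_chernoff:
  fixes X :: "'i \<Rightarrow> 'a \<Rightarrow> bool" and s :: "'i \<Rightarrow> real"
  assumes fin: "finite S" and ind: "indep_vars (\<lambda>_. count_space UNIV) X S"
    and pr: "\<And>i. i \<in> S \<Longrightarrow> prob {\<omega> \<in> space M. X i \<omega>} = \<rho>" and \<rho>: "0 \<le> \<rho>" "\<rho> \<le> 1"
    and s: "\<And>i. i \<in> S \<Longrightarrow> \<bar>s i\<bar> \<le> 1" and \<epsilon>: "0 < \<epsilon>" "\<epsilon> \<le> 1"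
  shows "prob {\<omega> \<in> space M. \<epsilon> * real (card S) * \<rho> \<le> (\<Sum>i\<in>S. s i * (of_bool (X i \<omega>) - \<rho>))}
     \<le> exp (- (\<epsilon>^2 * real (card S) * \<rho> / 4))"
proof -
  \<comment> \<open>The minimiser of u^2 - \<epsilon> u; the minimum is -\<epsilon>^2/4.\<close>
  define u where "u = \<epsilon> / 2"
  have u: "0 < u" "u \<le> 1" using \<epsilon> by (auto simp: u_def)
  have rv: "X i \<in> measurable M (count_space UNIV)" if "i \<in> S" for i using ind that
      by (auto simp: indep_vars_def)
  define Z where "Z i \<omega> = exp (u * (s i * (of_bool (X i \<omega>) - \<rho>)))" for i \<omega>
  define N where "N = (\<lambda>\<omega>. \<Sum>i\<in>S. s i * (of_bool (X i \<omega>) - \<rho>))"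
  have Zind: "indep_vars (\<lambda>_. borel) Z S"
    unfolding Z_def by (rule indep_vars_compose2[OF ind, where Y
        = "\<lambda>i b. exp (u * (s i * (of_bool b - \<rho>)))"]) simp
  have Zmeas: "Z i \<in> borel_measurable M" if "i \<in> S" for i using Zind that
      by (auto simp: indep_vars_def)
  have Xb: "integrable M (\<lambda>\<omega>. of_bool (X i \<omega>) :: real)" "expectation (\<lambda>\<omega>. of_bool (X i \<omega>)) = \<rho>"
      if i: "i \<in> S" for i
  proof -
    have m: "{\<omega> \<in> space M. X i \<omega>} \<in> events" using rv[OF i] by measurable
    have e: "(\<lambda>\<omega>. of_bool (X i \<omega>)) \<in> borel_measurable M"
      by (rule measurable_compose[OF rv[OF i]]) simp
    show "integrable M (\<lambda>\<omega>. of_bool (X i \<omega>) :: real)"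
      by (rule integrable_const_bound[where B = 1, OF _ e]) auto
    have "expectation (\<lambda>\<omega>. of_bool (X i \<omega>)) = expectation (indicator {\<omega>
        \<in> space M. X i \<omega>} :: _ \<Rightarrow> real)"
      by (intro Bochner_Integration.integral_cong refl) (auto simp: indicator_def)
    then show "expectation (\<lambda>\<omega>. of_bool (X i \<omega>)) = \<rho>" using m pr[OF i] by simp
  qed
  have Zint: "integrable M (Z i)" if i: "i \<in> S" for i
  proof (rule integrable_const_bound[where B = "exp 1"])
    show "AE \<omega> in M. norm (Z i \<omega>) \<le> exp 1"
    proof (rule AE_I2)
      fix \<omega>
      have "\<bar>of_bool (X i \<omega>) - \<rho>\<bar> \<le> 1" using \<rho> by (cases "X i \<omega>") auto
      then have "\<bar>s i\<bar> * \<bar>of_bool (X i \<omega>) - \<rho>\<bar> \<le> 1 * 1" using s[OF i] by (intro mult_mono) auto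
      then have "u * (\<bar>s i\<bar> * \<bar>of_bool (X i \<omega>) - \<rho>\<bar>) \<le> 1 * 1" using u by (intro mult_mono) auto
      then have "\<bar>u * (s i * (of_bool (X i \<omega>) - \<rho>))\<bar> \<le> 1" using u by (simp add: abs_mult)
      then show "norm (Z i \<omega>) \<le> exp 1" by (simp add: Z_def)
    qed
  qed (rule Zmeas[OF i])
  have Zle: "expectation (Z i) \<le> exp (u^2 * \<rho>)" if i: "i \<in> S" for i
  proof -
    define v where "v = u * s i"
    have v1: "\<bar>v\<bar> \<le> 1" "v^2 \<le> u^2"
    proof -
      have "\<bar>v\<bar> = u * \<bar>s i\<bar>" using u by (simp add: v_def abs_mult)
      also have "\<dots> \<le> u * 1" using s[OF i] u by (intro mult_left_mono) auto
      finally have "\<bar>v\<bar> \<le> \<bar>u\<bar>" using u by simp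
      then show "v^2 \<le> u^2" by (simp only: abs_le_square_iff)
      show "\<bar>v\<bar> \<le> 1" using \<open>\<bar>v\<bar> \<le> \<bar>u\<bar>\<close> u by simp
    qed
    \<comment> \<open>As \<open>of_bool\<close> equals its own square, the quadratic bound is affine
      in it and its expectation is explicit.\<close>
    have pw: "Z i \<omega> \<le> (1 - v * \<rho> + v^2 * \<rho>^2) + (v + v^2 - 2 * v^2 * \<rho>) * of_bool (X i \<omega>)" for \<omega>
    proof -
      have "\<bar>of_bool (X i \<omega>) - \<rho>\<bar> \<le> 1" using \<rho> by (cases "X i \<omega>") auto
      then have "\<bar>v\<bar> * \<bar>of_bool (X i \<omega>) - \<rho>\<bar> \<le> 1 * 1" using v1 by (intro mult_mono) auto
      then have "exp (v * (of_bool (X i \<omega>) - \<rho>)) \<le> 1 + v * (of_bool (X i \<omega>) - \<rho>)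
          + (v * (of_bool (X i \<omega>) - \<rho>))^2"
        by (intro exp_le_quadratic) (simp add: abs_mult)
      then show ?thesis by (cases "X i \<omega>") (simp_all add: Z_def v_def algebra_simps
          power2_eq_square)
    qed
    have "expectation (Z i) \<le> expectation (\<lambda>\<omega>. (1 - v * \<rho> + v^2 * \<rho>^2) + (v
        + v^2 - 2 * v^2 * \<rho>) * of_bool (X i \<omega>))"
      using Zint[OF i] Xb(1)[OF i] pw by (intro integral_mono) auto
    also have "\<dots> = (1 - v * \<rho> + v^2 * \<rho>^2) + (v + v^2 - 2 * v^2 * \<rho>) * \<rho>"
      using Xb[OF i] prob_space by simp
    also have "\<dots> = 1 + v^2 * \<rho> - v^2 * \<rho>^2" by (simp add: algebra_simps power2_eq_square)
    also have "\<dots> \<le> 1 + u^2 * \<rho>"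
    proof -
      have "v^2 * \<rho> \<le> u^2 * \<rho>" using v1 \<rho> by (intro mult_right_mono) auto
      moreover have "0 \<le> v^2 * \<rho>^2" by simp
      ultimately show ?thesis by linarith
    qed
    also have "\<dots> \<le> exp (u^2 * \<rho>)" by simp
    finally show ?thesis .
  qed
  have expN: "exp (u * N \<omega>) = (\<Prod>i\<in>S. Z i \<omega>)" for \<omega>
    unfolding N_def Z_def sum_distrib_left using fin by (simp add: exp_sum)
  have Eexp: "expectation (\<lambda>\<omega>. exp (u * N \<omega>)) \<le> exp (real (card S) * (u^2 * \<rho>))"
  proof -
    have "expectation (\<lambda>\<omega>. exp (u * N \<omega>)) = (\<Prod>i\<in>S. expectation (Z i))"
      unfolding expN by (rule indep_vars_lebesgue_integral[OF fin Zind Zint])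
    also have "\<dots> \<le> (\<Prod>i\<in>S. exp (u^2 * \<rho>))"
      by (intro prod_mono conjI Zle) (auto simp: Z_def)
    also have "\<dots> = exp (real (card S) * (u^2 * \<rho>))" by (simp add: exp_of_nat_mult)
    finally show ?thesis .
  qed
  define a where "a = \<epsilon> * real (card S) * \<rho>"
  have iexp: "integrable M (\<lambda>\<omega>. exp (u * N \<omega>))" unfolding expN
      by (rule indep_vars_integrable[OF fin Zind Zint])
  have "prob {\<omega> \<in> space M. a \<le> N \<omega>} = prob {\<omega> \<in> space M. exp (u * a) \<le> exp (u * N \<omega>)}"
    using u by simp
  also have "\<dots> \<le> expectation (\<lambda>\<omega>. exp (u * N \<omega>)) / exp (u * a)"
    by (rule integral_Markov_inequality_measure[OF iexp, where A = "{}"]) auto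
  also have "\<dots> \<le> exp (real (card S) * (u^2 * \<rho>)) / exp (u * a)"
    using Eexp by (intro divide_right_mono) auto
  also have "\<dots> = exp (- (\<epsilon>^2 * real (card S) * \<rho> / 4))"
    unfolding exp_diff[symmetric] by (simp add: a_def u_def power2_eq_square algebra_simps)
  finally show ?thesis by (simp add: a_def N_def)
qed

section \<open>Uniform deviation of the row sums over all vertex sets\<close>

lemma summable_exp_neg: "summable (\<lambda>n. exp (- real n))"
proof -
  have "summable (\<lambda>n. exp (- 1 :: real) ^ n)" by (intro summable_geometric) simp
  then show ?thesis by (simp add: exp_of_nat_mult[symmetric])
qed

text \<open>Maximised over \<open>U\<close>, this is up to a factor 2 the cut norm of the centred
  adjacency matrix divided by \<open>p\<close>.\<close>

definition cut_dev :: "nat \<Rightarrow> real \<Rightarrow> (nat \<Rightarrow> nat \<Rightarrow> bool) \<Rightarrow> nat set \<Rightarrow> real" where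
  "cut_dev n p xi U = (\<Sum>i=1..n. \<bar>\<Sum>j\<in>U. (if xi i j then 1 / p else 0) - 1\<bar>)"

lemma (in prob_space) cut_dev_tail:
  fixes \<xi> :: "nat \<Rightarrow> nat \<Rightarrow> 'a \<Rightarrow> bool"
  assumes rv: "\<And>i j. \<xi> i j \<in> measurable M (count_space UNIV)"
    and bern: "\<And>i j. i \<in> {1..n} \<Longrightarrow> j \<in> {1..n} \<Longrightarrow> prob {\<omega> \<in> space M. \<xi> i j \<omega>} = p"
    and ind: "indep_vars (\<lambda>_. count_space UNIV) (\<lambda>(i, j). \<xi> i j) ({1..n} \<times> {1..n})"
    and p: "0 < p" "p \<le> 1" and \<delta>: "0 < \<delta>" "\<delta> \<le> 1"
  shows "{\<omega> \<in> space M. \<exists>U\<subseteq>{1..n}. cut_dev n p (\<lambda>i j. \<xi> i j \<omega>) U \<ge> \<delta> * (real n)^2} \<in> events"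
    and "prob {\<omega> \<in> space M. \<exists>U\<subseteq>{1..n}. cut_dev n p (\<lambda>i j. \<xi> i j \<omega>) U \<ge> \<delta> * (real n)^2}
      \<le> 4^n * exp (- (\<delta>^2 * (real n)^2 * p / 4))"
proof -
  note rv[measurable]
  have one: "{\<omega> \<in> space M. cut_dev n p (\<lambda>i j. \<xi> i j \<omega>) U \<ge> \<delta> * (real n)^2} \<in> events" for U
    unfolding cut_dev_def by measurable
  have un: "{\<omega> \<in> space M. \<exists>U\<subseteq>{1..n}. cut_dev n p (\<lambda>i j. \<xi> i j \<omega>) U \<ge> \<delta> * (real n)^2}
     = (\<Union>U\<in>Pow {1..n}. {\<omega> \<in> space M. cut_dev n p (\<lambda>i j. \<xi> i j \<omega>) U \<ge> \<delta> * (real n)^2})" by auto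
  show "{\<omega> \<in> space M. \<exists>U\<subseteq>{1..n}. cut_dev n p (\<lambda>i j. \<xi> i j \<omega>) U \<ge> \<delta> * (real n)^2} \<in> events"
    unfolding un using one by (intro sets.finite_UN) auto
  define s where "s U V = (\<lambda>q :: nat \<times> nat. (if fst q \<in> V then 1 else - 1) * (if snd q
      \<in> U then 1 else 0) :: real)" for U V
  define E where "E U V = {\<omega> \<in> space M. \<delta> * real (card ({1..n} \<times> {1..n})) * p
     \<le> (\<Sum>q\<in>{1..n} \<times> {1..n}. s U V q * (of_bool ((case q of (i, j) \<Rightarrow> \<xi> i j) \<omega>) - p))}" for U V
  have Em: "E U V \<in> events" for U V unfolding E_def by (measurable, auto simp: case_prod_beta)
  have Ep: "prob (E U V) \<le> exp (- (\<delta>^2 * (real n)^2 * p / 4))" for U V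
  proof -
    have "prob (E U V) \<le> exp (- (\<delta>^2 * real (card ({1..n} \<times> {1..n})) * p / 4))"
      unfolding E_def by (rule bernoulli_chernoff[OF _ ind]) (use bern p \<delta> in \<open>auto simp: s_def\<close>)
    then show ?thesis by (simp add: power2_eq_square)
  qed
  have sub: "{\<omega> \<in> space M. \<exists>U\<subseteq>{1..n}. cut_dev n p (\<lambda>i j. \<xi> i j \<omega>) U \<ge> \<delta> * (real n)^2}
     \<subseteq> (\<Union>(U, V)\<in>Pow {1..n} \<times> Pow {1..n}. E U V)"
  proof
    fix \<omega> assume "\<omega> \<in> {\<omega> \<in> space M. \<exists>U\<subseteq>{1..n}. cut_dev n p (\<lambda>i j. \<xi> i j \<omega>) U \<ge> \<delta> * (real n)^2}"
    then obtain U where \<omega>: "\<omega> \<in> space M" and U: "U \<subseteq> {1..n}" and ge: "\<delta> * (real n)^2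
        \<le> cut_dev n p (\<lambda>i j. \<xi> i j \<omega>) U" by auto
    define a where "a i = (\<Sum>j\<in>U. (if \<xi> i j \<omega> then 1 / p else 0) - 1)" for i
    \<comment> \<open>The rows with nonnegative deviation. Knowing \<open>V\<close> resolves the
      absolute values into signs, so the event becomes a tail event of one signed sum of independent
      edges.\<close>
    define V where "V = {i \<in> {1..n}. 0 \<le> a i}"
    have pa: "p * a i = (\<Sum>j=1..n. (if j \<in> U then 1 else 0) * (of_bool (\<xi> i j \<omega>) - p))" for i
    proof -
      have "p * a i = (\<Sum>j\<in>U. of_bool (\<xi> i j \<omega>) - p)"
        unfolding a_def sum_distrib_left using p by (intro sum.cong) (auto simp: right_diff_distrib)
      also have "\<dots> = (\<Sum>j\<in>{j\<in>{1..n}. j \<in> U}. of_bool (\<xi> i j \<omega>) - p)"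
        using U by (intro sum.cong) auto
      also have "\<dots> = (\<Sum>j=1..n. if j \<in> U then of_bool (\<xi> i j \<omega>) - p else 0)"
        by (rule sum.inter_filter) simp
      also have "\<dots> = (\<Sum>j=1..n. (if j \<in> U then 1 else 0) * (of_bool (\<xi> i j \<omega>) - p))"
        by (intro sum.cong) auto
      finally show ?thesis .
    qed
    have "p * cut_dev n p (\<lambda>i j. \<xi> i j \<omega>) U = (\<Sum>i=1..n. p * \<bar>a i\<bar>)"
        by (simp add: cut_dev_def a_def sum_distrib_left)
    also have "\<dots> = (\<Sum>i=1..n. (if i \<in> V then 1 else - 1) * (p * a i))"
      by (intro sum.cong) (auto simp: V_def)
    also have "\<dots> = (\<Sum>i=1..n. \<Sum>j=1..n. s U V (i, j) * (of_bool (\<xi> i j \<omega>) - p))"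
      unfolding pa by (simp add: s_def sum_distrib_left mult_ac)
    also have "\<dots> = (\<Sum>q\<in>{1..n} \<times> {1..n}. s U V q * (of_bool ((case q of (i, j) \<Rightarrow> \<xi> i j) \<omega>) - p))"
      by (simp add: sum.cartesian_product case_prod_beta)
    finally have eq: "p * cut_dev n p (\<lambda>i j. \<xi> i j \<omega>) U
        = (\<Sum>q\<in>{1..n} \<times> {1..n}. s U V q * (of_bool ((case q of (i, j) \<Rightarrow> \<xi> i j) \<omega>) - p))" .
    have "p * (\<delta> * (real n)^2) \<le> p * cut_dev n p (\<lambda>i j. \<xi> i j \<omega>) U" using ge p
        by (intro mult_left_mono) auto
    then have "\<omega> \<in> E U V" unfolding E_def eq using \<omega> by (simp add: power2_eq_square mult_ac)
    moreover have "V \<subseteq> {1..n}" by (auto simp: V_def)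
    ultimately show "\<omega> \<in> (\<Union>(U, V)\<in>Pow {1..n} \<times> Pow {1..n}. E U V)" using U by auto
  qed
  have "prob {\<omega> \<in> space M. \<exists>U\<subseteq>{1..n}. cut_dev n p (\<lambda>i j. \<xi> i j \<omega>) U \<ge> \<delta> * (real n)^2}
     \<le> prob (\<Union>q\<in>Pow {1..n} \<times> Pow {1..n}. E (fst q) (snd q))"
    using sub Em by (intro finite_measure_mono sets.finite_UN) (auto simp: case_prod_beta)
  also have "\<dots> \<le> (\<Sum>q\<in>Pow {1..n} \<times> Pow {1..n}. prob (E (fst q) (snd q)))"
    using Em by (intro measure_UNION_le) auto
  also have "\<dots> \<le> (\<Sum>q\<in>Pow {1..n} \<times> Pow {1..n}. exp (- (\<delta>^2 * (real n)^2 * p / 4)))"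
    by (intro sum_mono Ep)
  also have "\<dots> = 4^n * exp (- (\<delta>^2 * (real n)^2 * p / 4))"
    by (simp add: card_cartesian_product card_Pow power_mult_distrib[symmetric])
  finally show "prob {\<omega> \<in> space M. \<exists>U\<subseteq>{1..n}. cut_dev n p (\<lambda>i j. \<xi> i j \<omega>) U \<ge> \<delta> * (real n)^2}
      \<le> 4^n * exp (- (\<delta>^2 * (real n)^2 * p / 4))" .
qed

lemma (in prob_space) cut_dev_AE:
  fixes \<xi> :: "nat \<Rightarrow> nat \<Rightarrow> nat \<Rightarrow> 'a \<Rightarrow> bool" and p W :: "nat \<Rightarrow> real"
  assumes rv: "\<And>n i j. \<xi> n i j \<in> measurable M (count_space UNIV)"
    and bern: "\<And>n i j. n \<ge> 2 \<Longrightarrow> i \<in> {1..n} \<Longrightarrow> j \<in> {1..n} \<Longrightarrow> prob {\<omega> \<in> space M. \<xi> n i j \<omega>} = p n"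
    and ind: "\<And>n. n \<ge> 2 \<Longrightarrow> indep_vars (\<lambda>_. count_space UNIV) (\<lambda>(i, j). \<xi> n i j) ({1..n} \<times> {1..n})"
    and p: "\<And>n. n \<ge> 2 \<Longrightarrow> 0 < p n \<and> p n \<le> 1" and W: "\<And>n. n \<ge> 2 \<Longrightarrow> W n \<ge> 1"
    and lim: "filterlim (\<lambda>n. real n * p n / (W n)^2) at_top sequentially" and \<epsilon>: "0 < \<epsilon>" "\<epsilon> \<le> 1"
  shows "AE \<omega> in M. \<forall>\<^sub>F n in sequentially. \<forall>U\<subseteq>{1..n}. W n * cut_dev n (p n) (\<lambda>i j. \<xi> n i j \<omega>) U
      \<le> \<epsilon> * (real n)^2"
proof -
  define A where "A n = (if n \<ge> 2 then {\<omega>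
      \<in> space M. \<exists>U\<subseteq>{1..n}. cut_dev n (p n) (\<lambda>i j. \<xi> n i j \<omega>) U \<ge> (\<epsilon> / W n) * (real n)^2} else
      {})" for n
  have d: "0 < \<epsilon> / W n" "\<epsilon> / W n \<le> 1" if "n \<ge> 2" for n using W[OF that] \<epsilon>
      by (auto simp: divide_le_eq)
  have Am: "A n \<in> events" for n
    unfolding A_def using cut_dev_tail(1)[OF rv bern ind _ _ d] p by auto
  have Ap: "prob (A n) \<le> 4^n * exp (- ((\<epsilon> / W n)^2 * (real n)^2 * p n / 4))" if n: "n \<ge> 2" for n
    unfolding A_def using cut_dev_tail(2)[OF rv bern[OF n] ind[OF n] _ _ d[OF n]] p[OF n] n by auto
  \<comment> \<open>Beyond 16/\<epsilon>^2 the exponent is at least 4n. Since 4 \<le> exp 3, the 4^n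
    pairs of sets use up 3n of it and leave the summable exp(-n).\<close>
  have "\<forall>\<^sub>F n in sequentially. real n * p n / (W n)^2 \<ge> 16 / \<epsilon>^2" using lim
      by (simp add: filterlim_at_top)
  then have "\<forall>\<^sub>F n in sequentially. norm (prob (A n)) \<le> exp (- real n)"
    using eventually_ge_at_top[of 2]
  proof eventually_elim
    case (elim n)
    have "16 \<le> \<epsilon>^2 * (real n * p n / (W n)^2)" using elim(1) \<epsilon>
        by (simp add: divide_le_eq mult.commute)
    then have "real n * 16 \<le> real n * (\<epsilon>^2 * (real n * p n / (W n)^2))"
        by (intro mult_left_mono) auto
    also have "\<dots> = (\<epsilon> / W n)^2 * (real n)^2 * p n" by (simp add: power_divide power2_eq_square)
    finally have x: "4 * real n \<le> (\<epsilon> / W n)^2 * (real n)^2 * p n / 4" by simp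
    have "(4::real) \<le> exp 3" using exp_ge_add_one_self[of 3] by simp
    then have "(4::real)^n \<le> exp 3 ^ n" by (intro power_mono) auto
    then have "prob (A n) \<le> exp 3 ^ n * exp (- (4 * real n))"
      using x by (intro order_trans[OF Ap[OF elim(2)]] mult_mono) auto
    also have "\<dots> = exp (- real n)" by (simp add: exp_of_nat_mult[symmetric] exp_add[symmetric])
    finally show ?case by simp
  qed
  then have "summable (\<lambda>n. prob (A n))" by (rule summable_comparison_test_ev[OF _ summable_exp_neg])
  then have "AE \<omega> in M. \<forall>\<^sub>F n in sequentially. \<omega> \<in> space M - A n"
    by (intro borel_cantelli_AE1 Am) (auto simp: emeasure_eq_measure)
  then show ?thesis
  proof eventually_elim
    case (elim \<omega>)
    then show ?case using eventually_ge_at_top[of 2]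
    proof eventually_elim
      case (elim n)
      have "W n * cut_dev n (p n) (\<lambda>i j. \<xi> n i j \<omega>) U \<le> \<epsilon> * (real n)^2" if "U \<subseteq> {1..n}" for U
      proof -
        have "cut_dev n (p n) (\<lambda>i j. \<xi> n i j \<omega>) U < (\<epsilon> / W n) * (real n)^2"
          using elim that by (auto simp: A_def not_le)
        then have "W n * cut_dev n (p n) (\<lambda>i j. \<xi> n i j \<omega>) U \<le> W n * ((\<epsilon> / W n) * (real n)^2)"
          using W[OF elim(2)] by (intro mult_left_mono) auto
        then show ?thesis using W[OF elim(2)] by simp
      qed
      then show ?case by blast
    qed
  qed
qed

lemma (in prob_space) cut_dev_sequence_AE:
  fixes \<xi> :: "nat \<Rightarrow> nat \<Rightarrow> nat \<Rightarrow> 'a \<Rightarrow> bool" and p W :: "nat \<Rightarrow> real"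
  assumes rv: "\<And>n i j. \<xi> n i j \<in> measurable M (count_space UNIV)"
    and bern: "\<And>n i j. n \<ge> 2 \<Longrightarrow> i \<in> {1..n} \<Longrightarrow> j \<in> {1..n} \<Longrightarrow> prob {\<omega> \<in> space M. \<xi> n i j \<omega>} = p n"
    and ind: "\<And>n. n \<ge> 2 \<Longrightarrow> indep_vars (\<lambda>_. count_space UNIV) (\<lambda>(i, j). \<xi> n i j) ({1..n} \<times> {1..n})"
    and p: "\<And>n. n \<ge> 2 \<Longrightarrow> 0 < p n \<and> p n \<le> 1" and W: "\<And>n. n \<ge> 2 \<Longrightarrow> W n \<ge> 1"
    and lim: "filterlim (\<lambda>n. real n * p n / (W n)^2) at_top sequentially"
  shows "AE \<omega> in M. \<exists>\<delta>. (\<lambda>n. W n * \<delta> n) \<longlonglongrightarrow> 0 \<and>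
     (\<forall>\<^sub>F n in sequentially. \<forall>U\<subseteq>{1..n}. cut_dev n (p n) (\<lambda>i j. \<xi> n i j \<omega>) U \<le> \<delta> n * (real n)^2)"
proof -
  have "AE \<omega> in M. \<forall>k. \<forall>\<^sub>F n in sequentially. \<forall>U\<subseteq>{1..n}.
      W n * cut_dev n (p n) (\<lambda>i j. \<xi> n i j \<omega>) U \<le> (1 / real (Suc k)) * (real n)^2"
    unfolding AE_all_countable by (intro allI cut_dev_AE[OF assms]) auto
  then show ?thesis
  proof eventually_elim
    case (elim \<omega>)
    \<comment> \<open>The exact maximal deviation, hence the smallest admissible sequence. The
      countably many tolerances then show directly that it tends to 0 after multiplication by
      \<open>W\<close>.\<close>
    define \<delta> where "\<delta> n = Max (cut_dev n (p n) (\<lambda>i j. \<xi> n i j \<omega>) ` Pow {1..n}) / (real n)^2" for n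
    have up: "cut_dev n (p n) (\<lambda>i j. \<xi> n i j \<omega>) U \<le> \<delta> n * (real n)^2" if "U \<subseteq> {1..n}" "n \<ge> 2"
        for U n
      using that by (auto simp: \<delta>_def intro!: Max_ge)
    have "(\<lambda>n. W n * \<delta> n) \<longlonglongrightarrow> 0"
    proof (rule LIMSEQ_I)
      fix r :: real assume r: "r > 0"
      obtain k where k: "1 / real (Suc k) < r" using nat_approx_posE[OF r] by blast
      have "\<forall>\<^sub>F n in sequentially. norm (W n * \<delta> n - 0) < r"
        using elim[rule_format, of k] eventually_ge_at_top[of 2]
      proof eventually_elim
        case (elim n)
        have "Max (cut_dev n (p n) (\<lambda>i j. \<xi> n i j \<omega>) ` Pow {1..n})
            \<in> cut_dev n (p n) (\<lambda>i j. \<xi> n i j \<omega>) ` Pow {1..n}"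
          by (intro Max_in) auto
        then obtain U where U: "U \<subseteq> {1..n}" "Max (cut_dev n (p n) (\<lambda>i j. \<xi> n i j \<omega>) ` Pow {1..n})
            = cut_dev n (p n) (\<lambda>i j. \<xi> n i j \<omega>) U" by auto
        have "W n * \<delta> n = W n * cut_dev n (p n) (\<lambda>i j. \<xi> n i j \<omega>) U / (real n)^2"
          unfolding \<delta>_def U(2) by (rule times_divide_eq_right)
        also have "\<dots> \<le> 1 / real (Suc k) * (real n)^2 / (real n)^2" using elim(1) U(1)
            by (intro divide_right_mono) auto
        also have "\<dots> = 1 / real (Suc k)" using elim(2) by simp
        finally have "W n * \<delta> n \<le> 1 / real (Suc k)" .
        moreover have "0 \<le> W n * \<delta> n"
          using W[OF elim(2)] unfolding \<delta>_def U(2)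
              by (auto simp: cut_dev_def intro!: mult_nonneg_nonneg divide_nonneg_nonneg sum_nonneg)
        ultimately show ?case using k by simp
      qed
      then show "\<exists>no. \<forall>n\<ge>no. norm (W n * \<delta> n - 0) < r" by (simp add: eventually_sequentially)
    qed
    moreover have "\<forall>\<^sub>F n in sequentially. \<forall>U\<subseteq>{1..n}. cut_dev n (p n) (\<lambda>i j. \<xi> n i j \<omega>) U
        \<le> \<delta> n * (real n)^2"
      using eventually_ge_at_top[of 2] by eventually_elim (use up in blast)
    ultimately show ?case by blast
  qed
qed

section \<open>Empirical measures seen from fixed vertices\<close>

lemma exp_neg_le_inverse_square:
  assumes "(y::real) > 0" shows "exp (- y) \<le> 4 / y^2"
proof -
  have "y / 2 \<le> exp (y / 2)" using exp_ge_add_one_self[of "y / 2"] by linarith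
  then have "(y / 2)^2 \<le> exp (y / 2)^2" using assms by (intro power_mono) auto
  also have "exp (y / 2)^2 = exp y" by (simp add: exp_double[symmetric])
  finally have "y^2 / 4 \<le> exp y" by (simp add: power_divide)
  then show ?thesis using assms by (simp add: exp_minus field_simps)
qed

text \<open>With an exponent of order at least n^(3/5), the inequality exp(-y) \<le> 4/y^2 gives the
  summable majorant n^(-6/5).\<close>

lemma summable_exp_growth:
  fixes \<rho> :: "nat \<Rightarrow> real"
  assumes "\<forall>\<^sub>F n in sequentially. real n powr (3/5) \<le> real n * \<rho> n" "c > 0"
  shows "summable (\<lambda>n. exp (- (c * (real n * \<rho> n))))"
proof (rule summable_comparison_test_ev)
  show "summable (\<lambda>n. (4 / c^2) * real n powr (- (6/5)))"
    by (intro summable_mult) (simp add: summable_real_powr_iff)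
  show "\<forall>\<^sub>F n in sequentially. norm (exp (- (c * (real n * \<rho> n))))
      \<le> (4 / c^2) * real n powr (- (6/5))"
    using assms(1) eventually_gt_at_top[of 0]
  proof eventually_elim
    case (elim n)
    define y where "y = c * real n powr (3/5)"
    have y: "y > 0" using assms(2) elim(2) by (simp add: y_def)
    have "exp (- (c * (real n * \<rho> n))) \<le> exp (- y)"
      unfolding y_def using elim(1) assms(2) by (simp add: mult_left_mono)
    also have "\<dots> \<le> 4 / y^2" by (rule exp_neg_le_inverse_square[OF y])
    also have "y^2 = c^2 * real n powr (6/5)"
      using elim(2) by (simp add: y_def power_mult_distrib powr_power)
    also have "4 / (c^2 * real n powr (6/5)) = (4 / c^2) * real n powr (- (6/5))"
      by (simp add: powr_minus_divide)
    finally show ?case by simp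
  qed
qed

text \<open>The selected indices are random but independent of the row. Conditioning on the selected
  set \<open>U\<close>, the event splits into \<open>C U\<close>, determined by the positions, and
  \<open>D U\<close>, determined by the edges. The events \<open>C U\<close> are disjoint, so their
  probabilities sum to at most 1 and the union over subsets costs no factor.\<close>

lemma (in prob_space) row_tail:
  fixes X :: "nat \<Rightarrow> 'a \<Rightarrow> bool" and y :: "nat \<Rightarrow> 'a \<Rightarrow> real" and \<beta> :: "real \<Rightarrow> real"
  assumes Fa: "space Fa = space M" and Fb: "space Fb = space M"
      and indep: "indep_set (sets Fa) (sets Fb)"
    and y: "\<And>i. i \<in> {1..n} \<Longrightarrow> y i \<in> borel_measurable Fa"
    and X: "\<And>i. i \<in> {1..n} \<Longrightarrow> X i \<in> measurable Fb (count_space UNIV)"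
    and ind: "indep_vars (\<lambda>_. count_space UNIV) X {1..n}"
    and pr: "\<And>i. i \<in> {1..n} \<Longrightarrow> prob {\<omega> \<in> space M. X i \<omega>} = \<rho>" and \<rho>: "0 \<le> \<rho>" "\<rho> \<le> 1"
    and \<beta>: "\<beta> \<in> borel_measurable borel" "\<And>z. \<beta> z = 0 \<or> \<beta> z = 1" and \<epsilon>: "0 < \<epsilon>" "\<epsilon> \<le> 1"
  shows "{\<omega> \<in> space M. \<epsilon> * real n * \<rho> \<le> \<bar>\<Sum>i=1..n. \<beta> (y i \<omega>) * (of_bool (X i \<omega>) - \<rho>)\<bar>} \<in> events"
    and "prob {\<omega> \<in> space M. \<epsilon> * real n * \<rho> \<le> \<bar>\<Sum>i=1..n. \<beta> (y i \<omega>) * (of_bool (X i \<omega>) - \<rho>)\<bar>}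
      \<le> 2 * exp (- (\<epsilon>^2 * real n * \<rho> / 4))"
proof -
  have sub: "sets Fa \<subseteq> events" "sets Fb \<subseteq> events" using indep
      by (auto simp: indep_set_def indep_sets_def split: bool.splits)
  define C where "C U = {\<omega> \<in> space M. \<forall>i\<in>{1..n}. \<beta> (y i \<omega>) = (if i \<in> U then 1 else 0)}" for U
  define D where "D U = {\<omega> \<in> space M. \<epsilon> * real n * \<rho> \<le> \<bar>\<Sum>i=1..n. (if i
      \<in> U then 1 else 0) * (of_bool (X i \<omega>) - \<rho>)\<bar>}" for U
  have CFa: "C U \<in> sets Fa" for U
  proof -
    have "{\<omega> \<in> space Fa. \<forall>i\<in>{1..n}. \<beta> (y i \<omega>) = (if i \<in> U then 1 else 0)} \<in> sets Fa"
    proof (rule sets.sets_Collect_finite_All)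
      fix i assume i: "i \<in> {1..n}"
      have [measurable]: "(\<lambda>\<omega>. \<beta> (y i \<omega>)) \<in> borel_measurable Fa"
          by (rule measurable_compose[OF y[OF i] \<beta>(1)])
      show "{\<omega> \<in> space Fa. \<beta> (y i \<omega>) = (if i \<in> U then 1 else 0)} \<in> sets Fa" by measurable
    qed auto
    then show ?thesis by (simp add: C_def Fa)
  qed
  have DFb: "D U \<in> sets Fb" for U
  proof -
    have [measurable]: "(\<lambda>\<omega>. \<Sum>i=1..n. (if i \<in> U then 1 else 0) * (of_bool (X i \<omega>) - \<rho>))
        \<in> borel_measurable Fb"
    proof (rule borel_measurable_sum)
      fix i assume "i \<in> {1..n}"
      from X[OF this] show "(\<lambda>\<omega>. (if i \<in> U then 1 else 0) * (of_bool (X i \<omega>) - \<rho>))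
          \<in> borel_measurable Fb"
        by (rule measurable_compose[where g = "\<lambda>b. (if i \<in> U then 1 else 0) * (of_bool b
            - \<rho>)"]) simp
    qed
    have "{\<omega> \<in> space Fb. \<epsilon> * real n * \<rho> \<le> \<bar>\<Sum>i=1..n. (if i \<in> U then 1 else 0) * (of_bool (X i \<omega>)
        - \<rho>)\<bar>} \<in> sets Fb"
      by measurable
    then show ?thesis by (simp add: D_def Fb)
  qed
  have eq: "{\<omega> \<in> space M. \<epsilon> * real n * \<rho> \<le> \<bar>\<Sum>i=1..n. \<beta> (y i \<omega>) * (of_bool (X i \<omega>) - \<rho>)\<bar>}
      = (\<Union>U\<in>Pow {1..n}. C U \<inter> D U)"
  proof (intro set_eqI iffI)
    fix \<omega> assume a: "\<omega> \<in> {\<omega> \<in> space M. \<epsilon> * real n * \<rho> \<le> \<bar>\<Sum>i=1..n. \<beta> (y i \<omega>) * (of_bool (X i \<omega>)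
        - \<rho>)\<bar>}"
    define U where "U = {i \<in> {1..n}. \<beta> (y i \<omega>) = 1}"
    have be: "\<beta> (y i \<omega>) = (if i \<in> U then 1 else 0)" if "i \<in> {1..n}" for i
        using \<beta>(2)[of "y i \<omega>"] that by (auto simp: U_def)
    then have "\<omega> \<in> C U" using a unfolding C_def by blast
    moreover have "(\<Sum>i=1..n. \<beta> (y i \<omega>) * (of_bool (X i \<omega>) - \<rho>)) = (\<Sum>i=1..n. (if i
        \<in> U then 1 else 0) * (of_bool (X i \<omega>) - \<rho>))"
      using be by (intro sum.cong) auto
    then have "\<omega> \<in> D U" using a unfolding D_def by (simp only: mem_Collect_eq)
    moreover have "U \<in> Pow {1..n}" by (auto simp: U_def)
    ultimately show "\<omega> \<in> (\<Union>U\<in>Pow {1..n}. C U \<inter> D U)" by blast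
  next
    fix \<omega> assume "\<omega> \<in> (\<Union>U\<in>Pow {1..n}. C U \<inter> D U)"
    then obtain U where U: "\<omega> \<in> C U" "\<omega> \<in> D U" by blast
    then have "(\<Sum>i=1..n. \<beta> (y i \<omega>) * (of_bool (X i \<omega>) - \<rho>)) = (\<Sum>i=1..n. (if i
        \<in> U then 1 else 0) * (of_bool (X i \<omega>) - \<rho>))"
      by (intro sum.cong) (auto simp: C_def)
    then show "\<omega> \<in> {\<omega> \<in> space M. \<epsilon> * real n * \<rho> \<le> \<bar>\<Sum>i=1..n. \<beta> (y i \<omega>) * (of_bool (X i \<omega>) - \<rho>)\<bar>}"
        using U(2) by (simp add: D_def)
  qed
  have CDe: "C U \<in> events" "D U \<in> events" for U using CFa DFb sub by blast+
  show "{\<omega> \<in> space M. \<epsilon> * real n * \<rho> \<le> \<bar>\<Sum>i=1..n. \<beta> (y i \<omega>) * (of_bool (X i \<omega>) - \<rho>)\<bar>} \<in> events"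
    unfolding eq using CDe by (intro sets.finite_UN) auto
  have DP: "prob (D U) \<le> 2 * exp (- (\<epsilon>^2 * real n * \<rho> / 4))" for U
  proof -
    define s where "s i = (if i \<in> U then 1 else 0 :: real)" for i
    define E1 where "E1 = {\<omega> \<in> space M. \<epsilon> * real (card {1..n}) * \<rho>
        \<le> (\<Sum>i\<in>{1..n}. s i * (of_bool (X i \<omega>) - \<rho>))}"
    define E2 where "E2 = {\<omega> \<in> space M. \<epsilon> * real (card {1..n}) * \<rho> \<le> (\<Sum>i\<in>{1..n}.
        - s i * (of_bool (X i \<omega>) - \<rho>))}"
    have Xm: "X i \<in> measurable M (count_space UNIV)" if "i \<in> {1..n}" for i using ind that
        by (auto simp: indep_vars_def)
    have sm: "(\<lambda>\<omega>. \<Sum>i\<in>{1..n}. v i * (of_bool (X i \<omega>) - \<rho>)) \<in> borel_measurable M"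
        for v :: "nat \<Rightarrow> real"
    proof (rule borel_measurable_sum)
      fix i assume "i \<in> {1..n}"
      from Xm[OF this] show "(\<lambda>\<omega>. v i * (of_bool (X i \<omega>) - \<rho>)) \<in> borel_measurable M"
        by (rule measurable_compose[where g = "\<lambda>b. v i * (of_bool b - \<rho>)"]) simp
    qed
    have [measurable]: "E1 \<in> events" "E2 \<in> events"
      unfolding E1_def E2_def using sm[of s] sm[of "\<lambda>i. - s i"] by measurable
    have "prob E1 \<le> exp (- (\<epsilon>^2 * real (card {1..n}) * \<rho> / 4))"
      unfolding E1_def by (rule bernoulli_chernoff[OF _ ind pr \<rho> _ \<epsilon>]) (auto simp: s_def)
    moreover have "prob E2 \<le> exp (- (\<epsilon>^2 * real (card {1..n}) * \<rho> / 4))"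
      unfolding E2_def by (rule bernoulli_chernoff[OF _ ind pr \<rho> _ \<epsilon>]) (auto simp: s_def)
    moreover have "prob (D U) \<le> prob (E1 \<union> E2)"
    proof (rule finite_measure_mono)
      show "D U \<subseteq> E1 \<union> E2"
      proof
        fix \<omega> assume "\<omega> \<in> D U"
        then have a: "\<omega> \<in> space M" "\<epsilon> * real n * \<rho> \<le> \<bar>\<Sum>i=1..n. s i * (of_bool (X i \<omega>) - \<rho>)\<bar>"
            by (auto simp: D_def s_def)
        have "(\<Sum>i\<in>{1..n}. - s i * (of_bool (X i \<omega>) - \<rho>)) = - (\<Sum>i=1..n. s i * (of_bool (X i \<omega>) - \<rho>))"
          by (simp add: sum_negf)
        then show "\<omega> \<in> E1 \<union> E2" using a unfolding E1_def E2_def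
            by (auto simp: abs_if split: if_splits)
      qed
    qed simp
    moreover have "prob (E1 \<union> E2) \<le> prob E1 + prob E2" by (rule measure_Un_le) auto
    ultimately show ?thesis by simp
  qed
  have disj: "disjoint_family_on C (Pow {1..n})"
    unfolding disjoint_family_on_def
  proof (intro ballI impI)
    fix U V assume UV: "U \<in> Pow {1..n}" "V \<in> Pow {1..n}" "U \<noteq> V"
    then obtain i where i: "i \<in> {1..n}" "(i \<in> U) \<noteq> (i \<in> V)" by blast
    then show "C U \<inter> C V = {}" by (auto simp: C_def split: if_splits)
  qed
  have "prob (\<Union>U\<in>Pow {1..n}. C U \<inter> D U) \<le> (\<Sum>U\<in>Pow {1..n}. prob (C U \<inter> D U))"
    using CDe by (intro measure_UNION_le) auto
  also have "\<dots> = (\<Sum>U\<in>Pow {1..n}. prob (C U) * prob (D U))"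
    using indep_setD[OF indep CFa DFb] by simp
  also have "\<dots> \<le> (\<Sum>U\<in>Pow {1..n}. prob (C U) * (2 * exp (- (\<epsilon>^2 * real n * \<rho> / 4))))"
    by (intro sum_mono mult_left_mono DP) auto
  also have "\<dots> = (\<Sum>U\<in>Pow {1..n}. prob (C U)) * (2 * exp (- (\<epsilon>^2 * real n * \<rho> / 4)))"
      by (rule sum_distrib_right[symmetric])
  also have "\<dots> \<le> 1 * (2 * exp (- (\<epsilon>^2 * real n * \<rho> / 4)))"
  proof (rule mult_right_mono)
    have "(\<Sum>U\<in>Pow {1..n}. prob (C U)) = prob (\<Union>U\<in>Pow {1..n}. C U)"
      using CDe disj by (intro finite_measure_finite_Union[symmetric]) auto
    then show "(\<Sum>U\<in>Pow {1..n}. prob (C U)) \<le> 1" using prob_le_1 by simp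
  qed simp
  finally show "prob {\<omega> \<in> space M. \<epsilon> * real n * \<rho> \<le> \<bar>\<Sum>i=1..n. \<beta> (y i \<omega>) * (of_bool (X i \<omega>) - \<rho>)\<bar>}
      \<le> 2 * exp (- (\<epsilon>^2 * real n * \<rho> / 4))" unfolding eq by simp
qed

lemma (in prob_space) row_AE:
  fixes X :: "nat \<Rightarrow> nat \<Rightarrow> 'a \<Rightarrow> bool" and y :: "nat \<Rightarrow> nat \<Rightarrow> 'a \<Rightarrow> real" and \<beta> :: "real \<Rightarrow> real"
      and \<rho> :: "nat \<Rightarrow> real"
  assumes Fa: "space Fa = space M" and Fb: "space Fb = space M"
      and indep: "indep_set (sets Fa) (sets Fb)"
    and y: "\<And>n i. y n i \<in> borel_measurable Fa"
    and X: "\<And>n i. X n i \<in> measurable Fb (count_space UNIV)"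
    and ind: "\<And>n. n \<ge> n0 \<Longrightarrow> indep_vars (\<lambda>_. count_space UNIV) (X n) {1..n}"
    and pr: "\<And>n i. n \<ge> n0 \<Longrightarrow> i \<in> {1..n} \<Longrightarrow> prob {\<omega> \<in> space M. X n i \<omega>} = \<rho> n"
    and \<rho>: "\<And>n. n \<ge> n0 \<Longrightarrow> 0 < \<rho> n \<and> \<rho> n \<le> 1"
    and growth: "\<forall>\<^sub>F n in sequentially. real n powr (3/5) \<le> real n * \<rho> n"
    and \<beta>: "\<beta> \<in> borel_measurable borel" "\<And>z. \<beta> z = 0 \<or> \<beta> z = 1"
  shows "AE \<omega> in M. (\<lambda>n. \<Sum>i=1..n. ((if X n i \<omega> then 1 / (real n * \<rho> n) else 0) - 1 / real n) * \<beta>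
      (y n i \<omega>)) \<longlonglongrightarrow> 0"
proof -
  define Z where "Z n \<omega> = (\<Sum>i=1..n. \<beta> (y n i \<omega>) * (of_bool (X n i \<omega>) - \<rho> n))" for n \<omega>
  have ae: "AE \<omega> in M. \<forall>\<^sub>F n in sequentially. \<bar>Z n \<omega>\<bar> \<le> \<epsilon> * real n * \<rho> n" if \<epsilon>: "0 < \<epsilon>" "\<epsilon> \<le> 1"
      for \<epsilon>
  proof -
    define A where "A n = (if n \<ge> n0 then {\<omega> \<in> space M. \<epsilon> * real n * \<rho> n \<le> \<bar>Z n \<omega>\<bar>} else {})" for n
    have t1: "{\<omega> \<in> space M. \<epsilon> * real n * \<rho> n \<le> \<bar>Z n \<omega>\<bar>} \<in> events" if n: "n \<ge> n0" for n
      unfolding Z_def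
      by (rule row_tail(1)[OF Fa Fb indep y X ind[OF n] pr[OF n] _ _ \<beta> \<epsilon>]) (use \<rho>[OF n] in auto)
    have t2: "prob {\<omega> \<in> space M. \<epsilon> * real n * \<rho> n \<le> \<bar>Z n \<omega>\<bar>}
        \<le> 2 * exp (- (\<epsilon>^2 * real n * \<rho> n / 4))" if n: "n \<ge> n0" for n
      unfolding Z_def
      by (rule row_tail(2)[OF Fa Fb indep y X ind[OF n] pr[OF n] _ _ \<beta> \<epsilon>]) (use \<rho>[OF n] in auto)
    have Am: "A n \<in> events" for n using t1 by (simp add: A_def)
    have "summable (\<lambda>n. exp (- ((\<epsilon>^2 / 4) * (real n * \<rho> n))))"
      by (rule summable_exp_growth[OF growth]) (use \<epsilon> in simp)
    then have "summable (\<lambda>n. 2 * exp (- (\<epsilon>^2 * real n * \<rho> n / 4)))"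
      using summable_mult[of _ 2] by (simp add: mult_ac)
    moreover have "\<forall>\<^sub>F n in sequentially. norm (prob (A n)) \<le> 2 * exp (- (\<epsilon>^2 * real n * \<rho> n / 4))"
      using eventually_ge_at_top[of n0] by eventually_elim (use t2 in \<open>simp add: A_def\<close>)
    ultimately have "summable (\<lambda>n. prob (A n))" by (rule summable_comparison_test_ev[rotated])
    then have "AE \<omega> in M. \<forall>\<^sub>F n in sequentially. \<omega> \<in> space M - A n"
      by (intro borel_cantelli_AE1 Am) (auto simp: emeasure_eq_measure)
    then show ?thesis
    proof eventually_elim
      case (elim \<omega>)
      then show ?case using eventually_ge_at_top[of n0]
        by eventually_elim (auto simp: A_def not_le intro: less_imp_le)
    qed
  qed
  have "AE \<omega> in M. \<forall>k. \<forall>\<^sub>F n in sequentially. \<bar>Z n \<omega>\<bar> \<le> (1 / real (Suc k)) * real n * \<rho> n"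
    unfolding AE_all_countable by (intro allI ae) auto
  then show ?thesis
  proof eventually_elim
    case (elim \<omega>)
    have zz: "(\<Sum>i=1..n. ((if X n i \<omega> then 1 / (real n * \<rho> n) else 0) - 1 / real n) * \<beta> (y n i \<omega>))
        = Z n \<omega> / (real n * \<rho> n)"
      if "n \<ge> n0" for n
      unfolding Z_def sum_divide_distrib using \<rho>[OF that]
      by (intro sum.cong refl) (auto simp: field_simps)
    show ?case
    proof (rule LIMSEQ_I)
      fix r :: real assume r: "r > 0"
      obtain k where k: "1 / real (Suc k) < r" using nat_approx_posE[OF r] by blast
      have "\<forall>\<^sub>F n in sequentially. norm ((\<Sum>i=1..n. ((if X n i \<omega> then 1 / (real n * \<rho> n) else 0) -
          1 / real n) * \<beta> (y n i \<omega>)) - 0) < r"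
        using elim[rule_format, of k] eventually_ge_at_top[of "max 1 n0"]
      proof eventually_elim
        case (elim n)
        have n: "n \<ge> n0" "real n > 0" using elim(2) by auto
        have np: "real n * \<rho> n > 0" using n \<rho>[OF n(1)] by simp
        have "\<bar>Z n \<omega> / (real n * \<rho> n)\<bar> = \<bar>Z n \<omega>\<bar> / (real n * \<rho> n)" using np
            by (simp add: abs_divide)
        also have "\<dots> \<le> 1 / real (Suc k)" using elim(1) np by (simp add: divide_le_eq mult.assoc)
        finally show ?case unfolding zz[OF n(1)] using k by simp
      qed
      then show "\<exists>no. \<forall>n\<ge>no. norm ((\<Sum>i=1..n. ((if X n i \<omega> then 1 / (real n * \<rho> n) else 0) - 1 /
          real n) * \<beta> (y n i \<omega>)) - 0) < r"
        by (simp add: eventually_sequentially)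
    qed
  qed
qed

text \<open>Countably many arcs control all test functions: with \<open>K\<close> arcs the error is
  at most 2 pi/K times the total variation, uniformly in the test function. The total mass is a
  separate hypothesis because it multiplies the constant part of \<open>f\<close>.\<close>

lemma BL_discrepancy_tendsto:
  fixes c y :: "nat \<Rightarrow> nat \<Rightarrow> real"
  assumes st: "\<And>K a. (\<lambda>n. \<Sum>i=1..n. c n i * stp K a (y n i)) \<longlonglongrightarrow> 0"
    and m: "(\<lambda>n. \<Sum>i=1..n. c n i) \<longlonglongrightarrow> 0" and b: "\<forall>\<^sub>F n in sequentially. (\<Sum>i=1..n. \<bar>c n i\<bar>) \<le> C"
  shows "\<exists>\<Delta>. \<Delta> \<longlonglongrightarrow> 0 \<and> (\<forall>n. \<forall>f\<in>BL_test. \<bar>\<Sum>i=1..n. c n i * f (y n i)\<bar> \<le> \<Delta> n)"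
proof -
  define \<Delta> where "\<Delta> n = (SUP f\<in>BL_test. \<bar>\<Sum>i=1..n. c n i * f (y n i)\<bar>)" for n
  have ub: "\<bar>\<Sum>i=1..n. c n i * f (y n i)\<bar> \<le> (\<Sum>i=1..n. \<bar>c n i\<bar>)" if "f \<in> BL_test" for f n
    using that by (intro order_trans[OF sum_abs] sum_mono) (auto simp: abs_mult BL_test_def
        intro!: mult_left_le)
  have bdd: "bdd_above ((\<lambda>f. \<bar>\<Sum>i=1..n. c n i * f (y n i)\<bar>) ` BL_test)" for n
    using ub by (intro bdd_aboveI2[where M = "\<Sum>i=1..n. \<bar>c n i\<bar>"]) auto
  have up: "\<bar>\<Sum>i=1..n. c n i * f (y n i)\<bar> \<le> \<Delta> n" if "f \<in> BL_test" for f n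
    unfolding \<Delta>_def by (rule cSUP_upper[OF that bdd])
  have le: "\<Delta> n \<le> \<bar>\<Sum>i=1..n. c n i\<bar> + 2 * pi / real K * (\<Sum>a<K. \<bar>\<Sum>i=1..n. c n i * stp K a (y n i)\<bar>)
     + 2 * pi / real K * (\<Sum>i=1..n. \<bar>c n i\<bar>)" if K: "K > 0" for n K
    unfolding \<Delta>_def
  proof (rule cSUP_least)
    show "BL_test \<noteq> {}" using zero_BL_test by blast
    fix f assume f: "f \<in> BL_test"
    show "\<bar>\<Sum>i=1..n. c n i * f (y n i)\<bar> \<le> \<bar>\<Sum>i=1..n. c n i\<bar>
        + 2 * pi / real K * (\<Sum>a<K. \<bar>\<Sum>i=1..n. c n i * stp K a (y n i)\<bar>)
     + 2 * pi / real K * (\<Sum>i=1..n. \<bar>c n i\<bar>)"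
      using step_weighted_bound[of 1 f 1 K "c n" "y n" "{1..n}"] f K by (simp add: BL_test_iff)
  qed
  have "\<Delta> \<longlonglongrightarrow> 0"
  proof (rule LIMSEQ_I)
    fix r :: real assume r: "r > 0"
    obtain K :: nat where K': "4 * pi * \<bar>C\<bar> / r < real K" using reals_Archimedean2 by blast
    moreover have "0 \<le> 4 * pi * \<bar>C\<bar> / r" using r by simp
    ultimately have K: "K > 0" by (auto intro!: gr0I)
    have CK: "2 * pi / real K * \<bar>C\<bar> < r / 2" using K' K r by (simp add: field_simps)
    define H where "H n = \<bar>\<Sum>i=1..n. c n i\<bar>
        + 2 * pi / real K * (\<Sum>a<K. \<bar>\<Sum>i=1..n. c n i * stp K a (y n i)\<bar>)" for n
    have "H \<longlonglongrightarrow> \<bar>0\<bar> + 2 * pi / real K * (\<Sum>a<K. \<bar>0\<bar>)"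
      unfolding H_def by (intro tendsto_add tendsto_mult tendsto_const tendsto_rabs tendsto_sum m
          st)
    then have "\<forall>\<^sub>F n in sequentially. H n < r / 2" using r by (intro order_tendstoD(2)) auto
    then have "\<forall>\<^sub>F n in sequentially. norm (\<Delta> n - 0) < r"
      using b
    proof eventually_elim
      case (elim n)
      have "2 * pi / real K * (\<Sum>i=1..n. \<bar>c n i\<bar>) \<le> 2 * pi / real K * \<bar>C\<bar>" using elim(2)
          by (intro mult_left_mono) auto
      then have "\<Delta> n < r" using le[OF K, of n] elim(1) CK unfolding H_def by linarith
      moreover have "0 \<le> \<Delta> n" using up[OF zero_BL_test, of n] by linarith
      ultimately show ?case by simp
    qed
    then show "\<exists>no. \<forall>n\<ge>no. norm (\<Delta> n - 0) < r" by (simp add: eventually_sequentially)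
  qed
  then show ?thesis using up by blast
qed

lemma (in prob_space) row_discrepancy_AE:
  fixes X :: "nat \<Rightarrow> nat \<Rightarrow> 'a \<Rightarrow> bool" and y :: "nat \<Rightarrow> nat \<Rightarrow> 'a \<Rightarrow> real" and \<rho> :: "nat \<Rightarrow> real"
  assumes Fa: "space Fa = space M" and Fb: "space Fb = space M"
      and indep: "indep_set (sets Fa) (sets Fb)"
    and y: "\<And>n i. y n i \<in> borel_measurable Fa"
    and X: "\<And>n i. X n i \<in> measurable Fb (count_space UNIV)"
    and ind: "\<And>n. n \<ge> n0 \<Longrightarrow> indep_vars (\<lambda>_. count_space UNIV) (X n) {1..n}"
    and pr: "\<And>n i. n \<ge> n0 \<Longrightarrow> i \<in> {1..n} \<Longrightarrow> prob {\<omega> \<in> space M. X n i \<omega>} = \<rho> n"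
    and \<rho>: "\<And>n. n \<ge> n0 \<Longrightarrow> 0 < \<rho> n \<and> \<rho> n \<le> 1"
    and growth: "\<forall>\<^sub>F n in sequentially. real n powr (3/5) \<le> real n * \<rho> n"
  shows "AE \<omega> in M. (\<forall>\<^sub>F n in sequentially. (\<Sum>i=1..n. if X n i \<omega> then 1 / (real n * \<rho> n) else 0)
      \<le> 2) \<and>
    (\<exists>\<Delta>. \<Delta> \<longlonglongrightarrow> 0 \<and> (\<forall>n. \<forall>f\<in>BL_test.
       \<bar>\<Sum>i=1..n. ((if X n i \<omega> then 1 / (real n * \<rho> n) else 0) - 1 / real n) * f (y n i \<omega>)\<bar> \<le> \<Delta> n))"
proof -
  define c where "c \<omega> n i = (if X n i \<omega> then 1 / (real n * \<rho> n) else 0) - 1 / real n" for \<omega> n i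
  \<comment> \<open>The constant choice of \<beta> yields the total mass; for \<open>K > 0\<close>
    the arcs all omit the angle 0 and do not provide it.\<close>
  have 1: "AE \<omega> in M. (\<lambda>n. \<Sum>i=1..n. c \<omega> n i * 1) \<longlonglongrightarrow> 0"
    unfolding c_def by (rule row_AE[OF assms, where \<beta> = "\<lambda>_. 1"]) auto
  have 2: "AE \<omega> in M. \<forall>K a. (\<lambda>n. \<Sum>i=1..n. c \<omega> n i * stp K a (y n i \<omega>)) \<longlonglongrightarrow> 0"
    unfolding AE_all_countable c_def by (intro allI row_AE[OF assms]) (auto simp: stp_def)
  from 1 2 show ?thesis
  proof eventually_elim
    case (elim \<omega>)
    have m: "(\<lambda>n. \<Sum>i=1..n. c \<omega> n i) \<longlonglongrightarrow> 0" using elim(1) by simp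
    then have "\<forall>\<^sub>F n in sequentially. (\<Sum>i=1..n. c \<omega> n i) < 1" by (rule order_tendstoD(2)) simp
    then have mass: "\<forall>\<^sub>F n in sequentially. (\<Sum>i=1..n. if X n i \<omega> then 1 / (real n * \<rho> n) else 0)
        \<le> 2"
      using eventually_gt_at_top[of 0]
      by eventually_elim (simp add: c_def sum_subtractf)
    have "\<forall>\<^sub>F n in sequentially. (\<Sum>i=1..n. \<bar>c \<omega> n i\<bar>) \<le> 3"
      using mass eventually_ge_at_top[of "max 1 n0"]
    proof eventually_elim
      case (elim n)
      have "\<bar>c \<omega> n i\<bar> \<le> (if X n i \<omega> then 1 / (real n * \<rho> n) else 0) + 1 / real n" for i
      proof -
        have "0 \<le> 1 / (real n * \<rho> n)" "0 \<le> 1 / real n" using \<rho>[of n] elim(2) by auto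
        moreover have "\<bar>(if Q then a else 0) - b\<bar> \<le> (if Q then a else 0) + b" if "0 \<le> a" "0 \<le> b"
            for Q and a b :: real
          using that by (cases Q) auto
        ultimately show ?thesis unfolding c_def by blast
      qed
      then have "(\<Sum>i=1..n. \<bar>c \<omega> n i\<bar>) \<le> (\<Sum>i=1..n. (if X n i \<omega> then 1 / (real n * \<rho> n) else 0)
          + 1 / real n)"
        by (intro sum_mono)
      also have "\<dots> = (\<Sum>i=1..n. if X n i \<omega> then 1 / (real n * \<rho> n) else 0) + 1" using elim(2)
          by (simp add: sum.distrib)
      finally show ?case using elim(1) by linarith
    qed
    from BL_discrepancy_tendsto[OF _ m this, of "\<lambda>n i. y n i \<omega>"] elim(2) mass
    show ?case unfolding c_def by blast
  qed
qed

section \<open>Bounds for the interaction kernel and conclusion\<close>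

lemma periodic2_continuous_bounded:
  fixes F :: "real \<Rightarrow> real \<Rightarrow> real"
  assumes per: "periodic2 F" and cont: "continuous_on UNIV (\<lambda>z. F (fst z) (snd z))"
  shows "\<exists>C\<ge>1. \<forall>x y. \<bar>F x y\<bar> \<le> C"
proof -
  have "compact ((\<lambda>z. F (fst z) (snd z)) ` ({0..2 * pi} \<times> {0..2 * pi}))"
    by (intro compact_continuous_image continuous_on_subset[OF cont] compact_Times) auto
  then have "bounded ((\<lambda>z. F (fst z) (snd z)) ` ({0..2 * pi} \<times> {0..2 * pi}))"
      by (rule compact_imp_bounded)
  then obtain C where C': "\<forall>b\<in>(\<lambda>z. F (fst z) (snd z)) ` ({0..2 * pi} \<times> {0..2 * pi}). norm b \<le> C"
    unfolding bounded_iff by blast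
  have C: "\<bar>F u v\<bar> \<le> C" if "u \<in> {0..2 * pi}" "v \<in> {0..2 * pi}" for u v
    using C'[rule_format, of "F u v"] that by (force simp: image_iff)
  have "\<bar>F x y\<bar> \<le> max C 1" for x y
  proof -
    have "periodic1 (\<lambda>x. F x y)" "periodic1 (F (rmod x))" using per
        by (auto simp: periodic1_def periodic2_def)
    then have "F x y = F (rmod x) (rmod y)"
        using periodic1_rmod[of "\<lambda>x. F x y" x] periodic1_rmod[of "F (rmod x)" y] by simp
    moreover have "\<bar>F (rmod x) (rmod y)\<bar> \<le> C" using rmod_bounds[of x] rmod_bounds[of y]
        by (intro C) auto
    ultimately show ?thesis by linarith
  qed
  then show ?thesis by (intro exI[of _ "max C 1"]) auto
qed

text \<open>The partial derivatives inherit periodicity from \<open>G\<close> because derivatives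
  are unique; being continuous and periodic they are bounded, which gives the Lipschitz constants by
  the mean value inequality.\<close>

lemma smooth_periodic_bounds:
  assumes sm: "smooth2 G" and per: "periodic2 G"
  shows "\<exists>A L. 1 \<le> A \<and> 1 \<le> L \<and> (\<forall>x y. \<bar>G x y\<bar> \<le> A) \<and> (\<forall>x x' y. \<bar>G x y - G x' y\<bar> \<le> L * \<bar>x - x'\<bar>)
     \<and> (\<forall>x y y'. \<bar>G x y - G x y'\<bar> \<le> L * \<bar>y - y'\<bar>)"
proof -
  obtain D where D0: "D 0 0 = G" and Dc: "\<And>a b. continuous_on UNIV (\<lambda>z. D a b (fst z) (snd z))"
    and Dx: "\<And>a b x y. ((\<lambda>u. D a b u y) has_real_derivative D (Suc a) b x y) (at x)"
    and Dy: "\<And>a b x y. ((\<lambda>v. D a b x v) has_real_derivative D a (Suc b) x y) (at y)"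
    using sm unfolding smooth2_def by blast
  have gx: "((\<lambda>u. G u y) has_real_derivative D (Suc 0) 0 x y) (at x)" for x y using Dx[of 0 0] D0
      by simp
  have gy: "((\<lambda>v. G x v) has_real_derivative D 0 (Suc 0) x y) (at y)" for x y using Dy[of 0 0] D0
      by simp
  have p1: "G (u + 2 * pi) v = G u v" and p2: "G u (v + 2 * pi) = G u v" for u v using per
      by (auto simp: periodic2_def)
  have "periodic2 (D (Suc 0) 0)" unfolding periodic2_def
  proof (intro allI conjI)
    fix x y
    have "((\<lambda>u. G (u + 2 * pi) y) has_real_derivative D (Suc 0) 0 (x + 2 * pi) y) (at x)"
      using gx[of y "x + 2 * pi"] by (simp add: DERIV_shift)
    then show "D (Suc 0) 0 (x + 2 * pi) y = D (Suc 0) 0 x y" using gx[of y x] DERIV_unique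
        by (simp add: p1) blast
    show "D (Suc 0) 0 x (y + 2 * pi) = D (Suc 0) 0 x y" using gx[of "y
        + 2 * pi" x] gx[of y x] DERIV_unique by (simp add: p2) blast
  qed
  then obtain L1 where L1: "L1 \<ge> 1" "\<And>x y. \<bar>D (Suc 0) 0 x y\<bar> \<le> L1"
      using periodic2_continuous_bounded[OF _ Dc] by blast
  have "periodic2 (D 0 (Suc 0))" unfolding periodic2_def
  proof (intro allI conjI)
    fix x y
    have "((\<lambda>v. G x (v + 2 * pi)) has_real_derivative D 0 (Suc 0) x (y + 2 * pi)) (at y)"
      using gy[of x "y + 2 * pi"] by (simp add: DERIV_shift)
    then show "D 0 (Suc 0) x (y + 2 * pi) = D 0 (Suc 0) x y" using gy[of x y] DERIV_unique
        by (simp add: p2) blast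
    show "D 0 (Suc 0) (x + 2 * pi) y = D 0 (Suc 0) x y" using gy[of "x
        + 2 * pi" y] gy[of x y] DERIV_unique by (simp add: p1) blast
  qed
  then obtain L2 where L2: "L2 \<ge> 1" "\<And>x y. \<bar>D 0 (Suc 0) x y\<bar> \<le> L2"
      using periodic2_continuous_bounded[OF _ Dc] by blast
  have "continuous_on UNIV (\<lambda>z. G (fst z) (snd z))" using Dc[of 0 0] by (simp add: D0)
  then obtain A where A: "A \<ge> 1" "\<And>x y. \<bar>G x y\<bar> \<le> A" using periodic2_continuous_bounded[OF per]
      by blast
  define L where "L = max L1 L2"
  have "norm (G x y - G x' y) \<le> L * norm (x - x')" for x x' y
    by (rule field_differentiable_bound[of UNIV "\<lambda>u. G u y" "\<lambda>u. D (Suc 0) 0 u y"])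
       (use gx L1(2) in \<open>auto simp: L_def intro: le_max_iff_disj[THEN iffD2]\<close>)
  moreover have "norm (G x y - G x y') \<le> L * norm (y - y')" for x y y'
    by (rule field_differentiable_bound[of UNIV "\<lambda>v. G x v" "\<lambda>v. D 0 (Suc 0) x v"])
       (use gy L2(2) in \<open>auto simp: L_def intro: le_max_iff_disj[THEN iffD2]\<close>)
  moreover have "1 \<le> L" using L1(1) by (simp add: L_def)
  ultimately show ?thesis using A unfolding real_norm_def by blast
qed

text \<open>Carries \<open>gen_sigma\<close> as the sigma-algebra of a measure space, so that
  measurability with respect to it can be expressed by \<open>measurable\<close>.\<close>

definition gen_meas :: "'w measure \<Rightarrow> ('i \<Rightarrow> 'w \<Rightarrow> 'b) \<Rightarrow> 'b measure \<Rightarrow> 'w measure" where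
  "gen_meas P X N = sigma (space P) (\<Union>i. {X i -` A \<inter> space P | A. A \<in> sets N})"

lemma gen_meas: "space (gen_meas P X N) = space P" "sets (gen_meas P X N) = gen_sigma P X N"
proof -
  have "(\<Union>i. {X i -` A \<inter> space P | A. A \<in> sets N}) \<subseteq> Pow (space P)" by auto
  then show "space (gen_meas P X N) = space P" "sets (gen_meas P X N) = gen_sigma P X N"
    unfolding gen_meas_def gen_sigma_def by (simp_all add: space_measure_of sets_measure_of)
qed

lemma gen_meas_measurable:
  assumes "X i \<in> measurable P N" shows "X i \<in> measurable (gen_meas P X N) N"
proof (rule measurableI)
  show "X i w \<in> space N" if "w \<in> space (gen_meas P X N)" for w
    using that assms by (simp add: gen_meas measurable_space)
  show "X i -` A \<inter> space (gen_meas P X N) \<in> sets (gen_meas P X N)" if "A \<in> sets N" for A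
    unfolding gen_meas gen_sigma_def using that by (intro sigma_sets.Basic) auto
qed

lemma filterlim_inverse_sqrt:
  assumes "filterlim f at_top sequentially" shows "(\<lambda>n. 1 / sqrt (f n)) \<longlonglongrightarrow> 0"
  by (intro tendsto_divide_0[OF tendsto_const] filterlim_at_top_imp_at_infinity
      filterlim_compose[OF sqrt_at_top assms])

text \<open>From 1 \<le> n z^k one gets z^a \<ge> n^(-a/k). The cases used are a/k = 1/3 and a/k =
  2/5; the larger one leaves the exponent 3/5, enough for the Borel-Cantelli argument on one
  row.\<close>

lemma growth_exponent:
  fixes z :: real
  assumes n: "n \<ge> 1" and z: "0 < z" and k: "k > 0" "1 \<le> real n * z ^ k" and a: "0 \<le> a" "a / real k
      \<le> 2/5"
  shows "real n powr (3/5) \<le> real n * z powr a"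
proof -
  have np: "real n > 0" using n by simp
  have "1 / real n \<le> z ^ k" using k np by (simp add: divide_le_eq mult.commute)
  then have "(1 / real n) powr (a / real k) \<le> (z ^ k) powr (a / real k)" using a k np
      by (intro powr_mono2) auto
  also have "(z ^ k) powr (a / real k) = z powr a" using z k
      by (simp add: powr_realpow[symmetric] powr_powr)
  finally have 1: "(1 / real n) powr (a / real k) \<le> z powr a" .
  have "real n powr (3/5) = real n powr 1 * real n powr (- (2/5))" unfolding powr_add[symmetric]
      by simp
  also have "\<dots> \<le> real n * real n powr (- (a / real k))"
    using a n by (simp add: powr_mono)
  also have "real n powr (- (a / real k)) = (1 / real n) powr (a / real k)"
    using np by (simp add: powr_minus_divide powr_divide)
  also have "real n * (1 / real n) powr (a / real k) \<le> real n * z powr a" using 1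
      by (intro mult_left_mono) auto
  finally show ?thesis .
qed

theorem mainTheorem1:
  fixes P :: "'w measure" and M :: "'m measure"
    and p :: "nat \<Rightarrow> real" and T :: real
    and \<Gamma> :: "real \<Rightarrow> real \<Rightarrow> real"
    and \<xi> :: "nat \<Rightarrow> nat \<Rightarrow> nat \<Rightarrow> 'w \<Rightarrow> bool"
    and \<theta>0 :: "nat \<Rightarrow> nat \<Rightarrow> 'w \<Rightarrow> real"
    and B :: "nat \<Rightarrow> 'm \<Rightarrow> real \<Rightarrow> real"
    and \<theta> :: "nat \<Rightarrow> nat \<Rightarrow> 'w \<Rightarrow> 'm \<Rightarrow> real \<Rightarrow> real"
    and \<mu>0 :: "real measure" and \<mu> :: "real \<Rightarrow> real measure"
  assumes T_pos: "T > 0"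
    and p_range: "\<And>n. n \<ge> 2 \<Longrightarrow> 0 < p n \<and> p n \<le> 1"
    and Gamma_smooth: "smooth2 \<Gamma>" and Gamma_per: "periodic2 \<Gamma>"
    and P_prob: "prob_space P"
    and graph_rv: "\<And>n i j. (\<xi> n i j) \<in> measurable P (count_space UNIV)"
    and graph_bern: "\<And>n i j. n \<ge> 2 \<Longrightarrow> i \<in> {1..n} \<Longrightarrow> j \<in> {1..n} \<Longrightarrow>
        measure P {\<omega> \<in> space P. \<xi> n i j \<omega>} = p n"
    and graph_indep: "\<And>n. n \<ge> 2 \<Longrightarrow> prob_space.indep_vars P (\<lambda>_. count_space UNIV)
        (\<lambda>(i, j). \<xi> n i j) ({1..n} \<times> {1..n})"
    and init_rv: "\<And>n i. \<theta>0 n i \<in> borel_measurable P"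
    and A0: "AE \<omega> in P. (\<lambda>n. d_BL (emp_measure n (\<lambda>_. 1 / real n) (\<lambda>i. \<theta>0 n i \<omega>)) \<mu>0)
        \<longlonglongrightarrow> 0"
    and mu0_prob: "prob_space \<mu>0" and mu0_sets: "sets \<mu>0 = sets borel"
    and BM: "BM_family M B"
    and particles: "\<And>n i \<omega> \<omega>'. n \<ge> 2 \<Longrightarrow> i \<in> {1..n} \<Longrightarrow> \<omega> \<in> space P \<Longrightarrow> \<omega>' \<in> space M \<Longrightarrow>
        continuous_on {0..T} (\<theta> n i \<omega> \<omega>') \<and>
        (\<forall>t\<in>{0..T}. \<theta> n i \<omega> \<omega>' t = \<theta>0 n i \<omega> +
           integral {0..t} (\<lambda>s. (1 / (real n * p n)) *
             (\<Sum>j=1..n. if \<xi> n i j \<omega> then \<Gamma> (\<theta> n i \<omega> \<omega>' s) (\<theta> n j \<omega> \<omega>' s) else 0))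
           + B i \<omega>' t)"
    and limit_eq: "mckean_vlasov_sol \<Gamma> T \<mu>0 \<mu>"
  shows
    "(filterlim (\<lambda>n. real n * p n) at_top sequentially \<longrightarrow>
        (\<forall>q::real\<ge>1. AE \<omega> in P.
          (\<lambda>n. \<integral>\<^sup>+ \<omega>'. ennreal ((SUP s\<in>{0..T}.
              d_BL (emp_measure n (\<lambda>_. 1 / real n) (\<lambda>i. \<theta> n i \<omega> \<omega>' s)) (\<mu> s)) powr q) \<partial>M)
          \<longlonglongrightarrow> 0))
     \<and>
     (prob_space.indep_set P
         (gen_sigma P (\<lambda>(n, i). \<theta>0 n i) borel)
         (gen_sigma P (\<lambda>(n, i, j). \<xi> n i j) (count_space UNIV))
      \<longrightarrow>
      (filterlim (\<lambda>n. real n * p n ^ 3) at_top sequentially \<longrightarrow>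
        (\<forall>l::nat\<ge>1. \<forall>q::real\<ge>1. AE \<omega> in P.
          (\<lambda>n. \<integral>\<^sup>+ \<omega>'. ennreal ((SUP s\<in>{0..T}.
              d_BL (emp_measure n (\<lambda>i. if \<xi> n l i \<omega> then 1 / (real n * p n) else 0)
                      (\<lambda>i. \<theta> n i \<omega> \<omega>' s)) (\<mu> s)) powr q) \<partial>M)
          \<longlonglongrightarrow> 0))
      \<and>
      (filterlim (\<lambda>n. real n * p n ^ 5) at_top sequentially \<longrightarrow>
        (\<forall>q::real\<ge>1. AE \<omega> in P.
          (\<lambda>n. \<integral>\<^sup>+ \<omega>'. ennreal ((SUP s\<in>{0..T}.
              d_BL (emp_measure n (\<lambda>i. if \<xi> n 1 i \<omega> \<and> \<xi> n 2 i \<omega> then 1 / (real n * p n ^ 2) else 0)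
                      (\<lambda>i. \<theta> n i \<omega> \<omega>' s)) (\<mu> s)) powr q) \<partial>M)
          \<longlonglongrightarrow> 0)))"
proof -
  interpret P: prob_space P by (rule P_prob)
  obtain A L where AL: "1 \<le> A" "1 \<le> L" "\<forall>x y. \<bar>\<Gamma> x y\<bar> \<le> A" "\<forall>x x' y. \<bar>\<Gamma> x y - \<Gamma> x' y\<bar> \<le> L * \<bar>x
      - x'\<bar>"
     "\<forall>x y y'. \<bar>\<Gamma> x y - \<Gamma> x y'\<bar> \<le> L * \<bar>y - y'\<bar>"
    using smooth_periodic_bounds[OF Gamma_smooth Gamma_per] by blast
  interpret mean_field_limit \<Gamma> T A L \<mu>0 \<mu>
    by unfold_locales (use T_pos Gamma_per AL limit_eq in auto)
  define dn where "dn \<omega> n = d_BL (emp_measure n (\<lambda>_. 1 / real n) (\<lambda>i. \<theta>0 n i \<omega>)) \<mu>0" for \<omega> n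
  \<comment> \<open>The deterministic core shared by the three claims: one realisation \<omega>
    satisfying finitely many asymptotic conditions, each of which holds almost surely.\<close>
  have core: "(\<lambda>n. \<integral>\<^sup>+ \<omega>'. ennreal ((SUP s\<in>{0..T}. d_BL (emp_measure n (w n) (\<lambda>i. \<theta> n i \<omega> \<omega>' s))
      (\<mu> s)) powr q) \<partial>M) \<longlonglongrightarrow> 0"
    if \<omega>: "\<omega> \<in> space P" and d0: "dn \<omega> \<longlonglongrightarrow> 0" and q: "1 \<le> q"
      and W: "\<And>n. n \<ge> 2 \<Longrightarrow> W n \<ge> 1" and Wl: "(\<lambda>n. W n / sqrt (real n)) \<longlonglongrightarrow> 0"
      and cut: "\<exists>\<delta>. (\<lambda>n. W n * \<delta> n) \<longlonglongrightarrow> 0 \<and>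
         (\<forall>\<^sub>F n in sequentially. \<forall>U\<subseteq>{1..n}. cut_dev n (p n) (\<lambda>i j. \<xi> n i j \<omega>) U \<le> \<delta> n * (real n)^2)"
      and w: "\<And>n i. n \<ge> 2 \<Longrightarrow> i \<in> {1..n} \<Longrightarrow> 0 \<le> w n i \<and> w n i \<le> W n / real n"
      and sw: "\<forall>\<^sub>F n in sequentially. (\<Sum>i=1..n. w n i) \<le> 2"
      and disc: "\<exists>\<Delta>. \<Delta> \<longlonglongrightarrow> 0 \<and> (\<forall>n. \<forall>f\<in>BL_test. \<bar>\<Sum>i=1..n. (w n i - 1 / real n) * f (\<theta>0 n i \<omega>)\<bar> \<le> \<Delta> n)"
    for \<omega> q and W :: "nat \<Rightarrow> real" and w :: "nat \<Rightarrow> nat \<Rightarrow> real"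
  proof -
    obtain \<delta> where \<delta>: "(\<lambda>n. W n * \<delta> n) \<longlonglongrightarrow> 0"
      "\<forall>\<^sub>F n in sequentially. \<forall>U\<subseteq>{1..n}. cut_dev n (p n) (\<lambda>i j. \<xi> n i j \<omega>) U \<le> \<delta> n * (real n)^2"
          using cut by blast
    obtain \<Delta> where \<Delta>: "\<Delta> \<longlonglongrightarrow> 0" "\<forall>n. \<forall>f\<in>BL_test. \<bar>\<Sum>i=1..n. (w n i - 1 / real n) * f (\<theta>0 n i \<omega>)\<bar> \<le> \<Delta> n"
      using disc by blast
    have d: "\<bar>(\<Sum>i=1..n. 1 / real n * f (\<theta>0 n i \<omega>)) - muI 0 f\<bar> \<le> dn \<omega> n" if n: "n \<ge> 2" and f: "f
        \<in> BL_test" for n f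
    proof -
      have e: "(\<integral>y. f y \<partial>(emp_measure n (\<lambda>_. 1 / real n) (\<lambda>i. \<theta>0 n i \<omega>)))
          = (\<Sum>i=1..n. 1 / real n * f (\<theta>0 n i \<omega>))" if "f \<in> BL_test" for f
        by (rule integral_emp_measure[OF _ BL_test_borel[OF that]]) simp
      have "\<bar>(\<integral>y. f y \<partial>(emp_measure n (\<lambda>_. 1 / real n) (\<lambda>i. \<theta>0 n i \<omega>))) - (\<integral>y. f y \<partial>\<mu>0)\<bar> \<le> dn \<omega> n"
        unfolding dn_def
      proof (rule d_BL_upper[OF _ _ f])
        fix f assume f: "f \<in> BL_test"
        show "\<bar>\<integral>y. f y \<partial>\<mu>0\<bar> \<le> 1" by (rule integral_bound_prob[OF mu0_prob]) (use f in \<open>simp add: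
            BL_test_def\<close>)
        have "\<bar>\<Sum>i=1..n. 1 / real n * f (\<theta>0 n i \<omega>)\<bar> \<le> (\<Sum>i=1..n. 1 / real n)"
          using f by (intro order_trans[OF sum_abs] sum_mono) (auto simp: abs_mult BL_test_def
              divide_le_eq)
        then show "\<bar>\<integral>y. f y \<partial>(emp_measure n (\<lambda>_. 1 / real n) (\<lambda>i. \<theta>0 n i \<omega>))\<bar> \<le> 1"
            unfolding e[OF f] using n by simp
      qed
      then show ?thesis unfolding e[OF f] muI_def mu_0 .
    qed
    show ?thesis
    proof (rule quenched_limit[OF BM, where p = p and \<delta> = \<delta> and \<Delta> = \<Delta> and d = "dn \<omega>" and W = W
          and xi = "\<lambda>n i j. \<xi> n i j \<omega>" and x = "\<lambda>n i. \<theta>0 n i \<omega>"])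
      show "\<forall>\<^sub>F n in sequentially. \<forall>U\<subseteq>{1..n}.
           (\<Sum>i=1..n. \<bar>\<Sum>j\<in>U. (if \<xi> n i j \<omega> then 1 / p n else 0) - 1\<bar>) \<le> \<delta> n * (real n)^2"
        using \<delta>(2) unfolding cut_dev_def .
      show "\<forall>\<^sub>F n in sequentially. W n \<ge> 1" using eventually_ge_at_top[of 2]
          by eventually_elim (rule W)
      show "\<forall>\<^sub>F n in sequentially. \<forall>i\<in>{1..n}. 0 \<le> w n i \<and> w n i \<le> W n / real n"
        using eventually_ge_at_top[of 2] by eventually_elim (use w in blast)
      show "\<forall>\<^sub>F n in sequentially. \<forall>f\<in>BL_test. \<bar>\<Sum>i=1..n. (w n i - 1 / real n) * f (\<theta>0 n i \<omega>)\<bar> \<le> \<Delta> n"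
        using \<Delta>(2) by (intro always_eventually) blast
      show "\<forall>\<^sub>F n in sequentially. \<forall>f\<in>BL_test. \<bar>(\<Sum>i=1..n. 1 / real n * f (\<theta>0 n i \<omega>)) - muI 0 f\<bar>
          \<le> dn \<omega> n"
        using eventually_ge_at_top[of 2] by eventually_elim (use d in blast)
      show "continuous_on {0..T} (\<theta> n i \<omega> \<omega>')" if "n \<ge> 2" "i \<in> {1..n}" "\<omega>' \<in> space M" for n i \<omega>'
        using particles[OF that(1,2) \<omega> that(3)] by blast
      show "\<theta> n i \<omega> \<omega>' t = \<theta>0 n i \<omega> + integral {0..t} (\<lambda>s. (1 / (real n * p n)) *
             (\<Sum>j=1..n. if \<xi> n i j \<omega> then \<Gamma> (\<theta> n i \<omega> \<omega>' s) (\<theta> n j \<omega> \<omega>' s) else 0)) + B i \<omega>' t"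
        if "n \<ge> 2" "i \<in> {1..n}" "\<omega>' \<in> space M" "t \<in> {0..T}" for n i \<omega>' t
        using particles[OF that(1,2) \<omega> that(3)] that(4) by blast
    qed (use p_range \<delta>(1) \<Delta>(1) d0 Wl sw q in auto)
  qed
  have cutAE: "AE \<omega> in P. \<exists>\<delta>. (\<lambda>n. W n * \<delta> n) \<longlonglongrightarrow> 0 \<and>
         (\<forall>\<^sub>F n in sequentially. \<forall>U\<subseteq>{1..n}. cut_dev n (p n) (\<lambda>i j. \<xi> n i j \<omega>) U \<le> \<delta> n * (real n)^2)"
    if "\<And>n. n \<ge> 2 \<Longrightarrow> W n \<ge> 1" "filterlim (\<lambda>n. real n * p n / (W n)^2) at_top sequentially" for W
    by (rule P.cut_dev_sequence_AE) (fact graph_rv graph_bern graph_indep p_range that)+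
  have A0': "AE \<omega> in P. dn \<omega> \<longlonglongrightarrow> 0" using A0 by (simp add: dn_def[abs_def])
  have mono: "filterlim (\<lambda>n. real n * p n ^ b) at_top sequentially"
    if "filterlim (\<lambda>n. real n * p n ^ a) at_top sequentially" "b \<le> a" for a b :: nat
  proof (rule filterlim_at_top_mono[OF that(1)])
    show "\<forall>\<^sub>F n in sequentially. real n * p n ^ a \<le> real n * p n ^ b"
      using eventually_ge_at_top[of 2]
    proof eventually_elim
      case (elim n)
      have "p n ^ a \<le> p n ^ b" using p_range[OF elim] that(2) by (intro power_decreasing) auto
      then show ?case by (intro mult_left_mono) auto
    qed
  qed
  have part1: "AE \<omega> in P. (\<lambda>n. \<integral>\<^sup>+ \<omega>'. ennreal ((SUP s\<in>{0..T}.
              d_BL (emp_measure n (\<lambda>_. 1 / real n) (\<lambda>i. \<theta> n i \<omega> \<omega>' s)) (\<mu> s)) powr q) \<partial>M) \<longlonglongrightarrow> 0"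
    if lim: "filterlim (\<lambda>n. real n * p n) at_top sequentially" and q: "1 \<le> q" for q :: real
  proof -
    have "AE \<omega> in P. \<exists>\<delta>. (\<lambda>n. 1 * \<delta> n) \<longlonglongrightarrow> 0 \<and>
         (\<forall>\<^sub>F n in sequentially. \<forall>U\<subseteq>{1..n}. cut_dev n (p n) (\<lambda>i j. \<xi> n i j \<omega>) U \<le> \<delta> n * (real n)^2)"
      by (rule cutAE) (use lim in auto)
    then show ?thesis using A0' AE_space
    proof eventually_elim
      case (elim \<omega>)
      show ?case
      \<comment> \<open>Uniform weights have \<open>W = 1\<close> and zero discrepancy at time 0, so
        independence of graph and initial condition does not enter.\<close>
      proof (rule core[of \<omega> q "\<lambda>_. 1", OF elim(3,2) q])
        show "(\<lambda>n. 1 / sqrt (real n)) \<longlonglongrightarrow> 0"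
            by (rule filterlim_inverse_sqrt[OF filterlim_real_sequentially])
        show "\<exists>\<delta>. (\<lambda>n. 1 * \<delta> n) \<longlonglongrightarrow> 0 \<and>
         (\<forall>\<^sub>F n in sequentially. \<forall>U\<subseteq>{1..n}. cut_dev n (p n) (\<lambda>i j. \<xi> n i j \<omega>) U
             \<le> \<delta> n * (real n)^2)" by (rule elim(1))
        show "\<exists>\<Delta>. \<Delta> \<longlonglongrightarrow> 0 \<and> (\<forall>n. \<forall>f\<in>BL_test. \<bar>\<Sum>i=1..n. (1 / real n - 1 / real n) * f (\<theta>0 n i \<omega>)\<bar>
            \<le> \<Delta> n)"
          by (intro exI[of _ "\<lambda>_. 0"]) auto
        show "\<forall>\<^sub>F n in sequentially. (\<Sum>i=1..n. 1 / real n) \<le> 2" by (intro always_eventually) simp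
      qed auto
    qed
  qed
  \<comment> \<open>Both vertex statements at once, with \<open>W = 1 / p n ^ a\<close> for a = 1 or
    a = 2. The condition that n p / W^2 diverges is exactly the hypothesis on n p^(2a+1).\<close>
  have part2: "AE \<omega> in P. (\<lambda>n. \<integral>\<^sup>+ \<omega>'. ennreal ((SUP s\<in>{0..T}.
              d_BL (emp_measure n (\<lambda>i. if X n i \<omega> then 1 / (real n * p n ^ a) else 0)
                      (\<lambda>i. \<theta> n i \<omega> \<omega>' s)) (\<mu> s)) powr q) \<partial>M) \<longlonglongrightarrow> 0"
    if indep: "P.indep_set (gen_sigma P (\<lambda>(n, i). \<theta>0 n i) borel) (gen_sigma P (\<lambda>(n, i, j). \<xi> n i
        j) (count_space UNIV))"
      and lim: "filterlim (\<lambda>n. real n * p n ^ (2 * a + 1)) at_top sequentially" and a: "a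
          \<in> {1, 2}" and q: "1 \<le> q"
      and X: "\<And>n i. X n i \<in> measurable (gen_meas P (\<lambda>(n, i, j). \<xi> n i j) (count_space UNIV))
          (count_space UNIV)"
      and ind: "\<And>n. n \<ge> n0 \<Longrightarrow> P.indep_vars (\<lambda>_. count_space UNIV) (X n) {1..n}"
      and pr: "\<And>n i. n \<ge> n0 \<Longrightarrow> i \<in> {1..n} \<Longrightarrow> P.prob {\<omega> \<in> space P. X n i \<omega>} = p n ^ a" and n0: "n0 \<ge> 2"
    for X :: "nat \<Rightarrow> nat \<Rightarrow> 'w \<Rightarrow> bool" and a n0 :: nat and q :: real
  proof -
    have W: "1 / p n ^ a \<ge> 1" if "n \<ge> 2" for n using p_range[OF that] by (simp add: power_le_one)
    have lim': "filterlim (\<lambda>n. real n * p n / (1 / p n ^ a)^2) at_top sequentially"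
      using lim by (simp add: power_divide power_mult[symmetric] power_add mult_ac)
    have cutA: "AE \<omega> in P. \<exists>\<delta>. (\<lambda>n. 1 / p n ^ a * \<delta> n) \<longlonglongrightarrow> 0 \<and>
         (\<forall>\<^sub>F n in sequentially. \<forall>U\<subseteq>{1..n}. cut_dev n (p n) (\<lambda>i j. \<xi> n i j \<omega>) U \<le> \<delta> n * (real n)^2)"
      by (rule cutAE[OF W lim'])
    have "filterlim (\<lambda>n. real n * p n ^ (2 * a)) at_top sequentially" by (rule mono[OF lim]) simp
    from filterlim_inverse_sqrt[OF this] have "(\<lambda>n. 1 / sqrt (real n * p n ^ (2 * a))) \<longlonglongrightarrow> 0" .
    moreover have "\<forall>\<^sub>F n in sequentially. 1 / sqrt (real n * p n ^ (2 * a))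
        = 1 / p n ^ a / sqrt (real n)"
      using eventually_ge_at_top[of 2]
    proof eventually_elim
      case (elim n)
      have "p n ^ (2 * a) = (p n ^ a)^2" by (simp only: power_mult[symmetric] mult.commute)
      then have "sqrt (p n ^ (2 * a)) = p n ^ a" using p_range[OF elim]
          by (simp only: real_sqrt_abs) simp
      then show ?case by (simp add: real_sqrt_mult)
    qed
    ultimately have Wl: "(\<lambda>n. 1 / p n ^ a / sqrt (real n)) \<longlonglongrightarrow> 0" by (rule Lim_transform_eventually)
    have growth: "\<forall>\<^sub>F n in sequentially. real n powr (3/5) \<le> real n * p n ^ a"
    proof -
      have "\<forall>\<^sub>F n in sequentially. 1 \<le> real n * p n ^ (2 * a + 1)" using lim
          by (simp add: filterlim_at_top)
      then show ?thesis using eventually_ge_at_top[of 2]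
      proof eventually_elim
        case (elim n)
        have "real n powr (3/5) \<le> real n * p n powr real a"
          by (rule growth_exponent[where k = "2 * a + 1"]) (use elim p_range[of n] a in auto)
        then show ?case using p_range[OF elim(2)] by (simp add: powr_realpow)
      qed
    qed
    define Fa where "Fa = gen_meas P (\<lambda>(n, i). \<theta>0 n i) borel"
    define Fb where "Fb = gen_meas P (\<lambda>(n, i, j). \<xi> n i j) (count_space UNIV)"
    have y: "\<theta>0 n i \<in> borel_measurable Fa" for n i
      unfolding Fa_def using gen_meas_measurable[of "\<lambda>(n, i). \<theta>0 n i" "(n, i)" P borel] init_rv
          by simp
    have row: "AE \<omega> in P. (\<forall>\<^sub>F n in sequentially. (\<Sum>i=1..n.
        if X n i \<omega> then 1 / (real n * p n ^ a) else 0) \<le> 2) \<and>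
      (\<exists>\<Delta>. \<Delta> \<longlonglongrightarrow> 0 \<and> (\<forall>n. \<forall>f\<in>BL_test.
       \<bar>\<Sum>i=1..n. ((if X n i \<omega> then 1 / (real n * p n ^ a) else 0) - 1 / real n) * f (\<theta>0 n i \<omega>)\<bar>
           \<le> \<Delta> n))"
    proof (rule P.row_discrepancy_AE[of Fa Fb, where \<rho> = "\<lambda>n. p n ^ a" and ?n0.0 = n0])
      show "space Fa = space P" "space Fb = space P" by (simp_all add: Fa_def Fb_def gen_meas)
      show "P.indep_set (sets Fa) (sets Fb)" using indep by (simp add: Fa_def Fb_def gen_meas)
      show "X n i \<in> measurable Fb (count_space UNIV)" for n i unfolding Fb_def by (rule X)
      show "0 < p n ^ a \<and> p n ^ a \<le> 1" if "n \<ge> n0" for n using p_range[of n] that n0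
          by (simp add: power_le_one)
    qed (fact y ind pr growth)+
    from cutA row A0' AE_space show ?thesis
    proof eventually_elim
      case (elim \<omega>)
      show ?case
      proof (rule core[OF elim(4,3) q W Wl elim(1) _ elim(2)[THEN conjunct1] elim(2)[THEN
          conjunct2]])
        fix n i :: nat assume n: "2 \<le> n"
        show "0 \<le> (if X n i \<omega> then 1 / (real n * p n ^ a) else 0)
            \<and> (if X n i \<omega> then 1 / (real n * p n ^ a) else 0) \<le> 1 / p n ^ a / real n"
          using p_range[OF n] by (simp add: mult.commute)
      qed auto
    qed
  qed
  have xi_meas: "\<xi> n i j \<in> measurable (gen_meas P (\<lambda>(n, i, j). \<xi> n i j) (count_space UNIV))
      (count_space UNIV)" for n i j
    using gen_meas_measurable[of "\<lambda>(n, i, j). \<xi> n i j" "(n, i, j)" P "count_space UNIV"] graph_rv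
        by simp
  have part2a: "AE \<omega> in P. (\<lambda>n. \<integral>\<^sup>+ \<omega>'. ennreal ((SUP s\<in>{0..T}.
              d_BL (emp_measure n (\<lambda>i. if \<xi> n l i \<omega> then 1 / (real n * p n) else 0)
                      (\<lambda>i. \<theta> n i \<omega> \<omega>' s)) (\<mu> s)) powr q) \<partial>M) \<longlonglongrightarrow> 0"
    if indep: "P.indep_set (gen_sigma P (\<lambda>(n, i). \<theta>0 n i) borel) (gen_sigma P (\<lambda>(n, i, j). \<xi> n i
        j) (count_space UNIV))"
      and lim: "filterlim (\<lambda>n. real n * p n ^ 3) at_top sequentially" and l: "l \<ge> 1" and q: "1
          \<le> q" for l :: nat and q :: real
  proof -
    have "AE \<omega> in P. (\<lambda>n. \<integral>\<^sup>+ \<omega>'. ennreal ((SUP s\<in>{0..T}.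
              d_BL (emp_measure n (\<lambda>i. if \<xi> n l i \<omega> then 1 / (real n * p n ^ 1) else 0)
                      (\<lambda>i. \<theta> n i \<omega> \<omega>' s)) (\<mu> s)) powr q) \<partial>M) \<longlonglongrightarrow> 0"
    \<comment> \<open>The row of vertex \<open>l\<close> belongs to the graph only when
      \<open>l \<le> n\<close>, so the edge laws are used from \<open>max 2 l\<close> on.\<close>
    proof (rule part2[of 1 q "\<lambda>n. \<xi> n l" "max 2 l", OF indep _ _ q xi_meas])
      show "filterlim (\<lambda>n. real n * p n ^ (2 * 1 + 1)) at_top sequentially" using lim
          by (simp add: numeral_3_eq_3)
      fix n assume n: "max 2 l \<le> n"
      show "P.prob {\<omega> \<in> space P. \<xi> n l i \<omega>} = p n ^ 1" if "i \<in> {1..n}" for i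
        using graph_bern[of n l i] n l that by simp
      have "P.indep_vars (\<lambda>i. PiM {(l, i)} (\<lambda>_. count_space UNIV)) (\<lambda>i \<omega>. restrict (\<lambda>q. (case q of
          (i, j) \<Rightarrow> \<xi> n i j) \<omega>) {(l, i)}) {1..n}"
        by (rule P.indep_vars_restrict[OF graph_indep]) (use n l in \<open>auto simp:
            disjoint_family_on_def\<close>)
      then have "P.indep_vars (\<lambda>_. count_space UNIV) (\<lambda>i \<omega>. (\<lambda>u. u (l, i)) (restrict (\<lambda>q. (case q
          of (i, j) \<Rightarrow> \<xi> n i j) \<omega>) {(l, i)})) {1..n}"
        by (rule P.indep_vars_compose2) (rule measurable_component_singleton, simp)
      then show "P.indep_vars (\<lambda>_. count_space UNIV) (\<xi> n l) {1..n}" by simp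
    qed auto
    then show ?thesis unfolding power_one_right .
  qed
  have part2b: "AE \<omega> in P. (\<lambda>n. \<integral>\<^sup>+ \<omega>'. ennreal ((SUP s\<in>{0..T}.
              d_BL (emp_measure n (\<lambda>i. if \<xi> n 1 i \<omega> \<and> \<xi> n 2 i \<omega> then 1 / (real n * p n ^ 2) else 0)
                      (\<lambda>i. \<theta> n i \<omega> \<omega>' s)) (\<mu> s)) powr q) \<partial>M) \<longlonglongrightarrow> 0"
    if indep: "P.indep_set (gen_sigma P (\<lambda>(n, i). \<theta>0 n i) borel) (gen_sigma P (\<lambda>(n, i, j). \<xi> n i
        j) (count_space UNIV))"
      and lim: "filterlim (\<lambda>n. real n * p n ^ 5) at_top sequentially" and q: "1 \<le> q" for q :: real
  proof (rule part2[of 2 q "\<lambda>n i \<omega>. \<xi> n 1 i \<omega> \<and> \<xi> n 2 i \<omega>" 2, OF indep _ _ q])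
    show "filterlim (\<lambda>n. real n * p n ^ (2 * 2 + 1)) at_top sequentially" using lim by simp
    show "(\<lambda>\<omega>. \<xi> n 1 i \<omega> \<and> \<xi> n 2 i \<omega>) \<in> measurable (gen_meas P (\<lambda>(n, i, j). \<xi> n i j) (count_space
        UNIV)) (count_space UNIV)" for n i
      using xi_meas[of n 1 i] xi_meas[of n 2 i] by measurable
    fix n :: nat assume n: "2 \<le> n"
    define Z where "Z = (\<lambda>q :: nat \<times> nat. case q of (i, j) \<Rightarrow> \<xi> n i j)"
    have Zi: "P.indep_vars (\<lambda>_. count_space UNIV) Z ({1..n} \<times> {1..n})" unfolding Z_def
        by (rule graph_indep[OF n])
    show "P.prob {\<omega> \<in> space P. \<xi> n 1 i \<omega> \<and> \<xi> n 2 i \<omega>} = p n ^ 2" if i: "i \<in> {1..n}" for i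
    proof -
      have "P.prob (\<Inter>q\<in>{(1, i), (2, i)}. Z q -` {True} \<inter> space P)
          = (\<Prod>q\<in>{(1, i), (2, i)}. P.prob (Z q -` {True} \<inter> space P))"
        by (rule P.indep_varsD[OF Zi]) (use i n in auto)
      moreover have "(\<Inter>q\<in>{(1, i), (2, i)}. Z q -` {True} \<inter> space P) = {\<omega> \<in> space P. \<xi> n 1 i \<omega>
          \<and> \<xi> n 2 i \<omega>}"
        by (auto simp: Z_def)
      moreover have "P.prob (Z q -` {True} \<inter> space P) = p n" if "q \<in> {(1, i), (2, i)}" for q
      proof -
        have "Z q -` {True} \<inter> space P = {\<omega> \<in> space P. \<xi> n (fst q) (snd q) \<omega>}"
            by (auto simp: Z_def case_prod_beta)
        then show ?thesis using graph_bern[OF n, of "fst q" "snd q"] that i n by auto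
      qed
      ultimately show ?thesis by (simp add: power2_eq_square)
    qed
    \<comment> \<open>The pairs of edges into different \<open>i\<close> are disjoint, so the
      common-neighbour indicators are again independent, with success probability p^2.\<close>
    have "P.indep_vars (\<lambda>i. PiM {(1, i), (2, i)} (\<lambda>_. count_space UNIV)) (\<lambda>i \<omega>. restrict (\<lambda>q. Z q
        \<omega>) {(1, i), (2, i)}) {1..n}"
      by (rule P.indep_vars_restrict[OF Zi]) (use n in \<open>auto simp: disjoint_family_on_def\<close>)
    then have "P.indep_vars (\<lambda>_. count_space UNIV) (\<lambda>i \<omega>. (\<lambda>u. u (1, i)
        \<and> u (2, i)) (restrict (\<lambda>q. Z q \<omega>) {(1, i), (2, i)})) {1..n}"
    proof (rule P.indep_vars_compose2)
      fix i
      have "(\<lambda>u. u (1, i)) \<in> measurable (PiM {(1, i), (2, i)} (\<lambda>_. count_space UNIV)) (count_space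
          (UNIV :: bool set))"
        "(\<lambda>u. u (2, i)) \<in> measurable (PiM {(1, i), (2, i)} (\<lambda>_. count_space UNIV)) (count_space
            (UNIV :: bool set))"
        by (rule measurable_component_singleton, simp)+
      then show "(\<lambda>u. u (1, i) \<and> u (2, i))
          \<in> measurable (PiM {(1, i), (2, i)} (\<lambda>_. count_space UNIV)) (count_space (UNIV :: bool
          set))"
        by measurable
    qed
    then show "P.indep_vars (\<lambda>_. count_space UNIV) (\<lambda>i \<omega>. \<xi> n 1 i \<omega> \<and> \<xi> n 2 i \<omega>) {1..n}"
        by (simp add: Z_def)
  qed auto
  show ?thesis using part1 part2a part2b by blast
qed

end
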